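(* Let $\mathfrak k$ be a semisimple bundle of ideals of a Lie algebroid $A\Rightarrow M$. Then: (i) The simplicial differential $\delta^0\colon\Omega^\bullet(M;\mathfrak k)\to\Omega^\bullet_{im}(A;\mathfrak k)^{\mathrm{Hor}}$ is an isomorphism. (ii) Any IM connection $(\mathcal C,v)$ for $\mathfrak k$ is uniquely primitive (there is exactly one $F\in\Omega^2(M;\mathfrak k)$ with $\Omega^{(\mathcal C,v)}=\delta^0F$), with vanishing curvature 3-form, $d^\nabla F=0$. (iii) There is a bijective correspondence, $(\mathcal C,v)\mapsto(v,\mathcal C|_{\mathfrak k})$, between IM connections $\mathcal A(A;\mathfrak k)$ and pairs $(v,\nabla)$, where $v\colon A\to\mathfrak k$ is a splitting and $\nabla$ is a bracket-preserving linear connection on $\mathfrak k$ such that $\nabla^A_{h(\alpha)}=\nabla_{\rho(\alpha)}$ for all $\alpha\in A$.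
   Context: $A\Rightarrow M$ is a Lie algebroid with anchor $\rho$. A bundle of ideals is a vector subbundle $\mathfrak k\subset A$, $\mathfrak k\subset\ker\rho$, with $[\Gamma(A),\Gamma(\mathfrak k)]\subset\Gamma(\mathfrak k)$; put $\nabla^A_\alpha\xi=[\alpha,\xi]$ for $\alpha\in\Gamma(A)$, $\xi\in\Gamma(\mathfrak k)$. It is semisimple if $\mathfrak k$ is a locally trivial bundle of Lie algebras with semisimple typical fibre. IM forms of degree $q$, $\Omega^q_{im}(A;\mathfrak k)$: pairs $c=(c_0,c_1)$, $c_0\colon\Gamma(A)\to\Omega^q(M;\mathfrak k)$ $\mathbb R$-linear, $c_1\colon A\to\Lambda^{q-1}T^*M\otimes\mathfrak k$ a bundle map, with $c_0(f\alpha)=fc_0(\alpha)+df\wedge c_1(\alpha)$, $c_0[\alpha,\beta]=\mathcal L^A_\alpha c_0(\beta)-\mathcal L^A_\beta c_0(\alpha)$, $c_1[\alpha,\beta]=\mathcal L^A_\alpha(c_1(\beta))-\iota_{\rho(\beta)}c_0(\alpha)$, $\iota_{\rho(\alpha)}c_1(\beta)=-\iota_{\rho(\beta)}c_1(\alpha)$, where $(\mathcal L^A_\alpha\gamma)(\underline X)=[\alpha,\gamma(\underline X)]-\sum_j\gamma(\dots,[\rho(\alpha),X_j],\dots)$. $c$ is horizontal if $c_1|_{\mathfrak k}=0$; $\Omega^q_{im}(A;\mathfrak k)^{\mathrm{Hor}}$ denotes horizontal IM forms. For $\gamma\in\Omega^q(M;\mathfrak k)$, $\delta^0\gamma$ is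 the horizontal IM form $(\delta^0\gamma)_0(\alpha)=\mathcal L^A_\alpha\gamma$, $(\delta^0\gamma)_1(\beta)=\iota_{\rho(\beta)}\gamma$. An IM connection is an IM 1-form $(\mathcal C,v)$ with $v|_{\mathfrak k}=\mathrm{id}$; the set of these is $\mathcal A(A;\mathfrak k)$. It induces the connection $\nabla_X\xi=\mathcal C(\xi)(X)$ on $\mathfrak k$, denoted $\mathcal C|_{\mathfrak k}$. Its curvature is the horizontal IM 2-form $\Omega^{(\mathcal C,v)}$ with $\Omega^{(\mathcal C,v)}_0(\alpha)=d^\nabla(\mathcal C\alpha)$, $\Omega^{(\mathcal C,v)}_1(\alpha)=\mathcal C(\alpha-v(\alpha))$. A splitting is a vector bundle map $v\colon A\to\mathfrak k$ with $v|_{\mathfrak k}=\mathrm{id}$, and $h=\mathrm{id}-v$. $\nabla$ is bracket-preserving if $\nabla_X[\xi,\eta]=[\nabla_X\xi,\eta]+[\xi,\nabla_X\eta]$. The condition in (iii) means $[h(\alpha),\xi]=\nabla_{\rho(\alpha)}\xi$ for $\alpha\in\Gamma(A)$, $\xi\in\Gamma(\mathfrak k)$. *)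

theory Defs
  imports "HOL-Analysis.Analysis"
begin

section \<open>Smooth maps between normed spaces\<close>

text \<open>Only used on open sets \<open>S\<close>. A map of a finite-dimensional space is \<open>C\<^sup>k\<^sup>+\<^sup>1\<close> iff it is differentiable
  and all its directional derivatives are \<open>C\<^sup>k\<close>.\<close>

fun C_k_on :: "nat \<Rightarrow> 'a::real_normed_vector set \<Rightarrow> ('a \<Rightarrow> 'b::real_normed_vector) \<Rightarrow> bool" where
  "C_k_on 0 S f \<longleftrightarrow> continuous_on S f"
| "C_k_on (Suc k) S f \<longleftrightarrow>
     (\<forall>y\<in>S. f differentiable (at y)) \<and> (\<forall>w. C_k_on k S (\<lambda>y. frechet_derivative f (at y) w))"

definition smooth_on :: "'a::real_normed_vector set \<Rightarrow> ('a \<Rightarrow> 'b::real_normed_vector) \<Rightarrow> bool" where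
  "smooth_on S f \<longleftrightarrow> (\<forall>k. C_k_on k S f)"

section \<open>Smooth manifolds\<close>

text \<open>The manifold \<open>M\<close> is a whole type \<open>'m\<close> with its topology, and a chart \<open>(U, x)\<close> is a coordinate map
  \<open>x\<close> on the open set \<open>U\<close>. The model space \<open>'e\<close> is a finite-dimensional inner product space rather than
  a type of class \<open>euclidean_space\<close>, since the latter excludes dimension 0.\<close>

type_synonym ('m, 'e) chart = "'m set \<times> ('m \<Rightarrow> 'e)"

definition finite_dimensional :: "'a::real_vector itself \<Rightarrow> bool" where
  "finite_dimensional _ \<longleftrightarrow> (\<exists>B :: 'a set. finite B \<and> span B = UNIV)"

definition smooth_manifold ::
  "('m::{t2_space, second_countable_topology}, 'e::real_inner) chart set \<Rightarrow> bool" where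
  "smooth_manifold \<A> \<longleftrightarrow>
     finite_dimensional TYPE('e) \<and>
     (\<Union>(U, x)\<in>\<A>. U) = UNIV \<and>
     (\<forall>(U, x)\<in>\<A>. open U \<and> open (x ` U) \<and> inj_on x U \<and>
        homeomorphism U (x ` U) x (inv_into U x)) \<and>
     (\<forall>(U, x)\<in>\<A>. \<forall>(V, y)\<in>\<A>. smooth_on (x ` (U \<inter> V)) (y \<circ> inv_into U x))"

definition smooth_map_on ::
  "('m, 'e::real_normed_vector) chart set \<Rightarrow> 'm set \<Rightarrow> ('m \<Rightarrow> 'b::real_normed_vector) \<Rightarrow> bool" where
  "smooth_map_on \<A> W f \<longleftrightarrow> (\<forall>(U, x)\<in>\<A>. smooth_on (x ` (U \<inter> W)) (f \<circ> inv_into U x))"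

abbreviation smooth_functions :: "('m, 'e::real_normed_vector) chart set \<Rightarrow> ('m \<Rightarrow> real) set" where
  "smooth_functions \<A> \<equiv> {f. smooth_map_on \<A> UNIV f}"

subsection \<open>The tangent bundle\<close>

text \<open>Every tangent space is a copy of the model space \<open>'e\<close>: a tangent vector at \<open>p\<close> is given by its
  coordinates in the preferred chart \<open>chart_at \<A> p\<close>. The derivative of a change of charts gives the
  coordinates of a tangent vector in any other chart (\<open>tangent_coord\<close>) and conversely
  (\<open>tangent_vec\<close>).\<close>

definition chart_at :: "('m, 'e) chart set \<Rightarrow> 'm \<Rightarrow> ('m, 'e) chart" where
  "chart_at \<A> p = (SOME c. c \<in> \<A> \<and> p \<in> fst c)"

definition tangent_deriv ::
  "('m, 'e::real_normed_vector) chart set \<Rightarrow> ('m \<Rightarrow> 'b::real_normed_vector) \<Rightarrow> 'm \<Rightarrow> 'e \<Rightarrow> 'b" where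
  "tangent_deriv \<A> f p =
     (case chart_at \<A> p of (U, x) \<Rightarrow> frechet_derivative (f \<circ> inv_into U x) (at (x p)))"

definition tangent_coord ::
  "('m, 'e::real_normed_vector) chart set \<Rightarrow> ('m, 'e) chart \<Rightarrow> 'm \<Rightarrow> 'e \<Rightarrow> 'e" where
  "tangent_coord \<A> c p = tangent_deriv \<A> (snd c) p"

definition tangent_vec ::
  "('m, 'e::real_normed_vector) chart set \<Rightarrow> ('m, 'e) chart \<Rightarrow> 'm \<Rightarrow> 'e \<Rightarrow> 'e" where
  "tangent_vec \<A> c p =
     (case c of (U, x) \<Rightarrow> frechet_derivative (snd (chart_at \<A> p) \<circ> inv_into U x) (at (x p)))"

definition vector_fields :: "('m, 'e::real_normed_vector) chart set \<Rightarrow> ('m \<Rightarrow> 'e) set" where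
  "vector_fields \<A> = {X. \<forall>(U, x)\<in>\<A>. smooth_map_on \<A> U (\<lambda>p. tangent_coord \<A> (U, x) p (X p))}"

text \<open>In the coordinates of a chart, \<open>[X, Y] = DY(X) - DX(Y)\<close>.\<close>

definition vf_bracket ::
  "('m, 'e::real_normed_vector) chart set \<Rightarrow> ('m \<Rightarrow> 'e) \<Rightarrow> ('m \<Rightarrow> 'e) \<Rightarrow> 'm \<Rightarrow> 'e" where
  "vf_bracket \<A> X Y p =
     (let c = chart_at \<A> p in
        tangent_deriv \<A> (\<lambda>q. tangent_coord \<A> c q (Y q)) p (X p)
      - tangent_deriv \<A> (\<lambda>q. tangent_coord \<A> c q (X q)) p (Y p))"

text \<open>A global vector field through a given tangent vector. It is used to evaluate expressions that
  are \<open>C\<^sup>\<infinity>(M)\<close>-multilinear in vector fields on tangent vectors; the result does not depend on the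
  extension.\<close>

definition vf_ext :: "('m, 'e::real_normed_vector) chart set \<Rightarrow> 'm \<Rightarrow> 'e \<Rightarrow> 'm \<Rightarrow> 'e" where
  "vf_ext \<A> p w = (SOME X. X \<in> vector_fields \<A> \<and> X p = w)"

section \<open>Vector bundles and Lie algebroids\<close>

text \<open>A vector bundle over \<open>M\<close> with model fibre \<open>'f\<close> is a family of real vector spaces \<open>E p\<close> with local
  trivialisations \<open>(U, \<phi>)\<close>, \<open>\<phi> p : E p \<rightarrow> 'f\<close> for \<open>p \<in> U\<close>, whose transition functions are smooth. The
  fibres are realised as subspaces of an arbitrary real vector space \<open>'v\<close>; \<open>'v\<close> only provides the
  vector space operations and is unrelated to the smooth structure.\<close>

type_synonym ('m, 'v, 'f) triv = "'m set \<times> ('m \<Rightarrow> 'v \<Rightarrow> 'f)"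

definition linear_map_on :: "'a::real_vector set \<Rightarrow> ('a \<Rightarrow> 'b::real_vector) \<Rightarrow> bool" where
  "linear_map_on V f \<longleftrightarrow>
     (\<forall>a\<in>V. \<forall>b\<in>V. f (a + b) = f a + f b) \<and> (\<forall>r. \<forall>a\<in>V. f (r *\<^sub>R a) = r *\<^sub>R f a)"

definition vector_bundle ::
  "('m::topological_space, 'e::real_inner) chart set \<Rightarrow> ('m \<Rightarrow> 'v::real_vector set) \<Rightarrow>
   ('m, 'v, 'f::real_inner) triv set \<Rightarrow> bool" where
  "vector_bundle \<A> E \<T> \<longleftrightarrow>
     finite_dimensional TYPE('f) \<and>
     (\<forall>p. subspace (E p)) \<and>
     (\<Union>(U, \<phi>)\<in>\<T>. U) = UNIV \<and>
     (\<forall>(U, \<phi>)\<in>\<T>. open U \<and> (\<forall>p\<in>U. linear_map_on (E p) (\<phi> p) \<and> bij_betw (\<phi> p) (E p) UNIV)) \<and>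
     (\<forall>(U, \<phi>)\<in>\<T>. \<forall>(V, \<psi>)\<in>\<T>. \<forall>w.
        smooth_map_on \<A> (U \<inter> V) (\<lambda>p. \<psi> p (inv_into (E p) (\<phi> p) w)))"

text \<open>The data of a Lie algebroid \<open>A \<Rightarrow> M\<close>: atlas of \<open>M\<close>, fibres and trivialisations of \<open>A\<close>, the bracket
  on \<open>\<Gamma>(A)\<close> and the anchor \<open>\<rho> p : A p \<rightarrow> T\<^sub>pM\<close>. The values of the bracket outside \<open>\<Gamma>(A)\<close> and of the
  anchor outside \<open>A p\<close> are irrelevant.\<close>

record ('m, 'e, 'v, 'f) algebroid_data =
  atlas :: "('m, 'e) chart set"
  fibre :: "'m \<Rightarrow> 'v set"
  trivs :: "('m, 'v, 'f) triv set"
  bracket :: "('m \<Rightarrow> 'v) \<Rightarrow> ('m \<Rightarrow> 'v) \<Rightarrow> ('m \<Rightarrow> 'v)"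
  anchor :: "'m \<Rightarrow> 'v \<Rightarrow> 'e"

definition sections ::
  "('m::topological_space, 'e::real_inner, 'v::real_vector, 'f::real_inner) algebroid_data \<Rightarrow> ('m \<Rightarrow> 'v) set" where
  "sections L =
     {\<alpha>. (\<forall>p. \<alpha> p \<in> fibre L p) \<and> (\<forall>(U, \<phi>)\<in>trivs L. smooth_map_on (atlas L) U (\<lambda>p. \<phi> p (\<alpha> p)))}"

definition anchor_sec ::
  "('m::topological_space, 'e::real_inner, 'v::real_vector, 'f::real_inner) algebroid_data \<Rightarrow>
   ('m \<Rightarrow> 'v) \<Rightarrow> 'm \<Rightarrow> 'e" where
  "anchor_sec L \<alpha> = (\<lambda>p. anchor L p (\<alpha> p))"

definition lie_algebroid ::
  "('m::{t2_space, second_countable_topology}, 'e::real_inner, 'v::real_vector, 'f::real_inner) algebroid_data \<Rightarrow> bool" where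
  "lie_algebroid L \<longleftrightarrow>
     smooth_manifold (atlas L) \<and>
     vector_bundle (atlas L) (fibre L) (trivs L) \<and>
     (\<comment> \<open>the anchor is a vector bundle map\<close>
      (\<forall>p. linear_map_on (fibre L p) (anchor L p)) \<and>
      (\<forall>(U, \<phi>)\<in>trivs L. \<forall>(V, x)\<in>atlas L. \<forall>w.
         smooth_map_on (atlas L) (U \<inter> V)
           (\<lambda>p. tangent_coord (atlas L) (V, x) p (anchor L p (inv_into (fibre L p) (\<phi> p) w))))) \<and>
     (\<comment> \<open>\<open>\<Gamma>(A)\<close> is a real Lie algebra\<close>
      (\<forall>\<alpha>\<in>sections L. \<forall>\<beta>\<in>sections L. bracket L \<alpha> \<beta> \<in> sections L) \<and>
      (\<forall>\<alpha>\<in>sections L. \<forall>\<beta>\<in>sections L. \<forall>\<eta>\<in>sections L. \<forall>r s.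
         bracket L (\<lambda>p. r *\<^sub>R \<alpha> p + s *\<^sub>R \<beta> p) \<eta> =
           (\<lambda>p. r *\<^sub>R bracket L \<alpha> \<eta> p + s *\<^sub>R bracket L \<beta> \<eta> p)) \<and>
      (\<forall>\<alpha>\<in>sections L. \<forall>\<beta>\<in>sections L. bracket L \<alpha> \<beta> = (\<lambda>p. - bracket L \<beta> \<alpha> p)) \<and>
      (\<forall>\<alpha>\<in>sections L. \<forall>\<beta>\<in>sections L. \<forall>\<eta>\<in>sections L.
         (\<lambda>p. bracket L \<alpha> (bracket L \<beta> \<eta>) p + bracket L \<beta> (bracket L \<eta> \<alpha>) p
            + bracket L \<eta> (bracket L \<alpha> \<beta>) p) = (\<lambda>p. 0))) \<and>
     (\<comment> \<open>Leibniz rule\<close>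
      \<forall>\<alpha>\<in>sections L. \<forall>\<beta>\<in>sections L. \<forall>f\<in>smooth_functions (atlas L).
         bracket L \<alpha> (\<lambda>p. f p *\<^sub>R \<beta> p) =
           (\<lambda>p. f p *\<^sub>R bracket L \<alpha> \<beta> p + tangent_deriv (atlas L) f p (anchor L p (\<alpha> p)) *\<^sub>R \<beta> p))"

section \<open>Semisimple bundles of ideals\<close>

definition sub_sections ::
  "('m::topological_space, 'e::real_inner, 'v::real_vector, 'f::real_inner) algebroid_data \<Rightarrow>
   ('m \<Rightarrow> 'v set) \<Rightarrow> ('m \<Rightarrow> 'v) set" where
  "sub_sections L K = {\<xi> \<in> sections L. \<forall>p. \<xi> p \<in> K p}"

text \<open>A local trivialisation of the vector bundle \<open>A\<close> (not necessarily in \<open>trivs L\<close>, but smoothly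
  compatible with it) that is adapted to \<open>K\<close>: it identifies the fibres of \<open>K\<close> with the subspace \<open>W\<close> of
  the model fibre. Its restriction to \<open>K\<close> is a local trivialisation of \<open>K\<close>, and every local
  trivialisation of a subbundle arises in this way after shrinking its domain.\<close>

definition adapted_triv ::
  "('m::topological_space, 'e::real_inner, 'v::real_vector, 'f::real_inner) algebroid_data \<Rightarrow>
   ('m \<Rightarrow> 'v set) \<Rightarrow> 'f set \<Rightarrow> ('m, 'v, 'f) triv \<Rightarrow> bool" where
  "adapted_triv L K W = (\<lambda>(U, \<phi>).
     open U \<and>
     (\<forall>p\<in>U. linear_map_on (fibre L p) (\<phi> p) \<and> bij_betw (\<phi> p) (fibre L p) UNIV) \<and>
     (\<forall>(V, \<psi>)\<in>trivs L. \<forall>w.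
        smooth_map_on (atlas L) (U \<inter> V) (\<lambda>p. \<psi> p (inv_into (fibre L p) (\<phi> p) w)) \<and>
        smooth_map_on (atlas L) (U \<inter> V) (\<lambda>p. \<phi> p (inv_into (fibre L p) (\<psi> p) w))) \<and>
     (\<forall>p\<in>U. \<phi> p ` K p = W))"

definition vector_subbundle ::
  "('m::topological_space, 'e::real_inner, 'v::real_vector, 'f::real_inner) algebroid_data \<Rightarrow>
   ('m \<Rightarrow> 'v set) \<Rightarrow> bool" where
  "vector_subbundle L K \<longleftrightarrow>
     (\<forall>p. subspace (K p) \<and> K p \<subseteq> fibre L p) \<and>
     (\<exists>W. subspace W \<and> (\<forall>p. \<exists>U \<phi>. p \<in> U \<and> adapted_triv L K W (U, \<phi>)))"

definition bundle_of_ideals ::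
  "('m::topological_space, 'e::real_inner, 'v::real_vector, 'f::real_inner) algebroid_data \<Rightarrow>
   ('m \<Rightarrow> 'v set) \<Rightarrow> bool" where
  "bundle_of_ideals L K \<longleftrightarrow>
     vector_subbundle L K \<and>
     (\<forall>p. \<forall>a\<in>K p. anchor L p a = 0) \<and>
     (\<forall>\<alpha>\<in>sections L. \<forall>\<xi>\<in>sub_sections L K. bracket L \<alpha> \<xi> \<in> sub_sections L K)"

text \<open>Lie algebras on a subspace \<open>W\<close>; only the values of the bracket on \<open>W\<close> matter. A Lie algebra is
  semisimple if its radical is trivial, i.e. if it has no nonzero solvable ideal.\<close>

definition lie_algebra_on :: "'g::real_vector set \<Rightarrow> ('g \<Rightarrow> 'g \<Rightarrow> 'g) \<Rightarrow> bool" where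
  "lie_algebra_on W br \<longleftrightarrow>
     subspace W \<and>
     (\<forall>a\<in>W. \<forall>b\<in>W. br a b \<in> W) \<and>
     (\<forall>a\<in>W. linear_map_on W (br a) \<and> linear_map_on W (\<lambda>b. br b a)) \<and>
     (\<forall>a\<in>W. br a a = 0) \<and>
     (\<forall>a\<in>W. \<forall>b\<in>W. \<forall>c\<in>W. br a (br b c) + br b (br c a) + br c (br a b) = 0)"

definition lie_ideal_on :: "'g::real_vector set \<Rightarrow> ('g \<Rightarrow> 'g \<Rightarrow> 'g) \<Rightarrow> 'g set \<Rightarrow> bool" where
  "lie_ideal_on W br I \<longleftrightarrow> subspace I \<and> I \<subseteq> W \<and> (\<forall>a\<in>W. \<forall>b\<in>I. br a b \<in> I)"

definition derived_subalgebra :: "('g::real_vector \<Rightarrow> 'g \<Rightarrow> 'g) \<Rightarrow> 'g set \<Rightarrow> 'g set" where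
  "derived_subalgebra br I = span {br a b | a b. a \<in> I \<and> b \<in> I}"

definition lie_solvable :: "('g::real_vector \<Rightarrow> 'g \<Rightarrow> 'g) \<Rightarrow> 'g set \<Rightarrow> bool" where
  "lie_solvable br I \<longleftrightarrow> (\<exists>n. (derived_subalgebra br ^^ n) I = {0})"

definition semisimple_lie_algebra_on :: "'g::real_vector set \<Rightarrow> ('g \<Rightarrow> 'g \<Rightarrow> 'g) \<Rightarrow> bool" where
  "semisimple_lie_algebra_on W br \<longleftrightarrow>
     lie_algebra_on W br \<and> (\<forall>I. lie_ideal_on W br I \<and> lie_solvable br I \<longrightarrow> I = {0})"

text \<open>\<open>K\<close> is locally trivial as a bundle of Lie algebras, with typical fibre \<open>(W, br)\<close>. The bracket on
  the fibres of \<open>K\<close> is the one induced by the \<open>C\<^sup>\<infinity>(M)\<close>-bilinear bracket on \<open>\<Gamma>(K)\<close>.\<close>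

definition lie_algebra_bundle ::
  "('m::topological_space, 'e::real_inner, 'v::real_vector, 'f::real_inner) algebroid_data \<Rightarrow>
   ('m \<Rightarrow> 'v set) \<Rightarrow> 'f set \<Rightarrow> ('f \<Rightarrow> 'f \<Rightarrow> 'f) \<Rightarrow> bool" where
  "lie_algebra_bundle L K W br \<longleftrightarrow>
     lie_algebra_on W br \<and>
     (\<forall>p. \<exists>U \<phi>. p \<in> U \<and> adapted_triv L K W (U, \<phi>) \<and>
        (\<forall>q\<in>U. \<forall>\<xi>\<in>sub_sections L K. \<forall>\<eta>\<in>sub_sections L K.
           \<phi> q (bracket L \<xi> \<eta> q) = br (\<phi> q (\<xi> q)) (\<phi> q (\<eta> q))))"

definition semisimple_bundle_of_ideals ::
  "('m::topological_space, 'e::real_inner, 'v::real_vector, 'f::real_inner) algebroid_data \<Rightarrow>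
   ('m \<Rightarrow> 'v set) \<Rightarrow> bool" where
  "semisimple_bundle_of_ideals L K \<longleftrightarrow>
     bundle_of_ideals L K \<and>
     (\<exists>W br. lie_algebra_bundle L K W br \<and> semisimple_lie_algebra_on W br)"

section \<open>Differential forms with values in \<open>K\<close>\<close>

text \<open>An alternating \<open>q\<close>-linear map is a function on lists of tangent vectors that vanishes on lists of
  length different from \<open>q\<close>. With this convention, equality of forms is equality of functions, and the
  contraction of a 0-form is 0.\<close>

type_synonym ('m, 'e, 'v) vform = "'m \<Rightarrow> 'e list \<Rightarrow> 'v"

definition alternating_maps :: "'v::real_vector set \<Rightarrow> nat \<Rightarrow> ('e::real_vector list \<Rightarrow> 'v) set" where
  "alternating_maps V q = {\<omega>.
     (\<forall>vs. length vs = q \<longrightarrow> \<omega> vs \<in> V) \<and>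
     (\<forall>vs. length vs \<noteq> q \<longrightarrow> \<omega> vs = 0) \<and>
     (\<forall>vs i. length vs = q \<and> i < q \<longrightarrow> linear (\<lambda>u. \<omega> (vs[i := u]))) \<and>
     (\<forall>vs i j. length vs = q \<and> i < j \<and> j < q \<and> vs ! i = vs ! j \<longrightarrow> \<omega> vs = 0)}"

definition forms ::
  "('m::topological_space, 'e::real_inner, 'v::real_vector, 'f::real_inner) algebroid_data \<Rightarrow>
   ('m \<Rightarrow> 'v set) \<Rightarrow> nat \<Rightarrow> ('m, 'e, 'v) vform set" where
  "forms L K q = {\<gamma>.
     (\<forall>p. \<gamma> p \<in> alternating_maps (K p) q) \<and>
     (\<forall>(U, \<phi>)\<in>trivs L. \<forall>c\<in>atlas L. \<forall>es.
        smooth_map_on (atlas L) (U \<inter> fst c) (\<lambda>p. \<phi> p (\<gamma> p (map (tangent_vec (atlas L) c p) es))))}"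

definition form_add :: "('m, 'e, 'v::real_vector) vform \<Rightarrow> ('m, 'e, 'v) vform \<Rightarrow> ('m, 'e, 'v) vform" where
  "form_add \<gamma> \<gamma>' = (\<lambda>p vs. \<gamma> p vs + \<gamma>' p vs)"

definition form_scale :: "('m \<Rightarrow> real) \<Rightarrow> ('m, 'e, 'v::real_vector) vform \<Rightarrow> ('m, 'e, 'v) vform" where
  "form_scale f \<gamma> = (\<lambda>p vs. f p *\<^sub>R \<gamma> p vs)"

definition form_zero :: "('m, 'e, 'v::real_vector) vform" where
  "form_zero = (\<lambda>p vs. 0)"

definition form_minus :: "('m, 'e, 'v::real_vector) vform \<Rightarrow> ('m, 'e, 'v) vform" where
  "form_minus \<gamma> = (\<lambda>p vs. - \<gamma> p vs)"

definition eval_form :: "('m, 'e, 'v) vform \<Rightarrow> ('m \<Rightarrow> 'e) list \<Rightarrow> 'm \<Rightarrow> 'v" where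
  "eval_form \<gamma> Xs = (\<lambda>p. \<gamma> p (map (\<lambda>X. X p) Xs))"

definition contract :: "('m \<Rightarrow> 'e) \<Rightarrow> ('m, 'e, 'v) vform \<Rightarrow> ('m, 'e, 'v) vform" where
  "contract X \<gamma> = (\<lambda>p vs. \<gamma> p (X p # vs))"

definition delete_nth :: "nat \<Rightarrow> 'a list \<Rightarrow> 'a list" where
  "delete_nth i xs = take i xs @ drop (Suc i) xs"

text \<open>\<open>df \<and> \<eta>\<close>, with \<open>(df \<and> \<eta>)(X\<^sub>0, \<dots>, X\<^sub>n) = \<Sum>\<^sub>i (-1)\<^sup>i df(X\<^sub>i) \<eta>(X\<^sub>0, \<dots>, omit X\<^sub>i, \<dots>, X\<^sub>n)\<close>.\<close>

definition d_wedge ::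
  "('m, 'e::real_normed_vector) chart set \<Rightarrow> ('m \<Rightarrow> real) \<Rightarrow> ('m, 'e, 'v::real_vector) vform \<Rightarrow>
   ('m, 'e, 'v) vform" where
  "d_wedge \<A> f \<eta> = (\<lambda>p vs.
     \<Sum>i<length vs. ((-1) ^ i * tangent_deriv \<A> f p (vs ! i)) *\<^sub>R \<eta> p (delete_nth i vs))"

text \<open>\<open>(\<L>\<^sup>A\<^sub>\<alpha>\<gamma>)(X\<^sub>1, \<dots>, X\<^sub>q) = [\<alpha>, \<gamma>(X\<^sub>1, \<dots>, X\<^sub>q)] - \<Sum>\<^sub>j \<gamma>(\<dots>, [\<rho>(\<alpha>), X\<^sub>j], \<dots>)\<close>\<close>

definition lie_deriv ::
  "('m::topological_space, 'e::real_inner, 'v::real_vector, 'f::real_inner) algebroid_data \<Rightarrow>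
   ('m \<Rightarrow> 'v) \<Rightarrow> ('m, 'e, 'v) vform \<Rightarrow> ('m, 'e, 'v) vform" where
  "lie_deriv L \<alpha> \<gamma> = (\<lambda>p vs.
     let Xs = map (vf_ext (atlas L) p) vs in
       bracket L \<alpha> (eval_form \<gamma> Xs) p
     - (\<Sum>j<length Xs. eval_form \<gamma> (Xs[j := vf_bracket (atlas L) (anchor_sec L \<alpha>) (Xs ! j)]) p))"

section \<open>Infinitesimally multiplicative forms\<close>

text \<open>\<open>c\<^sub>0\<close> is only relevant on \<open>\<Gamma>(A)\<close> and \<open>c\<^sub>1 p\<close> on \<open>A p\<close>; elsewhere they are set to 0, so that equality
  of IM forms is equality of functions.\<close>

type_synonym ('m, 'e, 'v) im_data =
  "(('m \<Rightarrow> 'v) \<Rightarrow> ('m, 'e, 'v) vform) \<times> ('m \<Rightarrow> 'v \<Rightarrow> 'e list \<Rightarrow> 'v)"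

definition app_sec :: "('m \<Rightarrow> 'v \<Rightarrow> 'b) \<Rightarrow> ('m \<Rightarrow> 'v) \<Rightarrow> 'm \<Rightarrow> 'b" where
  "app_sec c\<^sub>1 \<alpha> = (\<lambda>p. c\<^sub>1 p (\<alpha> p))"

text \<open>Bundle maps \<open>A \<rightarrow> \<Lambda>\<^sup>r T\<^sup>*M \<otimes> K\<close>.\<close>

definition form_bundle_maps ::
  "('m::topological_space, 'e::real_inner, 'v::real_vector, 'f::real_inner) algebroid_data \<Rightarrow>
   ('m \<Rightarrow> 'v set) \<Rightarrow> nat \<Rightarrow> ('m \<Rightarrow> 'v \<Rightarrow> 'e list \<Rightarrow> 'v) set" where
  "form_bundle_maps L K r = {c\<^sub>1.
     (\<forall>p. \<forall>a\<in>fibre L p. c\<^sub>1 p a \<in> alternating_maps (K p) r) \<and>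
     (\<forall>p a. a \<notin> fibre L p \<longrightarrow> c\<^sub>1 p a = (\<lambda>vs. 0)) \<and>
     (\<forall>p vs. linear_map_on (fibre L p) (\<lambda>a. c\<^sub>1 p a vs)) \<and>
     (\<forall>(U, \<phi>)\<in>trivs L. \<forall>c\<in>atlas L. \<forall>w es.
        smooth_map_on (atlas L) (U \<inter> fst c)
          (\<lambda>p. \<phi> p (c\<^sub>1 p (inv_into (fibre L p) (\<phi> p) w) (map (tangent_vec (atlas L) c p) es))))}"

text \<open>In degree \<open>q = 0\<close> the target \<open>\<Lambda>\<^sup>q\<^sup>-\<^sup>1 T\<^sup>*M \<otimes> K\<close> of \<open>c\<^sub>1\<close> is the zero bundle.\<close>

definition im_forms ::
  "('m::topological_space, 'e::real_inner, 'v::real_vector, 'f::real_inner) algebroid_data \<Rightarrow>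
   ('m \<Rightarrow> 'v set) \<Rightarrow> nat \<Rightarrow> ('m, 'e, 'v) im_data set" where
  "im_forms L K q = {(c\<^sub>0, c\<^sub>1).
     (\<forall>\<alpha>\<in>sections L. c\<^sub>0 \<alpha> \<in> forms L K q) \<and>
     (\<forall>\<alpha>. \<alpha> \<notin> sections L \<longrightarrow> c\<^sub>0 \<alpha> = form_zero) \<and>
     (\<forall>\<alpha>\<in>sections L. \<forall>\<beta>\<in>sections L. \<forall>r s.
        c\<^sub>0 (\<lambda>p. r *\<^sub>R \<alpha> p + s *\<^sub>R \<beta> p) =
          form_add (form_scale (\<lambda>_. r) (c\<^sub>0 \<alpha>)) (form_scale (\<lambda>_. s) (c\<^sub>0 \<beta>))) \<and>
     c\<^sub>1 \<in> (case q of 0 \<Rightarrow> {\<lambda>p a vs. 0} | Suc r \<Rightarrow> form_bundle_maps L K r) \<and>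
     (\<forall>\<alpha>\<in>sections L. \<forall>f\<in>smooth_functions (atlas L).
        c\<^sub>0 (\<lambda>p. f p *\<^sub>R \<alpha> p) =
          form_add (form_scale f (c\<^sub>0 \<alpha>)) (d_wedge (atlas L) f (app_sec c\<^sub>1 \<alpha>))) \<and>
     (\<forall>\<alpha>\<in>sections L. \<forall>\<beta>\<in>sections L.
        c\<^sub>0 (bracket L \<alpha> \<beta>) =
          form_add (lie_deriv L \<alpha> (c\<^sub>0 \<beta>)) (form_minus (lie_deriv L \<beta> (c\<^sub>0 \<alpha>))) \<and>
        app_sec c\<^sub>1 (bracket L \<alpha> \<beta>) =
          form_add (lie_deriv L \<alpha> (app_sec c\<^sub>1 \<beta>)) (form_minus (contract (anchor_sec L \<beta>) (c\<^sub>0 \<alpha>))) \<and>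
        contract (anchor_sec L \<alpha>) (app_sec c\<^sub>1 \<beta>) =
          form_minus (contract (anchor_sec L \<beta>) (app_sec c\<^sub>1 \<alpha>)))}"

definition horizontal_im_forms ::
  "('m::topological_space, 'e::real_inner, 'v::real_vector, 'f::real_inner) algebroid_data \<Rightarrow>
   ('m \<Rightarrow> 'v set) \<Rightarrow> nat \<Rightarrow> ('m, 'e, 'v) im_data set" where
  "horizontal_im_forms L K q = {(c\<^sub>0, c\<^sub>1) \<in> im_forms L K q. \<forall>p. \<forall>a\<in>K p. c\<^sub>1 p a = (\<lambda>vs. 0)}"

definition im_add :: "('m, 'e, 'v::real_vector) im_data \<Rightarrow> ('m, 'e, 'v) im_data \<Rightarrow> ('m, 'e, 'v) im_data" where
  "im_add c c' = (\<lambda>\<alpha>. form_add (fst c \<alpha>) (fst c' \<alpha>), \<lambda>p a vs. snd c p a vs + snd c' p a vs)"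

definition im_scale :: "real \<Rightarrow> ('m, 'e, 'v::real_vector) im_data \<Rightarrow> ('m, 'e, 'v) im_data" where
  "im_scale r c = (\<lambda>\<alpha>. form_scale (\<lambda>_. r) (fst c \<alpha>), \<lambda>p a vs. r *\<^sub>R snd c p a vs)"

definition delta0 ::
  "('m::topological_space, 'e::real_inner, 'v::real_vector, 'f::real_inner) algebroid_data \<Rightarrow>
   ('m, 'e, 'v) vform \<Rightarrow> ('m, 'e, 'v) im_data" where
  "delta0 L \<gamma> =
     (\<lambda>\<alpha>. if \<alpha> \<in> sections L then lie_deriv L \<alpha> \<gamma> else form_zero,
      \<lambda>p a vs. if a \<in> fibre L p then \<gamma> p (anchor L p a # vs) else 0)"

section \<open>Connections\<close>

text \<open>A linear connection on \<open>K\<close> is a map \<open>\<nabla> : \<Gamma>(K) \<rightarrow> \<Omega>\<^sup>1(M; K)\<close>, extended by 0 outside \<open>\<Gamma>(K)\<close>, and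
  \<open>\<nabla>\<^sub>X\<xi> = (\<nabla>\<xi>)(X)\<close>.\<close>

type_synonym ('m, 'e, 'v) conn = "('m \<Rightarrow> 'v) \<Rightarrow> ('m, 'e, 'v) vform"

definition covariant :: "('m, 'e, 'v) conn \<Rightarrow> ('m \<Rightarrow> 'e) \<Rightarrow> ('m \<Rightarrow> 'v) \<Rightarrow> 'm \<Rightarrow> 'v" where
  "covariant D X \<xi> = eval_form (D \<xi>) [X]"

definition linear_connections ::
  "('m::topological_space, 'e::real_inner, 'v::real_vector, 'f::real_inner) algebroid_data \<Rightarrow>
   ('m \<Rightarrow> 'v set) \<Rightarrow> ('m, 'e, 'v) conn set" where
  "linear_connections L K = {D.
     (\<forall>\<xi>\<in>sub_sections L K. D \<xi> \<in> forms L K 1) \<and>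
     (\<forall>\<xi>. \<xi> \<notin> sub_sections L K \<longrightarrow> D \<xi> = form_zero) \<and>
     (\<forall>\<xi>\<in>sub_sections L K. \<forall>\<eta>\<in>sub_sections L K.
        D (\<lambda>p. \<xi> p + \<eta> p) = form_add (D \<xi>) (D \<eta>)) \<and>
     (\<forall>\<xi>\<in>sub_sections L K. \<forall>f\<in>smooth_functions (atlas L). \<forall>X\<in>vector_fields (atlas L).
        covariant D X (\<lambda>p. f p *\<^sub>R \<xi> p) =
          (\<lambda>p. f p *\<^sub>R covariant D X \<xi> p + tangent_deriv (atlas L) f p (X p) *\<^sub>R \<xi> p))}"

definition bracket_preserving ::
  "('m::topological_space, 'e::real_inner, 'v::real_vector, 'f::real_inner) algebroid_data \<Rightarrow>
   ('m \<Rightarrow> 'v set) \<Rightarrow> ('m, 'e, 'v) conn \<Rightarrow> bool" where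
  "bracket_preserving L K D \<longleftrightarrow>
     (\<forall>X\<in>vector_fields (atlas L). \<forall>\<xi>\<in>sub_sections L K. \<forall>\<eta>\<in>sub_sections L K.
        covariant D X (bracket L \<xi> \<eta>) =
          (\<lambda>p. bracket L (covariant D X \<xi>) \<eta> p + bracket L \<xi> (covariant D X \<eta>) p))"

text \<open>The exterior covariant derivative, by the Koszul formula:
  \<open>(d\<^sup>\<nabla>\<omega>)(X\<^sub>0, \<dots>, X\<^sub>q) = \<Sum>\<^sub>i (-1)\<^sup>i \<nabla>\<^bsub>X\<^sub>i\<^esub> (\<omega>(\<dots>, omit X\<^sub>i, \<dots>))
    + \<Sum>\<^bsub>i<j\<^esub> (-1)\<^sup>i\<^sup>+\<^sup>j \<omega>([X\<^sub>i, X\<^sub>j], \<dots>, omit X\<^sub>i, \<dots>, omit X\<^sub>j, \<dots>)\<close>.\<close>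

definition ext_covariant ::
  "('m::topological_space, 'e::real_inner, 'v::real_vector, 'f::real_inner) algebroid_data \<Rightarrow>
   ('m, 'e, 'v) conn \<Rightarrow> ('m, 'e, 'v) vform \<Rightarrow> ('m, 'e, 'v) vform" where
  "ext_covariant L D \<omega> = (\<lambda>p vs.
     let Xs = map (vf_ext (atlas L) p) vs in
       (\<Sum>i<length Xs. (-1) ^ i *\<^sub>R covariant D (Xs ! i) (eval_form \<omega> (delete_nth i Xs)) p)
     + (\<Sum>j<length Xs. \<Sum>i<j. (-1) ^ (i + j) *\<^sub>R
          eval_form \<omega> (vf_bracket (atlas L) (Xs ! i) (Xs ! j) # delete_nth i (delete_nth j Xs)) p))"

text \<open>Splittings \<open>v : A \<rightarrow> K\<close>, set to 0 outside the fibres of \<open>A\<close>, and \<open>h = id - v\<close>.\<close>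

definition splittings ::
  "('m::topological_space, 'e::real_inner, 'v::real_vector, 'f::real_inner) algebroid_data \<Rightarrow>
   ('m \<Rightarrow> 'v set) \<Rightarrow> ('m \<Rightarrow> 'v \<Rightarrow> 'v) set" where
  "splittings L K = {v.
     (\<forall>p. linear_map_on (fibre L p) (v p) \<and> v p ` fibre L p \<subseteq> K p) \<and>
     (\<forall>p a. a \<notin> fibre L p \<longrightarrow> v p a = 0) \<and>
     (\<forall>(U, \<phi>)\<in>trivs L. \<forall>w.
        smooth_map_on (atlas L) U (\<lambda>p. \<phi> p (v p (inv_into (fibre L p) (\<phi> p) w)))) \<and>
     (\<forall>p. \<forall>a\<in>K p. v p a = a)}"

definition horizontal_part :: "('m \<Rightarrow> 'v::real_vector \<Rightarrow> 'v) \<Rightarrow> ('m \<Rightarrow> 'v) \<Rightarrow> 'm \<Rightarrow> 'v" where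
  "horizontal_part v \<alpha> = (\<lambda>p. \<alpha> p - v p (\<alpha> p))"

text \<open>For an IM 1-form \<open>(\<C>, c\<^sub>1)\<close>, \<open>c\<^sub>1\<close> takes values in \<open>\<Lambda>\<^sup>0 T\<^sup>*M \<otimes> K\<close>; \<open>vertical_part\<close> is the associated
  map \<open>A \<rightarrow> K\<close>.\<close>

definition vertical_part :: "('m, 'e, 'v) im_data \<Rightarrow> 'm \<Rightarrow> 'v \<Rightarrow> 'v" where
  "vertical_part c = (\<lambda>p a. snd c p a [])"

definition im_connections ::
  "('m::topological_space, 'e::real_inner, 'v::real_vector, 'f::real_inner) algebroid_data \<Rightarrow>
   ('m \<Rightarrow> 'v set) \<Rightarrow> ('m, 'e, 'v) im_data set" where
  "im_connections L K = {c \<in> im_forms L K 1. \<forall>p. \<forall>a\<in>K p. vertical_part c p a = a}"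

definition induced_connection ::
  "('m::topological_space, 'e::real_inner, 'v::real_vector, 'f::real_inner) algebroid_data \<Rightarrow>
   ('m \<Rightarrow> 'v set) \<Rightarrow> ('m, 'e, 'v) im_data \<Rightarrow> ('m, 'e, 'v) conn" where
  "induced_connection L K c = (\<lambda>\<xi>. if \<xi> \<in> sub_sections L K then fst c \<xi> else form_zero)"

text \<open>\<open>\<alpha> \<mapsto> \<C>(\<alpha> - v(\<alpha>))\<close> is \<open>C\<^sup>\<infinity>(M)\<close>-linear; its value on \<open>a \<in> A p\<close> is computed by means of a global section
  through \<open>a\<close>.\<close>

definition sec_ext ::
  "('m::topological_space, 'e::real_inner, 'v::real_vector, 'f::real_inner) algebroid_data \<Rightarrow>
   'm \<Rightarrow> 'v \<Rightarrow> 'm \<Rightarrow> 'v" where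
  "sec_ext L p a = (SOME \<alpha>. \<alpha> \<in> sections L \<and> \<alpha> p = a)"

definition im_curvature ::
  "('m::topological_space, 'e::real_inner, 'v::real_vector, 'f::real_inner) algebroid_data \<Rightarrow>
   ('m \<Rightarrow> 'v set) \<Rightarrow> ('m, 'e, 'v) im_data \<Rightarrow> ('m, 'e, 'v) im_data" where
  "im_curvature L K c =
     (\<lambda>\<alpha>. if \<alpha> \<in> sections L then ext_covariant L (induced_connection L K c) (fst c \<alpha>) else form_zero,
      \<lambda>p a vs. if a \<in> fibre L p
        then fst c (horizontal_part (vertical_part c) (sec_ext L p a)) p vs else 0)"

end

theory Submission
  imports Defs "Jordan_Normal_Form.Jordan_Normal_Form_Existence"
begin

text \<open>
  Everything rests on one fact about a semisimple Lie algebra: it has no centre and all its derivations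
  are inner, so that \<open>ad\<close> identifies it with its Lie algebra of derivations. For sections of the bundle
  of ideals \<open>K\<close> this becomes: the value of a section \<open>\<zeta>\<close> at a point is determined by the values
  of all \<open>[\<zeta>, \<xi>]\<close> there (\<open>ad_injective\<close>), and every \<open>C\<^sup>\<infinity>(M)\<close>-linear derivation of \<open>\<Gamma>(K)\<close> is \<open>[\<zeta>, -]\<close> for a
  smooth section \<open>\<zeta>\<close> (\<open>ad_surjective\<close>). Consequently a \<open>K\<close>-valued form is the same as a
  \<open>C\<^sup>\<infinity>(M)\<close>-multilinear alternating family of such derivations (\<open>form_of_derivations\<close>), and an equation
  between \<open>K\<close>-valued forms may be checked after bracketing both sides with an arbitrary section of \<open>K\<close>.

  (i) Let \<open>c\<close> be a horizontal IM form. On \<open>\<Gamma>(K)\<close> the \<open>df\<close>-term in the Leibniz rule of \<open>c\<^sub>0\<close> vanishes, and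
  \<open>\<L>\<^sup>A\<^sub>\<xi>\<close> is just \<open>[\<xi>, -]\<close> since \<open>\<rho>(\<xi>) = 0\<close>. So the equation for \<open>c\<^sub>0[\<xi>, \<eta>]\<close> says that
  \<open>\<xi> \<mapsto> c\<^sub>0(\<xi>)(X\<^sub>1, \<dots>, X\<^sub>q)\<close> is a \<open>C\<^sup>\<infinity>(M)\<close>-linear derivation, which gives a unique form \<open>\<gamma>\<close> with
  \<open>c\<^sub>0(\<xi>) = [\<xi>, \<gamma>]\<close>. The equations for \<open>c\<^sub>0[\<alpha>, \<xi>]\<close> and \<open>c\<^sub>1[\<xi>, \<beta>]\<close> then force \<open>c = \<delta>\<^sup>0\<gamma>\<close>.

  (ii) The connection \<open>\<nabla>\<close> induced by an IM connection \<open>(\<C>, v)\<close> preserves brackets, so its curvature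
  consists of derivations and there is an \<open>F\<close> with \<open>[\<xi>, F(X, Y)] = \<nabla>\<^sub>X\<nabla>\<^sub>Y\<xi> - \<nabla>\<^sub>Y\<nabla>\<^sub>X\<xi> - \<nabla>\<^bsub>[X, Y]\<^esub>\<xi>\<close>
  (\<open>curvature_form\<close>). The IM equations with one argument in \<open>\<Gamma>(K)\<close> read
  \<open>[\<C>(\<alpha>)(X), \<xi>] = \<nabla>\<^sub>X[\<alpha>, \<xi>] - [\<alpha>, \<nabla>\<^sub>X\<xi>] + \<nabla>\<^bsub>[\<rho>(\<alpha>), X]\<^esub>\<xi>\<close> and \<open>[h(\<alpha>), \<xi>] = \<nabla>\<^bsub>\<rho>(\<alpha>)\<^esub>\<xi>\<close>. Substituting them,
  both components of \<open>\<Omega>\<^bsup>(\<C>, v)\<^esup> = \<delta>\<^sup>0F\<close>, and also \<open>d\<^sup>\<nabla>F = 0\<close>, turn into identities between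
  commutators of operators on \<open>\<Gamma>(K)\<close>. Uniqueness of \<open>F\<close> is the injectivity in (i).

  (iii) The first of these two formulas shows that \<open>\<nabla>\<close> determines \<open>\<C>\<close>. Conversely its right-hand side
  is a \<open>C\<^sup>\<infinity>(M)\<close>-linear derivation in \<open>\<xi>\<close> for every bracket-preserving \<open>\<nabla>\<close>, and so defines \<open>\<C>\<close>; the second formula is what
  makes the Leibniz rule and the equation for \<open>c\<^sub>1\<close> hold.

  The algebraic fact follows from the nondegeneracy of the Killing form. Its radical is an ideal, so it
  suffices that this ideal is solvable (Cartan's criterion). Let \<open>x\<close> lie in the derived algebra of the radical, and let \<open>D\<close> act on the generalised
  eigenspaces of \<open>ad x\<close> on the complexification as multiplication by the conjugate eigenvalue. Since generalised eigenspaces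
  satisfy \<open>[E\<^sub>\<kappa>, E\<^sub>\<mu>] \<subseteq> E\<^bsub>\<kappa>+\<mu>\<^esub>\<close>, \<open>D\<close> is a derivation, so \<open>tr(D ad[a, c]) = tr(ad(Da) ad c) = 0\<close> for
  \<open>a\<close>, \<open>c\<close> in the radical. Hence \<open>tr(D ad x)\<close>, which is the sum of the \<open>|\<lambda>|\<^sup>2\<close> over the eigenvalues, is zero, \<open>ad x\<close> is
  nilpotent, and Engel's theorem applies.
\<close>

section \<open>Jordan bases\<close>

lemma jordan_matrix_entry:
  assumes "i < sum_list (map fst nas)" "j < sum_list (map fst nas)"
    and "jordan_matrix nas $$ (i, j) \<noteq> 0"
  shows "i = j \<or> (j = Suc i \<and> jordan_matrix nas $$ (i, i) = jordan_matrix nas $$ (j, j))"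
  using assms
proof (induction nas arbitrary: i j)
  case Nil
  then show ?case by simp
next
  case (Cons na nas)
  obtain n a where na: "na = (n, a)" by force
  let ?N = "sum_list (map fst nas)"
  have lt: "i < n + ?N" "j < n + ?N" using Cons.prems by (auto simp: na)
  have e: "jordan_matrix (na # nas) $$ (i, j) = (if i < n then if j < n then jordan_block n a $$ (i, j) else 0
       else if j < n then 0 else jordan_matrix nas $$ (i - n, j - n))"
    if "i < n + ?N" "j < n + ?N" for i j
    unfolding na jordan_matrix_Cons using that by (subst index_mat_four_block) auto
  have nz: "jordan_matrix (na # nas) $$ (i, j) \<noteq> 0" by (rule Cons.prems)
  consider "i < n" "j < n" | "\<not> i < n" "\<not> j < n"
    using nz e[OF lt] by (metis (full_types))
  then show ?case
  proof cases
    case 1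
    then show ?thesis using nz e[OF lt] e[OF lt(1) lt(1)] e[OF lt(2) lt(2)]
      by (simp split: if_splits)
  next
    case 2
    then have "i - n = j - n \<or> j - n = Suc (i - n) \<and>
        jordan_matrix nas $$ (i - n, i - n) = jordan_matrix nas $$ (j - n, j - n)"
      using nz e[OF lt] lt by (intro Cons.IH) auto
    then show ?thesis using 2 e[OF lt(1) lt(1)] e[OF lt(2) lt(2)] by auto
  qed
qed

text \<open>The Jordan normal form in coordinates: the columns of \<open>P\<close> are a Jordan basis, \<open>Q\<close> is the inverse of \<open>P\<close>, \<open>l j\<close> is
the eigenvalue that belongs to column \<open>j\<close>, and \<open>e j\<close> is the entry above it, which is zero at the start of a block.\<close>

lemma complex_jordan_basis:
  fixes X :: "nat \<Rightarrow> nat \<Rightarrow> complex"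
  obtains P Q :: "nat \<Rightarrow> nat \<Rightarrow> complex" and l e :: "nat \<Rightarrow> complex"
  where "\<And>i j. i < n \<Longrightarrow> j < n \<Longrightarrow> (\<Sum>k<n. P i k * Q k j) = (if i = j then 1 else 0)"
    and "\<And>i j. i < n \<Longrightarrow> j < n \<Longrightarrow> (\<Sum>k<n. Q i k * P k j) = (if i = j then 1 else 0)"
    and "\<And>i j. i < n \<Longrightarrow> j < n \<Longrightarrow>
           (\<Sum>k<n. X i k * P k j) = l j * P i j + (if j = 0 then 0 else e j * P i (j - 1))"
    and "\<And>j. j < n \<Longrightarrow> j \<noteq> 0 \<Longrightarrow> e j \<noteq> 0 \<Longrightarrow> l (j - 1) = l j"
proof -
  define A where "A = mat n n (\<lambda>(i, j). X i j)"
  have A: "A \<in> carrier_mat n n" by (simp add: A_def)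
  obtain as where "char_poly A = (\<Prod>a\<leftarrow>as. [:- a, 1:])"
    using char_poly_factorized[OF A] by auto
  then obtain nas where "jordan_nf A nas" using jordan_nf_exists[OF A] by blast
  then have "similar_mat A (jordan_matrix nas)" by (simp add: jordan_nf_def)
  then obtain P Q where w: "similar_mat_wit A (jordan_matrix nas) P Q" by (auto simp: similar_mat_def)
  define J where "J = jordan_matrix nas"
  have PQ: "P * Q = 1\<^sub>m n" and QP: "Q * P = 1\<^sub>m n" and AJ: "A = P * J * Q"
    and P: "P \<in> carrier_mat n n" and Q: "Q \<in> carrier_mat n n" and J: "J \<in> carrier_mat n n"
    using w A by (auto simp: J_def similar_mat_wit_def Let_def)
  have n: "sum_list (map fst nas) = n"
    using J unfolding J_def by (metis carrier_matD(1) jordan_matrix_dim(1))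
  have AP: "A * P = P * J"
  proof -
    have "A * P = P * J * (Q * P)" unfolding AJ using P Q J by (simp add: assoc_mult_mat[of _ n n _ n _ n])
    also have "\<dots> = P * J" using QP P J by simp
    finally show ?thesis .
  qed
  have ent: "(B * C) $$ (i, j) = (\<Sum>k<n. B $$ (i, k) * C $$ (k, j))"
    if "B \<in> carrier_mat n n" "C \<in> carrier_mat n n" "i < n" "j < n" for B C :: "complex mat" and i j
    using that by (auto simp: scalar_prod_def lessThan_atLeast0)
  have Jent: "i = j \<or> (j = Suc i \<and> J $$ (i, i) = J $$ (j, j))" if "i < n" "j < n" "J $$ (i, j) \<noteq> 0" for i j
    using jordan_matrix_entry[of i nas j] that by (simp add: J_def n)
  show ?thesis
  proof (rule that[of "\<lambda>i j. P $$ (i, j)" "\<lambda>i j. Q $$ (i, j)" "\<lambda>j. J $$ (j, j)" "\<lambda>j. J $$ (j - 1, j)"])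
    fix i j assume ij: "i < n" "j < n"
    show "(\<Sum>k<n. P $$ (i, k) * Q $$ (k, j)) = (if i = j then 1 else 0)"
      using ent[OF P Q ij] ij by (simp add: PQ)
    show "(\<Sum>k<n. Q $$ (i, k) * P $$ (k, j)) = (if i = j then 1 else 0)"
      using ent[OF Q P ij] ij by (simp add: QP)
    have "(\<Sum>k<n. X i k * P $$ (k, j)) = (A * P) $$ (i, j)"
      using ent[OF A P ij] ij by (simp add: A_def)
    also have "\<dots> = (\<Sum>k<n. P $$ (i, k) * J $$ (k, j))"
      unfolding AP by (rule ent[OF P J ij])
    also have "\<dots> = (\<Sum>k\<in>{j} \<union> (if j = 0 then {} else {j - 1}). P $$ (i, k) * J $$ (k, j))"
    proof (rule sum.mono_neutral_right)
      show "{j} \<union> (if j = 0 then {} else {j - 1}) \<subseteq> {..<n}" using ij by auto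
      show "\<forall>k\<in>{..<n} - ({j} \<union> (if j = 0 then {} else {j - 1})). P $$ (i, k) * J $$ (k, j) = 0"
      proof
        fix k assume k: "k \<in> {..<n} - ({j} \<union> (if j = 0 then {} else {j - 1}))"
        then have "k \<noteq> j" "j \<noteq> Suc k" by (auto split: if_splits)
        then show "P $$ (i, k) * J $$ (k, j) = 0" using Jent[of k j] ij k by auto
      qed
    qed simp
    also have "\<dots> = J $$ (j, j) * P $$ (i, j) + (if j = 0 then 0 else J $$ (j - 1, j) * P $$ (i, j - 1))"
      by (auto simp: mult.commute)
    finally show "(\<Sum>k<n. X i k * P $$ (k, j)) =
        J $$ (j, j) * P $$ (i, j) + (if j = 0 then 0 else J $$ (j - 1, j) * P $$ (i, j - 1))" .
  next
    fix j assume "j < n" "j \<noteq> 0" "J $$ (j - 1, j) \<noteq> 0"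
    then have "j - 1 < n" "j - 1 \<noteq> j" by auto
    then show "J $$ (j - 1, j - 1) = J $$ (j, j)"
      using Jent[OF _ \<open>j < n\<close> \<open>J $$ (j - 1, j) \<noteq> 0\<close>] by blast
  qed
qed

section \<open>Lie algebras and the Killing form\<close>

(* The matrix library shares these names with the theory of real vector spaces and inner products. *)
hide_const (open) VectorSpace.subspace LinearCombinations.module.span Modules.additive Matrix.orthogonal
hide_fact (open) VectorSpace.subspace_def Matrix.orthogonal_def
no_notation scalar_prod (infix "\<bullet>" 70)

lemma linear_map_onD:
  assumes "linear_map_on V f"
  shows "a \<in> V \<Longrightarrow> b \<in> V \<Longrightarrow> f (a + b) = f a + f b" "a \<in> V \<Longrightarrow> f (r *\<^sub>R a) = r *\<^sub>R f a"
  using assms by (auto simp: linear_map_on_def)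

lemma linear_map_on_sum:
  assumes "linear_map_on V f" "subspace V" "\<And>i. i \<in> I \<Longrightarrow> g i \<in> V"
  shows "f (\<Sum>i\<in>I. c i *\<^sub>R g i) = (\<Sum>i\<in>I. c i *\<^sub>R f (g i))"
proof -
  have "f 0 = 0" using linear_map_onD(2)[OF assms(1) subspace_0[OF assms(2)], of 0] by simp
  then show ?thesis using assms(3)
  proof (induction I rule: infinite_finite_induct)
    case (insert x F)
    have "(\<Sum>i\<in>F. c i *\<^sub>R g i) \<in> V"
      using insert by (intro subspace_sum[OF assms(2)] subspace_scale[OF assms(2)]) auto
    then show ?case
      using insert linear_map_onD[OF assms(1)] by (simp add: subspace_scale[OF assms(2)])
  qed auto
qed

text \<open>The inner product space need not be of class \<open>euclidean_space\<close>, so the basis comes from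
Gram-Schmidt; it is indexed by numbers in order to serve as a basis for matrices.\<close>

lemma subspace_onb:
  fixes W :: "'f::real_inner set"
  assumes "finite_dimensional TYPE('f)" "subspace W"
  obtains n :: nat and b :: "nat \<Rightarrow> 'f"
  where "\<And>i. i < n \<Longrightarrow> b i \<in> W"
    and "\<And>i j. i < n \<Longrightarrow> j < n \<Longrightarrow> b i \<bullet> b j = (if i = j then 1 else 0)"
    and "\<And>w. w \<in> W \<Longrightarrow> w = (\<Sum>i<n. (w \<bullet> b i) *\<^sub>R b i)"
proof -
  obtain E :: "'f set" where E: "finite E" "span E = UNIV"
    using assms(1) by (auto simp: finite_dimensional_def)
  obtain B where B: "B \<subseteq> W" "independent B" "W \<subseteq> span B"
    using maximal_independent_subset[of W] by blast
  have "finite B" using independent_span_bound[OF E(1) B(2)] E(2) by auto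
  then obtain C where C: "finite C" "span C = span B" "pairwise orthogonal C"
    using basis_orthogonal by blast
  have WC: "W = span C" using B C assms(2) by (metis span_minimal subset_antisym)
  define C' where "C' = (\<lambda>c. (1 / norm c) *\<^sub>R c) ` (C - {0})"
  have fin: "finite C'" using C(1) by (simp add: C'_def)
  have sub: "C' \<subseteq> W" unfolding C'_def WC by (auto intro: span_scale span_base)
  have orth: "c \<bullet> d = (if c = d then 1 else 0)" if "c \<in> C'" "d \<in> C'" for c d
  proof -
    obtain c' d' where cd: "c = (1 / norm c') *\<^sub>R c'" "d = (1 / norm d') *\<^sub>R d'"
      "c' \<in> C" "d' \<in> C" "c' \<noteq> 0" "d' \<noteq> 0"
      using \<open>c \<in> C'\<close> \<open>d \<in> C'\<close> unfolding C'_def by auto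
    show ?thesis
    proof (cases "c = d")
      case True
      then show ?thesis using cd by (simp add: dot_square_norm power2_eq_square)
    next
      case False
      then have "c' \<noteq> d'" using cd by auto
      then have "c' \<bullet> d' = 0" using C(3) cd by (auto simp: pairwise_def orthogonal_def)
      then show ?thesis using False cd by simp
    qed
  qed
  have "C \<subseteq> span C'"
  proof
    fix c assume "c \<in> C"
    show "c \<in> span C'"
    proof (cases "c = 0")
      case False
      then have "(1 / norm c) *\<^sub>R c \<in> C'" using \<open>c \<in> C\<close> by (auto simp: C'_def)
      then have "norm c *\<^sub>R ((1 / norm c) *\<^sub>R c) \<in> span C'" by (intro span_scale span_base)
      then show ?thesis using False by simp
    qed (simp add: span_zero)
  qed
  then have sp: "W \<subseteq> span C'" unfolding WC by (simp add: span_minimal)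
  have ex: "w = (\<Sum>c\<in>C'. (w \<bullet> c) *\<^sub>R c)" if "w \<in> span C'" for w
    using that
  proof (induction rule: span_induct_alt)
    case base
    show ?case by simp
  next
    case (step r x y)
    have "(\<Sum>c\<in>C'. ((r *\<^sub>R x + y) \<bullet> c) *\<^sub>R c) = r *\<^sub>R (\<Sum>c\<in>C'. (x \<bullet> c) *\<^sub>R c) + (\<Sum>c\<in>C'. (y \<bullet> c) *\<^sub>R c)"
      by (simp add: inner_add_left scaleR_add_left sum.distrib scaleR_sum_right)
    also have "(\<Sum>c\<in>C'. (x \<bullet> c) *\<^sub>R c) = (\<Sum>c\<in>C'. if c = x then c else 0)"
      using orth step(1) by (intro sum.cong) auto
    also have "\<dots> = x" using fin step(1) by simp
    finally show ?case using step by simp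
  qed
  obtain b where b: "bij_betw b {0..<card C'} C'" using ex_bij_betw_nat_finite[OF fin] by blast
  show ?thesis
  proof (rule that[of "card C'" b])
    show "b i \<in> W" if "i < card C'" for i using that sub bij_betwE[OF b] by auto
    show "b i \<bullet> b j = (if i = j then 1 else 0)" if "i < card C'" "j < card C'" for i j
      using orth[of "b i" "b j"] that bij_betwE[OF b] b
      by (auto simp: bij_betw_def inj_on_def)
    show "w = (\<Sum>i<card C'. (w \<bullet> b i) *\<^sub>R b i)" if "w \<in> W" for w
      using ex[of w] sp that sum.reindex_bij_betw[OF b, of "\<lambda>c. (w \<bullet> c) *\<^sub>R c"]
      by (auto simp: lessThan_atLeast0)
  qed
qed

text \<open>The orthonormal basis is there to define traces.\<close>

locale lie_onb =
  fixes W :: "'f::real_inner set" and br :: "'f \<Rightarrow> 'f \<Rightarrow> 'f" and n :: nat and b :: "nat \<Rightarrow> 'f"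
  assumes lie: "lie_algebra_on W br"
    and b_in [simp, intro]: "\<And>i. i < n \<Longrightarrow> b i \<in> W"
    and onb: "\<And>i j. i < n \<Longrightarrow> j < n \<Longrightarrow> b i \<bullet> b j = (if i = j then 1 else 0)"
    and expand: "\<And>w. w \<in> W \<Longrightarrow> w = (\<Sum>i<n. (w \<bullet> b i) *\<^sub>R b i)"
begin

lemma subW: "subspace W" using lie by (simp add: lie_algebra_on_def)

lemma W_closed [simp, intro]:
  "0 \<in> W" "x \<in> W \<Longrightarrow> y \<in> W \<Longrightarrow> x + y \<in> W" "x \<in> W \<Longrightarrow> y \<in> W \<Longrightarrow> x - y \<in> W"
  "x \<in> W \<Longrightarrow> r *\<^sub>R x \<in> W" "x \<in> W \<Longrightarrow> - x \<in> W" "x \<in> W \<Longrightarrow> y \<in> W \<Longrightarrow> br x y \<in> W"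
  using subW lie by (auto simp: subspace_0 subspace_add subspace_diff subspace_scale subspace_neg lie_algebra_on_def)

lemma br_lin:
  assumes "x \<in> W"
  shows "linear_map_on W (br x)" "linear_map_on W (\<lambda>y. br y x)"
  using lie assms by (auto simp: lie_algebra_on_def)

lemma br_simps [simp]:
  "x \<in> W \<Longrightarrow> y \<in> W \<Longrightarrow> z \<in> W \<Longrightarrow> br x (y + z) = br x y + br x z"
  "x \<in> W \<Longrightarrow> y \<in> W \<Longrightarrow> z \<in> W \<Longrightarrow> br (y + z) x = br y x + br z x"
  "x \<in> W \<Longrightarrow> y \<in> W \<Longrightarrow> br x (r *\<^sub>R y) = r *\<^sub>R br x y"
  "x \<in> W \<Longrightarrow> y \<in> W \<Longrightarrow> br (r *\<^sub>R y) x = r *\<^sub>R br y x"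
  "x \<in> W \<Longrightarrow> br x x = 0"
  using linear_map_onD[OF br_lin(1)] linear_map_onD[OF br_lin(2)] lie
  by (auto simp: lie_algebra_on_def)

lemma br_simps2 [simp]:
  "x \<in> W \<Longrightarrow> br x 0 = 0" "x \<in> W \<Longrightarrow> br 0 x = 0"
  "x \<in> W \<Longrightarrow> y \<in> W \<Longrightarrow> br x (- y) = - br x y"
  "x \<in> W \<Longrightarrow> y \<in> W \<Longrightarrow> br (- y) x = - br y x"
  "x \<in> W \<Longrightarrow> y \<in> W \<Longrightarrow> z \<in> W \<Longrightarrow> br x (y - z) = br x y - br x z"
  "x \<in> W \<Longrightarrow> y \<in> W \<Longrightarrow> z \<in> W \<Longrightarrow> br (y - z) x = br y x - br z x"
  using br_simps(3)[of x 0 0] br_simps(4)[of x 0 0] br_simps(3)[of x y "-1"] br_simps(4)[of x y "-1"]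
    br_simps(1)[of x y "- z"] br_simps(2)[of x y "- z"] br_simps(3)[of x z "-1"] br_simps(4)[of x z "-1"]
  by auto

lemma br_anti:
  assumes "x \<in> W" "y \<in> W"
  shows "br y x = - br x y"
proof -
  have "br (x + y) (x + y) = br x y + br y x" using assms by (subst br_simps) simp_all
  moreover have "br (x + y) (x + y) = 0" using assms by simp
  ultimately show ?thesis by (simp add: eq_neg_iff_add_eq_0 add.commute)
qed

lemma jacobi:
  assumes "x \<in> W" "y \<in> W" "z \<in> W"
  shows "br x (br y z) = br (br x y) z + br y (br x z)"
proof -
  have "br x (br y z) + br y (br z x) + br z (br x y) = 0" using lie assms by (auto simp: lie_algebra_on_def)
  then show ?thesis using assms br_anti[of "br x y" z] br_anti[of x z] by (simp add: algebra_simps eq_neg_iff_add_eq_0)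
qed

definition endo :: "('f \<Rightarrow> 'f) \<Rightarrow> bool" where
  "endo T \<longleftrightarrow> linear_map_on W T \<and> (\<forall>x\<in>W. T x \<in> W)"

definition tr :: "('f \<Rightarrow> 'f) \<Rightarrow> real" where
  "tr T = (\<Sum>i<n. T (b i) \<bullet> b i)"

text \<open>The Killing form.\<close>

definition kf :: "'f \<Rightarrow> 'f \<Rightarrow> real" where
  "kf x y = tr (\<lambda>z. br x (br y z))"

lemma endo_expand:
  assumes "endo T" "x \<in> W"
  shows "T x = (\<Sum>i<n. (x \<bullet> b i) *\<^sub>R T (b i))"
proof -
  have "T x = T (\<Sum>i<n. (x \<bullet> b i) *\<^sub>R b i)" using expand[OF assms(2)] by simp
  also have "\<dots> = (\<Sum>i<n. (x \<bullet> b i) *\<^sub>R T (b i))"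
    using assms(1) by (intro linear_map_on_sum[OF _ subW]) (auto simp: endo_def)
  finally show ?thesis .
qed

lemma tr_comp:
  assumes "endo S" "endo T"
  shows "tr (\<lambda>x. S (T x)) = (\<Sum>i<n. \<Sum>k<n. (T (b i) \<bullet> b k) * (S (b k) \<bullet> b i))"
proof -
  have "S (T (b i)) = (\<Sum>k<n. (T (b i) \<bullet> b k) *\<^sub>R S (b k))" if "i < n" for i
    using endo_expand[OF assms(1)] assms(2) that by (auto simp: endo_def)
  then show ?thesis by (simp add: tr_def inner_sum_left)
qed

lemma tr_comm:
  assumes "endo S" "endo T"
  shows "tr (\<lambda>x. S (T x)) = tr (\<lambda>x. T (S x))"
  unfolding tr_comp[OF assms] tr_comp[OF assms(2,1)]
  by (subst sum.swap) (simp add: mult.commute)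

lemma endo_br: "x \<in> W \<Longrightarrow> endo (br x)"
  using br_lin by (auto simp: endo_def)

lemma endo_comp: "endo S \<Longrightarrow> endo T \<Longrightarrow> endo (\<lambda>x. S (T x))"
  by (auto simp: endo_def linear_map_on_def)

lemma kf_sym: "x \<in> W \<Longrightarrow> y \<in> W \<Longrightarrow> kf x y = kf y x"
  unfolding kf_def by (rule tr_comm) (auto intro: endo_br)

lemma kf_add: "x \<in> W \<Longrightarrow> y \<in> W \<Longrightarrow> z \<in> W \<Longrightarrow> kf x (y + z) = kf x y + kf x z"
  and kf_scale: "x \<in> W \<Longrightarrow> y \<in> W \<Longrightarrow> kf x (r *\<^sub>R y) = r * kf x y"
  by (simp_all add: kf_def tr_def sum.distrib inner_add_left sum_distrib_left)

text \<open>By the Jacobi identity both sides are differences of traces that agree up to cyclic permutation.\<close>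

lemma kf_invariant:
  assumes "x \<in> W" "y \<in> W" "z \<in> W"
  shows "kf (br x y) z = - kf y (br x z)"
proof -
  have 1: "tr (\<lambda>w. br x (br y (br z w))) = tr (\<lambda>w. br y (br z (br x w)))"
    using tr_comm[OF endo_br[OF assms(1)] endo_comp[OF endo_br[OF assms(2)] endo_br[OF assms(3)]]] .
  have a: "br (br x y) (br z w) = br x (br y (br z w)) - br y (br x (br z w))" if "w \<in> W" for w
    using jacobi[of x y "br z w"] assms that by (simp add: algebra_simps)
  have c: "br y (br (br x z) w) = br y (br x (br z w)) - br y (br z (br x w))" if "w \<in> W" for w
    using jacobi[of x z w] assms that by (simp add: algebra_simps)
  have "kf (br x y) z = tr (\<lambda>w. br x (br y (br z w))) - tr (\<lambda>w. br y (br x (br z w)))"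
    by (simp add: kf_def tr_def a inner_diff_left sum_subtractf)
  moreover have "kf y (br x z) = tr (\<lambda>w. br y (br x (br z w))) - tr (\<lambda>w. br y (br z (br x w)))"
    by (simp add: kf_def tr_def c inner_diff_left sum_subtractf)
  ultimately show ?thesis using 1 by simp
qed

definition killing_radical :: "'f set" where
  "killing_radical = {x \<in> W. \<forall>y\<in>W. kf x y = 0}"

lemma killing_radical_ideal: "lie_ideal_on W br killing_radical"
  unfolding lie_ideal_on_def
proof (intro conjI ballI)
  show "subspace killing_radical"
    unfolding subspace_def
  proof (intro conjI ballI allI)
    have "kf 0 y = 0" if "y \<in> W" for y
      using kf_scale[of y 0 0] kf_sym[of y 0] that by simp
    then show "0 \<in> killing_radical" by (simp add: killing_radical_def)
    show "x + y \<in> killing_radical" if "x \<in> killing_radical" "y \<in> killing_radical" for x y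
      using that kf_add kf_sym by (auto simp: killing_radical_def)
    show "r *\<^sub>R x \<in> killing_radical" if "x \<in> killing_radical" for r x
      using that kf_scale kf_sym by (auto simp: killing_radical_def)
  qed
  fix a x assume a: "a \<in> W" "x \<in> killing_radical"
  then show "br a x \<in> killing_radical"
    using kf_invariant[of a x] by (auto simp: killing_radical_def)
qed (auto simp: killing_radical_def)

end

section \<open>Engel's theorem\<close>

context lie_onb
begin

abbreviation ad_word :: "'f list \<Rightarrow> 'f \<Rightarrow> 'f" where
  "ad_word xs w \<equiv> foldr br xs w"

lemma ad_word_in: "set xs \<subseteq> W \<Longrightarrow> w \<in> W \<Longrightarrow> ad_word xs w \<in> W"
  by (induction xs) auto

text \<open>The descending filtration of \<open>W\<close> by the spans of \<open>ad h\<^sub>1 \<dots> ad h\<^sub>k W\<close>.\<close>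

definition word_span :: "'f set \<Rightarrow> nat \<Rightarrow> 'f set" where
  "word_span H k = span {ad_word hs w | hs w. set hs \<subseteq> H \<and> length hs = k \<and> w \<in> W}"

lemma word_span_add: "x \<in> word_span H k \<Longrightarrow> y \<in> word_span H k \<Longrightarrow> x + y \<in> word_span H k"
  by (simp add: word_span_def span_add)

lemma word_span_sub:
  assumes "H \<subseteq> W"
  shows "word_span H k \<subseteq> W"
  unfolding word_span_def using assms ad_word_in by (intro span_minimal subW) blast

lemma word_span_step:
  assumes "H \<subseteq> W" "h \<in> H" "w \<in> word_span H k"
  shows "br h w \<in> word_span H (Suc k)"
proof -
  have hW: "h \<in> W" using assms by auto
  have "w \<in> W \<and> br h w \<in> word_span H (Suc k)"
    using assms(3) unfolding word_span_def[of H k]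
  proof (induction rule: span_induct_alt)
    case base
    then show ?case using hW by (simp add: word_span_def span_zero)
  next
    case (step c x y)
    then obtain hs w where x: "x = ad_word hs w" "set hs \<subseteq> H" "length hs = k" "w \<in> W" by auto
    have xW: "x \<in> W" using x assms(1) ad_word_in[of hs w] by auto
    have "br h x = ad_word (h # hs) w" by (simp add: x)
    then have "br h x \<in> word_span H (Suc k)"
      unfolding word_span_def using x assms(2)
      by (intro span_base CollectI exI[of _ "h # hs"] exI[of _ w]) auto
    then have "c *\<^sub>R br h x + br h y \<in> word_span H (Suc k)"
      using step unfolding word_span_def by (auto intro: span_add span_scale)
    then show ?case using step xW hW by simp
  qed
  then show ?thesis by simp
qed

text \<open>\<open>ad y\<close> acts on a word \<open>ad h\<^sub>1 \<dots> ad h\<^sub>k w\<close> by the product rule.\<close>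

lemma word_span_normalised:
  assumes "H \<subseteq> W" "y \<in> W" "\<And>h. h \<in> H \<Longrightarrow> br y h \<in> H" "w \<in> word_span H k"
  shows "br y w \<in> word_span H k"
proof -
  have gen: "br y (ad_word hs v) \<in> word_span H (length hs)" if "set hs \<subseteq> H" "v \<in> W" for hs v
    using that
  proof (induction hs)
    case Nil
    then show ?case using assms(2) unfolding word_span_def by (auto intro!: span_base)
  next
    case (Cons h hs)
    have W: "h \<in> W" "ad_word hs v \<in> W" using Cons.prems assms(1) ad_word_in[of hs v] by auto
    have 1: "br y (ad_word (h # hs) v) = br (br y h) (ad_word hs v) + br h (br y (ad_word hs v))"
      using jacobi[OF assms(2) W] by simp
    have "ad_word (br y h # hs) v \<in> word_span H (Suc (length hs))"
      unfolding word_span_def using Cons.prems assms(3)[of h]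
      by (intro span_base CollectI exI[of _ "br y h # hs"] exI[of _ v]) auto
    then have 2: "br (br y h) (ad_word hs v) \<in> word_span H (length (h # hs))" by simp
    have "br h (br y (ad_word hs v)) \<in> word_span H (Suc (length hs))"
      using Cons by (intro word_span_step[OF assms(1)]) auto
    then have 3: "br h (br y (ad_word hs v)) \<in> word_span H (length (h # hs))" by simp
    show ?case unfolding 1 by (rule word_span_add[OF 2 3])
  qed
  have "w \<in> W \<and> br y w \<in> word_span H k"
    using assms(4) unfolding word_span_def[of H k]
  proof (induction rule: span_induct_alt)
    case base
    then show ?case using assms(2) by (simp add: span_zero)
  next
    case (step c x z)
    then obtain hs v where x: "x = ad_word hs v" "set hs \<subseteq> H" "length hs = k" "v \<in> W" by auto
    have xW: "x \<in> W" using x assms(1) ad_word_in[of hs v] by auto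
    have "c *\<^sub>R br y x + br y z \<in> word_span H k"
      using step gen[of hs v] x unfolding word_span_def by (auto intro: span_add span_scale)
    moreover have "z \<in> W" using step by blast
    ultimately show ?case using xW assms(2) unfolding word_span_def[of H k, symmetric] by simp
  qed
  then show ?thesis by simp
qed

text \<open>\<open>H\<close> acts nilpotently: for some \<open>M\<close> all products of \<open>M\<close> operators \<open>ad h\<close> vanish.\<close>

definition nil_words :: "'f set \<Rightarrow> bool" where
  "nil_words H \<longleftrightarrow> (\<exists>M. \<forall>hs w. set hs \<subseteq> H \<and> length hs = M \<and> w \<in> W \<longrightarrow> ad_word hs w = 0)"

text \<open>The inductive step of Engel's theorem. Since \<open>y\<close> normalises \<open>H\<close>, it preserves the filtration
\<open>word_span H\<close>, while \<open>H\<close> raises the degree by one. Modulo the next step of the filtration a word in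
\<open>H + \<real>y\<close> is therefore a multiple of a power of \<open>ad y\<close>, so a word of length \<open>r\<close> raises the degree.\<close>

lemma nil_words_extend:
  assumes H: "subspace H" "H \<subseteq> W" "nil_words H" and y: "y \<in> W" "\<And>h. h \<in> H \<Longrightarrow> br y h \<in> H"
    and nil: "\<And>w. w \<in> W \<Longrightarrow> (br y ^^ r) w = 0"
  shows "nil_words {h + t *\<^sub>R y | h t. h \<in> H}"
proof -
  let ?H = "{h + t *\<^sub>R y | h t. h \<in> H}"
  obtain M where M: "\<And>hs w. set hs \<subseteq> H \<Longrightarrow> length hs = M \<Longrightarrow> w \<in> W \<Longrightarrow> ad_word hs w = 0"
    using H(3) by (auto simp: nil_words_def)
  have HW: "?H \<subseteq> W" using H y by auto
  have subF: "subspace (word_span H k)" for k by (simp add: word_span_def)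
  have stepS: "word_span H (Suc k) \<subseteq> word_span H k" for k
  proof -
    have "ad_word hs w \<in> word_span H k" if "set hs \<subseteq> H" and l: "length hs = Suc k" and "w \<in> W" for hs w
    proof -
      obtain hs' h where hs: "hs = hs' @ [h]" using l by (metis length_Suc_conv rev_exhaust list.distinct(1))
      have "ad_word hs w = ad_word hs' (br h w)" by (simp add: hs)
      then show ?thesis unfolding word_span_def using that hs H(2)
        by (intro span_base CollectI exI[of _ hs'] exI[of _ "br h w"]) auto
    qed
    then show ?thesis unfolding word_span_def[of H "Suc k"] by (intro span_minimal subF) auto
  qed
  have stab: "br z w \<in> word_span H k" if zH: "z \<in> ?H" and "w \<in> word_span H k" for z w k
  proof -
    obtain h t where z: "z = h + t *\<^sub>R y" "h \<in> H" using zH by auto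
    have W: "w \<in> W" "h \<in> W" using that word_span_sub[OF H(2)] z H(2) by auto
    have "br h w \<in> word_span H k" using word_span_step[OF H(2) z(2) that(2)] stepS by blast
    moreover have "br y w \<in> word_span H k" by (rule word_span_normalised[OF H(2) y that(2)])
    ultimately show ?thesis using subF W y(1) unfolding z(1)
      by (simp add: subspace_add subspace_scale)
  qed
  have mod: "\<exists>c. ad_word zs w - c *\<^sub>R (br y ^^ length zs) w \<in> word_span H (Suc k)"
    if "set zs \<subseteq> ?H" "w \<in> word_span H k" for zs w k
    using that(1)
  proof (induction zs)
    case Nil
    show ?case by (rule exI[of _ 1]) (simp add: subspace_0[OF subF])
  next
    case (Cons z zs)
    obtain c where c: "ad_word zs w - c *\<^sub>R (br y ^^ length zs) w \<in> word_span H (Suc k)"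
      using Cons by auto
    obtain h t where z: "z = h + t *\<^sub>R y" "h \<in> H" using Cons.prems by auto
    let ?u = "ad_word zs w" and ?v = "(br y ^^ length zs) w"
    note wk = that(2)
    have u: "?u \<in> word_span H k" using Cons.prems
      by (induction zs) (use wk stab in auto)
    have "(br y ^^ m) w \<in> word_span H k" for m
      by (induction m) (use wk word_span_normalised[OF H(2) y] in auto)
    then have v: "?v \<in> word_span H k" .
    have W: "?u \<in> W" "?v \<in> W" "h \<in> W" using u v word_span_sub[OF H(2)] z H(2) by auto
    have "br z ?u - (t * c) *\<^sub>R br y ?v = br h ?u + t *\<^sub>R br y (?u - c *\<^sub>R ?v)"
      using W y(1) unfolding z(1) by (simp add: algebra_simps)
    moreover have "br h ?u \<in> word_span H (Suc k)" by (rule word_span_step[OF H(2) z(2) u])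
    moreover have "br y (?u - c *\<^sub>R ?v) \<in> word_span H (Suc k)"
      by (rule word_span_normalised[OF H(2) y c])
    ultimately have "br z ?u - (t * c) *\<^sub>R br y ?v \<in> word_span H (Suc k)"
      by (simp add: subspace_add[OF subF] subspace_scale[OF subF])
    then show ?case by (intro exI[of _ "t * c"]) simp
  qed
  \<comment> \<open>Cut the word into blocks of length \<open>r\<close>; by \<open>nil\<close> each of them leads one step down the filtration.\<close>
  have down: "ad_word zs w \<in> word_span H k" if "set zs \<subseteq> ?H" "length zs = k * r" "w \<in> W" for zs w k
    using that
  proof (induction k arbitrary: zs)
    case 0
    then show ?case unfolding word_span_def by (auto intro!: span_base)
  next
    case (Suc k)
    define us vs where "us = take r zs" and "vs = drop r zs"
    have zs: "zs = us @ vs" "length us = r" "length vs = k * r" "set us \<subseteq> ?H" "set vs \<subseteq> ?H"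
      using Suc.prems set_take_subset[of r zs] set_drop_subset[of r zs] by (auto simp: us_def vs_def)
    have v: "ad_word vs w \<in> word_span H k" using Suc zs by blast
    then have vW: "ad_word vs w \<in> W" using word_span_sub[OF H(2)] by auto
    obtain c where "ad_word us (ad_word vs w) - c *\<^sub>R (br y ^^ length us) (ad_word vs w) \<in> word_span H (Suc k)"
      using mod[OF zs(4) v] by auto
    then show ?case using nil[OF vW] by (simp add: zs)
  qed
  have "word_span H M \<subseteq> {0}"
    unfolding word_span_def by (intro span_minimal) (use M in \<open>auto simp: subspace_def\<close>)
  then show ?thesis unfolding nil_words_def using down[of _ M]
    by (intro exI[of _ "M * r"]) blast
qed

text \<open>Take a linearly independent \<open>S\<close> of maximal cardinality among those that span a subalgebra of \<open>N\<close>
which acts nilpotently. If its span \<open>H\<close> is not all of \<open>N\<close>, let words in \<open>H\<close> act on some element outside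
\<open>H\<close>; a longest word that does not move it into \<open>H\<close> produces an element outside \<open>H\<close> that normalises \<open>H\<close>, so that \<open>S\<close> can be enlarged.\<close>

lemma engel:
  assumes N: "subspace N" "N \<subseteq> W" "\<And>x y. x \<in> N \<Longrightarrow> y \<in> N \<Longrightarrow> br x y \<in> N"
    and nil: "\<And>x w. x \<in> N \<Longrightarrow> w \<in> W \<Longrightarrow> (br x ^^ r) w = 0"
  shows "nil_words N"
proof -
  define good where "good S \<longleftrightarrow> finite S \<and> independent S \<and> S \<subseteq> N \<and>
    (\<forall>x\<in>span S. \<forall>y\<in>span S. br x y \<in> span S) \<and> nil_words (span S)" for S
  have WB: "W \<subseteq> span (b ` {..<n})"
    using expand by (metis (no_types, lifting) image_eqI span_base span_scale span_sum subsetI)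
  have card: "card S \<le> n" if "good S" for S
  proof -
    have "card S \<le> card (b ` {..<n})"
      using that independent_span_bound[of "b ` {..<n}" S] WB N(2) by (auto simp: good_def)
    also have "\<dots> \<le> n" using card_image_le[of "{..<n}" b] by simp
    finally show ?thesis .
  qed
  have "good {}" unfolding good_def nil_words_def
  proof (intro conjI)
    show "\<exists>M. \<forall>hs w. set hs \<subseteq> span {} \<and> length hs = M \<and> w \<in> W \<longrightarrow> ad_word hs w = 0"
    proof (intro exI[of _ 1] allI impI)
      fix hs :: "'f list" and w assume "set hs \<subseteq> span {} \<and> length hs = 1 \<and> w \<in> W"
      then show "ad_word hs w = 0" by (cases hs) auto
    qed
  qed (auto simp: real_vector.independent_empty)
  then obtain S where S: "good S" "\<And>T. good T \<Longrightarrow> card T \<le> card S"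
    using card ex_has_greatest_nat[of good "{}" card "Suc n"] by (auto simp: less_Suc_eq_le)
  let ?H = "span S"
  have HN: "?H \<subseteq> N" using S(1) N(1) by (simp add: good_def span_minimal)
  have HW: "?H \<subseteq> W" using HN N(2) by auto
  obtain M where M: "\<And>hs w. set hs \<subseteq> ?H \<Longrightarrow> length hs = M \<Longrightarrow> w \<in> W \<Longrightarrow> ad_word hs w = 0"
    using S(1) unfolding good_def nil_words_def by blast
  have "?H = N"
  proof (rule ccontr)
    assume "?H \<noteq> N"
    then obtain y0 where y0: "y0 \<in> N" "y0 \<notin> ?H" using HN by auto
    \<comment> \<open>Words of length \<open>M\<close> in \<open>?H\<close> vanish, so there is a longest word with this property.\<close>
    define P where "P hs \<longleftrightarrow> set hs \<subseteq> ?H \<and> ad_word hs y0 \<notin> ?H" for hs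
    have len: "length hs < M" if "P hs" for hs
    proof (rule ccontr)
      assume "\<not> length hs < M"
      then have "hs = take (length hs - M) hs @ drop (length hs - M) hs" "length (drop (length hs - M) hs) = M"
        by auto
      moreover have "set (drop (length hs - M) hs) \<subseteq> ?H"
        using that set_drop_subset[of "length hs - M" hs] unfolding P_def by blast
      ultimately have "ad_word hs y0 = ad_word (take (length hs - M) hs) 0"
        using M y0 N(2) by (metis foldr_append subsetD)
      also have "\<dots> = 0"
      proof -
        have "ad_word us 0 = 0" if "set us \<subseteq> W" for us
          using that by (induction us) auto
        then show ?thesis using that HW set_take_subset[of "length hs - M" hs] unfolding P_def by blast
      qed
      finally show False using that by (simp add: P_def span_zero)
    qed
    have "P []" using y0 by (simp add: P_def)
    then obtain hs where hs: "P hs" "\<And>gs. P gs \<Longrightarrow> length gs \<le> length hs"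
      using len ex_has_greatest_nat[of P "[]" length M] by auto
    define y where "y = ad_word hs y0"
    have yN: "y \<in> N"
    proof -
      have "ad_word gs y0 \<in> N" if "set gs \<subseteq> N" for gs
        using that by (induction gs) (use y0 N(3) in auto)
      then show ?thesis using hs(1) HN by (auto simp: P_def y_def)
    qed
    have yW: "y \<in> W" using yN N(2) by auto
    have yH: "y \<notin> ?H" using hs(1) by (simp add: P_def y_def)
    have norm: "br h y \<in> ?H" if "h \<in> ?H" for h
    proof (rule ccontr)
      assume "br h y \<notin> ?H"
      then have "P (h # hs)" using hs(1) that by (auto simp: P_def y_def)
      then show False using hs(2)[of "h # hs"] by simp
    qed
    have norm': "br y h \<in> ?H" if "h \<in> ?H" for h
      using norm[OF that] br_anti[of h y] that HW yW by (auto simp: span_neg)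
    have sp: "span (insert y S) = {h + t *\<^sub>R y | h t. h \<in> ?H}"
    proof (intro Set.set_eqI iffI)
      fix z assume "z \<in> span (insert y S)"
      then obtain t where "z - t *\<^sub>R y \<in> ?H" by (auto simp: span_insert)
      then show "z \<in> {h + t *\<^sub>R y | h t. h \<in> ?H}" by (intro CollectI exI[of _ "z - t *\<^sub>R y"] exI[of _ t]) auto
    next
      fix z assume "z \<in> {h + t *\<^sub>R y | h t. h \<in> ?H}"
      then obtain h t where "z = h + t *\<^sub>R y" "h \<in> ?H" by auto
      then show "z \<in> span (insert y S)" by (auto simp: span_insert intro!: exI[of _ t])
    qed
    have "good (insert y S)"
      unfolding good_def
    proof (intro conjI)
      show "finite (insert y S)" "insert y S \<subseteq> N" using S(1) yN by (auto simp: good_def)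
      show "independent (insert y S)" using S(1) yH by (auto simp: good_def independent_insert)
      show "nil_words (span (insert y S))" unfolding sp
        using S(1) yN yW norm' nil HW
        by (intro nil_words_extend[where r = r]) (auto simp: good_def)
      show "\<forall>u\<in>span (insert y S). \<forall>v\<in>span (insert y S). br u v \<in> span (insert y S)"
      proof (intro ballI)
        fix u v assume "u \<in> span (insert y S)" "v \<in> span (insert y S)"
        then obtain h t k s where uv: "u = h + t *\<^sub>R y" "h \<in> ?H" "v = k + s *\<^sub>R y" "k \<in> ?H"
          unfolding sp by auto
        have W: "h \<in> W" "k \<in> W" using uv HW by auto
        have "br u v = br h k + s *\<^sub>R br h y + t *\<^sub>R br y k"
          unfolding uv(1,3) using W yW by (simp add: scaleR_add_right)
        moreover have "br h k \<in> ?H" using S(1) uv(2,4) unfolding good_def by blast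
        ultimately have "br u v \<in> ?H"
          using span_add[OF span_add[OF _ span_scale[OF norm[OF uv(2)]]] span_scale[OF norm'[OF uv(4)]]] by metis
        then show "br u v \<in> span (insert y S)" using span_mono[of S "insert y S"] by blast
      qed
    qed
    moreover have "card (insert y S) = Suc (card S)"
    proof -
      have "y \<notin> S" using yH span_base[of y S] by blast
      then show ?thesis using S(1) by (simp add: good_def)
    qed
    ultimately show False using S(2)[of "insert y S"] by simp
  qed
  then show ?thesis using S(1) by (auto simp: good_def)
qed

lemma derived_subalgebra_le:
  assumes "subspace S" "\<And>x y. x \<in> I \<Longrightarrow> y \<in> I \<Longrightarrow> br x y \<in> S"
  shows "derived_subalgebra br I \<subseteq> S"
  unfolding derived_subalgebra_def using assms by (intro span_minimal) auto

lemma derived_subalgebra_power: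
  assumes "subspace I" "\<And>x y. x \<in> I \<Longrightarrow> y \<in> I \<Longrightarrow> br x y \<in> I"
  shows "subspace ((derived_subalgebra br ^^ k) I) \<and> (derived_subalgebra br ^^ k) I \<subseteq> I"
proof (induction k)
  case (Suc k)
  have "derived_subalgebra br ((derived_subalgebra br ^^ k) I) \<subseteq> I"
    using Suc assms(2) by (intro derived_subalgebra_le[OF assms(1)]) blast
  then show ?case by (simp add: derived_subalgebra_def[of br "(derived_subalgebra br ^^ k) I"])
qed (use assms in auto)

text \<open>The derived series of \<open>I\<close> descends at least as fast as the filtration \<open>word_span I\<close>.\<close>

lemma nil_words_solvable:
  assumes I: "subspace I" "I \<subseteq> W" "\<And>x y. x \<in> I \<Longrightarrow> y \<in> I \<Longrightarrow> br x y \<in> I" and nil: "nil_words I"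
  shows "lie_solvable br I"
proof -
  obtain M where M: "\<And>hs w. set hs \<subseteq> I \<Longrightarrow> length hs = M \<Longrightarrow> w \<in> W \<Longrightarrow> ad_word hs w = 0"
    using nil by (auto simp: nil_words_def)
  have sub: "(derived_subalgebra br ^^ k) I \<subseteq> word_span I k" for k
  proof (induction k)
    case 0
    show ?case using I(2) unfolding word_span_def by (auto intro!: span_base)
  next
    case (Suc k)
    let ?D = "(derived_subalgebra br ^^ k) I"
    have "br x y \<in> word_span I (Suc k)" if "x \<in> ?D" "y \<in> ?D" for x y
      using that Suc derived_subalgebra_power[OF I(1,3), of k] by (intro word_span_step I(2)) auto
    then have "derived_subalgebra br ?D \<subseteq> word_span I (Suc k)"
      by (intro derived_subalgebra_le) (auto simp: word_span_def)
    then show ?case by simp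
  qed
  have "word_span I M \<subseteq> {0}"
    unfolding word_span_def by (intro span_minimal) (use M in \<open>auto simp: subspace_def\<close>)
  then have "(derived_subalgebra br ^^ M) I = {0}"
    using sub[of M] derived_subalgebra_power[OF I(1,3), of M] subspace_0 by blast
  then show ?thesis by (auto simp: lie_solvable_def)
qed

end

section \<open>Cartan's criterion: the radical of the Killing form is solvable\<close>

text \<open>A pair \<open>(a, b)\<close> stands for the element \<open>a + i b\<close> of the complexification.\<close>

definition csc :: "complex \<Rightarrow> 'f::real_vector \<times> 'f \<Rightarrow> 'f \<times> 'f" where
  "csc z u = (Re z *\<^sub>R fst u - Im z *\<^sub>R snd u, Re z *\<^sub>R snd u + Im z *\<^sub>R fst u)"

interpretation csc: vector_space "csc :: complex \<Rightarrow> 'f::real_vector \<times> 'f \<Rightarrow> 'f \<times> 'f"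
  by unfold_locales (auto simp: csc_def prod_eq_iff algebra_simps)

context lie_onb
begin

abbreviation WC :: "('f \<times> 'f) set" where "WC \<equiv> W \<times> W"

text \<open>The complex bilinear extension of the bracket.\<close>

definition cbr :: "'f \<times> 'f \<Rightarrow> 'f \<times> 'f \<Rightarrow> 'f \<times> 'f" where
  "cbr u v = (br (fst u) (fst v) - br (snd u) (snd v), br (fst u) (snd v) + br (snd u) (fst v))"

lemma WC_closed [simp, intro]:
  "0 \<in> WC" "u \<in> WC \<Longrightarrow> v \<in> WC \<Longrightarrow> u + v \<in> WC" "u \<in> WC \<Longrightarrow> v \<in> WC \<Longrightarrow> u - v \<in> WC"
  "u \<in> WC \<Longrightarrow> csc z u \<in> WC" "u \<in> WC \<Longrightarrow> v \<in> WC \<Longrightarrow> cbr u v \<in> WC"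
  by (auto simp: csc_def cbr_def zero_prod_def)

lemma WC_sum: "(\<And>i. i \<in> I \<Longrightarrow> f i \<in> WC) \<Longrightarrow> (\<Sum>i\<in>I. f i) \<in> WC"
  by (induction I rule: infinite_finite_induct) auto

lemma cbr_simps:
  "u \<in> WC \<Longrightarrow> v \<in> WC \<Longrightarrow> w \<in> WC \<Longrightarrow> cbr u (v + w) = cbr u v + cbr u w"
  "u \<in> WC \<Longrightarrow> v \<in> WC \<Longrightarrow> w \<in> WC \<Longrightarrow> cbr (v + w) u = cbr v u + cbr w u"
  "u \<in> WC \<Longrightarrow> v \<in> WC \<Longrightarrow> cbr u (csc z v) = csc z (cbr u v)"
  "u \<in> WC \<Longrightarrow> v \<in> WC \<Longrightarrow> cbr (csc z u) v = csc z (cbr u v)"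
  by (auto simp: cbr_def csc_def prod_eq_iff algebra_simps)

lemma cbr_jacobi:
  assumes "x \<in> W" "u \<in> WC" "v \<in> WC"
  shows "cbr (x, 0) (cbr u v) = cbr (cbr (x, 0) u) v + cbr u (cbr (x, 0) v)"
  using assms jacobi[of x "fst u" "fst v"] jacobi[of x "fst u" "snd v"]
    jacobi[of x "snd u" "fst v"] jacobi[of x "snd u" "snd v"]
  by (auto simp: cbr_def prod_eq_iff algebra_simps)

definition clin :: "('f \<times> 'f \<Rightarrow> 'f \<times> 'f) \<Rightarrow> bool" where
  "clin T \<longleftrightarrow> (\<forall>u\<in>WC. \<forall>v\<in>WC. T (u + v) = T u + T v) \<and> (\<forall>z. \<forall>u\<in>WC. T (csc z u) = csc z (T u)) \<and>
     (\<forall>u\<in>WC. T u \<in> WC)"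

lemma clinD:
  assumes "clin T"
  shows "u \<in> WC \<Longrightarrow> v \<in> WC \<Longrightarrow> T (u + v) = T u + T v" "u \<in> WC \<Longrightarrow> T (csc z u) = csc z (T u)"
    "u \<in> WC \<Longrightarrow> T u \<in> WC"
  using assms unfolding clin_def by blast+

lemma clinI:
  assumes "\<And>u v. u \<in> WC \<Longrightarrow> v \<in> WC \<Longrightarrow> T (u + v) = T u + T v" "\<And>z u. u \<in> WC \<Longrightarrow> T (csc z u) = csc z (T u)"
    "\<And>u. u \<in> WC \<Longrightarrow> T u \<in> WC"
  shows "clin T"
  unfolding clin_def by (intro conjI ballI allI; rule assms; assumption)

lemma clin_0: "clin T \<Longrightarrow> T 0 = 0"
  using clinD(2)[of T 0 0] by simp

lemma clin_sum:
  assumes "clin T" "\<And>i. i \<in> I \<Longrightarrow> f i \<in> WC"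
  shows "T (\<Sum>i\<in>I. csc (c i) (f i)) = (\<Sum>i\<in>I. csc (c i) (T (f i)))"
  using assms(2)
proof (induction I rule: infinite_finite_induct)
  case (insert x F)
  have "(\<Sum>i\<in>F. csc (c i) (f i)) \<in> WC" using insert by (intro WC_sum WC_closed) auto
  then show ?case using insert by (simp add: clinD[OF assms(1)] WC_closed)
qed (simp_all add: clin_0[OF assms(1)])

lemma clin_cbr: "u \<in> WC \<Longrightarrow> clin (cbr u)" "u \<in> WC \<Longrightarrow> clin (\<lambda>v. cbr v u)"
  by (rule clinI; rule cbr_simps WC_closed; assumption)+

lemma clin_comp: "clin S \<Longrightarrow> clin T \<Longrightarrow> clin (\<lambda>u. S (T u))"
  by (rule clinI) (simp_all only: clinD)

definition co :: "nat \<Rightarrow> 'f \<times> 'f \<Rightarrow> complex" where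
  "co i u = Complex (fst u \<bullet> b i) (snd u \<bullet> b i)"

lemma co_simps: "co i (u + v) = co i u + co i v" "co i (u - v) = co i u - co i v" "co i (csc z u) = z * co i u"
  by (auto simp: co_def csc_def complex_eq_iff inner_add_left inner_diff_left)

lemma co_0 [simp]: "co i 0 = 0" by (simp add: co_def complex_eq_iff)

lemma co_sum: "co i (\<Sum>j\<in>I. f j) = (\<Sum>j\<in>I. co i (f j))"
  by (induction I rule: infinite_finite_induct) (auto simp: co_simps)

lemma co_b: "i < n \<Longrightarrow> j < n \<Longrightarrow> co i (b j, 0) = (if i = j then 1 else 0)"
  by (auto simp: co_def complex_eq_iff onb)

lemma co_expand:
  assumes "u \<in> WC"
  shows "u = (\<Sum>i<n. csc (co i u) (b i, 0))"
proof -
  have "fst u = (\<Sum>i<n. (fst u \<bullet> b i) *\<^sub>R b i)" "snd u = (\<Sum>i<n. (snd u \<bullet> b i) *\<^sub>R b i)"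
    using assms by (auto intro: expand)
  then show ?thesis by (simp add: prod_eq_iff fst_sum snd_sum csc_def co_def)
qed

definition ctr :: "('f \<times> 'f \<Rightarrow> 'f \<times> 'f) \<Rightarrow> complex" where
  "ctr T = (\<Sum>i<n. co i (T (b i, 0)))"

lemma ctr_comp:
  assumes "clin S" "clin T"
  shows "ctr (\<lambda>x. S (T x)) = (\<Sum>i<n. \<Sum>k<n. co k (T (b i, 0)) * co i (S (b k, 0)))"
proof -
  have "S (T (b i, 0)) = (\<Sum>k<n. csc (co k (T (b i, 0))) (S (b k, 0)))" if "i < n" for i
  proof -
    have "T (b i, 0) \<in> WC" using clinD(3)[OF assms(2)] that by auto
    then have "S (T (b i, 0)) = S (\<Sum>k<n. csc (co k (T (b i, 0))) (b k, 0))"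
      using co_expand by simp
    also have "\<dots> = (\<Sum>k<n. csc (co k (T (b i, 0))) (S (b k, 0)))"
      by (intro clin_sum assms(1)) auto
    finally show ?thesis .
  qed
  then show ?thesis by (simp add: ctr_def co_sum co_simps)
qed

lemma ctr_comm:
  assumes "clin S" "clin T"
  shows "ctr (\<lambda>x. S (T x)) = ctr (\<lambda>x. T (S x))"
  unfolding ctr_comp[OF assms] ctr_comp[OF assms(2,1)]
  by (subst sum.swap) (simp add: mult.commute)

lemma ctr_cbr:
  assumes "u \<in> WC" "c \<in> W"
  shows "ctr (\<lambda>z. cbr u (cbr (c, 0) z)) = Complex (kf (fst u) c) (kf (snd u) c)"
  using assms unfolding ctr_def kf_def tr_def
  by (auto simp: cbr_def co_def complex_eq_iff)

end

text \<open>A Jordan basis \<open>P\<close> of \<open>ad x\<close> on the complexification, with dual basis \<open>q\<close>, eigenvalues \<open>l\<close> and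
superdiagonal entries \<open>e\<close>.\<close>

locale lie_jordan = lie_onb W br n b
  for W :: "'f::real_inner set" and br n b +
  fixes x :: 'f and P :: "nat \<Rightarrow> 'f \<times> 'f" and q :: "nat \<Rightarrow> 'f \<times> 'f \<Rightarrow> complex" and l e :: "nat \<Rightarrow> complex"
  assumes xW [simp]: "x \<in> W"
    and P_in [simp, intro]: "\<And>j. j < n \<Longrightarrow> P j \<in> WC"
    and q_add: "\<And>j u v. q j (u + v) = q j u + q j v"
    and q_csc: "\<And>j z u. q j (csc z u) = z * q j u"
    and q_P: "\<And>i j. i < n \<Longrightarrow> j < n \<Longrightarrow> q i (P j) = (if i = j then 1 else 0)"
    and P_expand: "\<And>u. u \<in> WC \<Longrightarrow> u = (\<Sum>j<n. csc (q j u) (P j))"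
    and XP: "\<And>j. j < n \<Longrightarrow> cbr (x, 0) (P j) = csc (l j) (P j) + (if j = 0 then 0 else csc (e j) (P (j - 1)))"
    and e_l: "\<And>j. j < n \<Longrightarrow> j \<noteq> 0 \<Longrightarrow> e j \<noteq> 0 \<Longrightarrow> l (j - 1) = l j"
begin

abbreviation X :: "'f \<times> 'f \<Rightarrow> 'f \<times> 'f" where "X \<equiv> cbr (x, 0)"

lemma clin_X: "clin X" by (rule clin_cbr) simp

lemma q_0 [simp]: "q j 0 = 0" using q_csc[of j 0 0] by simp

lemma q_diff: "q j (u - v) = q j u - q j v"
  using q_add[of j "u - v" v] by simp

lemma q_sum: "q j (\<Sum>i\<in>I. f i) = (\<Sum>i\<in>I. q j (f i))"
  by (induction I rule: infinite_finite_induct) (auto simp: q_add)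

definition Y :: "complex \<Rightarrow> 'f \<times> 'f \<Rightarrow> 'f \<times> 'f" where
  "Y \<nu> u = X u - csc \<nu> u"

lemma clin_Y: "clin (Y \<nu>)"
proof (rule clinI)
  show "Y \<nu> (u + v) = Y \<nu> u + Y \<nu> v" if "u \<in> WC" "v \<in> WC" for u v
    using clinD(1)[OF clin_X that] by (simp add: Y_def csc.scale_right_distrib)
  show "Y \<nu> (csc z u) = csc z (Y \<nu> u)" if "u \<in> WC" for z u
    using clinD(2)[OF clin_X that] by (simp add: Y_def csc.scale_right_diff_distrib mult.commute)
  show "Y \<nu> u \<in> WC" if "u \<in> WC" for u
    unfolding Y_def using that clinD(3)[OF clin_X] by blast
qed

lemma Y_pow: "clin (Y \<nu> ^^ m)"
proof (induction m)
  case 0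
  show ?case by (rule clinI) simp_all
next
  case (Suc m)
  then show ?case using clin_comp[OF clin_Y Suc] by (simp add: comp_def)
qed

lemma Y_cbr:
  assumes "u \<in> WC" "v \<in> WC"
  shows "Y (\<kappa> + \<mu>) (cbr u v) = cbr (Y \<kappa> u) v + cbr u (Y \<mu> v)"
proof -
  have d: "cbr (a - c) v = cbr a v - cbr c v" if "a \<in> WC" "c \<in> WC" for a c
    using cbr_simps(2)[OF assms(2), of "a - c" c] that by (simp add: WC_closed)
  have d': "cbr u (a - c) = cbr u a - cbr u c" if "a \<in> WC" "c \<in> WC" for a c
    using cbr_simps(1)[OF assms(1), of "a - c" c] that by (simp add: WC_closed)
  have "X u \<in> WC" "X v \<in> WC" using assms clinD(3)[OF clin_X] by auto
  then show ?thesis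
    unfolding Y_def using assms cbr_jacobi[OF xW assms]
    by (simp add: d d' cbr_simps WC_closed csc.scale_left_distrib)
qed

text \<open>\<open>[E\<^sub>\<kappa>, E\<^sub>\<mu>] \<subseteq> E\<^bsub>\<kappa>+\<mu>\<^esub>\<close> for generalised eigenspaces: by \<open>Y_cbr\<close> every application of
\<open>Y (\<kappa> + \<mu>)\<close> to a bracket uses up one application of \<open>Y \<kappa>\<close> or \<open>Y \<mu>\<close> to a factor.\<close>

lemma gen_eigen_cbr:
  assumes "u \<in> WC" "v \<in> WC" "(Y \<kappa> ^^ r) u = 0" "(Y \<mu> ^^ s) v = 0"
  shows "(Y (\<kappa> + \<mu>) ^^ (r + s)) (cbr u v) = 0"
  using assms
proof (induction "r + s" arbitrary: r s u v)
  case 0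
  then show ?case by (simp add: clin_0[OF clin_cbr(2)])
next
  case (Suc m)
  show ?case
  proof (cases "r = 0 \<or> s = 0")
    case True
    then have "cbr u v = 0"
      using Suc.prems clin_0[OF clin_cbr(1)[OF Suc.prems(1)]] clin_0[OF clin_cbr(2)[OF Suc.prems(2)]] by auto
    then show ?thesis using clin_0[OF Y_pow] by simp
  next
    case False
    then obtain r' s' where rs: "r = Suc r'" "s = Suc s'" by (metis not0_implies_Suc)
    have Yu: "Y \<kappa> u \<in> WC" "Y \<mu> v \<in> WC" using Suc.prems clinD(3)[OF clin_Y] by auto
    have "(Y (\<kappa> + \<mu>) ^^ (r' + s)) (cbr (Y \<kappa> u) v) = 0"
      using Suc.hyps(2) Suc.prems rs Yu by (intro Suc.hyps(1)) (auto simp: funpow_swap1)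
    moreover have "(Y (\<kappa> + \<mu>) ^^ (r + s')) (cbr u (Y \<mu> v)) = 0"
      using Suc.hyps(2) Suc.prems rs Yu by (intro Suc.hyps(1)) (auto simp: funpow_swap1)
    moreover have "(Y (\<kappa> + \<mu>) ^^ (r + s)) (cbr u v) = (Y (\<kappa> + \<mu>) ^^ (r' + s)) (Y (\<kappa> + \<mu>) (cbr u v))"
      by (simp add: rs funpow_swap1)
    moreover have "r + s' = r' + s" by (simp add: rs)
    ultimately show ?thesis
      unfolding Y_cbr[OF Suc.prems(1,2)]
      using clinD(1)[OF Y_pow[of "r' + s" "\<kappa> + \<mu>"], of "cbr (Y \<kappa> u) v" "cbr u (Y \<mu> v)"] Yu Suc.prems
      by (simp add: WC_closed)
  qed
qed

lemma P_gen_eigen: "j < n \<Longrightarrow> (Y (l j) ^^ Suc j) (P j) = 0"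
proof (induction j)
  case 0
  then show ?case using XP[of 0] by (simp add: Y_def)
next
  case (Suc j)
  have "Y (l (Suc j)) (P (Suc j)) = csc (e (Suc j)) (P j)"
    using XP[of "Suc j"] Suc.prems by (simp add: Y_def)
  then have "(Y (l (Suc j)) ^^ Suc (Suc j)) (P (Suc j)) = (Y (l (Suc j)) ^^ Suc j) (csc (e (Suc j)) (P j))"
    by (simp add: funpow_swap1)
  also have "\<dots> = csc (e (Suc j)) ((Y (l (Suc j)) ^^ Suc j) (P j))"
    using Suc.prems by (intro clinD(2) Y_pow) auto
  also have "\<dots> = 0"
    using Suc e_l[of "Suc j"] by (cases "e (Suc j) = 0") auto
  finally show ?case .
qed

lemma q_X:
  assumes "u \<in> WC" "j < n"
  shows "q j (X u) = l j * q j u + (if Suc j < n then e (Suc j) * q (Suc j) u else 0)"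
proof -
  have "X u = X (\<Sum>k<n. csc (q k u) (P k))" using P_expand[OF assms(1)] by simp
  also have "\<dots> = (\<Sum>k<n. csc (q k u) (X (P k)))" by (intro clin_sum clin_X) auto
  finally have "q j (X u) = (\<Sum>k<n. q k u * q j (X (P k)))" by (simp add: q_sum q_csc)
  also have "\<dots> = (\<Sum>k<n. (if k = j then l j * q j u else 0) + (if k = Suc j then e k * q k u else 0))"
    using assms(2) by (intro sum.cong) (auto simp: XP q_add q_csc q_P)
  also have "\<dots> = l j * q j u + (if Suc j < n then e (Suc j) * q (Suc j) u else 0)"
    using assms(2) by (simp add: sum.distrib)
  finally show ?thesis .
qed

text \<open>The basis vectors \<open>P j\<close> with \<open>l j \<noteq> \<nu>\<close> span an invariant complement on which
\<open>ad x - \<nu>\<close> is triangular with nonzero diagonal, hence injective. The inner induction runs down from the last coordinate.\<close>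

lemma gen_eigen_coord:
  assumes "u \<in> WC" "(Y \<nu> ^^ m) u = 0" "j < n" "l j \<noteq> \<nu>"
  shows "q j u = 0"
proof -
  have step: "\<forall>j<n. l j \<noteq> \<nu> \<longrightarrow> q j u = 0"
    if u: "u \<in> WC" and z: "\<And>j. j < n \<Longrightarrow> l j \<noteq> \<nu> \<Longrightarrow> q j (Y \<nu> u) = 0" for u
  proof (intro allI impI)
    fix j assume "j < n" "l j \<noteq> \<nu>"
    then show "q j u = 0"
    proof (induction "n - j" arbitrary: j rule: less_induct)
      case less
      have "e (Suc j) * q (Suc j) u = 0" if "Suc j < n"
      proof (cases "e (Suc j) = 0")
        case False
        then have "l (Suc j) \<noteq> \<nu>" using e_l[of "Suc j"] that less(3) by simp
        moreover have "n - Suc j < n - j" using that by simp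
        ultimately show ?thesis using less(1)[of "Suc j"] that by simp
      qed simp
      moreover have "q j (Y \<nu> u) = (l j - \<nu>) * q j u + (if Suc j < n then e (Suc j) * q (Suc j) u else 0)"
        using q_X[OF u less(2)] by (simp add: Y_def q_diff q_csc algebra_simps)
      ultimately show ?case using z[OF less(2,3)] less(3) by (auto split: if_splits)
    qed
  qed
  have "\<forall>j<n. l j \<noteq> \<nu> \<longrightarrow> q j u = 0" using assms(1,2)
  proof (induction m arbitrary: u)
    case 0
    then show ?case by simp
  next
    case (Suc m)
    have "Y \<nu> u \<in> WC" using Suc.prems clinD(3)[OF clin_Y] by auto
    moreover have "(Y \<nu> ^^ m) (Y \<nu> u) = 0" using Suc.prems by (simp add: funpow_swap1)
    ultimately show ?case using Suc.IH Suc.prems(1) by (intro step) auto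
  qed
  then show ?thesis using assms by blast
qed

text \<open>Multiplication by the conjugate of the eigenvalue on each generalised eigenspace of \<open>ad x\<close>.\<close>

definition D :: "'f \<times> 'f \<Rightarrow> 'f \<times> 'f" where
  "D u = (\<Sum>j<n. csc (cnj (l j) * q j u) (P j))"

lemma clin_D: "clin D"
proof (rule clinI)
  show "D (csc z u) = csc z (D u)" for z u
    by (simp add: D_def csc.scale_sum_right q_csc mult.left_commute)
  show "D u \<in> WC" for u
    unfolding D_def by (intro WC_sum WC_closed) auto
  show "D (u + v) = D u + D v" for u v
    by (simp add: D_def q_add distrib_left csc.scale_left_distrib sum.distrib)
qed

lemma D_gen_eigen:
  assumes "u \<in> WC" "(Y \<nu> ^^ m) u = 0"
  shows "D u = csc (cnj \<nu>) u"
proof -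
  have "D u = (\<Sum>j<n. csc (cnj \<nu>) (csc (q j u) (P j)))"
    unfolding D_def using gen_eigen_coord[OF assms] by (intro sum.cong) auto
  also have "\<dots> = csc (cnj \<nu>) u" by (simp only: csc.scale_sum_right[symmetric] P_expand[OF assms(1), symmetric])
  finally show ?thesis .
qed

text \<open>Eigenvalues add under the bracket, and conjugation is additive. The rule is checked on basis
vectors and extended to each argument by linearity.\<close>

lemma D_derivation:
  assumes "u \<in> WC" "v \<in> WC"
  shows "D (cbr u v) = cbr (D u) v + cbr u (D v)"
proof -
  have DP: "D (P i) = csc (cnj (l i)) (P i)" if "i < n" for i
    using D_gen_eigen[OF P_in[OF that] P_gen_eigen[OF that]] .
  have PP: "D (cbr (P i) (P j)) = cbr (D (P i)) (P j) + cbr (P i) (D (P j))" if "i < n" "j < n" for i j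
  proof -
    have "D (cbr (P i) (P j)) = csc (cnj (l i + l j)) (cbr (P i) (P j))"
      using that by (intro D_gen_eigen[OF _ gen_eigen_cbr[OF _ _ P_gen_eigen P_gen_eigen]]) auto
    then show ?thesis
      using that by (simp add: DP cbr_simps csc.scale_left_distrib P_in)
  qed
  have uP: "D (cbr u (P j)) = cbr (D u) (P j) + cbr u (D (P j))" if "j < n" for j
  proof -
    have PW: "P j \<in> WC" "D (P j) \<in> WC" using that clinD(3)[OF clin_D] by auto
    have DPW: "D (P i) \<in> WC" if "i < n" for i using that clinD(3)[OF clin_D] by auto
    have e: "cbr u c = (\<Sum>i<n. csc (q i u) (cbr (P i) c))" if "c \<in> WC" for c
      using P_expand[OF assms(1)] clin_sum[OF clin_cbr(2)[OF that], of "{..<n}" P "\<lambda>i. q i u"] by simp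
    have "D (cbr u (P j)) = (\<Sum>i<n. csc (q i u) (D (cbr (P i) (P j))))"
      unfolding e[OF PW(1)] using PW by (intro clin_sum clin_D) auto
    also have "\<dots> = (\<Sum>i<n. csc (q i u) (cbr (D (P i)) (P j))) + (\<Sum>i<n. csc (q i u) (cbr (P i) (D (P j))))"
      using that by (simp add: PP csc.scale_right_distrib sum.distrib)
    also have "(\<Sum>i<n. csc (q i u) (cbr (P i) (D (P j)))) = cbr u (D (P j))"
      using e[OF PW(2)] by simp
    also have "(\<Sum>i<n. csc (q i u) (cbr (D (P i)) (P j))) = cbr (\<Sum>i<n. csc (q i u) (D (P i))) (P j)"
      using clin_sum[OF clin_cbr(2)[OF PW(1)], of "{..<n}" "\<lambda>i. D (P i)" "\<lambda>i. q i u"] DPW by auto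
    also have "(\<Sum>i<n. csc (q i u) (D (P i))) = D u"
      using P_expand[OF assms(1)] clin_sum[OF clin_D, of "{..<n}" P "\<lambda>i. q i u"] by simp
    finally show ?thesis by simp
  qed
  have DuW: "D u \<in> WC" using assms clinD(3)[OF clin_D] by auto
  have DPW: "D (P i) \<in> WC" if "i < n" for i using that clinD(3)[OF clin_D] by auto
  have e: "cbr c v = (\<Sum>i<n. csc (q i v) (cbr c (P i)))" if "c \<in> WC" for c
    using P_expand[OF assms(2)] clin_sum[OF clin_cbr(1)[OF that], of "{..<n}" P "\<lambda>i. q i v"] by simp
  have "D (cbr u v) = (\<Sum>i<n. csc (q i v) (D (cbr u (P i))))"
    unfolding e[OF assms(1)] using assms by (intro clin_sum clin_D) auto
  also have "\<dots> = (\<Sum>i<n. csc (q i v) (cbr (D u) (P i))) + (\<Sum>i<n. csc (q i v) (cbr u (D (P i))))"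
    by (simp add: uP csc.scale_right_distrib sum.distrib)
  also have "(\<Sum>i<n. csc (q i v) (cbr (D u) (P i))) = cbr (D u) v" using e[OF DuW] by simp
  also have "(\<Sum>i<n. csc (q i v) (cbr u (D (P i)))) = cbr u (\<Sum>i<n. csc (q i v) (D (P i)))"
    using clin_sum[OF clin_cbr(1)[OF assms(1)], of "{..<n}" "\<lambda>i. D (P i)" "\<lambda>i. q i v"] DPW by auto
  also have "(\<Sum>i<n. csc (q i v) (D (P i))) = D v"
    using P_expand[OF assms(2)] clin_sum[OF clin_D, of "{..<n}" P "\<lambda>i. q i v"] by simp
  finally show ?thesis .
qed

lemma ctr_P:
  assumes "clin T"
  shows "ctr T = (\<Sum>j<n. q j (T (P j)))"
proof -
  have "T (b i, 0) = (\<Sum>j<n. csc (q j (b i, 0)) (T (P j)))" if "i < n" for i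
  proof -
    have "T (b i, 0) = T (\<Sum>j<n. csc (q j (b i, 0)) (P j))"
      using P_expand[of "(b i, 0)"] that by simp
    also have "\<dots> = (\<Sum>j<n. csc (q j (b i, 0)) (T (P j)))" by (intro clin_sum assms) auto
    finally show ?thesis .
  qed
  then have "ctr T = (\<Sum>i<n. \<Sum>j<n. q j (b i, 0) * co i (T (P j)))"
    by (simp add: ctr_def co_sum co_simps)
  also have "\<dots> = (\<Sum>j<n. \<Sum>i<n. q j (b i, 0) * co i (T (P j)))" by (rule sum.swap)
  also have "\<dots> = (\<Sum>j<n. q j (T (P j)))"
  proof (intro sum.cong refl)
    fix j assume "j \<in> {..<n}"
    then have "T (P j) \<in> WC" using clinD(3)[OF assms] by auto
    from co_expand[OF this] have "q j (T (P j)) = q j (\<Sum>i<n. csc (co i (T (P j))) (b i, 0))" by simp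
    then show "(\<Sum>i<n. q j (b i, 0) * co i (T (P j))) = q j (T (P j))"
      by (simp add: q_sum q_csc mult.commute)
  qed
  finally show ?thesis .
qed

lemma ctr_DX: "ctr (\<lambda>u. D (X u)) = (\<Sum>j<n. cnj (l j) * l j)"
proof -
  have "q j (D (X (P j))) = cnj (l j) * l j" if "j < n" for j
  proof -
    have "q j (D u) = cnj (l j) * q j u" for u
      using that by (simp add: D_def q_sum q_csc q_P if_distrib cong: if_cong)
    then show ?thesis using that by (cases j) (simp_all add: XP q_add q_csc q_P)
  qed
  then show ?thesis by (simp add: ctr_P[OF clin_comp[OF clin_D clin_X]])
qed

text \<open>\<open>tr(D [ad a, ad c]) = tr([D, ad a] ad c) = tr(ad(D a) ad c)\<close>, and the real and imaginary parts of the
last trace are values of the Killing form at \<open>c\<close>.\<close>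

lemma ctr_D_bracket:
  assumes "a \<in> killing_radical" "c \<in> killing_radical"
  shows "ctr (\<lambda>u. D (cbr (br a c, 0) u)) = 0"
proof -
  have W: "a \<in> W" "c \<in> W" "(a, 0) \<in> WC" "(c, 0) \<in> WC" using assms by (auto simp: killing_radical_def)
  note cl = clin_D clin_cbr(1)[OF W(3)] clin_cbr(1)[OF W(4)]
  have bW: "(b i, 0) \<in> WC" if "i < n" for i using that by simp
  have br: "cbr (br a c, 0) u = cbr (a, 0) (cbr (c, 0) u) - cbr (c, 0) (cbr (a, 0) u)" if "u \<in> WC" for u
    using cbr_jacobi[OF W(1,4) that] by (simp add: cbr_def W)
  have Dd: "D (u - v) = D u - D v" if "u \<in> WC" "v \<in> WC" for u v
    using clinD(1)[OF clin_D, of "u - v" v] that by (simp add: WC_closed)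
  have "ctr (\<lambda>u. D (cbr (br a c, 0) u))
      = ctr (\<lambda>u. D (cbr (a, 0) (cbr (c, 0) u))) - ctr (\<lambda>u. D (cbr (c, 0) (cbr (a, 0) u)))"
    unfolding ctr_def sum_subtractf[symmetric]
    by (intro sum.cong refl) (simp add: br bW Dd W WC_closed co_simps)
  also have "ctr (\<lambda>u. D (cbr (c, 0) (cbr (a, 0) u))) = ctr (\<lambda>u. cbr (a, 0) (D (cbr (c, 0) u)))"
    using ctr_comm[OF clin_comp[OF cl(1,3)] cl(2)] .
  also have "ctr (\<lambda>u. D (cbr (a, 0) (cbr (c, 0) u))) - \<dots> = ctr (\<lambda>u. cbr (D (a, 0)) (cbr (c, 0) u))"
    unfolding ctr_def sum_subtractf[symmetric]
    by (intro sum.cong refl) (simp add: D_derivation bW W WC_closed co_simps)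
  also have "\<dots> = 0"
  proof -
    have "D (a, 0) \<in> WC" using clinD(3)[OF clin_D W(3)] .
    then show ?thesis using assms(2) kf_sym[of _ c] W
      by (simp add: ctr_cbr killing_radical_def complex_eq_iff mem_Times_iff)
  qed
  finally show ?thesis .
qed

text \<open>The trace of \<open>D ad x\<close> is the sum of the \<open>|l j|\<^sup>2\<close>, so its vanishing kills all eigenvalues of \<open>ad x\<close>.\<close>

lemma nilpotent:
  assumes "x \<in> span {br a c | a c. a \<in> killing_radical \<and> c \<in> killing_radical}" "w \<in> W"
  shows "(br x ^^ n) w = 0"
proof -
  have "x \<in> W \<and> ctr (\<lambda>u. D (cbr (x, 0) u)) = 0"
    using assms(1)
  proof (induction rule: span_induct_alt)
    case base
    have "cbr (0, 0) (b i, 0) = 0" if "i < n" for i using that by (simp add: cbr_def prod_eq_iff)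
    then show ?case by (simp add: ctr_def clin_0[OF clin_D])
  next
    case (step r u y)
    then obtain a c where u: "u = br a c" "a \<in> killing_radical" "c \<in> killing_radical" by auto
    have W: "u \<in> W" using u by (auto simp: killing_radical_def)
    have "co i (D (cbr (r *\<^sub>R u + y, 0) (b i, 0))) =
        complex_of_real r * co i (D (cbr (u, 0) (b i, 0))) + co i (D (cbr (y, 0) (b i, 0)))" if "i < n" for i
    proof -
      have "cbr (r *\<^sub>R u + y, 0) (b i, 0) = csc (complex_of_real r) (cbr (u, 0) (b i, 0)) + cbr (y, 0) (b i, 0)"
        using W step that by (simp add: cbr_def csc_def)
      moreover have "cbr (u, 0) (b i, 0) \<in> WC" "cbr (y, 0) (b i, 0) \<in> WC" using W step that by auto
      ultimately show ?thesis
        by (simp add: clinD[OF clin_D] WC_closed co_simps)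
    qed
    then have "ctr (\<lambda>z. D (cbr (r *\<^sub>R u + y, 0) z)) =
        complex_of_real r * ctr (\<lambda>z. D (cbr (u, 0) z)) + ctr (\<lambda>z. D (cbr (y, 0) z))"
      by (simp add: ctr_def sum.distrib sum_distrib_left)
    then show ?case using step ctr_D_bracket[OF u(2,3)] u(1) W by simp
  qed
  then have "(\<Sum>j<n. cnj (l j) * l j) = 0" using ctr_DX by simp
  then have "(\<Sum>j<n. complex_of_real ((cmod (l j))\<^sup>2)) = 0"
    by (simp only: complex_norm_square mult.commute)
  then have "(\<Sum>j<n. (cmod (l j))\<^sup>2) = 0" by (metis of_real_eq_0_iff of_real_sum)
  then have l0: "l j = 0" if "j < n" for j
    using that by (subst (asm) sum_nonneg_eq_0_iff) auto
  have YX: "Y 0 = X" by (auto simp: Y_def)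
  have XP0: "(X ^^ n) (P j) = 0" if "j < n" for j
  proof -
    have "(X ^^ n) (P j) = (X ^^ (n - Suc j + Suc j)) (P j)" using that by simp
    also have "\<dots> = (X ^^ (n - Suc j)) ((X ^^ Suc j) (P j))" by (simp only: funpow_add comp_apply)
    also have "(X ^^ Suc j) (P j) = 0" using P_gen_eigen[OF that] l0[OF that] YX by simp
    finally show ?thesis using clin_0[OF Y_pow[of "n - Suc j" 0]] YX by simp
  qed
  have "(w, 0) \<in> WC" using assms by simp
  from P_expand[OF this] have "(X ^^ n) (w, 0) = (X ^^ n) (\<Sum>j<n. csc (q j (w, 0)) (P j))" by simp
  also have "\<dots> = (\<Sum>j<n. csc (q j (w, 0)) ((X ^^ n) (P j)))"
    by (intro clin_sum) (use Y_pow[of n 0] YX in auto)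
  also have "\<dots> = 0" using XP0 by simp
  finally have 0: "(X ^^ n) (w, 0) = 0" .
  have "(X ^^ m) (w, 0) = ((br x ^^ m) w, 0) \<and> (br x ^^ m) w \<in> W" for m
    using assms(2) by (induction m) (auto simp: cbr_def)
  then show ?thesis using 0 by (metis Pair_inject zero_prod_def)
qed

end

context lie_onb
begin

text \<open>The preceding argument applied to a Jordan basis of the matrix of \<open>ad x\<close>.\<close>

lemma killing_radical_nilpotent:
  assumes "x \<in> span {br a c | a c. a \<in> killing_radical \<and> c \<in> killing_radical}" "w \<in> W"
  shows "(br x ^^ n) w = 0"
proof -
  have "{br a c | a c. a \<in> killing_radical \<and> c \<in> killing_radical} \<subseteq> W"
    by (auto simp: killing_radical_def)
  then have x: "x \<in> W" using assms(1) span_minimal[OF _ subW] by blast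
  obtain P Q l e where
    PQ: "\<And>i j. i < n \<Longrightarrow> j < n \<Longrightarrow> (\<Sum>k<n. P i k * Q k j) = (if i = j then 1 else 0)" and
    QP: "\<And>i j. i < n \<Longrightarrow> j < n \<Longrightarrow> (\<Sum>k<n. Q i k * P k j) = (if i = j then 1 else 0)" and
    XP: "\<And>i j. i < n \<Longrightarrow> j < n \<Longrightarrow> (\<Sum>k<n. complex_of_real (br x (b k) \<bullet> b i) * P k j)
           = l j * P i j + (if j = 0 then 0 else e j * P i (j - 1))" and
    el: "\<And>j. j < n \<Longrightarrow> j \<noteq> 0 \<Longrightarrow> e j \<noteq> 0 \<Longrightarrow> l (j - 1) = l j"
    by (rule complex_jordan_basis[of n "\<lambda>i k. complex_of_real (br x (b k) \<bullet> b i)"]) (rule that; assumption)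
  define P' where "P' j = (\<Sum>i<n. csc (P i j) (b i, 0))" for j
  define q where "q j u = (\<Sum>k<n. Q j k * co k u)" for j u
  have P'W: "P' j \<in> WC" for j unfolding P'_def by (intro WC_sum WC_closed) auto
  have coP: "co i (P' j) = P i j" if "i < n" for i j
    using that by (simp add: P'_def co_sum co_simps co_b if_distrib cong: if_cong)
  have eqI: "u = v" if "u \<in> WC" "v \<in> WC" "\<And>i. i < n \<Longrightarrow> co i u = co i v" for u v
    using co_expand[OF that(1)] co_expand[OF that(2)] that(3) by simp
  interpret lie_jordan W br n b x P' q l e
  proof unfold_locales
    show "x \<in> W" by (rule x)
    show "P' j \<in> WC" for j by (rule P'W)
    show "q j (u + v) = q j u + q j v" for j u v
      by (simp add: q_def co_simps ring_distribs sum.distrib)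
    show "q j (csc z u) = z * q j u" for j z u
      by (simp add: q_def co_simps sum_distrib_left algebra_simps)
    show "q i (P' j) = (if i = j then 1 else 0)" if "i < n" "j < n" for i j
      using QP[OF that] by (simp add: q_def coP)
    show "u = (\<Sum>j<n. csc (q j u) (P' j))" if "u \<in> WC" for u
    proof (rule eqI[OF that])
      show "(\<Sum>j<n. csc (q j u) (P' j)) \<in> WC" using P'W by (intro WC_sum WC_closed)
      fix i assume i: "i < n"
      have "co i (\<Sum>j<n. csc (q j u) (P' j)) = (\<Sum>j<n. \<Sum>k<n. Q j k * co k u * P i j)"
        using i by (simp add: co_sum co_simps coP q_def sum_distrib_right)
      also have "\<dots> = (\<Sum>k<n. \<Sum>j<n. Q j k * co k u * P i j)" by (rule sum.swap)
      also have "\<dots> = (\<Sum>k<n. co k u * (\<Sum>j<n. P i j * Q j k))"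
        by (simp add: sum_distrib_left algebra_simps)
      also have "\<dots> = co i u" using i by (simp add: PQ if_distrib cong: if_cong)
      finally show "co i u = co i (\<Sum>j<n. csc (q j u) (P' j))" by simp
    qed
    show "cbr (x, 0) (P' j) = csc (l j) (P' j) + (if j = 0 then 0 else csc (e j) (P' (j - 1)))" if j: "j < n" for j
    proof (rule eqI)
      have xC: "(x, 0) \<in> WC" using x by simp
      show "cbr (x, 0) (P' j) \<in> WC" using xC P'W by (intro WC_closed)
      show "csc (l j) (P' j) + (if j = 0 then 0 else csc (e j) (P' (j - 1))) \<in> WC"
        using P'W by (auto intro!: WC_closed)
      fix i assume i: "i < n"
      have "cbr (x, 0) (P' j) = (\<Sum>k<n. csc (P k j) (cbr (x, 0) (b k, 0)))"
        unfolding P'_def by (intro clin_sum clin_cbr(1)[OF xC]) auto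
      then have "co i (cbr (x, 0) (P' j)) = (\<Sum>k<n. P k j * co i (cbr (x, 0) (b k, 0)))"
        by (simp add: co_sum co_simps)
      also have "\<dots> = (\<Sum>k<n. complex_of_real (br x (b k) \<bullet> b i) * P k j)"
      proof (intro sum.cong refl)
        fix k assume "k \<in> {..<n}"
        then have "co i (cbr (x, 0) (b k, 0)) = complex_of_real (br x (b k) \<bullet> b i)"
          using x by (simp add: co_def cbr_def complex_of_real_def)
        then show "P k j * co i (cbr (x, 0) (b k, 0)) = complex_of_real (br x (b k) \<bullet> b i) * P k j" by simp
      qed
      finally show "co i (cbr (x, 0) (P' j)) =
          co i (csc (l j) (P' j) + (if j = 0 then 0 else csc (e j) (P' (j - 1))))"
        unfolding XP[OF i j] using i by (simp add: co_simps coP)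
    qed
    show "l (j - 1) = l j" if "j < n" "j \<noteq> 0" "e j \<noteq> 0" for j by (rule el[OF that])
  qed
  show ?thesis by (rule nilpotent[OF assms])
qed

lemma killing_radical_solvable: "lie_solvable br killing_radical"
proof -
  let ?s = "killing_radical"
  let ?N = "derived_subalgebra br ?s"
  have s: "subspace ?s" "?s \<subseteq> W" "\<And>x y. x \<in> W \<Longrightarrow> y \<in> ?s \<Longrightarrow> br x y \<in> ?s"
    using killing_radical_ideal by (auto simp: lie_ideal_on_def)
  have N: "subspace ?N" by (simp add: derived_subalgebra_def)
  have Ns: "?N \<subseteq> ?s" unfolding derived_subalgebra_def using s by (intro span_minimal) auto
  have br: "br x y \<in> ?N" if "x \<in> ?N" "y \<in> ?N" for x y
    using that Ns unfolding derived_subalgebra_def by (intro span_base) auto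
  have "nil_words ?N"
    using N Ns s(2) br killing_radical_nilpotent
    by (intro engel[where r = n]) (auto simp: derived_subalgebra_def)
  then have "lie_solvable br ?N" using N Ns s(2) br by (intro nil_words_solvable) auto
  then obtain m where "(derived_subalgebra br ^^ m) ?N = {0}" by (auto simp: lie_solvable_def)
  then have "(derived_subalgebra br ^^ Suc m) ?s = {0}" by (simp add: funpow_swap1)
  then show ?thesis unfolding lie_solvable_def by blast
qed

end

section \<open>Derivations of semisimple Lie algebras\<close>

definition lie_derivation_on :: "'g::real_vector set \<Rightarrow> ('g \<Rightarrow> 'g \<Rightarrow> 'g) \<Rightarrow> ('g \<Rightarrow> 'g) \<Rightarrow> bool" where
  "lie_derivation_on W br T \<longleftrightarrow> linear_map_on W T \<and> (\<forall>a\<in>W. T a \<in> W) \<and>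
     (\<forall>a\<in>W. \<forall>c\<in>W. T (br a c) = br (T a) c + br a (T c))"

locale semisimple_onb = lie_onb W br n b
  for W :: "'f::real_inner set" and br n b +
  assumes semisimple: "semisimple_lie_algebra_on W br"
    and fin: "finite_dimensional TYPE('f)"
begin

text \<open>Cartan's criterion: the radical of the Killing form is a solvable ideal.\<close>

lemma killing_nondegenerate:
  assumes "x \<in> W" "\<And>y. y \<in> W \<Longrightarrow> kf x y = 0"
  shows "x = 0"
proof -
  have "killing_radical = {0}"
    using semisimple killing_radical_ideal killing_radical_solvable
    unfolding semisimple_lie_algebra_on_def by blast
  then show ?thesis using assms unfolding killing_radical_def by blast
qed

lemma centre_trivial:
  assumes "x \<in> W" "\<And>y. y \<in> W \<Longrightarrow> br x y = 0"
  shows "x = 0"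
proof (rule killing_nondegenerate[OF assms(1)])
  fix y assume "y \<in> W"
  then show "kf x y = 0" using assms(2) by (simp add: kf_def tr_def)
qed

lemma kf_expand:
  assumes "x \<in> W" "y \<in> W"
  shows "kf x y = (\<Sum>i<n. kf x (b i) *\<^sub>R b i) \<bullet> y"
proof -
  have lin: "linear_map_on W (kf x)"
    using kf_add[OF assms(1)] kf_scale[OF assms(1)] by (auto simp: linear_map_on_def)
  have "kf x y = kf x (\<Sum>i<n. (y \<bullet> b i) *\<^sub>R b i)" using expand[OF assms(2)] by simp
  also have "\<dots> = (\<Sum>i<n. (y \<bullet> b i) *\<^sub>R kf x (b i))"
    by (intro linear_map_on_sum[OF lin subW]) auto
  also have "\<dots> = (\<Sum>i<n. kf x (b i) *\<^sub>R b i) \<bullet> y"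
    by (simp add: inner_sum_left inner_commute[of y] mult.commute)
  finally show ?thesis .
qed

text \<open>\<open>F\<close> represents the Killing form by the inner product. If \<open>a'\<close> is the orthogonal projection of \<open>a\<close>
to the image of \<open>F\<close>, then \<open>a - a'\<close> is orthogonal to this image, so it lies in the radical and vanishes.\<close>

lemma kf_represent:
  assumes "a \<in> W"
  shows "\<exists>x\<in>W. \<forall>y\<in>W. kf x y = a \<bullet> y"
proof -
  define F where "F x = (\<Sum>i<n. kf x (b i) *\<^sub>R b i)" for x
  have F: "kf x y = F x \<bullet> y" if "x \<in> W" "y \<in> W" for x y
    unfolding F_def by (rule kf_expand[OF that])
  have Fadd: "F (x + y) = F x + F y" if "x \<in> W" "y \<in> W" for x y
    unfolding F_def sum.distrib[symmetric]
    using that kf_add kf_sym by (intro sum.cong) (auto simp: scaleR_add_left)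
  have Fscale: "F (r *\<^sub>R x) = r *\<^sub>R F x" if "x \<in> W" for r x
    unfolding F_def scaleR_sum_right
    using that kf_scale kf_sym by (intro sum.cong) auto
  have sub: "subspace (F ` W)"
    unfolding real_vector.subspace_def
  proof (intro conjI ballI allI)
    have "F 0 = 0" using Fscale[of 0 0] by simp
    then show "0 \<in> F ` W" by (intro image_eqI[of _ _ 0]) simp_all
    fix u v assume "u \<in> F ` W" "v \<in> F ` W"
    then obtain x y where "u = F x" "v = F y" "x \<in> W" "y \<in> W" by blast
    then show "u + v \<in> F ` W" by (intro image_eqI[of _ _ "x + y"]) (simp_all add: Fadd)
  next
    fix r u assume "u \<in> F ` W"
    then obtain x where "u = F x" "x \<in> W" by blast
    then show "r *\<^sub>R u \<in> F ` W" by (intro image_eqI[of _ _ "r *\<^sub>R x"]) (simp_all add: Fscale)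
  qed
  obtain m :: nat and u where u: "\<And>i. i < m \<Longrightarrow> u i \<in> F ` W"
    "\<And>i j. i < m \<Longrightarrow> j < m \<Longrightarrow> u i \<bullet> u j = (if i = j then 1 else 0)"
    "\<And>w. w \<in> F ` W \<Longrightarrow> w = (\<Sum>i<m. (w \<bullet> u i) *\<^sub>R u i)"
    by (rule subspace_onb[OF fin sub]) (rule that; assumption)
  have FW: "F x \<in> W" for x unfolding F_def by (intro subspace_sum[OF subW]) auto
  define a' where "a' = (\<Sum>i<m. (a \<bullet> u i) *\<^sub>R u i)"
  have a'F: "a' \<in> F ` W" unfolding a'_def using u(1) by (intro subspace_sum[OF sub] subspace_scale[OF sub]) auto
  then have a'W: "a' \<in> W" using FW by auto
  have "a' \<bullet> u j = a \<bullet> u j" if "j < m" for j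
    using that by (simp add: a'_def inner_sum_left u(2) if_distrib cong: if_cong)
  then have orth: "(a - a') \<bullet> w = 0" if "w \<in> F ` W" for w
    by (subst u(3)[OF that]) (simp add: inner_sum_right inner_diff_left)
  have "kf (a - a') y = 0" if "y \<in> W" for y
    using F[OF that, of "a - a'"] kf_sym[of "a - a'" y] orth[of "F y"] assms a'W that
    by (simp add: inner_commute)
  then have "a - a' = 0" using assms a'W by (intro killing_nondegenerate) auto
  then obtain x where "x \<in> W" "a = F x" using a'F by auto
  then show ?thesis using F by auto
qed

text \<open>The formula defines the \<open>x\<close> that represents \<open>y \<mapsto> tr(T ad y)\<close> by means of the Killing form. Hence \<open>E = T - ad x\<close> is a
derivation with \<open>tr(E ad a) = 0\<close> for all \<open>a\<close>, and the Killing form of \<open>E y\<close> and \<open>c\<close> is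
\<open>tr([E, ad y] ad c) = tr(E ad[y, c]) = 0\<close>.\<close>

lemma derivation_inner:
  assumes z: "\<And>i. i < n \<Longrightarrow> z i \<in> W" "\<And>i y. i < n \<Longrightarrow> y \<in> W \<Longrightarrow> kf (z i) y = b i \<bullet> y"
    and T: "lie_derivation_on W br T" and y: "y \<in> W"
  shows "T y = br (\<Sum>i<n. (\<Sum>j<n. T (br (b i) (b j)) \<bullet> b j) *\<^sub>R z i) y"
proof -
  define x where "x = (\<Sum>i<n. (\<Sum>j<n. T (br (b i) (b j)) \<bullet> b j) *\<^sub>R z i)"
  have xW: "x \<in> W" unfolding x_def using z(1) by (intro subspace_sum[OF subW] subspace_scale[OF subW]) auto
  have eT: "endo T" using T by (auto simp: lie_derivation_on_def endo_def)
  have TW: "T a \<in> W" if "a \<in> W" for a using T that by (auto simp: lie_derivation_on_def)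
  have Tbr: "T (br a c) = br (T a) c + br a (T c)" if "a \<in> W" "c \<in> W" for a c
    using T that by (auto simp: lie_derivation_on_def)
  have Tlin: "T (a + c) = T a + T c" "T (r *\<^sub>R a) = r *\<^sub>R T a" if "a \<in> W" "c \<in> W" for a c r
    using T that linear_map_onD[of W T] by (auto simp: lie_derivation_on_def)
  \<comment> \<open>The functional \<open>y \<mapsto> tr(T ad y)\<close>, which \<open>x\<close> represents.\<close>
  define g where "g y = tr (\<lambda>w. T (br y w))" for y
  have glin: "linear_map_on W g"
    unfolding linear_map_on_def g_def tr_def
    by (auto simp: Tlin inner_add_left sum.distrib sum_distrib_left)
  have kx: "kf x y = g y" if "y \<in> W" for y
  proof -
    have lin: "linear_map_on W (\<lambda>x. kf x y)"
      unfolding linear_map_on_def using that kf_add kf_scale kf_sym by auto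
    have "kf x y = (\<Sum>i<n. (\<Sum>j<n. T (br (b i) (b j)) \<bullet> b j) *\<^sub>R kf (z i) y)"
      unfolding x_def using z(1) by (intro linear_map_on_sum[OF lin subW]) auto
    also have "\<dots> = (\<Sum>i<n. (y \<bullet> b i) *\<^sub>R g (b i))"
      using z(2) that by (intro sum.cong) (auto simp: g_def tr_def inner_commute)
    also have "\<dots> = g (\<Sum>i<n. (y \<bullet> b i) *\<^sub>R b i)"
      by (intro linear_map_on_sum[OF glin subW, symmetric]) auto
    also have "\<dots> = g y" using expand[OF that] by simp
    finally show ?thesis .
  qed
  define E where "E a = T a - br x a" for a
  have EW: "E a \<in> W" if "a \<in> W" for a using that TW xW by (simp add: E_def)
  have eE: "endo E"
    unfolding endo_def linear_map_on_def using EW xW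
    by (auto simp: E_def Tlin scaleR_diff_right)
  have Ebr: "br (E a) w = E (br a w) - br a (E w)" if "a \<in> W" "w \<in> W" for a w
    using that xW TW jacobi[OF xW that] by (simp add: E_def Tbr)
  have Ediff: "E (a - c) = E a - E c" if "a \<in> W" "c \<in> W" for a c
    using eE that linear_map_onD(1)[of W E "a - c" c] by (simp add: endo_def)
  have trE: "tr (\<lambda>w. E (br a w)) = 0" if "a \<in> W" for a
    using kx[OF that] by (simp add: E_def tr_def inner_diff_left sum_subtractf g_def kf_def)
  have "E y = 0"
  proof (rule killing_nondegenerate[OF EW[OF y]])
    fix c assume c: "c \<in> W"
    have "kf (E y) c = tr (\<lambda>w. E (br y (br c w))) - tr (\<lambda>w. br y (E (br c w)))"
      unfolding kf_def tr_def sum_subtractf[symmetric]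
      using y c by (intro sum.cong) (auto simp: Ebr inner_diff_left)
    also have "tr (\<lambda>w. br y (E (br c w))) = tr (\<lambda>w. E (br c (br y w)))"
      using tr_comm[OF endo_br[OF y] endo_comp[OF eE endo_br[OF c]]] .
    also have "tr (\<lambda>w. E (br y (br c w))) - tr (\<lambda>w. E (br c (br y w))) = tr (\<lambda>w. E (br (br y c) w))"
    proof -
      have "E (br (br y c) w) = E (br y (br c w)) - E (br c (br y w))" if "w \<in> W" for w
        using jacobi[OF y c that] Ediff[of "br y (br c w)" "br c (br y w)"] y c that by simp
      then show ?thesis by (simp add: tr_def sum_subtractf inner_diff_left)
    qed
    also have "\<dots> = 0" using y c by (intro trE) auto
    finally show "kf (E y) c = 0" .
  qed
  then show ?thesis by (simp add: E_def x_def)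
qed

end

text \<open>The elements \<open>b i\<close>, \<open>z i\<close> do not depend on the derivation. So in a smooth family of derivations, the elements
that induce them vary smoothly.\<close>

theorem semisimple_derivations_inner:
  fixes W :: "'f::real_inner set"
  assumes "finite_dimensional TYPE('f)" "semisimple_lie_algebra_on W br"
  obtains n :: nat and b z :: "nat \<Rightarrow> 'f"
  where "\<And>i. i < n \<Longrightarrow> b i \<in> W" "\<And>i. i < n \<Longrightarrow> z i \<in> W"
    "\<And>T y. lie_derivation_on W br T \<Longrightarrow> y \<in> W \<Longrightarrow>
       T y = br (\<Sum>i<n. (\<Sum>j<n. T (br (b i) (b j)) \<bullet> b j) *\<^sub>R z i) y"
proof -
  have lie: "lie_algebra_on W br" using assms(2) by (simp add: semisimple_lie_algebra_on_def)
  then have sub: "subspace W" by (simp add: lie_algebra_on_def)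
  obtain n :: nat and b where b: "\<And>i. i < n \<Longrightarrow> b i \<in> W"
    "\<And>i j. i < n \<Longrightarrow> j < n \<Longrightarrow> b i \<bullet> b j = (if i = j then 1 else 0)"
    "\<And>w. w \<in> W \<Longrightarrow> w = (\<Sum>i<n. (w \<bullet> b i) *\<^sub>R b i)"
    by (rule subspace_onb[OF assms(1) sub]) (rule that; assumption)
  interpret semisimple_onb W br n b
    by unfold_locales (use lie b assms in auto)
  have "\<forall>i. \<exists>x. i < n \<longrightarrow> x \<in> W \<and> (\<forall>y\<in>W. kf x y = b i \<bullet> y)"
    using kf_represent b(1) by blast
  then obtain z where z: "\<And>i. i < n \<Longrightarrow> z i \<in> W \<and> (\<forall>y\<in>W. kf (z i) y = b i \<bullet> y)" by metis
  show ?thesis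
  proof (rule that[of n b z])
    show "b i \<in> W" "z i \<in> W" if "i < n" for i using b(1) z that by auto
    show "T y = br (\<Sum>i<n. (\<Sum>j<n. T (br (b i) (b j)) \<bullet> b j) *\<^sub>R z i) y"
      if "lie_derivation_on W br T" "y \<in> W" for T y
      by (rule derivation_inner[OF _ _ that]) (use z in auto)
  qed
qed

lemma semisimple_centre_trivial:
  fixes W :: "'f::real_inner set"
  assumes "finite_dimensional TYPE('f)" "semisimple_lie_algebra_on W br" "x \<in> W" "\<And>y. y \<in> W \<Longrightarrow> br x y = 0"
  shows "x = 0"
proof -
  have lie: "lie_algebra_on W br" using assms(2) by (simp add: semisimple_lie_algebra_on_def)
  then have sub: "subspace W" by (simp add: lie_algebra_on_def)
  obtain n :: nat and b where b: "\<And>i. i < n \<Longrightarrow> b i \<in> W"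
    "\<And>i j. i < n \<Longrightarrow> j < n \<Longrightarrow> b i \<bullet> b j = (if i = j then 1 else 0)"
    "\<And>w. w \<in> W \<Longrightarrow> w = (\<Sum>i<n. (w \<bullet> b i) *\<^sub>R b i)"
    by (rule subspace_onb[OF assms(1) sub]) (rule that; assumption)
  interpret semisimple_onb W br n b
    by unfold_locales (use lie b assms in auto)
  show ?thesis using centre_trivial assms(3,4) by blast
qed

section \<open>Calculus of smooth maps\<close>

lemma C_k_on_cong:
  assumes "open S" "\<And>y. y \<in> S \<Longrightarrow> f y = g y" "C_k_on k S f"
  shows "C_k_on k S g"
  using assms(2,3)
proof (induction k arbitrary: f g)
  case 0
  then show ?case using continuous_on_eq[of S f g] by simp
next
  case (Suc k)
  have d: "(g has_derivative frechet_derivative f (at y)) (at y)" if "y \<in> S" for y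
    using Suc.prems that has_derivative_transform_within_open[OF _ assms(1) that, of f _ UNIV g]
    by (auto simp: frechet_derivative_works)
  then have "frechet_derivative g (at y) = frechet_derivative f (at y)" if "y \<in> S" for y
    using frechet_derivative_at[OF d[OF that]] by simp
  then have "C_k_on k S (\<lambda>y. frechet_derivative g (at y) w)" for w
    using Suc.prems(2) by (rule_tac Suc.IH[of "\<lambda>y. frechet_derivative f (at y) w"]) simp_all
  moreover have "g differentiable (at y)" if "y \<in> S" for y
    using d[OF that] by (auto simp: differentiable_def)
  ultimately show ?case by simp
qed

lemma C_k_on_SucI:
  assumes "open S" "\<And>y. y \<in> S \<Longrightarrow> (f has_derivative f' y) (at y)" "\<And>w. C_k_on k S (\<lambda>y. f' y w)"
  shows "C_k_on (Suc k) S f"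
proof -
  have "frechet_derivative f (at y) = f' y" if "y \<in> S" for y
    using frechet_derivative_at[OF assms(2)[OF that]] by simp
  then have "C_k_on k S (\<lambda>y. frechet_derivative f (at y) w)" for w
    by (intro C_k_on_cong[OF assms(1) _ assms(3)[of w]]) auto
  moreover have "f differentiable (at y)" if "y \<in> S" for y
    using assms(2)[OF that] by (auto simp: differentiable_def)
  ultimately show ?thesis by simp
qed

lemma C_k_on_SucD:
  assumes "C_k_on (Suc k) S f"
  shows "y \<in> S \<Longrightarrow> (f has_derivative frechet_derivative f (at y)) (at y)"
    and "C_k_on k S (\<lambda>y. frechet_derivative f (at y) w)"
  using assms by (auto simp: frechet_derivative_works)

lemma C_k_on_SucD': "C_k_on (Suc k) S f \<Longrightarrow> C_k_on k S f"
proof (induction k arbitrary: f)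
  case 0
  then show ?case by (auto intro!: differentiable_imp_continuous_on simp: differentiable_on_def differentiable_at_withinI)
next
  case (Suc k)
  then show ?case by (metis C_k_on.simps(2))
qed

lemma C_k_on_subset: "C_k_on k S f \<Longrightarrow> T \<subseteq> S \<Longrightarrow> C_k_on k T f"
  by (induction k arbitrary: f) (auto intro: continuous_on_subset)

lemma C_k_on_local:
  assumes "\<And>y. y \<in> S \<Longrightarrow> \<exists>T. open T \<and> y \<in> T \<and> C_k_on k T f"
  shows "C_k_on k S f"
  using assms
proof (induction k arbitrary: f)
  case 0
  have "continuous (at y) f" if "y \<in> S" for y
    using 0[OF that] by (auto simp: continuous_on_eq_continuous_at)
  then show ?case by (simp add: continuous_at_imp_continuous_on)
next
  case (Suc k)
  have "\<exists>T. open T \<and> y \<in> T \<and> C_k_on k T (\<lambda>y. frechet_derivative f (at y) w)" if "y \<in> S" for y w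
    using Suc.prems[OF that] by auto
  then have "C_k_on k S (\<lambda>y. frechet_derivative f (at y) w)" for w by (rule Suc.IH)
  moreover have "f differentiable (at y)" if "y \<in> S" for y using Suc.prems[OF that] by auto
  ultimately show ?case by simp
qed

lemma C_k_on_const: "open S \<Longrightarrow> C_k_on k S (\<lambda>y. c)"
proof (induction k arbitrary: c)
  case (Suc k)
  show ?case by (rule C_k_on_SucI[OF Suc.prems, where f' = "\<lambda>y w. 0"]) (auto intro: Suc)
qed simp

lemma C_k_on_bounded_linear_comp:
  assumes "open S" "bounded_linear L" "C_k_on k S f"
  shows "C_k_on k S (\<lambda>y. L (f y))"
  using assms(3)
proof (induction k arbitrary: f)
  case 0
  then show ?case using bounded_linear.continuous_on[OF assms(2)] by simp
next
  case (Suc k)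
  show ?case
    by (rule C_k_on_SucI[OF assms(1), where f' = "\<lambda>y w. L (frechet_derivative f (at y) w)"])
      (auto intro!: bounded_linear.has_derivative[OF assms(2)] C_k_on_SucD[OF Suc.prems] Suc.IH)
qed

lemma C_k_on_id: "open S \<Longrightarrow> C_k_on k S (\<lambda>y. y)"
proof (cases k)
  case (Suc m)
  assume "open S"
  then show ?thesis unfolding Suc
    by (rule C_k_on_SucI[where f' = "\<lambda>y w. w"]) (auto intro: C_k_on_const \<open>open S\<close>)
qed simp

lemma C_k_on_add:
  assumes "open S" "C_k_on k S f" "C_k_on k S g"
  shows "C_k_on k S (\<lambda>y. f y + g y)"
  using assms(2,3)
proof (induction k arbitrary: f g)
  case 0
  then show ?case by (auto intro: continuous_on_add)
next
  case (Suc k)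
  show ?case
    by (rule C_k_on_SucI[OF assms(1), where f' = "\<lambda>y w. frechet_derivative f (at y) w + frechet_derivative g (at y) w"])
      (auto intro!: has_derivative_add C_k_on_SucD[OF Suc.prems(1)] C_k_on_SucD[OF Suc.prems(2)] Suc.IH)
qed

lemma C_k_on_sum:
  assumes "open S" "\<And>i. i \<in> I \<Longrightarrow> C_k_on k S (f i)"
  shows "C_k_on k S (\<lambda>y. \<Sum>i\<in>I. f i y)"
  using assms(2)
  by (induction I rule: infinite_finite_induct) (auto intro: C_k_on_add C_k_on_const assms(1))

lemma C_k_on_bilinear:
  assumes "open S" "bounded_bilinear B" "C_k_on k S f" "C_k_on k S g"
  shows "C_k_on k S (\<lambda>y. B (f y) (g y))"
  using assms(3,4)
proof (induction k arbitrary: f g)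
  case 0
  then show ?case using bounded_bilinear.continuous_on[OF assms(2)] by auto
next
  case (Suc k)
  show ?case
  proof (rule C_k_on_SucI[OF assms(1), where f' = "\<lambda>y w. B (f y) (frechet_derivative g (at y) w) + B (frechet_derivative f (at y) w) (g y)"])
    show "((\<lambda>y. B (f y) (g y)) has_derivative (\<lambda>w. B (f y) (frechet_derivative g (at y) w) + B (frechet_derivative f (at y) w) (g y))) (at y)"
      if "y \<in> S" for y
      by (rule bounded_bilinear.FDERIV[OF assms(2) C_k_on_SucD(1)[OF Suc.prems(1) that] C_k_on_SucD(1)[OF Suc.prems(2) that]])
    show "C_k_on k S (\<lambda>y. B (f y) (frechet_derivative g (at y) w) + B (frechet_derivative f (at y) w) (g y))" for w
      by (intro C_k_on_add assms(1) Suc.IH C_k_on_SucD'[OF Suc.prems(1)] C_k_on_SucD'[OF Suc.prems(2)]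
          C_k_on_SucD(2)[OF Suc.prems(1)] C_k_on_SucD(2)[OF Suc.prems(2)])
  qed
qed

text \<open>Expanding the derivative of \<open>g\<close> in an orthonormal basis turns the chain rule into a sum of
products, to which the induction hypothesis applies.\<close>

lemma C_k_on_compose:
  fixes f :: "'b::real_inner \<Rightarrow> 'c::real_normed_vector" and g :: "'a::real_normed_vector \<Rightarrow> 'b"
  assumes "finite_dimensional TYPE('b)" "open S" "open T" "\<And>y. y \<in> S \<Longrightarrow> g y \<in> T" "C_k_on k T f" "C_k_on k S g"
  shows "C_k_on k S (\<lambda>y. f (g y))"
proof -
  obtain n :: nat and b :: "nat \<Rightarrow> 'b" where b: "\<And>w. w = (\<Sum>i<n. (w \<bullet> b i) *\<^sub>R b i)"
    by (rule subspace_onb[OF assms(1) subspace_UNIV]) (metis UNIV_I)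
  show ?thesis using assms(5,6)
  proof (induction k arbitrary: f)
    case 0
    then show ?case using continuous_on_compose2[of T f S g] assms(4) by auto
  next
    case (Suc k)
    show ?case
    proof (rule C_k_on_SucI[OF assms(2), where f' = "\<lambda>y w. \<Sum>i<n. (frechet_derivative g (at y) w \<bullet> b i) *\<^sub>R frechet_derivative f (at (g y)) (b i)"])
      fix y assume y: "y \<in> S"
      have f: "(f has_derivative frechet_derivative f (at (g y))) (at (g y))"
        using Suc.prems(1) assms(4)[OF y] by (intro C_k_on_SucD)
      have "((\<lambda>y. f (g y)) has_derivative (\<lambda>w. frechet_derivative f (at (g y)) (frechet_derivative g (at y) w))) (at y)"
        by (rule has_derivative_compose[OF C_k_on_SucD(1)[OF Suc.prems(2) y] f])
      moreover have "frechet_derivative f (at (g y)) v = (\<Sum>i<n. (v \<bullet> b i) *\<^sub>R frechet_derivative f (at (g y)) (b i))" for v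
      proof -
        have l: "linear (frechet_derivative f (at (g y)))" using f by (rule has_derivative_linear)
        have "frechet_derivative f (at (g y)) v = frechet_derivative f (at (g y)) (\<Sum>i<n. (v \<bullet> b i) *\<^sub>R b i)"
          using b[of v] by simp
        also have "\<dots> = (\<Sum>i<n. (v \<bullet> b i) *\<^sub>R frechet_derivative f (at (g y)) (b i))"
          by (simp add: linear_sum[OF l] linear_cmul[OF l])
        finally show ?thesis .
      qed
      ultimately show "((\<lambda>y. f (g y)) has_derivative (\<lambda>w. \<Sum>i<n. (frechet_derivative g (at y) w \<bullet> b i) *\<^sub>R frechet_derivative f (at (g y)) (b i))) (at y)"
        by (metis (no_types, lifting) ext)
    next
      fix w
      show "C_k_on k S (\<lambda>y. \<Sum>i<n. (frechet_derivative g (at y) w \<bullet> b i) *\<^sub>R frechet_derivative f (at (g y)) (b i))"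
      proof (intro C_k_on_sum assms(2) C_k_on_bilinear[OF assms(2) bounded_bilinear_scaleR])
        fix i
        show "C_k_on k S (\<lambda>y. frechet_derivative g (at y) w \<bullet> b i)"
          by (rule C_k_on_bounded_linear_comp[OF assms(2) bounded_linear_inner_left C_k_on_SucD(2)[OF Suc.prems(2)]])
        show "C_k_on k S (\<lambda>y. frechet_derivative f (at (g y)) (b i))"
          using Suc.IH[OF C_k_on_SucD(2)[OF Suc.prems(1)] C_k_on_SucD'[OF Suc.prems(2)]] .
      qed
    qed
  qed
qed

subsection \<open>Smooth maps\<close>

lemma smooth_onI: "(\<And>k. C_k_on k S f) \<Longrightarrow> smooth_on S f" and smooth_onD: "smooth_on S f \<Longrightarrow> C_k_on k S f"
  by (auto simp: smooth_on_def)

lemma smooth_on_cong: "open S \<Longrightarrow> smooth_on S f \<Longrightarrow> (\<And>y. y \<in> S \<Longrightarrow> f y = g y) \<Longrightarrow> smooth_on S g"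
  by (auto simp: smooth_on_def intro: C_k_on_cong)

lemma smooth_on_subset: "smooth_on S f \<Longrightarrow> T \<subseteq> S \<Longrightarrow> smooth_on T f"
  by (auto simp: smooth_on_def intro: C_k_on_subset)

lemma smooth_on_local:
  assumes "\<And>y. y \<in> S \<Longrightarrow> \<exists>T. open T \<and> y \<in> T \<and> smooth_on T f"
  shows "smooth_on S f"
  unfolding smooth_on_def
proof (intro allI C_k_on_local)
  show "\<exists>T. open T \<and> y \<in> T \<and> C_k_on k T f" if "y \<in> S" for k y
    using assms[OF that] by (auto simp: smooth_on_def)
qed

lemma smooth_on_const: "open S \<Longrightarrow> smooth_on S (\<lambda>y. c)"
  by (auto simp: smooth_on_def intro: C_k_on_const)

lemma smooth_on_id: "open S \<Longrightarrow> smooth_on S (\<lambda>y. y)"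
  by (auto simp: smooth_on_def intro: C_k_on_id)

lemma smooth_on_bounded_linear_comp: "open S \<Longrightarrow> bounded_linear L \<Longrightarrow> smooth_on S f \<Longrightarrow> smooth_on S (\<lambda>y. L (f y))"
  by (auto simp: smooth_on_def intro: C_k_on_bounded_linear_comp)

lemma smooth_on_add: "open S \<Longrightarrow> smooth_on S f \<Longrightarrow> smooth_on S g \<Longrightarrow> smooth_on S (\<lambda>y. f y + g y)"
  by (auto simp: smooth_on_def intro: C_k_on_add)

lemma smooth_on_sum: "open S \<Longrightarrow> (\<And>i. i \<in> I \<Longrightarrow> smooth_on S (f i)) \<Longrightarrow> smooth_on S (\<lambda>y. \<Sum>i\<in>I. f i y)"
  by (auto simp: smooth_on_def intro: C_k_on_sum)

lemma smooth_on_bilinear: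
  "open S \<Longrightarrow> bounded_bilinear B \<Longrightarrow> smooth_on S f \<Longrightarrow> smooth_on S g \<Longrightarrow> smooth_on S (\<lambda>y. B (f y) (g y))"
  by (auto simp: smooth_on_def intro: C_k_on_bilinear)

lemma smooth_on_compose:
  fixes f :: "'b::real_inner \<Rightarrow> 'c::real_normed_vector"
  assumes "finite_dimensional TYPE('b)" "open S" "open T" "\<And>y. y \<in> S \<Longrightarrow> g y \<in> T" "smooth_on T f" "smooth_on S g"
  shows "smooth_on S (\<lambda>y. f (g y))"
  using assms unfolding smooth_on_def by (auto intro: C_k_on_compose[OF assms(1-4)])

lemma smooth_on_has_derivative:
  "smooth_on S f \<Longrightarrow> y \<in> S \<Longrightarrow> (f has_derivative frechet_derivative f (at y)) (at y)"
  using C_k_on_SucD(1)[of 0 S f y] by (auto simp: smooth_on_def)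

lemma smooth_on_deriv: "smooth_on S f \<Longrightarrow> smooth_on S (\<lambda>y. frechet_derivative f (at y) w)"
  by (rule smooth_onI, rule C_k_on_SucD(2), rule smooth_onD)

lemma finite_dimensional_real: "finite_dimensional TYPE(real)"
  unfolding finite_dimensional_def
proof (intro exI conjI)
  have "x \<in> span {1::real}" for x using span_scale[OF span_base[of 1 "{1::real}"], of x] by simp
  then show "span {1::real} = UNIV" by blast
qed simp

lemma smooth_on_inverse: "smooth_on (- {0::real}) inverse"
proof -
  have "C_k_on k (- {0::real}) inverse" for k
  proof (induction k)
    case 0
    show ?case by (auto intro!: continuous_intros)
  next
    case (Suc k)
    have o: "open (- {0::real})" by auto
    have "C_k_on k (- {0}) (\<lambda>y. - (inverse y * w * inverse y))" for w :: real
      by (intro C_k_on_bounded_linear_comp[OF o bounded_linear_minus[OF bounded_linear_ident]]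
          C_k_on_bilinear[OF o bounded_bilinear_mult] Suc C_k_on_const o)
    then show ?case
      by (intro C_k_on_SucI[OF o, where f' = "\<lambda>y w. - (inverse y * w * inverse y)"] has_derivative_inverse') auto
  qed
  then show ?thesis by (rule smooth_onI)
qed

subsection \<open>A smooth function with compact support\<close>

text \<open>The functions \<open>t\<^sup>-\<^sup>m e\<^sup>-\<^sup>1\<^sup>/\<^sup>t\<close>, extended by zero to \<open>t \<le> 0\<close>. Their span is closed under differentiation,
which makes smoothness at 0 a simple induction.\<close>

definition flat :: "nat \<Rightarrow> real \<Rightarrow> real" where
  "flat m t = (if t > 0 then inverse t ^ m * exp (- inverse t) else 0)"

lemma flat_DERIV: "(flat m has_field_derivative (flat (m + 2) t - real m * flat (m + 1) t)) (at t)"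
proof -
  consider "t > 0" | "t < 0" | "t = 0" by linarith
  then show ?thesis
  proof cases
    case 1
    have "((\<lambda>t. inverse t ^ m * exp (- inverse t)) has_field_derivative (flat (m + 2) t - real m * flat (m + 1) t)) (at t)"
    proof -
      have i: "(inverse has_field_derivative - (inverse t * inverse t)) (at t)"
        using DERIV_inverse[of t UNIV] 1 by (simp add: power_Suc)
      have "((\<lambda>t. inverse t ^ m * exp (- inverse t)) has_field_derivative
          (real m * (- (inverse t * inverse t) * inverse t ^ (m - Suc 0))) * exp (- inverse t)
          + exp (- inverse t) * (inverse t * inverse t) * inverse t ^ m) (at t)"
        using DERIV_mult[OF DERIV_power[OF i, of m] DERIV_fun_exp[OF DERIV_minus[OF i]]] by simp
      then show ?thesis using 1 by (cases m) (simp_all add: flat_def algebra_simps)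
    qed
    moreover have "open {0::real<..}" by simp
    ultimately show ?thesis
      by (rule has_field_derivative_transform_within_open) (use 1 in \<open>auto simp: flat_def\<close>)
  next
    case 2
    have "((\<lambda>t. 0) has_field_derivative (flat (m + 2) t - real m * flat (m + 1) t)) (at t)"
      using 2 by (auto simp: flat_def)
    moreover have "open {..<0::real}" by simp
    ultimately show ?thesis
      by (rule has_field_derivative_transform_within_open) (use 2 in \<open>auto simp: flat_def\<close>)
  next
    case 3
    have "((\<lambda>h. flat m h / h) \<longlongrightarrow> 0) (at_right 0)"
    proof (rule Lim_transform_eventually)
      show "((\<lambda>h. (inverse h ^ Suc m) / exp (inverse h)) \<longlongrightarrow> 0) (at_right (0::real))"
        by (rule filterlim_compose[OF tendsto_power_div_exp_0 filterlim_inverse_at_top_right])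
      show "\<forall>\<^sub>F h in at_right 0. inverse h ^ Suc m / exp (inverse h) = flat m h / h"
        unfolding eventually_at_right_field
        by (intro exI[of _ 1]) (auto simp: flat_def exp_minus field_simps)
    qed
    moreover have "((\<lambda>h. flat m h / h) \<longlongrightarrow> 0) (at_left 0)"
    proof (rule Lim_transform_eventually)
      show "((\<lambda>h. 0) \<longlongrightarrow> 0) (at_left (0::real))" by simp
      show "\<forall>\<^sub>F h in at_left 0. 0 = flat m h / h"
        unfolding eventually_at_left_field by (intro exI[of _ "-1"]) (auto simp: flat_def)
    qed
    ultimately have "((\<lambda>h. flat m h / h) \<longlongrightarrow> 0) (at 0)" by (simp add: filterlim_split_at)
    then show ?thesis using 3 by (simp add: DERIV_def flat_def)
  qed
qed

lemma flat_smooth: "smooth_on UNIV (flat m)"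
proof -
  have "C_k_on k UNIV (flat m)" for k m
  proof (induction k arbitrary: m)
    case 0
    have "flat m differentiable (at t)" for t using flat_DERIV real_differentiable_def by blast
    then show ?case by (simp add: continuous_at_imp_continuous_on differentiable_imp_continuous_within)
  next
    case (Suc k)
    have *: "C_k_on k UNIV (\<lambda>t. w * (flat (m + 2) t + (- real m) * flat (m + 1) t))" for w
      by (intro C_k_on_bilinear[OF _ bounded_bilinear_mult] C_k_on_add C_k_on_const Suc open_UNIV)
    show ?case
      by (rule C_k_on_SucI[where f' = "\<lambda>t w. w * (flat (m + 2) t + (- real m) * flat (m + 1) t)"])
        (use flat_DERIV[of m] * in \<open>auto simp: has_field_derivative_def mult_commute_abs\<close>)
  qed
  then show ?thesis by (rule smooth_onI)
qed

text \<open>This function is positive exactly on the open ball of radius \<open>\<bar>r\<bar>\<close> around \<open>x0\<close>.\<close>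

lemma smooth_bump:
  fixes x0 :: "'a::real_inner"
  shows "smooth_on UNIV (\<lambda>x. flat 0 (r\<^sup>2 - (x - x0) \<bullet> (x - x0)))"
proof (rule smooth_on_compose[OF finite_dimensional_real, where f = "flat 0" and T = UNIV])
  have "smooth_on UNIV (\<lambda>x. r\<^sup>2 + - ((x + - x0) \<bullet> (x + - x0)))"
    by (intro smooth_on_add smooth_on_const open_UNIV smooth_on_id
        smooth_on_bounded_linear_comp[OF open_UNIV bounded_linear_minus[OF bounded_linear_ident]]
        smooth_on_bilinear[OF open_UNIV bounded_bilinear_inner])
  then show "smooth_on UNIV (\<lambda>x. r\<^sup>2 - (x - x0) \<bullet> (x - x0))" by simp
qed (auto intro: flat_smooth)

subsection \<open>Symmetry of second derivatives\<close>

text \<open>The mean value theorem, first in the direction \<open>u\<close> and then in the direction \<open>v\<close>.\<close>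

lemma second_difference:
  fixes f :: "'a::real_normed_vector \<Rightarrow> real"
  assumes "C_k_on 2 S f" "0 < h" "\<And>s t. 0 \<le> s \<Longrightarrow> s \<le> h \<Longrightarrow> 0 \<le> t \<Longrightarrow> t \<le> h \<Longrightarrow> y + s *\<^sub>R u + t *\<^sub>R v \<in> S"
  shows "\<exists>s t. 0 \<le> s \<and> s \<le> h \<and> 0 \<le> t \<and> t \<le> h \<and>
    f (y + h *\<^sub>R u + h *\<^sub>R v) - f (y + h *\<^sub>R u) - f (y + h *\<^sub>R v) + f y =
      h\<^sup>2 * frechet_derivative (\<lambda>z. frechet_derivative f (at z) u) (at (y + s *\<^sub>R u + t *\<^sub>R v)) v"
proof -
  have C: "C_k_on (Suc (Suc 0)) S f" using assms(1) by (simp add: numeral_2_eq_2)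
  let ?D = "\<lambda>z. frechet_derivative f (at z) u"
  have d1: "((\<lambda>s. f (y + s *\<^sub>R u + t *\<^sub>R v)) has_field_derivative ?D (y + s *\<^sub>R u + t *\<^sub>R v)) (at s)"
    if "0 \<le> s" "s \<le> h" "0 \<le> t" "t \<le> h" for s t
  proof -
    have "(f has_derivative frechet_derivative f (at (y + s *\<^sub>R u + t *\<^sub>R v))) (at (y + s *\<^sub>R u + t *\<^sub>R v))"
      using C_k_on_SucD(1)[OF C] assms(3) that by blast
    moreover have "((\<lambda>s. y + s *\<^sub>R u + t *\<^sub>R v) has_derivative (\<lambda>r. r *\<^sub>R u)) (at s)"
      by (auto intro!: derivative_eq_intros)
    ultimately have "((\<lambda>s. f (y + s *\<^sub>R u + t *\<^sub>R v)) has_derivative (\<lambda>r. frechet_derivative f (at (y + s *\<^sub>R u + t *\<^sub>R v)) (r *\<^sub>R u))) (at s)"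
      by (rule has_derivative_compose[rotated])
    moreover have "frechet_derivative f (at (y + s *\<^sub>R u + t *\<^sub>R v)) (r *\<^sub>R u) = r * ?D (y + s *\<^sub>R u + t *\<^sub>R v)" for r
      using linear_cmul[OF has_derivative_linear[OF \<open>(f has_derivative _) _\<close>], of r u] by simp
    ultimately show ?thesis by (simp add: has_field_derivative_def mult_commute_abs)
  qed
  have d2: "((\<lambda>t. ?D (y + s *\<^sub>R u + t *\<^sub>R v)) has_field_derivative frechet_derivative ?D (at (y + s *\<^sub>R u + t *\<^sub>R v)) v) (at t)"
    if "0 \<le> s" "s \<le> h" "0 \<le> t" "t \<le> h" for s t
  proof -
    have "(?D has_derivative frechet_derivative ?D (at (y + s *\<^sub>R u + t *\<^sub>R v))) (at (y + s *\<^sub>R u + t *\<^sub>R v))"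
      using C_k_on_SucD(1)[OF C_k_on_SucD(2)[OF C]] assms(3) that by blast
    moreover have "((\<lambda>t. y + s *\<^sub>R u + t *\<^sub>R v) has_derivative (\<lambda>r. r *\<^sub>R v)) (at t)"
      by (auto intro!: derivative_eq_intros)
    ultimately have "((\<lambda>t. ?D (y + s *\<^sub>R u + t *\<^sub>R v)) has_derivative (\<lambda>r. frechet_derivative ?D (at (y + s *\<^sub>R u + t *\<^sub>R v)) (r *\<^sub>R v))) (at t)"
      by (rule has_derivative_compose[rotated])
    moreover have "frechet_derivative ?D (at (y + s *\<^sub>R u + t *\<^sub>R v)) (r *\<^sub>R v) = r * frechet_derivative ?D (at (y + s *\<^sub>R u + t *\<^sub>R v)) v" for r
      using linear_cmul[OF has_derivative_linear[OF \<open>(?D has_derivative _) _\<close>], of r v] by simp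
    ultimately show ?thesis by (simp add: has_field_derivative_def mult_commute_abs)
  qed
  let ?g = "\<lambda>s. f (y + s *\<^sub>R u + h *\<^sub>R v) - f (y + s *\<^sub>R u + 0 *\<^sub>R v)"
  have "\<exists>s>0. s < h \<and> ?g h - ?g 0 = (h - 0) * (?D (y + s *\<^sub>R u + h *\<^sub>R v) - ?D (y + s *\<^sub>R u + 0 *\<^sub>R v))"
    using assms(2) by (intro MVT2 DERIV_diff d1) auto
  then obtain s where s: "0 < s" "s < h"
    "?g h - ?g 0 = h * (?D (y + s *\<^sub>R u + h *\<^sub>R v) - ?D (y + s *\<^sub>R u + 0 *\<^sub>R v))" by auto
  have "\<exists>t>0. t < h \<and> ?D (y + s *\<^sub>R u + h *\<^sub>R v) - ?D (y + s *\<^sub>R u + 0 *\<^sub>R v)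
      = (h - 0) * frechet_derivative ?D (at (y + s *\<^sub>R u + t *\<^sub>R v)) v"
    using assms(2) s by (intro MVT2 d2) auto
  then obtain t where t: "0 < t" "t < h" "?D (y + s *\<^sub>R u + h *\<^sub>R v) - ?D (y + s *\<^sub>R u + 0 *\<^sub>R v)
      = h * frechet_derivative ?D (at (y + s *\<^sub>R u + t *\<^sub>R v)) v" by auto
  have "f (y + h *\<^sub>R u + h *\<^sub>R v) - f (y + h *\<^sub>R u) - f (y + h *\<^sub>R v) + f y =
      h\<^sup>2 * frechet_derivative ?D (at (y + s *\<^sub>R u + t *\<^sub>R v)) v"
    using s(3) unfolding t(3) by (simp add: power2_eq_square)
  then show ?thesis using s t by (intro exI[of _ s] exI[of _ t]) simp
qed

text \<open>The second difference is symmetric in \<open>u\<close> and \<open>v\<close>, and divided by \<open>h\<^sup>2\<close> it is close to either side.\<close>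

lemma second_derivative_symmetric_real:
  fixes f :: "'a::real_normed_vector \<Rightarrow> real"
  assumes "open S" "y \<in> S" "C_k_on 2 S f"
  shows "frechet_derivative (\<lambda>z. frechet_derivative f (at z) u) (at y) v =
    frechet_derivative (\<lambda>z. frechet_derivative f (at z) v) (at y) u"
proof (rule ccontr)
  let ?H = "\<lambda>u v z. frechet_derivative (\<lambda>z. frechet_derivative f (at z) u) (at z) v"
  assume ne: "?H u v y \<noteq> ?H v u y"
  define e where "e = \<bar>?H u v y - ?H v u y\<bar> / 2"
  have e: "e > 0" using ne by (simp add: e_def)
  have C: "C_k_on (Suc (Suc 0)) S f" using assms(3) by (simp add: numeral_2_eq_2)
  have cont: "continuous_on S (?H u v)" for u v
    using C_k_on_SucD(2)[OF C_k_on_SucD(2)[OF C]] by simp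
  have "isCont (?H u v) y" "isCont (?H v u) y"
    using cont assms by (auto simp: continuous_on_eq_continuous_at)
  then obtain d1 d2 where d: "d1 > 0" "d2 > 0" "\<And>z. dist z y < d1 \<Longrightarrow> \<bar>?H u v z - ?H u v y\<bar> < e"
    "\<And>z. dist z y < d2 \<Longrightarrow> \<bar>?H v u z - ?H v u y\<bar> < e"
    using e unfolding continuous_at_eps_delta dist_real_def by metis
  obtain d3 where d3: "d3 > 0" "ball y d3 \<subseteq> S" using assms open_contains_ball by blast
  define d where "d = min d1 (min d2 d3)"
  \<comment> \<open>The summand 1 makes \<open>N\<close> positive even if \<open>u\<close> and \<open>v\<close> vanish.\<close>
  define N where "N = norm u + norm v + 1"
  define h where "h = d / N / 2"
  have dpos: "d > 0" using d d3 by (simp add: d_def)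
  have N: "N > 0" using norm_ge_zero[of u] norm_ge_zero[of v] unfolding N_def by linarith
  have h: "h > 0" using dpos N by (simp add: h_def)
  have near: "dist (y + s *\<^sub>R u + t *\<^sub>R v) y < d" if "0 \<le> s" "s \<le> h" "0 \<le> t" "t \<le> h" for s t u' v'
  proof -
    have "dist (y + s *\<^sub>R u + t *\<^sub>R v) y = norm (s *\<^sub>R u + t *\<^sub>R v)" by (simp add: dist_norm algebra_simps)
    also have "\<dots> \<le> s * norm u + t * norm v" using that norm_triangle_ineq[of "s *\<^sub>R u" "t *\<^sub>R v"] by simp
    also have "\<dots> \<le> h * norm u + h * norm v" using that by (intro add_mono mult_right_mono) auto
    also have "\<dots> < h * N" using h by (simp add: N_def algebra_simps)
    also have "\<dots> = d / 2" using N by (simp add: h_def)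
    also have "\<dots> < d" using dpos by simp
    finally show ?thesis .
  qed
  have near': "dist (y + s *\<^sub>R v + t *\<^sub>R u) y < d" if "0 \<le> s" "s \<le> h" "0 \<le> t" "t \<le> h" for s t
    using near[OF that(3,4,1,2)] by (simp add: add.commute add.left_commute add.assoc)
  have inS: "z \<in> S" if "dist z y < d" for z
    using that d3 by (auto simp: d_def dist_commute)
  obtain s t where st: "0 \<le> s" "s \<le> h" "0 \<le> t" "t \<le> h"
    "f (y + h *\<^sub>R u + h *\<^sub>R v) - f (y + h *\<^sub>R u) - f (y + h *\<^sub>R v) + f y = h\<^sup>2 * ?H u v (y + s *\<^sub>R u + t *\<^sub>R v)"
    using second_difference[OF assms(3) h, of y u v] near inS by metis
  obtain s' t' where st': "0 \<le> s'" "s' \<le> h" "0 \<le> t'" "t' \<le> h"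
    "f (y + h *\<^sub>R v + h *\<^sub>R u) - f (y + h *\<^sub>R v) - f (y + h *\<^sub>R u) + f y = h\<^sup>2 * ?H v u (y + s' *\<^sub>R v + t' *\<^sub>R u)"
    using second_difference[OF assms(3) h, of y v u] near' inS by metis
  have "y + h *\<^sub>R v + h *\<^sub>R u = y + h *\<^sub>R u + h *\<^sub>R v" by simp
  then have "h\<^sup>2 * ?H u v (y + s *\<^sub>R u + t *\<^sub>R v) = h\<^sup>2 * ?H v u (y + s' *\<^sub>R v + t' *\<^sub>R u)"
    using st(5) st'(5) by (smt (verit))
  then have eq: "?H u v (y + s *\<^sub>R u + t *\<^sub>R v) = ?H v u (y + s' *\<^sub>R v + t' *\<^sub>R u)" using h by simp
  have "\<bar>?H u v (y + s *\<^sub>R u + t *\<^sub>R v) - ?H u v y\<bar> < e" "\<bar>?H v u (y + s' *\<^sub>R v + t' *\<^sub>R u) - ?H v u y\<bar> < e"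
    using near[OF st(1-4)] near'[OF st'(1-4)] by (auto intro!: d(3,4) simp: d_def)
  moreover have False if "\<bar>a - p\<bar> < \<bar>p - q\<bar> / 2" "\<bar>a - q\<bar> < \<bar>p - q\<bar> / 2" for a p q :: real
    using that by (auto simp: abs_if split: if_splits)
  ultimately show False unfolding eq e_def by blast
qed

lemma second_derivative_symmetric:
  fixes f :: "'a::real_normed_vector \<Rightarrow> 'b::real_inner"
  assumes "open S" "y \<in> S" "smooth_on S f"
  shows "frechet_derivative (\<lambda>z. frechet_derivative f (at z) u) (at y) v =
    frechet_derivative (\<lambda>z. frechet_derivative f (at z) v) (at y) u"
proof -
  have H: "frechet_derivative (\<lambda>z. frechet_derivative f (at z) u) (at y) v \<bullet> c =
    frechet_derivative (\<lambda>z. frechet_derivative (\<lambda>z. f z \<bullet> c) (at z) u) (at y) v" for u v c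
  proof -
    have 1: "frechet_derivative (\<lambda>z. f z \<bullet> c) (at z) u = frechet_derivative f (at z) u \<bullet> c" if "z \<in> S" for z
      using frechet_derivative_at[OF has_derivative_inner_left[OF smooth_on_has_derivative[OF assms(3) that], of c]] by metis
    have "((\<lambda>z. frechet_derivative f (at z) u \<bullet> c) has_derivative
        (\<lambda>v. frechet_derivative (\<lambda>z. frechet_derivative f (at z) u) (at y) v \<bullet> c)) (at y)"
      by (rule has_derivative_inner_left[OF smooth_on_has_derivative[OF smooth_on_deriv[OF assms(3)] assms(2)]])
    then have "((\<lambda>z. frechet_derivative (\<lambda>z. f z \<bullet> c) (at z) u) has_derivative
        (\<lambda>v. frechet_derivative (\<lambda>z. frechet_derivative f (at z) u) (at y) v \<bullet> c)) (at y)"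
      by (rule has_derivative_transform_within_open[OF _ assms(1,2)]) (simp add: 1)
    from frechet_derivative_at[OF this] show ?thesis by metis
  qed
  have "C_k_on 2 S (\<lambda>z. f z \<bullet> c)" for c
    by (rule C_k_on_bounded_linear_comp[OF assms(1) bounded_linear_inner_left smooth_onD[OF assms(3)]])
  then have "frechet_derivative (\<lambda>z. frechet_derivative f (at z) u) (at y) v \<bullet> c =
    frechet_derivative (\<lambda>z. frechet_derivative f (at z) v) (at y) u \<bullet> c" for c
    unfolding H by (rule second_derivative_symmetric_real[OF assms(1,2)])
  then show ?thesis by (metis vector_eq_rdot)
qed

section \<open>Smooth manifolds\<close>

text \<open>The ball is a closed subset of a cube in an orthonormal basis.\<close>

lemma finite_dimensional_compact_cball:
  fixes x :: "'e::real_inner"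
  assumes "finite_dimensional TYPE('e)"
  shows "compact (cball x r)"
proof -
  obtain n :: nat and b :: "nat \<Rightarrow> 'e" where b: "\<And>i j. i < n \<Longrightarrow> j < n \<Longrightarrow> b i \<bullet> b j = (if i = j then 1 else 0)"
    "\<And>w. w = (\<Sum>i<n. (w \<bullet> b i) *\<^sub>R b i)"
    by (rule subspace_onb[OF assms subspace_UNIV]) (metis UNIV_I)
  define Q where "Q m = {\<Sum>i<m. c i *\<^sub>R b i | c. \<forall>i. \<bar>c i\<bar> \<le> r}" for m
  have Q: "compact (Q m)" for m
  proof (induction m)
    case 0
    have "finite (Q 0)" by (rule finite_subset[of _ "{0}"]) (auto simp: Q_def)
    then show ?case by (rule finite_imp_compact)
  next
    case (Suc m)
    have "Q (Suc m) = (\<lambda>(u, t). u + t *\<^sub>R b m) ` (Q m \<times> {- r..r})"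
    proof (intro Set.set_eqI iffI)
      fix w assume "w \<in> Q (Suc m)"
      then obtain c where c: "w = (\<Sum>i<Suc m. c i *\<^sub>R b i)" "\<forall>i. \<bar>c i\<bar> \<le> r" by (auto simp: Q_def)
      then have "w = (\<lambda>(u, t). u + t *\<^sub>R b m) ((\<Sum>i<m. c i *\<^sub>R b i), c m)" "(\<Sum>i<m. c i *\<^sub>R b i) \<in> Q m" "c m \<in> {- r..r}"
        by (auto simp: Q_def abs_le_iff dest: spec[of _ m])
      then show "w \<in> (\<lambda>(u, t). u + t *\<^sub>R b m) ` (Q m \<times> {- r..r})" by blast
    next
      fix w assume "w \<in> (\<lambda>(u, t). u + t *\<^sub>R b m) ` (Q m \<times> {- r..r})"
      then obtain c t where c: "w = (\<Sum>i<m. c i *\<^sub>R b i) + t *\<^sub>R b m" "\<forall>i. \<bar>c i\<bar> \<le> r" "- r \<le> t" "t \<le> r"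
        by (auto simp: Q_def)
      then have "w = (\<Sum>i<Suc m. (c(m := t)) i *\<^sub>R b i)" "\<forall>i. \<bar>(c(m := t)) i\<bar> \<le> r" by auto
      then show "w \<in> Q (Suc m)" unfolding Q_def by blast
    qed
    moreover have "compact ((\<lambda>(u, t). u + t *\<^sub>R b m) ` (Q m \<times> {- r..r}))"
      by (intro compact_continuous_image compact_Times Suc compact_Icc)
        (auto intro!: continuous_intros simp: case_prod_unfold)
    ultimately show ?case by simp
  qed
  have "cball 0 r \<subseteq> Q n"
  proof
    fix w :: 'e assume w: "w \<in> cball 0 r"
    then have "r \<ge> 0" by (meson dist_not_less_zero linorder_not_less mem_cball order_trans zero_le_dist)
    define c where "c i = (if i < n then w \<bullet> b i else 0)" for i
    have "\<bar>c i\<bar> \<le> r" for i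
    proof (cases "i < n")
      case True
      have "norm (b i) = 1" using b(1)[OF True True] by (simp add: norm_eq_sqrt_inner)
      then have "\<bar>w \<bullet> b i\<bar> \<le> norm w" using Cauchy_Schwarz_ineq2[of w "b i"] by simp
      then show ?thesis using w True by (simp add: c_def)
    qed (simp add: c_def \<open>r \<ge> 0\<close>)
    moreover have "w = (\<Sum>i<n. c i *\<^sub>R b i)" using b(2)[of w] by (simp add: c_def)
    ultimately show "w \<in> Q n" unfolding Q_def by blast
  qed
  then have "cball 0 r = cball 0 r \<inter> Q n" by auto
  then have "compact (cball (0::'e) r)" using closed_Int_compact[OF closed_cball Q] by metis
  then have "compact ((+) x ` cball 0 r)" by (rule compact_translation)
  then show ?thesis by (simp add: cball_translation[symmetric])
qed

lemma directional_derivative_derivative: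
  fixes F :: "'a::real_inner \<Rightarrow> 'b::real_normed_vector"
  assumes "finite_dimensional TYPE('a)" "open S" "smooth_on S F" "smooth_on S h" "z \<in> S"
  shows "frechet_derivative (\<lambda>z. frechet_derivative F (at z) (h z)) (at z) w =
    frechet_derivative F (at z) (frechet_derivative h (at z) w)
    + frechet_derivative (\<lambda>y. frechet_derivative F (at y) (h z)) (at z) w"
proof -
  obtain n :: nat and b :: "nat \<Rightarrow> 'a" where b: "\<And>w. w = (\<Sum>i<n. (w \<bullet> b i) *\<^sub>R b i)"
    by (rule subspace_onb[OF assms(1) subspace_UNIV]) (metis UNIV_I)
  let ?D = "\<lambda>z. frechet_derivative F (at z)"
  have exp: "?D y v = (\<Sum>i<n. (v \<bullet> b i) *\<^sub>R ?D y (b i))" if "y \<in> S" for y v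
  proof -
    have l: "linear (?D y)" by (rule has_derivative_linear[OF smooth_on_has_derivative[OF assms(3) that]])
    have "?D y v = ?D y (\<Sum>i<n. (v \<bullet> b i) *\<^sub>R b i)" using b[of v] by simp
    then show ?thesis by (simp add: linear_sum[OF l] linear_cmul[OF l])
  qed
  have h: "(h has_derivative frechet_derivative h (at z)) (at z)"
    by (rule smooth_on_has_derivative[OF assms(4,5)])
  have D: "((\<lambda>y. ?D y u) has_derivative frechet_derivative (\<lambda>y. ?D y u) (at z)) (at z)" for u
    by (rule smooth_on_has_derivative[OF smooth_on_deriv[OF assms(3)] assms(5)])
  have const: "frechet_derivative (\<lambda>y. ?D y (h z)) (at z) w = (\<Sum>i<n. (h z \<bullet> b i) *\<^sub>R frechet_derivative (\<lambda>y. ?D y (b i)) (at z) w)"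
  proof -
    have "((\<lambda>y. \<Sum>i<n. (h z \<bullet> b i) *\<^sub>R ?D y (b i)) has_derivative
        (\<lambda>w. \<Sum>i<n. (h z \<bullet> b i) *\<^sub>R frechet_derivative (\<lambda>y. ?D y (b i)) (at z) w)) (at z)"
      by (intro has_derivative_sum has_derivative_scaleR_right D)
    then have "((\<lambda>y. ?D y (h z)) has_derivative
        (\<lambda>w. \<Sum>i<n. (h z \<bullet> b i) *\<^sub>R frechet_derivative (\<lambda>y. ?D y (b i)) (at z) w)) (at z)"
      by (rule has_derivative_transform_within_open[OF _ assms(2,5)]) (rule exp[symmetric])
    from fun_cong[OF frechet_derivative_at[OF this], of w, symmetric] show ?thesis .
  qed
  have "((\<lambda>y. \<Sum>i<n. (h y \<bullet> b i) *\<^sub>R ?D y (b i)) has_derivative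
      (\<lambda>w. \<Sum>i<n. (h z \<bullet> b i) *\<^sub>R frechet_derivative (\<lambda>y. ?D y (b i)) (at z) w
        + (frechet_derivative h (at z) w \<bullet> b i) *\<^sub>R ?D z (b i))) (at z)"
    by (intro has_derivative_sum has_derivative_scaleR D has_derivative_inner_left h)
  then have "((\<lambda>y. ?D y (h y)) has_derivative
      (\<lambda>w. \<Sum>i<n. (h z \<bullet> b i) *\<^sub>R frechet_derivative (\<lambda>y. ?D y (b i)) (at z) w
        + (frechet_derivative h (at z) w \<bullet> b i) *\<^sub>R ?D z (b i))) (at z)"
    by (rule has_derivative_transform_within_open[OF _ assms(2,5)]) (rule exp[symmetric])
  from fun_cong[OF frechet_derivative_at[OF this], of w, symmetric]
  have "frechet_derivative (\<lambda>y. ?D y (h y)) (at z) w = (\<Sum>i<n. (h z \<bullet> b i) *\<^sub>R frechet_derivative (\<lambda>y. ?D y (b i)) (at z) w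
        + (frechet_derivative h (at z) w \<bullet> b i) *\<^sub>R ?D z (b i))" .
  then show ?thesis unfolding const using exp[OF assms(5), of "frechet_derivative h (at z) w"]
    by (simp add: sum.distrib)
qed

locale manifold =
  fixes \<A> :: "('m::{t2_space, second_countable_topology}, 'e::real_inner) chart set"
  assumes smooth_manifold: "smooth_manifold \<A>"
begin

abbreviation "sm \<equiv> smooth_map_on \<A>"
abbreviation "td \<equiv> tangent_deriv \<A>"
abbreviation "tc \<equiv> tangent_coord \<A>"
abbreviation "tv \<equiv> tangent_vec \<A>"
abbreviation "C \<equiv> smooth_functions \<A>"
abbreviation "VF \<equiv> vector_fields \<A>"

lemma fin_e: "finite_dimensional TYPE('e)"
  using smooth_manifold by (simp add: smooth_manifold_def)

lemma chart:
  assumes "(U, x) \<in> \<A>"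
  shows "open U" "open (x ` U)" "inj_on x U" "homeomorphism U (x ` U) x (inv_into U x)"
  using smooth_manifold assms by (auto simp: smooth_manifold_def)

lemma transition: "(U, x) \<in> \<A> \<Longrightarrow> (V, y) \<in> \<A> \<Longrightarrow> smooth_on (x ` (U \<inter> V)) (y \<circ> inv_into U x)"
  using smooth_manifold by (auto simp: smooth_manifold_def)

lemma chart_at: "chart_at \<A> p \<in> \<A>" "p \<in> fst (chart_at \<A> p)"
proof -
  have "p \<in> (\<Union>(U, x)\<in>\<A>. U)" using smooth_manifold by (simp add: smooth_manifold_def)
  then obtain c where "c \<in> \<A> \<and> p \<in> fst c" by auto
  then have "chart_at \<A> p \<in> \<A> \<and> p \<in> fst (chart_at \<A> p)" unfolding chart_at_def by (rule someI)
  then show "chart_at \<A> p \<in> \<A>" "p \<in> fst (chart_at \<A> p)" by auto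
qed

lemma obtain_chart_at:
  obtains U x where "chart_at \<A> p = (U, x)" "(U, x) \<in> \<A>" "p \<in> U"
  using chart_at[of p] by (cases "chart_at \<A> p") auto

lemma open_chart_image:
  assumes "(U, x) \<in> \<A>" "open W"
  shows "open (x ` (U \<inter> W))"
proof -
  have "openin (top_of_set (x ` U)) (x ` (U \<inter> W))"
    by (rule homeomorphism_imp_open_map[OF chart(4)[OF assms(1)]]) (simp add: assms(2) openin_open_Int)
  then show ?thesis using chart(2)[OF assms(1)] openin_open_trans by blast
qed

lemma inv_chart [simp]: "(U, x) \<in> \<A> \<Longrightarrow> p \<in> U \<Longrightarrow> inv_into U x (x p) = p"
  using chart(3) by (simp add: inv_into_f_f)

lemma sm_D: "sm W f \<Longrightarrow> (U, x) \<in> \<A> \<Longrightarrow> smooth_on (x ` (U \<inter> W)) (f \<circ> inv_into U x)"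
  by (auto simp: smooth_map_on_def)

lemma sm_subset: "sm W f \<Longrightarrow> V \<subseteq> W \<Longrightarrow> sm V f"
  unfolding smooth_map_on_def by (auto intro: smooth_on_subset image_mono)

lemma smI_chart:
  assumes "\<And>p. p \<in> W \<Longrightarrow> \<exists>U x V. (U, x) \<in> \<A> \<and> p \<in> U \<and> open V \<and> p \<in> V \<and> smooth_on (x ` (U \<inter> V)) (f \<circ> inv_into U x)"
  shows "sm W f"
  unfolding smooth_map_on_def
proof (intro ballI case_prodI2)
  fix c U' x' assume "c \<in> \<A>" "c = (U', x')"
  then have c': "(U', x') \<in> \<A>" by simp
  show "smooth_on (x' ` (U' \<inter> W)) (f \<circ> inv_into U' x')"
  proof (rule smooth_on_local)
    fix y assume "y \<in> x' ` (U' \<inter> W)"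
    then obtain p where p: "p \<in> U'" "p \<in> W" "y = x' p" by auto
    obtain U x V where c: "(U, x) \<in> \<A>" "p \<in> U" "open V" "p \<in> V" and s: "smooth_on (x ` (U \<inter> V)) (f \<circ> inv_into U x)"
      using assms[OF p(2)] by blast
    let ?T = "x' ` (U' \<inter> (U \<inter> V))"
    have oT: "open ?T" using open_chart_image[OF c'] chart(1)[OF c(1)] c(3) by blast
    have "smooth_on ?T (\<lambda>z. (f \<circ> inv_into U x) ((x \<circ> inv_into U' x') z))"
    proof (rule smooth_on_compose[OF fin_e oT open_chart_image[OF c(1,3)] _ s])
      show "smooth_on ?T (x \<circ> inv_into U' x')"
        by (rule smooth_on_subset[OF transition[OF c' c(1)]]) auto
    qed (use c' in auto)
    then have "smooth_on ?T (f \<circ> inv_into U' x')"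
      by (rule smooth_on_cong[OF oT]) (use c' c(1) in auto)
    then show "\<exists>T. open T \<and> y \<in> T \<and> smooth_on T (f \<circ> inv_into U' x')"
      using oT p c by (intro exI[of _ ?T]) auto
  qed
qed

lemma sm_local:
  assumes "\<And>p. p \<in> W \<Longrightarrow> \<exists>V. open V \<and> p \<in> V \<and> sm V f"
  shows "sm W f"
proof (rule smI_chart)
  fix p assume "p \<in> W"
  then obtain V where V: "open V" "p \<in> V" "sm V f" using assms by blast
  obtain U x where "(U, x) \<in> \<A>" "p \<in> U" by (rule obtain_chart_at)
  then show "\<exists>U x V. (U, x) \<in> \<A> \<and> p \<in> U \<and> open V \<and> p \<in> V \<and> smooth_on (x ` (U \<inter> V)) (f \<circ> inv_into U x)"
    using V sm_D by blast
qed

lemma sm_cong: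
  assumes "open W" "sm W f" "\<And>p. p \<in> W \<Longrightarrow> f p = g p"
  shows "sm W g"
  unfolding smooth_map_on_def
proof (intro ballI case_prodI2)
  fix c U x assume "c \<in> \<A>" "c = (U, x)"
  then have c: "(U, x) \<in> \<A>" by simp
  show "smooth_on (x ` (U \<inter> W)) (g \<circ> inv_into U x)"
    by (rule smooth_on_cong[OF open_chart_image[OF c assms(1)] sm_D[OF assms(2) c]]) (use c assms(3) in auto)
qed

lemma sm_const: "open W \<Longrightarrow> sm W (\<lambda>p. c)"
  unfolding smooth_map_on_def by (auto simp: comp_def intro: smooth_on_const open_chart_image)

lemma sm_add: "open W \<Longrightarrow> sm W f \<Longrightarrow> sm W g \<Longrightarrow> sm W (\<lambda>p. f p + g p)"
  unfolding smooth_map_on_def comp_def by (auto intro!: smooth_on_add open_chart_image)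

lemma sm_sum: "open W \<Longrightarrow> (\<And>i. i \<in> I \<Longrightarrow> sm W (f i)) \<Longrightarrow> sm W (\<lambda>p. \<Sum>i\<in>I. f i p)"
  unfolding smooth_map_on_def comp_def by (auto intro!: smooth_on_sum open_chart_image)

lemma sm_bilinear:
  assumes "open W" "bounded_bilinear B" "sm W f" "sm W g"
  shows "sm W (\<lambda>p. B (f p) (g p))"
  unfolding smooth_map_on_def
proof (intro ballI case_prodI2)
  fix c U x assume "c \<in> \<A>" "c = (U, x)"
  then have c: "(U, x) \<in> \<A>" by simp
  show "smooth_on (x ` (U \<inter> W)) ((\<lambda>p. B (f p) (g p)) \<circ> inv_into U x)"
    using smooth_on_bilinear[OF open_chart_image[OF c assms(1)] assms(2) sm_D[OF assms(3) c] sm_D[OF assms(4) c]]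
    by (simp only: comp_def)
qed

lemma sm_linear:
  assumes "open W" "bounded_linear B" "sm W f"
  shows "sm W (\<lambda>p. B (f p))"
  unfolding smooth_map_on_def
proof (intro ballI case_prodI2)
  fix c U x assume "c \<in> \<A>" "c = (U, x)"
  then have c: "(U, x) \<in> \<A>" by simp
  show "smooth_on (x ` (U \<inter> W)) ((\<lambda>p. B (f p)) \<circ> inv_into U x)"
    using smooth_on_bounded_linear_comp[OF open_chart_image[OF c assms(1)] assms(2) sm_D[OF assms(3) c]]
    by (simp only: comp_def)
qed

lemma sm_scaleR: "open W \<Longrightarrow> sm W f \<Longrightarrow> sm W g \<Longrightarrow> sm W (\<lambda>p. f p *\<^sub>R g p)"
  by (rule sm_bilinear[OF _ bounded_bilinear_scaleR])

lemma sm_mult: "open W \<Longrightarrow> sm W f \<Longrightarrow> sm W g \<Longrightarrow> sm W (\<lambda>p. f p * (g p :: real))"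
  by (rule sm_bilinear[OF _ bounded_bilinear_mult])

lemma sm_minus: "open W \<Longrightarrow> sm W f \<Longrightarrow> sm W (\<lambda>p. - f p)"
  by (rule sm_linear[OF _ bounded_linear_minus[OF bounded_linear_ident]])

lemma sm_diff: "open W \<Longrightarrow> sm W f \<Longrightarrow> sm W g \<Longrightarrow> sm W (\<lambda>p. f p - g p)"
  using sm_add[of W f "\<lambda>p. - g p"] sm_minus[of W g] by simp

lemma sm_inner_left: "open W \<Longrightarrow> sm W f \<Longrightarrow> sm W (\<lambda>p. f p \<bullet> c)"
  by (rule sm_linear[OF _ bounded_linear_inner_left])

lemma sm_compose:
  fixes F :: "'b::real_inner \<Rightarrow> 'c::real_normed_vector"
  assumes "finite_dimensional TYPE('b)" "open W" "open T" "\<And>p. p \<in> W \<Longrightarrow> g p \<in> T" "smooth_on T F" "sm W g"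
  shows "sm W (\<lambda>p. F (g p))"
  unfolding smooth_map_on_def
proof (intro ballI case_prodI2)
  fix c U x assume "c \<in> \<A>" "c = (U, x)"
  then have c: "(U, x) \<in> \<A>" by simp
  show "smooth_on (x ` (U \<inter> W)) ((\<lambda>p. F (g p)) \<circ> inv_into U x)"
    using smooth_on_compose[OF assms(1) open_chart_image[OF c assms(2)] assms(3) _ assms(5) sm_D[OF assms(6) c]]
      assms(4) c by (force simp: comp_def)
qed

lemma sm_inverse: "open W \<Longrightarrow> sm W f \<Longrightarrow> (\<And>p. p \<in> W \<Longrightarrow> f p \<noteq> 0) \<Longrightarrow> sm W (\<lambda>p. inverse (f p :: real))"
  by (rule sm_compose[OF finite_dimensional_real, of W "- {0}" f inverse]) (auto intro: smooth_on_inverse)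

lemma sm_chart: "(U, x) \<in> \<A> \<Longrightarrow> sm U x"
  unfolding smooth_map_on_def using transition by auto

subsection \<open>Tangent vectors\<close>

lemma chart_change_deriv:
  assumes "(U, x) \<in> \<A>" "(V, y) \<in> \<A>" "p \<in> U" "p \<in> V" "p \<in> W" "open W" "sm W f"
  shows "frechet_derivative (f \<circ> inv_into V y) (at (y p)) v =
    frechet_derivative (f \<circ> inv_into U x) (at (x p)) (frechet_derivative (x \<circ> inv_into V y) (at (y p)) v)"
proof -
  let ?S = "y ` (V \<inter> (U \<inter> W))"
  have S: "open ?S" "y p \<in> ?S"
    using assms chart(1)[OF assms(1)] open_chart_image[OF assms(2), of "U \<inter> W"] by auto
  have 1: "((x \<circ> inv_into V y) has_derivative frechet_derivative (x \<circ> inv_into V y) (at (y p))) (at (y p))"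
    by (rule smooth_on_has_derivative[OF transition[OF assms(2,1)]]) (use assms in auto)
  have e: "(x \<circ> inv_into V y) (y p) = x p" using assms by simp
  have 2: "((f \<circ> inv_into U x) has_derivative frechet_derivative (f \<circ> inv_into U x) (at (x p))) (at ((x \<circ> inv_into V y) (y p)))"
    unfolding e by (rule smooth_on_has_derivative[OF sm_D[OF assms(7,1)]]) (use assms in auto)
  from has_derivative_compose[OF 1 2]
  have "((f \<circ> inv_into V y) has_derivative
      (\<lambda>v. frechet_derivative (f \<circ> inv_into U x) (at (x p)) (frechet_derivative (x \<circ> inv_into V y) (at (y p)) v))) (at (y p))"
    by (rule has_derivative_transform_within_open[OF _ S]) (use assms in auto)
  from frechet_derivative_at[OF this] show ?thesis by metis
qed

lemma td_chart:
  assumes "(U, x) \<in> \<A>" "p \<in> U" "p \<in> W" "open W" "sm W f"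
  shows "td f p v = frechet_derivative (f \<circ> inv_into U x) (at (x p)) (tc (U, x) p v)"
proof -
  obtain V y where c: "chart_at \<A> p = (V, y)" "(V, y) \<in> \<A>" "p \<in> V" by (rule obtain_chart_at)
  show ?thesis using chart_change_deriv[OF assms(1) c(2) assms(2) c(3) assms(3-5), of v] c(1)
    by (simp add: tangent_deriv_def tangent_coord_def)
qed

lemma td_has_derivative:
  assumes "p \<in> W" "open W" "sm W f" "chart_at \<A> p = (U, x)"
  shows "((f \<circ> inv_into U x) has_derivative td f p) (at (x p))"
proof -
  have "(U, x) \<in> \<A>" "p \<in> U" using chart_at[of p] assms(4) by auto
  then show ?thesis
    using smooth_on_has_derivative[OF sm_D[OF assms(3)], of U x "x p"] assms by (simp add: tangent_deriv_def)
qed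

lemma td_eqI:
  assumes "chart_at \<A> p = (U, x)" "((f \<circ> inv_into U x) has_derivative D) (at (x p))"
  shows "td f p = D"
  using frechet_derivative_at[OF assms(2)] assms(1) by (simp add: tangent_deriv_def)

lemma td_linear:
  assumes "p \<in> W" "open W" "sm W f"
  shows "linear (td f p)"
proof -
  obtain U x where "chart_at \<A> p = (U, x)" by (rule obtain_chart_at)
  from has_derivative_linear[OF td_has_derivative[OF assms this]] show ?thesis .
qed

lemma td_const [simp]: "td (\<lambda>p. c) p v = 0"
proof -
  obtain U x where c: "chart_at \<A> p = (U, x)" by (rule obtain_chart_at)
  have "(((\<lambda>p. c) \<circ> inv_into U x) has_derivative (\<lambda>v. 0)) (at (x p))" by (simp add: comp_def)
  from td_eqI[OF c this] show ?thesis by simp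
qed

lemma td_add:
  assumes "p \<in> W" "open W" "sm W f" "sm W g"
  shows "td (\<lambda>q. f q + g q) p v = td f p v + td g p v"
proof -
  obtain U x where c: "chart_at \<A> p = (U, x)" by (rule obtain_chart_at)
  have "(((\<lambda>q. f q + g q) \<circ> inv_into U x) has_derivative (\<lambda>v. td f p v + td g p v)) (at (x p))"
    using has_derivative_add[OF td_has_derivative[OF assms(1-3) c] td_has_derivative[OF assms(1,2,4) c]] by (simp add: comp_def)
  from td_eqI[OF c this] show ?thesis by simp
qed

lemma td_bounded_linear:
  assumes "p \<in> W" "open W" "sm W f" "bounded_linear B"
  shows "td (\<lambda>q. B (f q)) p v = B (td f p v)"
proof -
  obtain U x where c: "chart_at \<A> p = (U, x)" by (rule obtain_chart_at)
  have "(((\<lambda>q. B (f q)) \<circ> inv_into U x) has_derivative (\<lambda>v. B (td f p v))) (at (x p))"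
    using bounded_linear.has_derivative[OF assms(4) td_has_derivative[OF assms(1-3) c]] by (simp add: comp_def)
  from td_eqI[OF c this] show ?thesis by simp
qed

lemma td_diff:
  assumes "p \<in> W" "open W" "sm W f" "sm W g"
  shows "td (\<lambda>q. f q - g q) p v = td f p v - td g p v"
  using td_add[OF assms(1-3) sm_minus[OF assms(2,4)]]
    td_bounded_linear[OF assms(1,2,4) bounded_linear_minus[OF bounded_linear_ident]] by simp

lemma td_scaleR:
  assumes "p \<in> W" "open W" "sm W f" "sm W g"
  shows "td (\<lambda>q. f q *\<^sub>R g q) p v = f p *\<^sub>R td g p v + td f p v *\<^sub>R g p"
proof -
  obtain U x where c: "chart_at \<A> p = (U, x)" "(U, x) \<in> \<A>" "p \<in> U" by (rule obtain_chart_at)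
  have "(((\<lambda>q. f q *\<^sub>R g q) \<circ> inv_into U x) has_derivative (\<lambda>v. f p *\<^sub>R td g p v + td f p v *\<^sub>R g p)) (at (x p))"
    using has_derivative_scaleR[OF td_has_derivative[OF assms(1-3) c(1)] td_has_derivative[OF assms(1,2,4) c(1)]] c(2,3)
    by (simp add: comp_def)
  from td_eqI[OF c(1) this] show ?thesis by simp
qed

lemma td_mult:
  assumes "p \<in> W" "open W" "sm W f" "sm W g"
  shows "td (\<lambda>q. f q * g q :: real) p v = f p * td g p v + td f p v * g p"
  using td_scaleR[OF assms] by simp

lemma tc_linear: "(U, x) \<in> \<A> \<Longrightarrow> p \<in> U \<Longrightarrow> linear (tc (U, x) p)"
  using td_linear[OF _ chart(1) sm_chart] by (simp add: tangent_coord_def)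

lemma tv_linear:
  assumes "(U, x) \<in> \<A>" "p \<in> U"
  shows "linear (tv (U, x) p)"
proof -
  obtain V y where c: "chart_at \<A> p = (V, y)" "(V, y) \<in> \<A>" "p \<in> V" by (rule obtain_chart_at)
  have "smooth_on (x ` (U \<inter> V)) (y \<circ> inv_into U x)" using transition assms c by blast
  then show ?thesis
    using has_derivative_linear[OF smooth_on_has_derivative, of "x ` (U \<inter> V)" _ "x p"] assms c
    by (simp add: tangent_vec_def)
qed

lemma deriv_chart_id:
  assumes "(U, x) \<in> \<A>" "p \<in> U"
  shows "frechet_derivative (x \<circ> inv_into U x) (at (x p)) v = v"
proof -
  have "((x \<circ> inv_into U x) has_derivative (\<lambda>v. v)) (at (x p))"
    by (rule has_derivative_transform_within_open[OF has_derivative_ident chart(2)[OF assms(1)]])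
      (use assms in auto)
  from frechet_derivative_at[OF this] show ?thesis by metis
qed

lemma tc_tv [simp]:
  assumes "(U, x) \<in> \<A>" "p \<in> U"
  shows "tc (U, x) p (tv (U, x) p v) = v"
proof -
  obtain V y where c: "chart_at \<A> p = (V, y)" "(V, y) \<in> \<A>" "p \<in> V" by (rule obtain_chart_at)
  show ?thesis
    using chart_change_deriv[OF c(2) assms(1) c(3) assms(2) assms(2) chart(1)[OF assms(1)] sm_chart[OF assms(1)], of v]
      deriv_chart_id[OF assms] c
    by (simp add: tangent_coord_def tangent_vec_def tangent_deriv_def)
qed

lemma tv_tc [simp]:
  assumes "(U, x) \<in> \<A>" "p \<in> U"
  shows "tv (U, x) p (tc (U, x) p v) = v"
proof -
  obtain V y where c: "chart_at \<A> p = (V, y)" "(V, y) \<in> \<A>" "p \<in> V" by (rule obtain_chart_at)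
  show ?thesis
    using chart_change_deriv[OF assms(1) c(2) assms(2) c(3) c(3) chart(1)[OF c(2)] sm_chart[OF c(2)], of v]
      deriv_chart_id[OF c(2,3)] c
    by (simp add: tangent_coord_def tangent_vec_def tangent_deriv_def)
qed

lemma tc_chart_at: "tc (chart_at \<A> p) p v = v"
  by (rule obtain_chart_at[of p]) (simp add: tangent_coord_def tangent_deriv_def deriv_chart_id)

subsection \<open>Vector fields\<close>

lemma sm_td_chart:
  assumes "(U, x) \<in> \<A>" "open W" "open V" "V \<subseteq> U \<inter> W" "sm W f" "sm V (\<lambda>q. tc (U, x) q (X q))"
  shows "sm V (\<lambda>q. td f q (X q))"
proof -
  obtain n :: nat and b :: "nat \<Rightarrow> 'e" where b: "\<And>w. w = (\<Sum>i<n. (w \<bullet> b i) *\<^sub>R b i)"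
    by (rule subspace_onb[OF fin_e subspace_UNIV]) (metis UNIV_I)
  let ?F = "f \<circ> inv_into U x"
  have F: "smooth_on (x ` (U \<inter> W)) ?F" by (rule sm_D[OF assms(5,1)])
  have "sm V (\<lambda>q. \<Sum>i<n. (tc (U, x) q (X q) \<bullet> b i) *\<^sub>R frechet_derivative ?F (at (x q)) (b i))"
  proof (intro sm_sum sm_scaleR sm_inner_left assms(3,6))
    fix i
    show "sm V (\<lambda>q. frechet_derivative ?F (at (x q)) (b i))"
      by (rule sm_compose[OF fin_e assms(3) open_chart_image[OF assms(1,2)] _ smooth_on_deriv[OF F]])
        (use assms sm_subset[OF sm_chart[OF assms(1)]] in auto)
  qed
  then show ?thesis
  proof (rule sm_cong[OF assms(3)])
    fix q assume q: "q \<in> V"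
    have l: "linear (frechet_derivative ?F (at (x q)))"
      by (rule has_derivative_linear[OF smooth_on_has_derivative[OF F]]) (use q assms in auto)
    have "td f q (X q) = frechet_derivative ?F (at (x q)) (tc (U, x) q (X q))"
      using q assms by (intro td_chart[of U x q W f]) auto
    also have "\<dots> = frechet_derivative ?F (at (x q)) (\<Sum>i<n. (tc (U, x) q (X q) \<bullet> b i) *\<^sub>R b i)"
      using b[of "tc (U, x) q (X q)"] by simp
    finally show "(\<Sum>i<n. (tc (U, x) q (X q) \<bullet> b i) *\<^sub>R frechet_derivative ?F (at (x q)) (b i)) = td f q (X q)"
      by (simp add: linear_sum[OF l] linear_cmul[OF l])
  qed
qed

lemma VF_D: "X \<in> VF \<Longrightarrow> (U, x) \<in> \<A> \<Longrightarrow> sm U (\<lambda>q. tc (U, x) q (X q))"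
  by (auto simp: vector_fields_def)

lemma VF_I_local:
  assumes "\<And>p. \<exists>U x V. (U, x) \<in> \<A> \<and> open V \<and> p \<in> V \<and> V \<subseteq> U \<and> sm V (\<lambda>q. tc (U, x) q (X q))"
  shows "X \<in> VF"
  unfolding vector_fields_def
proof (intro CollectI ballI case_prodI2 sm_local)
  fix c U' x' p assume "c \<in> \<A>" "c = (U', x')" and p: "p \<in> U'"
  then have c: "(U', x') \<in> \<A>" by simp
  obtain U x V where V: "(U, x) \<in> \<A>" "open V" "p \<in> V" "V \<subseteq> U" "sm V (\<lambda>q. tc (U, x) q (X q))"
    using assms by blast
  have "sm (V \<inter> U') (\<lambda>q. td x' q (X q))"
    using V chart(1)[OF c] sm_subset[OF V(5), of "V \<inter> U'"]
    by (intro sm_td_chart[OF V(1) chart(1)[OF c] _ _ sm_chart[OF c]]) auto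
  then show "\<exists>V. open V \<and> p \<in> V \<and> sm V (\<lambda>q. tc (U', x') q (X q))"
    using V chart(1)[OF c] p by (intro exI[of _ "V \<inter> U'"]) (auto simp: tangent_coord_def)
qed

lemma sm_td:
  assumes "X \<in> VF" "open W" "sm W f"
  shows "sm W (\<lambda>q. td f q (X q))"
proof (rule sm_local)
  fix p assume p: "p \<in> W"
  obtain U x where c: "(U, x) \<in> \<A>" "p \<in> U" by (rule obtain_chart_at)
  have "sm (U \<inter> W) (\<lambda>q. td f q (X q))"
    using assms chart(1)[OF c(1)] sm_subset[OF VF_D[OF assms(1) c(1)], of "U \<inter> W"]
    by (intro sm_td_chart[OF c(1) assms(2) _ _ assms(3)]) auto
  then show "\<exists>V. open V \<and> p \<in> V \<and> sm V (\<lambda>q. td f q (X q))"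
    using assms(2) p c chart(1)[OF c(1)] by (intro exI[of _ "U \<inter> W"]) auto
qed

lemma VF_add: "X \<in> VF \<Longrightarrow> Y \<in> VF \<Longrightarrow> (\<lambda>p. X p + Y p) \<in> VF"
  unfolding vector_fields_def
proof (intro CollectI ballI case_prodI2)
  fix c U x assume XY: "X \<in> {X. \<forall>(U, x)\<in>\<A>. sm U (\<lambda>p. tc (U, x) p (X p))}" "Y \<in> {X. \<forall>(U, x)\<in>\<A>. sm U (\<lambda>p. tc (U, x) p (X p))}"
    and "c \<in> \<A>" "c = (U, x)"
  then have c: "(U, x) \<in> \<A>" by simp
  have "sm U (\<lambda>p. tc (U, x) p (X p) + tc (U, x) p (Y p))" using XY c chart(1)[OF c] by (intro sm_add) auto
  then show "sm U (\<lambda>p. tc (U, x) p (X p + Y p))"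
    by (rule sm_cong[OF chart(1)[OF c]]) (simp add: linear_add[OF tc_linear[OF c]])
qed

lemma VF_scale: "f \<in> C \<Longrightarrow> X \<in> VF \<Longrightarrow> (\<lambda>p. f p *\<^sub>R X p) \<in> VF"
  unfolding vector_fields_def
proof (intro CollectI ballI case_prodI2)
  fix c U x assume f: "f \<in> C" and X: "X \<in> {X. \<forall>(U, x)\<in>\<A>. sm U (\<lambda>p. tc (U, x) p (X p))}"
    and "c \<in> \<A>" "c = (U, x)"
  then have c: "(U, x) \<in> \<A>" by simp
  have "sm U (\<lambda>p. f p *\<^sub>R tc (U, x) p (X p))" using X f c chart(1)[OF c] sm_subset[of UNIV f U] by (intro sm_scaleR) auto
  then show "sm U (\<lambda>p. tc (U, x) p (f p *\<^sub>R X p))"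
    by (rule sm_cong[OF chart(1)[OF c]]) (simp add: linear_cmul[OF tc_linear[OF c]])
qed

lemma C_const [simp]: "(\<lambda>p. r) \<in> C" by (simp add: sm_const)

lemma C_closed:
  "f \<in> C \<Longrightarrow> g \<in> C \<Longrightarrow> (\<lambda>p. f p + g p) \<in> C" "f \<in> C \<Longrightarrow> g \<in> C \<Longrightarrow> (\<lambda>p. f p * g p) \<in> C"
  "f \<in> C \<Longrightarrow> g \<in> C \<Longrightarrow> (\<lambda>p. f p - g p) \<in> C" "X \<in> VF \<Longrightarrow> f \<in> C \<Longrightarrow> (\<lambda>p. td f p (X p)) \<in> C"
  by (simp_all add: sm_add sm_mult sm_diff sm_td)

lemma VF_0: "(\<lambda>p. 0) \<in> VF"
proof -
  have "tc (U, x) p 0 = 0" if "(U, x) \<in> \<A>" "p \<in> U" for U x p using linear_0[OF tc_linear[OF that]] .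
  then have "sm U (\<lambda>p. tc (U, x) p 0)" if "(U, x) \<in> \<A>" for U x
    using sm_cong[OF chart(1)[OF that] sm_const[OF chart(1)[OF that], of 0], of "\<lambda>p. tc (U, x) p 0"] that by simp
  then show ?thesis by (auto simp: vector_fields_def)
qed

subsection \<open>Bump functions\<close>

text \<open>The support \<open>K\<close> is the preimage of a closed ball in a chart. It is compact, and therefore closed because the
manifold is a Hausdorff space, which is what makes the extension by zero smooth.\<close>

lemma bump:
  assumes "open W" "p \<in> W"
  obtains f K where "f \<in> C" "f p = 1" "closed K" "K \<subseteq> W" "\<And>q. q \<notin> K \<Longrightarrow> f q = 0"
proof -
  obtain U x where c: "(U, x) \<in> \<A>" "p \<in> U" by (rule obtain_chart_at)
  have o: "open (x ` (U \<inter> W))" by (rule open_chart_image[OF c(1) assms(1)])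
  have "x p \<in> x ` (U \<inter> W)" using c assms by auto
  then obtain r where r: "r > 0" "cball (x p) r \<subseteq> x ` (U \<inter> W)" using o open_contains_cball by blast
  define K where "K = inv_into U x ` cball (x p) r"
  define f where "f q = (if q \<in> U then flat 0 (r\<^sup>2 - (x q - x p) \<bullet> (x q - x p)) / flat 0 (r\<^sup>2) else 0)" for q
  have KUW: "K \<subseteq> U \<inter> W" using r(2) c unfolding K_def by auto
  have "continuous_on (cball (x p) r) (inv_into U x)"
    by (rule continuous_on_subset[of "x ` U"]) (use r(2) chart(4)[OF c(1)] in \<open>auto simp: homeomorphism_def\<close>)
  then have "compact K" unfolding K_def
    by (rule compact_continuous_image) (rule finite_dimensional_compact_cball[OF fin_e])
  then have K: "closed K" by (rule compact_imp_closed)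
  have out: "f q = 0" if "q \<notin> K" for q
  proof (cases "q \<in> U")
    case True
    have "x q \<notin> cball (x p) r" using that True c(1) unfolding K_def by (metis image_eqI inv_chart)
    then have "r < norm (x q - x p)" by (simp add: dist_norm norm_minus_commute)
    then have "r\<^sup>2 < (norm (x q - x p))\<^sup>2" using r(1) by (intro power_strict_mono) auto
    then show ?thesis by (simp add: f_def flat_def power2_norm_eq_inner)
  qed (simp add: f_def)
  have "sm UNIV f"
  proof (rule sm_local)
    fix q
    show "\<exists>V. open V \<and> q \<in> V \<and> sm V f"
    proof (cases "q \<in> U")
      case True
      have "sm U (\<lambda>q. inverse (flat 0 (r\<^sup>2)) *\<^sub>R (flat 0 (r\<^sup>2 - (x q - x p) \<bullet> (x q - x p))))"
        by (intro sm_scaleR sm_const chart(1)[OF c(1)]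
            sm_compose[OF fin_e chart(1)[OF c(1)] open_UNIV _ smooth_bump[of r "x p"] sm_chart[OF c(1)]]) auto
      then have "sm U f"
        by (rule sm_cong[OF chart(1)[OF c(1)]]) (simp add: f_def divide_inverse)
      then show ?thesis using True chart(1)[OF c(1)] by blast
    next
      case False
      then have "q \<in> - K" "open (- K)" using KUW K by auto
      moreover have "sm (- K) f"
        by (rule sm_cong[OF _ sm_const[of "- K" 0]]) (use K out in auto)
      ultimately show ?thesis by blast
    qed
  qed
  moreover have "f p = 1" using c r(1) by (simp add: f_def flat_def)
  ultimately show ?thesis using that[of f K] K KUW out by auto
qed

lemma sm_bump_extend:
  assumes "open U" "closed K" "K \<subseteq> U" "\<And>q. q \<notin> K \<Longrightarrow> f q = 0" "sm U f"
  shows "sm UNIV f"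
proof (rule sm_local)
  fix q
  have "sm (- K) f" by (rule sm_cong[OF _ sm_const[of "- K" 0]]) (use assms in auto)
  then show "\<exists>V. open V \<and> q \<in> V \<and> sm V f"
    using assms by (cases "q \<in> U") (auto intro: exI[of _ U] exI[of _ "- K"])
qed

lemma tangent_vector_eqI:
  assumes "\<And>f. f \<in> C \<Longrightarrow> td f p v = td f p w"
  shows "v = w"
proof -
  obtain U x where c: "chart_at \<A> p = (U, x)" "(U, x) \<in> \<A>" "p \<in> U" by (rule obtain_chart_at)
  obtain f K where f: "f \<in> C" "f p = 1" "closed K" "K \<subseteq> U" "\<And>q. q \<notin> K \<Longrightarrow> f q = 0"
    using bump[OF chart(1)[OF c(2)] c(3)] by metis
  have fU: "sm U f" using f(1) sm_subset[of UNIV f U] by blast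
  have "v \<bullet> d = w \<bullet> d" for d
  proof -
    have xd: "sm U (\<lambda>q. x q \<bullet> d)" by (rule sm_inner_left[OF chart(1)[OF c(2)] sm_chart[OF c(2)]])
    have "sm UNIV (\<lambda>q. f q * (x q \<bullet> d))"
      by (rule sm_bump_extend[OF chart(1)[OF c(2)] f(3,4)])
        (use f(5) sm_mult[OF chart(1)[OF c(2)] fU xd] in auto)
    then have e: "td (\<lambda>q. f q * (x q \<bullet> d)) p v = td (\<lambda>q. f q * (x q \<bullet> d)) p w" by (intro assms) simp
    have "td (\<lambda>q. f q * (x q \<bullet> d)) p u = u \<bullet> d + td f p u * (x p \<bullet> d)" for u
    proof -
      have "td x p u = u" using tc_chart_at[of p u] c by (simp add: tangent_coord_def)
      then show ?thesis
        using td_mult[OF c(3) chart(1)[OF c(2)] fU xd, of u] f(2)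
          td_bounded_linear[OF c(3) chart(1)[OF c(2)] sm_chart[OF c(2)] bounded_linear_inner_left, of d u] by simp
    qed
    then show ?thesis using e assms[OF f(1)] by simp
  qed
  then show ?thesis by (metis vector_eq_rdot)
qed

lemma VF_bump_frame:
  assumes "(U, x) \<in> \<A>" "f \<in> C" "closed K" "K \<subseteq> U" "\<And>q. q \<notin> K \<Longrightarrow> f q = 0"
  shows "(\<lambda>q. f q *\<^sub>R tv (U, x) q w) \<in> VF"
proof (rule VF_I_local)
  fix q
  show "\<exists>U' x' V. (U', x') \<in> \<A> \<and> open V \<and> q \<in> V \<and> V \<subseteq> U' \<and> sm V (\<lambda>q. tc (U', x') q (f q *\<^sub>R tv (U, x) q w))"
  proof (cases "q \<in> U")
    case True
    have "sm U (\<lambda>q. f q *\<^sub>R w)" using assms(2) sm_subset[of UNIV f U] chart(1)[OF assms(1)] by (intro sm_scaleR sm_const) auto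
    then have "sm U (\<lambda>q. tc (U, x) q (f q *\<^sub>R tv (U, x) q w))"
      by (rule sm_cong[OF chart(1)[OF assms(1)]]) (use assms(1) in \<open>simp add: linear_cmul[OF tc_linear[OF assms(1)]]\<close>)
    then show ?thesis using True assms(1) chart(1)[OF assms(1)] by blast
  next
    case False
    obtain V y where V: "(V, y) \<in> \<A>" "q \<in> V" by (rule obtain_chart_at)
    have o: "open (V \<inter> - K)" using chart(1)[OF V(1)] assms(3) by auto
    have "sm (V \<inter> - K) (\<lambda>q. tc (V, y) q (f q *\<^sub>R tv (U, x) q w))"
      by (rule sm_cong[OF o sm_const[OF o, of 0]])
        (use V assms(5) in \<open>auto simp: linear_0[OF tc_linear[OF V(1)]]\<close>)
    then show ?thesis using False V assms(4) o by (intro exI[of _ V] exI[of _ y] exI[of _ "V \<inter> - K"]) auto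
  qed
qed

lemma vector_field_through:
  obtains X where "X \<in> VF" "X p = w"
proof -
  obtain U x where c: "chart_at \<A> p = (U, x)" "(U, x) \<in> \<A>" "p \<in> U" by (rule obtain_chart_at)
  obtain f K where f: "f \<in> C" "f p = 1" "closed K" "K \<subseteq> U" "\<And>q. q \<notin> K \<Longrightarrow> f q = 0"
    using bump[OF chart(1)[OF c(2)] c(3)] by metis
  have "tv (U, x) p w = w" using tv_tc[OF c(2,3), of w] tc_chart_at[of p w] c(1) by simp
  then show ?thesis using that[OF VF_bump_frame[OF c(2) f(1,3,4,5), of w]] f(2) by simp
qed

lemma open_nonzero:
  fixes f :: "'m \<Rightarrow> real"
  assumes "f \<in> C"
  shows "open {q. f q \<noteq> 0}"
proof (subst open_subopen, intro ballI)
  fix p assume p: "p \<in> {q. f q \<noteq> 0}"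
  obtain U x where c: "(U, x) \<in> \<A>" "p \<in> U" by (rule obtain_chart_at)
  have "smooth_on (x ` U) (f \<circ> inv_into U x)" using sm_D[of UNIV f U x] assms c by simp
  then have 1: "continuous_on (x ` U) (f \<circ> inv_into U x)" using smooth_onD[of _ _ 0] by fastforce
  have "continuous_on U x" using chart(4)[OF c(1)] by (simp add: homeomorphism_def)
  from continuous_on_compose[OF this 1] have "continuous_on U f"
    by (rule continuous_on_eq) (use c in auto)
  then have "open (U \<inter> f -` (- {0}))"
    by (rule continuous_open_preimage[OF _ chart(1)[OF c(1)]]) auto
  then show "\<exists>T. open T \<and> p \<in> T \<and> T \<subseteq> {q. f q \<noteq> 0}"
    using p c by (intro exI[of _ "U \<inter> f -` (- {0})"]) auto
qed

lemma vf_ext: "vf_ext \<A> p w \<in> VF" "vf_ext \<A> p w p = w"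
proof -
  have "\<exists>X. X \<in> VF \<and> X p = w" by (metis vector_field_through)
  then have "vf_ext \<A> p w \<in> VF \<and> vf_ext \<A> p w p = w" unfolding vf_ext_def by (rule someI_ex)
  then show "vf_ext \<A> p w \<in> VF" "vf_ext \<A> p w p = w" by auto
qed

subsection \<open>The Lie bracket of vector fields\<close>

abbreviation "vb \<equiv> vf_bracket \<A>"

text \<open>In a chart, the second derivatives of \<open>f\<close> cancel by symmetry.\<close>

lemma td_vb:
  fixes f :: "'m \<Rightarrow> 'b::real_inner"
  assumes "X \<in> VF" "Y \<in> VF" "p \<in> W" "open W" "sm W f"
  shows "td f p (vb X Y p) = td (\<lambda>q. td f q (Y q)) p (X p) - td (\<lambda>q. td f q (X q)) p (Y p)"
proof -
  obtain U x where c: "chart_at \<A> p = (U, x)" "(U, x) \<in> \<A>" "p \<in> U" by (rule obtain_chart_at)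
  let ?N = "U \<inter> W" and ?S = "x ` (U \<inter> W)"
  have N: "open ?N" "p \<in> ?N" using assms c chart(1)[OF c(2)] by auto
  have S: "open ?S" "x p \<in> ?S" using open_chart_image[OF c(2) assms(4)] N by auto
  define F where "F = f \<circ> inv_into U x"
  have F: "smooth_on ?S F" unfolding F_def by (rule sm_D[OF assms(5) c(2)])
  have main: "td (\<lambda>q. td f q (Z q)) p v =
      frechet_derivative F (at (x p)) (td (\<lambda>q. tc (U, x) q (Z q)) p v)
      + frechet_derivative (\<lambda>y. frechet_derivative F (at y) (Z p)) (at (x p)) v" if "Z \<in> VF" for Z v
  proof -
    define h where "h = (\<lambda>q. tc (U, x) q (Z q)) \<circ> inv_into U x"
    have h: "smooth_on ?S h" unfolding h_def by (rule sm_D[OF sm_subset[OF VF_D[OF that c(2)]] c(2), THEN smooth_on_subset]) auto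
    have hp: "h (x p) = Z p" using c tc_chart_at[of p "Z p"] by (simp add: h_def)
    have smf: "sm ?N (\<lambda>q. td f q (Z q))" using sm_subset[OF sm_td[OF that assms(4,5)]] by blast
    have "((\<lambda>q. td f q (Z q)) \<circ> inv_into U x has_derivative td (\<lambda>q. td f q (Z q)) p) (at (x p))"
      by (rule td_has_derivative[OF N(2,1) smf c(1)])
    then have "((\<lambda>z. frechet_derivative F (at z) (h z)) has_derivative td (\<lambda>q. td f q (Z q)) p) (at (x p))"
      by (rule has_derivative_transform_within_open[OF _ S])
        (use c in \<open>auto simp: h_def F_def intro!: td_chart[OF c(2) _ _ assms(4,5)]\<close>)
    from frechet_derivative_at[OF this]
    have "td (\<lambda>q. td f q (Z q)) p v = frechet_derivative (\<lambda>z. frechet_derivative F (at z) (h z)) (at (x p)) v" by metis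
    also have "\<dots> = frechet_derivative F (at (x p)) (frechet_derivative h (at (x p)) v)
        + frechet_derivative (\<lambda>y. frechet_derivative F (at y) (h (x p))) (at (x p)) v"
      by (rule directional_derivative_derivative[OF fin_e S(1) F h S(2)])
    also have "frechet_derivative h (at (x p)) v = td (\<lambda>q. tc (U, x) q (Z q)) p v"
      using c by (simp add: h_def tangent_deriv_def)
    finally show ?thesis unfolding hp .
  qed
  have l: "linear (frechet_derivative F (at (x p)))"
    by (rule has_derivative_linear[OF smooth_on_has_derivative[OF F S(2)]])
  have "td f p (vb X Y p) = frechet_derivative F (at (x p)) (vb X Y p)"
    using c by (simp add: tangent_deriv_def F_def)
  also have "\<dots> = frechet_derivative F (at (x p)) (td (\<lambda>q. tc (U, x) q (Y q)) p (X p))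
      - frechet_derivative F (at (x p)) (td (\<lambda>q. tc (U, x) q (X q)) p (Y p))"
    using c by (simp add: vf_bracket_def Let_def linear_diff[OF l])
  finally show ?thesis unfolding main[OF assms(1)] main[OF assms(2)]
    using second_derivative_symmetric[OF S F, of "X p" "Y p"] by simp
qed

lemma VF_vb: "X \<in> VF \<Longrightarrow> Y \<in> VF \<Longrightarrow> vb X Y \<in> VF"
  unfolding vector_fields_def
proof (intro CollectI ballI case_prodI2)
  fix c U x assume "X \<in> {X. \<forall>(U, x)\<in>\<A>. sm U (\<lambda>p. tc (U, x) p (X p))}" "Y \<in> {X. \<forall>(U, x)\<in>\<A>. sm U (\<lambda>p. tc (U, x) p (X p))}"
    and "c \<in> \<A>" "c = (U, x)"
  then have c: "(U, x) \<in> \<A>" and XY: "X \<in> VF" "Y \<in> VF" by (auto simp: vector_fields_def)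
  note U = chart(1)[OF c]
  have "sm U (\<lambda>p. td (\<lambda>q. td x q (Y q)) p (X p) - td (\<lambda>q. td x q (X q)) p (Y p))"
    by (intro sm_diff sm_td XY U sm_chart[OF c])
  then show "sm U (\<lambda>p. tc (U, x) p (vb X Y p))"
    by (rule sm_cong[OF U]) (simp add: tangent_coord_def td_vb[OF XY _ U sm_chart[OF c]])
qed

text \<open>Vector fields are determined by their action on functions. Hence the identities for the Lie bracket follow from those for
commutators of derivations of \<open>C\<close>.\<close>

lemma vf_eqI:
  assumes "\<And>f p. f \<in> C \<Longrightarrow> td f p (X p) = td f p (Y p)"
  shows "X = Y"
  using tangent_vector_eqI assms by blast

lemma td_C_linear: "f \<in> C \<Longrightarrow> linear (td f p)"
  by (rule td_linear[of _ UNIV]) auto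

lemma td_vb_C:
  "X \<in> VF \<Longrightarrow> Y \<in> VF \<Longrightarrow> f \<in> C \<Longrightarrow>
    td f p (vb X Y p) = td (\<lambda>q. td f q (Y q)) p (X p) - td (\<lambda>q. td f q (X q)) p (Y p)"
  by (rule td_vb[of _ _ _ UNIV]) auto

lemma td_C:
  assumes "f \<in> C" "g \<in> C"
  shows "td (\<lambda>q. f q + g q) p v = td f p v + td g p v" "td (\<lambda>q. f q - g q) p v = td f p v - td g p v"
    "td (\<lambda>q. f q * g q) p v = f p * td g p v + td f p v * g p"
  using assms by (auto intro!: td_add[of _ UNIV] td_diff[of _ UNIV] td_mult[of _ UNIV])

lemma vb_anti: "X \<in> VF \<Longrightarrow> Y \<in> VF \<Longrightarrow> vb X Y = (\<lambda>p. - vb Y X p)"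
  by (rule vf_eqI) (simp add: td_vb_C linear_neg[OF td_C_linear])

lemma vb_add_right:
  assumes "X \<in> VF" "Y \<in> VF" "Z \<in> VF"
  shows "vb X (\<lambda>p. Y p + Z p) = (\<lambda>p. vb X Y p + vb X Z p)"
proof (rule vf_eqI)
  fix f p assume f: "f \<in> C"
  note C = C_closed(4)[OF assms(2) f] C_closed(4)[OF assms(3) f]
  have "(\<lambda>q. td f q (Y q + Z q)) = (\<lambda>q. td f q (Y q) + td f q (Z q))"
    using f by (simp add: linear_add[OF td_C_linear])
  then show "td f p (vb X (\<lambda>p. Y p + Z p) p) = td f p (vb X Y p + vb X Z p)"
    using assms f C linear_add[OF td_C_linear[OF C_closed(4)[OF assms(1) f]]]
    by (simp only: td_vb_C VF_add linear_add[OF td_C_linear] td_C)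
qed

lemma vb_scale_right:
  assumes "X \<in> VF" "Y \<in> VF" "g \<in> C"
  shows "vb X (\<lambda>p. g p *\<^sub>R Y p) = (\<lambda>p. g p *\<^sub>R vb X Y p + td g p (X p) *\<^sub>R Y p)"
proof (rule vf_eqI)
  fix f p assume f: "f \<in> C"
  note C = C_closed(4)[OF assms(2) f]
  have e: "(\<lambda>q. td f q (g q *\<^sub>R Y q)) = (\<lambda>q. g q * td f q (Y q))"
    using f by (simp add: linear_cmul[OF td_C_linear])
  have "td f p (vb X (\<lambda>p. g p *\<^sub>R Y p) p)
      = g p * td (\<lambda>q. td f q (Y q)) p (X p) + td g p (X p) * td f p (Y p) - g p * td (\<lambda>q. td f q (X q)) p (Y p)"
    unfolding td_vb_C[OF assms(1) VF_scale[OF assms(3,2)] f] e td_C(3)[OF assms(3) C]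
    by (simp add: linear_cmul[OF td_C_linear[OF C_closed(4)[OF assms(1) f]]])
  then show "td f p (vb X (\<lambda>p. g p *\<^sub>R Y p) p) = td f p (g p *\<^sub>R vb X Y p + td g p (X p) *\<^sub>R Y p)"
    unfolding linear_add[OF td_C_linear[OF f]] linear_cmul[OF td_C_linear[OF f]] td_vb_C[OF assms(1,2) f]
    by (simp add: right_diff_distrib)
qed

lemma vb_jacobi:
  assumes "X \<in> VF" "Y \<in> VF" "Z \<in> VF"
  shows "vb X (vb Y Z) p = vb (vb X Y) Z p + vb Y (vb X Z) p"
proof (rule tangent_vector_eqI)
  fix f assume f: "f \<in> C"
  note V = VF_vb[OF assms(1,2)] VF_vb[OF assms(1,3)] VF_vb[OF assms(2,3)]
  note C = C_closed(4)[OF assms(1) f] C_closed(4)[OF assms(2) f] C_closed(4)[OF assms(3) f]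
  note C' = C_closed(4)[OF assms(1) C(2)] C_closed(4)[OF assms(1) C(3)] C_closed(4)[OF assms(2) C(1)]
    C_closed(4)[OF assms(2) C(3)] C_closed(4)[OF assms(3) C(1)] C_closed(4)[OF assms(3) C(2)]
  have e: "(\<lambda>q. td f q (vb A B q)) = (\<lambda>q. td (\<lambda>q. td f q (B q)) q (A q) - td (\<lambda>q. td f q (A q)) q (B q))"
    if "A \<in> VF" "B \<in> VF" for A B using td_vb_C[OF that f] by auto
  show "td f p (vb X (vb Y Z) p) = td f p (vb (vb X Y) Z p + vb Y (vb X Z) p)"
    unfolding linear_add[OF td_C_linear[OF f]] td_vb_C[OF assms(1) V(3) f] td_vb_C[OF V(1) assms(3) f]
      td_vb_C[OF assms(2) V(2) f] e[OF assms(1,2)] e[OF assms(1,3)] e[OF assms(2,3)]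
      td_C(2)[OF C'(1,3)] td_C(2)[OF C'(2,5)] td_C(2)[OF C'(4,6)]
      td_vb_C[OF assms(1,2) C(3)] td_vb_C[OF assms(1,3) C(2)] td_vb_C[OF assms(2,3) C(1)]
    by simp
qed

end

section \<open>Vector bundles and subbundles\<close>

locale subbundle =
  fixes L :: "('m::{t2_space, second_countable_topology}, 'e::real_inner, 'v::real_vector, 'f::real_inner) algebroid_data"
    and K :: "'m \<Rightarrow> 'v set"
  assumes smooth_manifold_atlas: "smooth_manifold (atlas L)"
    and vector_bundle: "vector_bundle (atlas L) (fibre L) (trivs L)"
    and vector_subbundle: "vector_subbundle L K"
begin

sublocale manifold "atlas L" by unfold_locales (rule smooth_manifold_atlas)

abbreviation "\<Gamma> \<equiv> sections L"
abbreviation "\<K> \<equiv> sub_sections L K"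

lemma fin_f: "finite_dimensional TYPE('f)"
  using vector_bundle by (simp add: vector_bundle_def)

lemma fibre_subspace: "subspace (fibre L p)"
  using vector_bundle by (simp add: vector_bundle_def)

lemma K_subspace: "subspace (K p)" and K_fibre: "a \<in> K p \<Longrightarrow> a \<in> fibre L p"
  using vector_subbundle by (auto simp: vector_subbundle_def)

text \<open>Local trivialisations that are smoothly compatible with the given ones, without regard to \<open>K\<close>.\<close>

definition triv :: "'m set \<Rightarrow> ('m \<Rightarrow> 'v \<Rightarrow> 'f) \<Rightarrow> bool" where
  "triv U \<phi> \<longleftrightarrow> adapted_triv L (fibre L) UNIV (U, \<phi>)"

lemma trivs_open: "(U, \<phi>) \<in> trivs L \<Longrightarrow> open U"
  using vector_bundle by (auto simp: vector_bundle_def)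

lemma trivs_triv:
  assumes "(U, \<phi>) \<in> trivs L"
  shows "triv U \<phi>"
proof -
  have 1: "open U \<and> (\<forall>p\<in>U. linear_map_on (fibre L p) (\<phi> p) \<and> bij_betw (\<phi> p) (fibre L p) UNIV)"
    using vector_bundle assms unfolding vector_bundle_def by blast
  have 2: "smooth_map_on (atlas L) (U \<inter> V) (\<lambda>p. \<psi> p (inv_into (fibre L p) (\<phi> p) w))"
    "smooth_map_on (atlas L) (V \<inter> U) (\<lambda>p. \<phi> p (inv_into (fibre L p) (\<psi> p) w))"
    if "(V, \<psi>) \<in> trivs L" for V \<psi> w
    using vector_bundle assms that unfolding vector_bundle_def by blast+
  then show ?thesis using 1 unfolding triv_def adapted_triv_def by (auto simp: bij_betw_def Int_commute)
qed

lemma triv_cover: obtains U \<phi> where "(U, \<phi>) \<in> trivs L" "p \<in> U"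
proof -
  have "p \<in> (\<Union>(U, \<phi>)\<in>trivs L. U)" using vector_bundle by (simp add: vector_bundle_def)
  then show ?thesis using that by auto
qed

lemma adapted_triv_triv: "adapted_triv L K W (U, \<phi>) \<Longrightarrow> triv U \<phi>"
  unfolding triv_def adapted_triv_def by (auto simp: bij_betw_def)

lemma triv_props:
  assumes "triv U \<phi>"
  shows "open U" "p \<in> U \<Longrightarrow> linear_map_on (fibre L p) (\<phi> p)" "p \<in> U \<Longrightarrow> bij_betw (\<phi> p) (fibre L p) UNIV"
    "(V, \<psi>) \<in> trivs L \<Longrightarrow> sm (U \<inter> V) (\<lambda>p. \<psi> p (inv_into (fibre L p) (\<phi> p) w))"
    "(V, \<psi>) \<in> trivs L \<Longrightarrow> sm (U \<inter> V) (\<lambda>p. \<phi> p (inv_into (fibre L p) (\<psi> p) w))"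
  using assms unfolding triv_def adapted_triv_def by blast+

abbreviation (input) "iv \<phi> p \<equiv> inv_into (fibre L p) (\<phi> p)"

lemma triv_iv:
  assumes "triv U \<phi>" "p \<in> U"
  shows "iv \<phi> p w \<in> fibre L p" "\<phi> p (iv \<phi> p w) = w" "a \<in> fibre L p \<Longrightarrow> iv \<phi> p (\<phi> p a) = a"
proof -
  have b: "bij_betw (\<phi> p) (fibre L p) UNIV" by (rule triv_props(3)[OF assms])
  show "iv \<phi> p w \<in> fibre L p" using b inv_into_into[of w "\<phi> p" "fibre L p"] by (simp add: bij_betw_def)
  show "\<phi> p (iv \<phi> p w) = w" using b f_inv_into_f[of w "\<phi> p" "fibre L p"] by (simp add: bij_betw_def)
  show "iv \<phi> p (\<phi> p a) = a" if "a \<in> fibre L p" using b that by (simp add: bij_betw_def)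
qed

lemma triv_linear:
  assumes "triv U \<phi>" "p \<in> U"
  shows "a \<in> fibre L p \<Longrightarrow> c \<in> fibre L p \<Longrightarrow> \<phi> p (a + c) = \<phi> p a + \<phi> p c"
    "a \<in> fibre L p \<Longrightarrow> \<phi> p (r *\<^sub>R a) = r *\<^sub>R \<phi> p a" "\<phi> p 0 = 0"
proof -
  note l = linear_map_onD[OF triv_props(2)[OF assms]]
  show "a \<in> fibre L p \<Longrightarrow> c \<in> fibre L p \<Longrightarrow> \<phi> p (a + c) = \<phi> p a + \<phi> p c"
    "a \<in> fibre L p \<Longrightarrow> \<phi> p (r *\<^sub>R a) = r *\<^sub>R \<phi> p a" by (rule l; assumption)+
  show "\<phi> p 0 = 0" using l(2)[of 0 0] subspace_0[OF fibre_subspace] by simp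
qed

lemma triv_sum:
  assumes "triv U \<phi>" "p \<in> U" "\<And>i. i \<in> I \<Longrightarrow> a i \<in> fibre L p"
  shows "\<phi> p (\<Sum>i\<in>I. c i *\<^sub>R a i) = (\<Sum>i\<in>I. c i *\<^sub>R \<phi> p (a i))"
  by (rule linear_map_on_sum[OF triv_props(2)[OF assms(1,2)] fibre_subspace assms(3)])

lemma triv_inj:
  assumes "triv U \<phi>" "p \<in> U" "a \<in> fibre L p" "c \<in> fibre L p" "\<phi> p a = \<phi> p c"
  shows "a = c"
  using triv_iv(3)[OF assms(1,2)] assms(3-5) by metis

lemma iv_expand:
  assumes "triv U \<phi>" "p \<in> U" "\<And>w. w = (\<Sum>i<n. (w \<bullet> b i) *\<^sub>R b i)"
  shows "iv \<phi> p w = (\<Sum>i<n. (w \<bullet> b i) *\<^sub>R iv \<phi> p (b i))"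
proof (rule triv_inj[OF assms(1,2)])
  show "iv \<phi> p w \<in> fibre L p" by (rule triv_iv(1)[OF assms(1,2)])
  show "(\<Sum>i<n. (w \<bullet> b i) *\<^sub>R iv \<phi> p (b i)) \<in> fibre L p"
    by (intro subspace_sum subspace_scale fibre_subspace triv_iv(1)[OF assms(1,2)])
  show "\<phi> p (iv \<phi> p w) = \<phi> p (\<Sum>i<n. (w \<bullet> b i) *\<^sub>R iv \<phi> p (b i))"
    using assms(3)[of w] by (simp add: triv_sum[OF assms(1,2)] triv_iv[OF assms(1,2)])
qed

lemma sm_transition:
  assumes "triv U \<phi>" "(V, \<psi>) \<in> trivs L" "open N" "N \<subseteq> U \<inter> V" "sm N g"
  shows "sm N (\<lambda>p. \<psi> p (iv \<phi> p (g p)))" "sm N (\<lambda>p. \<phi> p (iv \<psi> p (g p)))"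
proof -
  obtain n :: nat and b :: "nat \<Rightarrow> 'f" where b: "\<And>w. w = (\<Sum>i<n. (w \<bullet> b i) *\<^sub>R b i)"
    by (rule subspace_onb[OF fin_f subspace_UNIV]) (metis UNIV_I)
  note V = trivs_triv[OF assms(2)]
  have "sm N (\<lambda>p. \<Sum>i<n. (g p \<bullet> b i) *\<^sub>R \<psi> p (iv \<phi> p (b i)))"
    by (intro sm_sum sm_scaleR sm_inner_left assms(3,5) sm_subset[OF triv_props(4)[OF assms(1,2)] assms(4)])
  then show "sm N (\<lambda>p. \<psi> p (iv \<phi> p (g p)))"
  proof (rule sm_cong[OF assms(3)])
    fix p assume "p \<in> N"
    then have p: "p \<in> U" "p \<in> V" using assms(4) by auto
    show "(\<Sum>i<n. (g p \<bullet> b i) *\<^sub>R \<psi> p (iv \<phi> p (b i))) = \<psi> p (iv \<phi> p (g p))"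
      unfolding iv_expand[OF assms(1) p(1) b, of "g p"]
      by (rule triv_sum[OF V p(2) triv_iv(1)[OF assms(1) p(1)], symmetric])
  qed
  have "sm N (\<lambda>p. \<Sum>i<n. (g p \<bullet> b i) *\<^sub>R \<phi> p (iv \<psi> p (b i)))"
    by (intro sm_sum sm_scaleR sm_inner_left assms(3,5) sm_subset[OF triv_props(5)[OF assms(1,2)] assms(4)])
  then show "sm N (\<lambda>p. \<phi> p (iv \<psi> p (g p)))"
  proof (rule sm_cong[OF assms(3)])
    fix p assume "p \<in> N"
    then have p: "p \<in> U" "p \<in> V" using assms(4) by auto
    show "(\<Sum>i<n. (g p \<bullet> b i) *\<^sub>R \<phi> p (iv \<psi> p (b i))) = \<phi> p (iv \<psi> p (g p))"
      unfolding iv_expand[OF V p(2) b, of "g p"]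
      by (rule triv_sum[OF assms(1) p(1) triv_iv(1)[OF V p(2)], symmetric])
  qed
qed

lemma section_fibre: "\<alpha> \<in> \<Gamma> \<Longrightarrow> \<alpha> p \<in> fibre L p"
  by (simp add: sections_def)

lemma section_K: "\<xi> \<in> \<K> \<Longrightarrow> \<xi> p \<in> K p" and K_sec: "\<xi> \<in> \<K> \<Longrightarrow> \<xi> \<in> \<Gamma>"
  by (auto simp: sub_sections_def)

lemma section_sm:
  assumes "\<alpha> \<in> \<Gamma>" "triv U \<phi>"
  shows "sm U (\<lambda>p. \<phi> p (\<alpha> p))"
proof (rule sm_local)
  fix p assume p: "p \<in> U"
  obtain V \<psi> where V: "(V, \<psi>) \<in> trivs L" "p \<in> V" by (rule triv_cover)
  have o: "open (U \<inter> V)" using triv_props(1)[OF assms(2)] trivs_open[OF V(1)] by auto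
  have "sm V (\<lambda>p. \<psi> p (\<alpha> p))" using assms(1) V(1) by (auto simp: sections_def)
  then have "sm (U \<inter> V) (\<lambda>p. \<phi> p (iv \<psi> p (\<psi> p (\<alpha> p))))"
    using sm_transition(2)[OF assms(2) V(1) o subset_refl] sm_subset[of V _ "U \<inter> V"] by blast
  then have "sm (U \<inter> V) (\<lambda>p. \<phi> p (\<alpha> p))"
    by (rule sm_cong[OF o]) (use triv_iv(3)[OF trivs_triv[OF V(1)]] section_fibre[OF assms(1)] in auto)
  then show "\<exists>V. open V \<and> p \<in> V \<and> sm V (\<lambda>p. \<phi> p (\<alpha> p))" using p V o by blast
qed

lemma sectionI_local:
  assumes "\<And>p. \<alpha> p \<in> fibre L p"
    and "\<And>p. \<exists>U \<phi> N. triv U \<phi> \<and> open N \<and> p \<in> N \<and> N \<subseteq> U \<and> sm N (\<lambda>q. \<phi> q (\<alpha> q))"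
  shows "\<alpha> \<in> \<Gamma>"
  unfolding sections_def
proof (intro CollectI conjI allI assms(1) ballI case_prodI2 sm_local)
  fix c V \<psi> p assume "c \<in> trivs L" "c = (V, \<psi>)" and p: "p \<in> V"
  then have V: "(V, \<psi>) \<in> trivs L" by simp
  obtain U \<phi> N where N: "triv U \<phi>" "open N" "p \<in> N" "N \<subseteq> U" "sm N (\<lambda>q. \<phi> q (\<alpha> q))" using assms(2) by blast
  have o: "open (N \<inter> V)" using N(2) trivs_open[OF V] by auto
  have "sm (N \<inter> V) (\<lambda>q. \<psi> q (iv \<phi> q (\<phi> q (\<alpha> q))))"
    using N by (intro sm_transition(1)[OF N(1) V o] sm_subset[OF N(5)]) auto
  then have "sm (N \<inter> V) (\<lambda>q. \<psi> q (\<alpha> q))"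
    by (rule sm_cong[OF o]) (use triv_iv(3)[OF N(1)] N(4) assms(1) in \<open>auto simp: subset_iff\<close>)
  then show "\<exists>V. open V \<and> p \<in> V \<and> sm V (\<lambda>q. \<psi> q (\<alpha> q))" using o p N by blast
qed

lemma sectionI:
  assumes "\<And>p. \<alpha> p \<in> fibre L p" "\<And>U \<phi>. (U, \<phi>) \<in> trivs L \<Longrightarrow> sm U (\<lambda>q. \<phi> q (\<alpha> q))"
  shows "\<alpha> \<in> \<Gamma>"
  using assms by (auto simp: sections_def)

lemma section_add:
  assumes "\<alpha> \<in> \<Gamma>" "\<beta> \<in> \<Gamma>"
  shows "(\<lambda>p. \<alpha> p + \<beta> p) \<in> \<Gamma>"
proof (rule sectionI)
  show "\<alpha> p + \<beta> p \<in> fibre L p" for p using assms section_fibre subspace_add[OF fibre_subspace] by blast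
  fix U \<phi> assume V: "(U, \<phi>) \<in> trivs L"
  note t = trivs_triv[OF V] and o = trivs_open[OF V]
  have "sm U (\<lambda>q. \<phi> q (\<alpha> q) + \<phi> q (\<beta> q))" by (intro sm_add o section_sm[OF _ t] assms)
  then show "sm U (\<lambda>q. \<phi> q (\<alpha> q + \<beta> q))"
    by (rule sm_cong[OF o]) (simp add: triv_linear[OF t] section_fibre assms)
qed

lemma section_scale:
  assumes "f \<in> C" "\<alpha> \<in> \<Gamma>"
  shows "(\<lambda>p. f p *\<^sub>R \<alpha> p) \<in> \<Gamma>"
proof (rule sectionI)
  show "f p *\<^sub>R \<alpha> p \<in> fibre L p" for p using assms section_fibre subspace_scale[OF fibre_subspace] by blast
  fix U \<phi> assume V: "(U, \<phi>) \<in> trivs L"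
  note t = trivs_triv[OF V] and o = trivs_open[OF V]
  have "sm U f" using assms(1) sm_subset[of UNIV f U] by simp
  then have "sm U (\<lambda>q. f q *\<^sub>R \<phi> q (\<alpha> q))" by (intro sm_scaleR o section_sm[OF _ t] assms)
  then show "sm U (\<lambda>q. \<phi> q (f q *\<^sub>R \<alpha> q))"
    by (rule sm_cong[OF o]) (simp add: triv_linear[OF t] section_fibre assms)
qed

lemma section_0: "(\<lambda>p. 0) \<in> \<Gamma>"
proof (rule sectionI)
  fix U \<phi> assume V: "(U, \<phi>) \<in> trivs L"
  show "sm U (\<lambda>q. \<phi> q 0)"
    by (rule sm_cong[OF trivs_open[OF V] sm_const[OF trivs_open[OF V], of 0]])
      (simp add: triv_linear(3)[OF trivs_triv[OF V]])
qed (rule subspace_0[OF fibre_subspace])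

lemma section_uminus: "\<alpha> \<in> \<Gamma> \<Longrightarrow> (\<lambda>p. - \<alpha> p) \<in> \<Gamma>"
  using section_scale[OF C_const[of "-1"]] by simp

lemma section_diff: "\<alpha> \<in> \<Gamma> \<Longrightarrow> \<beta> \<in> \<Gamma> \<Longrightarrow> (\<lambda>p. \<alpha> p - \<beta> p) \<in> \<Gamma>"
  using section_add[of \<alpha> "\<lambda>p. - \<beta> p"] section_uminus[of \<beta>] by simp

lemma K_closed:
  "\<xi> \<in> \<K> \<Longrightarrow> \<eta> \<in> \<K> \<Longrightarrow> (\<lambda>p. \<xi> p + \<eta> p) \<in> \<K>" "\<xi> \<in> \<K> \<Longrightarrow> \<eta> \<in> \<K> \<Longrightarrow> (\<lambda>p. \<xi> p - \<eta> p) \<in> \<K>"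
  "f \<in> C \<Longrightarrow> \<xi> \<in> \<K> \<Longrightarrow> (\<lambda>p. f p *\<^sub>R \<xi> p) \<in> \<K>" "(\<lambda>p. 0) \<in> \<K>" "\<xi> \<in> \<K> \<Longrightarrow> (\<lambda>p. - \<xi> p) \<in> \<K>"
  using section_add section_diff section_scale section_0 section_uminus K_subspace
  by (auto simp: sub_sections_def subspace_add subspace_diff subspace_scale subspace_0 subspace_neg)

lemma K_sum: "(\<And>i. i \<in> I \<Longrightarrow> \<xi> i \<in> \<K>) \<Longrightarrow> (\<lambda>p. \<Sum>i\<in>I. \<xi> i p) \<in> \<K>"
  by (induction I rule: infinite_finite_induct) (auto intro: K_closed)

subsection \<open>Local frames\<close>

lemma obtain_adapted:
  obtains W U \<phi> where "subspace W" "p \<in> U" "adapted_triv L K W (U, \<phi>)"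
  using vector_subbundle unfolding vector_subbundle_def by blast

lemma bump_frame:
  assumes "adapted_triv L K W (U, \<phi>)" "f \<in> C" "closed S" "S \<subseteq> U" "\<And>q. q \<notin> S \<Longrightarrow> f q = 0" "w \<in> W"
  shows "(\<lambda>q. if q \<in> U then f q *\<^sub>R iv \<phi> q w else 0) \<in> \<K>"
proof -
  let ?e = "\<lambda>q. if q \<in> U then f q *\<^sub>R iv \<phi> q w else 0"
  note t = adapted_triv_triv[OF assms(1)]
  have o: "open U" by (rule triv_props(1)[OF t])
  have fib: "?e q \<in> fibre L q" for q
    using triv_iv(1)[OF t, of q w] subspace_scale[OF fibre_subspace] subspace_0[OF fibre_subspace] by auto
  have "iv \<phi> q w \<in> K q" if "q \<in> U" for q
  proof -
    have "w \<in> \<phi> q ` K q" using assms(1,6) that by (auto simp: adapted_triv_def)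
    then obtain a where "a \<in> K q" "w = \<phi> q a" by auto
    then show ?thesis using triv_iv(3)[OF t that K_fibre] by simp
  qed
  then have K: "?e q \<in> K q" for q using subspace_scale[OF K_subspace] subspace_0[OF K_subspace] by auto
  have "?e \<in> \<Gamma>"
  proof (rule sectionI_local[OF fib])
    fix p
    show "\<exists>U' \<psi> N. triv U' \<psi> \<and> open N \<and> p \<in> N \<and> N \<subseteq> U' \<and> sm N (\<lambda>q. \<psi> q (?e q))"
    proof (cases "p \<in> U")
      case True
      have "sm U (\<lambda>q. f q *\<^sub>R w)" using assms(2) sm_subset[of UNIV f U] by (intro sm_scaleR sm_const o) auto
      then have "sm U (\<lambda>q. \<phi> q (?e q))"
        by (rule sm_cong[OF o]) (simp add: triv_linear[OF t] triv_iv[OF t])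
      then show ?thesis using True o t by blast
    next
      case False
      obtain V \<psi> where V: "(V, \<psi>) \<in> trivs L" "p \<in> V" by (rule triv_cover)
      have o: "open (V \<inter> - S)" using trivs_open[OF V(1)] assms(3) by auto
      have "sm (V \<inter> - S) (\<lambda>q. \<psi> q (?e q))"
        by (rule sm_cong[OF o sm_const[OF o, of 0]])
          (use assms(5) triv_linear(3)[OF trivs_triv[OF V(1)]] in auto)
      then show ?thesis using False V assms(4) o trivs_triv[OF V(1)]
        by (intro exI[of _ V] exI[of _ \<psi>] exI[of _ "V \<inter> - S"]) auto
    qed
  qed
  then show ?thesis using K by (auto simp: sub_sections_def)
qed

lemma section_through:
  assumes "a \<in> K p"
  obtains \<xi> where "\<xi> \<in> \<K>" "\<xi> p = a"
proof -
  obtain W U \<phi> where W: "p \<in> U" "adapted_triv L K W (U, \<phi>)" by (rule obtain_adapted)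
  note t = adapted_triv_triv[OF W(2)]
  obtain f S where f: "f \<in> C" "f p = 1" "closed S" "S \<subseteq> U" "\<And>q. q \<notin> S \<Longrightarrow> f q = 0"
    using bump[OF triv_props(1)[OF t] W(1)] by metis
  have w: "\<phi> p a \<in> W" using W assms by (auto simp: adapted_triv_def)
  show ?thesis
    using that[OF bump_frame[OF W(2) f(1,3,4,5) w]] W(1) f(2) triv_iv(3)[OF t W(1) K_fibre[OF assms]] by simp
qed

text \<open>The function \<open>f\<close> is a bump function at \<open>p\<close>. It cuts off both the sections of a local frame
and the coefficients of \<open>\<xi>\<close>, hence the square.\<close>

lemma local_frame:
  obtains n :: nat and e f where "\<And>i. i < n \<Longrightarrow> e i \<in> \<K>" "f \<in> C" "f p = 1"
    "\<And>\<xi>. \<xi> \<in> \<K> \<Longrightarrow> \<exists>g. (\<forall>i<n. g i \<in> C) \<and> (\<forall>q. (f q * f q) *\<^sub>R \<xi> q = (\<Sum>i<n. g i q *\<^sub>R e i q)) \<and>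
       (\<xi> p = 0 \<longrightarrow> (\<forall>i<n. g i p = 0))"
proof -
  obtain W U \<phi> where W: "subspace W" "p \<in> U" "adapted_triv L K W (U, \<phi>)" by (rule obtain_adapted)
  note t = adapted_triv_triv[OF W(3)]
  have o: "open U" by (rule triv_props(1)[OF t])
  obtain f S where f: "f \<in> C" "f p = 1" "closed S" "S \<subseteq> U" "\<And>q. q \<notin> S \<Longrightarrow> f q = 0"
    using bump[OF o W(2)] by metis
  obtain n :: nat and b where b: "\<And>i. i < n \<Longrightarrow> b i \<in> W" "\<And>w. w \<in> W \<Longrightarrow> w = (\<Sum>i<n. (w \<bullet> b i) *\<^sub>R b i)"
    by (rule subspace_onb[OF fin_f W(1)]) metis
  define e where "e i q = (if q \<in> U then f q *\<^sub>R iv \<phi> q (b i) else 0)" for i q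
  have e: "e i \<in> \<K>" if "i < n" for i
    using bump_frame[OF W(3) f(1,3,4,5) b(1)[OF that]] unfolding e_def[abs_def] .
  have fU: "sm U f" using f(1) sm_subset[of UNIV f U] by simp
  show ?thesis
  proof (rule that[OF e f(1,2)])
    fix \<xi> assume \<xi>: "\<xi> \<in> \<K>"
    define g where "g i q = (if q \<in> U then f q * (\<phi> q (\<xi> q) \<bullet> b i) else 0)" for i q
    have "g i \<in> C" for i
    proof -
      have "sm U (\<lambda>q. f q * (\<phi> q (\<xi> q) \<bullet> b i))"
        by (intro sm_mult sm_inner_left o fU section_sm[OF K_sec[OF \<xi>] t])
      then have "sm U (g i)" by (rule sm_cong[OF o]) (simp add: g_def)
      then have "sm UNIV (g i)" by (rule sm_bump_extend[OF o f(3,4), rotated]) (simp add: g_def f(5))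
      then show ?thesis by simp
    qed
    moreover have "(f q * f q) *\<^sub>R \<xi> q = (\<Sum>i<n. g i q *\<^sub>R e i q)" for q
    proof (cases "q \<in> U")
      case True
      have "\<phi> q (\<xi> q) \<in> W" using W(3) True section_K[OF \<xi>] by (auto simp: adapted_triv_def)
      then have w: "\<phi> q (\<xi> q) = (\<Sum>i<n. (\<phi> q (\<xi> q) \<bullet> b i) *\<^sub>R b i)" by (rule b(2))
      have "\<xi> q = (\<Sum>i<n. (\<phi> q (\<xi> q) \<bullet> b i) *\<^sub>R iv \<phi> q (b i))"
      proof (rule triv_inj[OF t True])
        show "\<xi> q \<in> fibre L q" using \<xi> K_sec section_fibre by blast
        show "(\<Sum>i<n. (\<phi> q (\<xi> q) \<bullet> b i) *\<^sub>R iv \<phi> q (b i)) \<in> fibre L q"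
          by (intro subspace_sum subspace_scale fibre_subspace triv_iv(1)[OF t True])
        show "\<phi> q (\<xi> q) = \<phi> q (\<Sum>i<n. (\<phi> q (\<xi> q) \<bullet> b i) *\<^sub>R iv \<phi> q (b i))"
          using w by (simp add: triv_sum[OF t True] triv_iv[OF t True])
      qed
      then have "(f q * f q) *\<^sub>R \<xi> q = (f q * f q) *\<^sub>R (\<Sum>i<n. (\<phi> q (\<xi> q) \<bullet> b i) *\<^sub>R iv \<phi> q (b i))" by simp
      also have "\<dots> = (\<Sum>i<n. g i q *\<^sub>R e i q)"
        unfolding scaleR_sum_right using True by (intro sum.cong) (auto simp: g_def e_def)
      finally show ?thesis .
    next
      case False
      then have "f q = 0" using f by auto
      then show ?thesis using False by (simp add: g_def)
    qed
    moreover have "g i p = 0" if "\<xi> p = 0" for i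
      using that by (simp add: g_def triv_linear(3)[OF t])
    ultimately show "\<exists>g. (\<forall>i<n. g i \<in> C) \<and> (\<forall>q. (f q * f q) *\<^sub>R \<xi> q = (\<Sum>i<n. g i q *\<^sub>R e i q)) \<and>
       (\<xi> p = 0 \<longrightarrow> (\<forall>i<n. g i p = 0))" by blast
  qed
qed

text \<open>If a section vanishes at \<open>p\<close>, then so do its coefficients in a frame near \<open>p\<close>, and \<open>C\<close>-linearity gives \<open>\<Phi> \<zeta> p = 0\<close>.\<close>

lemma tensorial:
  fixes \<Phi> :: "('m \<Rightarrow> 'v) \<Rightarrow> 'm \<Rightarrow> 'z::real_vector"
  assumes add: "\<And>\<xi> \<eta>. \<xi> \<in> \<K> \<Longrightarrow> \<eta> \<in> \<K> \<Longrightarrow> \<Phi> (\<lambda>q. \<xi> q + \<eta> q) = (\<lambda>q. \<Phi> \<xi> q + \<Phi> \<eta> q)"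
    and scale: "\<And>f \<xi>. f \<in> C \<Longrightarrow> \<xi> \<in> \<K> \<Longrightarrow> \<Phi> (\<lambda>q. f q *\<^sub>R \<xi> q) = (\<lambda>q. f q *\<^sub>R \<Phi> \<xi> q)"
    and "\<xi> \<in> \<K>" "\<eta> \<in> \<K>" "\<xi> p = \<eta> p"
  shows "\<Phi> \<xi> p = \<Phi> \<eta> p"
proof -
  have zero: "\<Phi> (\<lambda>q. 0) = (\<lambda>q. 0)" using scale[OF C_const[of 0] K_closed(4)] by simp
  have sum: "\<Phi> (\<lambda>q. \<Sum>i\<in>I. \<zeta> i q) = (\<lambda>q. \<Sum>i\<in>I. \<Phi> (\<zeta> i) q)" if "\<And>i. i \<in> I \<Longrightarrow> \<zeta> i \<in> \<K>" for I :: "nat set" and \<zeta>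
    using that
  proof (induction I rule: infinite_finite_induct)
    case (insert i I)
    then show ?case using add[of "\<zeta> i" "\<lambda>q. \<Sum>i\<in>I. \<zeta> i q"] K_sum[of I \<zeta>] by simp
  qed (simp_all add: zero)
  have vanish: "\<Phi> \<zeta> p = 0" if \<zeta>: "\<zeta> \<in> \<K>" "\<zeta> p = 0" for \<zeta>
  proof -
    obtain n :: nat and e f where e: "\<And>i. i < n \<Longrightarrow> e i \<in> \<K>" and f: "f \<in> C" "f p = 1"
      and fr: "\<And>\<xi>. \<xi> \<in> \<K> \<Longrightarrow> \<exists>g. (\<forall>i<n. g i \<in> C) \<and> (\<forall>q. (f q * f q) *\<^sub>R \<xi> q = (\<Sum>i<n. g i q *\<^sub>R e i q)) \<and>
         (\<xi> p = 0 \<longrightarrow> (\<forall>i<n. g i p = 0))"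
      by (rule local_frame[of p]) blast
    obtain g where g: "\<And>i. i < n \<Longrightarrow> g i \<in> C" "\<And>q. (f q * f q) *\<^sub>R \<zeta> q = (\<Sum>i<n. g i q *\<^sub>R e i q)"
      "\<And>i. i < n \<Longrightarrow> g i p = 0"
      using fr[OF \<zeta>(1)] \<zeta>(2) by blast
    have "\<Phi> \<zeta> p = (f p * f p) *\<^sub>R \<Phi> \<zeta> p" using f by simp
    also have "\<dots> = \<Phi> (\<lambda>q. (f q * f q) *\<^sub>R \<zeta> q) p" using scale[OF C_closed(2)[OF f(1) f(1)] \<zeta>(1)] by simp
    also have "(\<lambda>q. (f q * f q) *\<^sub>R \<zeta> q) = (\<lambda>q. \<Sum>i<n. g i q *\<^sub>R e i q)" using g(2) by auto
    also have "\<Phi> (\<lambda>q. \<Sum>i<n. g i q *\<^sub>R e i q) = (\<lambda>q. \<Sum>i<n. \<Phi> (\<lambda>q. g i q *\<^sub>R e i q) q)"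
      using g(1) e K_closed(3) by (intro sum) auto
    also have "(\<Sum>i<n. \<Phi> (\<lambda>q. g i q *\<^sub>R e i q) p) = 0"
      using scale[OF g(1) e] g(3) by (intro sum.neutral) auto
    finally show ?thesis .
  qed
  have "\<Phi> (\<lambda>q. \<xi> q - \<eta> q) = (\<lambda>q. \<Phi> \<xi> q - \<Phi> \<eta> q)"
    using add[OF assms(3) K_closed(3)[OF C_const[of "-1"] assms(4)]] scale[OF C_const[of "-1"] assms(4)] by simp
  moreover have "\<Phi> (\<lambda>q. \<xi> q - \<eta> q) p = 0" using assms(3-5) K_closed(2) by (intro vanish) auto
  ultimately show ?thesis by simp
qed

end

subsection \<open>The tangent bundle\<close>

context manifold
begin

text \<open>The tangent bundle as a vector bundle, with the coordinates of the charts as trivialisations. It makes the results on sections of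
bundles available for vector fields.\<close>

definition tangent_bundle :: "('m, 'e, 'e, 'e) algebroid_data" where
  "tangent_bundle = \<lparr>atlas = \<A>, fibre = \<lambda>_. UNIV, trivs = (\<lambda>c. (fst c, tc c)) ` \<A>,
     bracket = \<lambda>X Y. X, anchor = \<lambda>p a. a\<rparr>"

lemma tangent_bundle_sections: "sections tangent_bundle = VF"
  by (auto simp: tangent_bundle_def sections_def vector_fields_def)

lemma tc_bij: "(U, x) \<in> \<A> \<Longrightarrow> p \<in> U \<Longrightarrow> bij_betw (tc (U, x) p) UNIV UNIV"
  by (rule bij_betw_byWitness[of _ "tv (U, x) p"]) auto

lemma tc_inv: "(U, x) \<in> \<A> \<Longrightarrow> p \<in> U \<Longrightarrow> inv_into UNIV (tc (U, x) p) w = tv (U, x) p w"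
  using inv_into_f_f[OF bij_betw_imp_inj_on[OF tc_bij], of U x p "tv (U, x) p w"] tc_tv[of U x p w] by simp

lemma tangent_transition:
  assumes "(U, x) \<in> \<A>" "(V, y) \<in> \<A>"
  shows "sm (U \<inter> V) (\<lambda>p. tc (V, y) p (inv_into UNIV (tc (U, x) p) w))"
proof -
  have o: "open (U \<inter> V)" using chart(1) assms by blast
  have "sm (U \<inter> V) (\<lambda>p. td y p (inv_into UNIV (tc (U, x) p) w))"
  proof (rule sm_td_chart[OF assms(1) chart(1)[OF assms(2)] o subset_refl sm_chart[OF assms(2)]])
    show "sm (U \<inter> V) (\<lambda>q. tc (U, x) q (inv_into UNIV (tc (U, x) q) w))"
      by (rule sm_cong[OF o sm_const[OF o, of w]]) (use assms in \<open>simp add: tc_inv\<close>)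
  qed
  then show ?thesis by (simp add: tangent_coord_def)
qed

lemma tangent_subbundle: "subbundle tangent_bundle (\<lambda>_. UNIV)"
proof
  have lin: "linear_map_on UNIV (tc (U, x) p)" if "(U, x) \<in> \<A>" "p \<in> U" for U x p
    using tc_linear[OF that] by (auto simp: linear_map_on_def linear_add linear_cmul)
  show "smooth_manifold (atlas tangent_bundle)" using smooth_manifold by (simp add: tangent_bundle_def)
  have cov: "\<exists>c\<in>\<A>. p \<in> fst c" for p using chart_at by blast
  show "vector_bundle (atlas tangent_bundle) (fibre tangent_bundle) (trivs tangent_bundle)"
    unfolding vector_bundle_def
    using cov fin_e smooth_manifold chart(1) lin tc_bij tangent_transition
    by (auto simp: tangent_bundle_def smooth_manifold_def)
  show "vector_subbundle tangent_bundle (\<lambda>_. UNIV)"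
  proof -
    have "\<exists>U \<phi>. p \<in> U \<and> adapted_triv tangent_bundle (\<lambda>_. UNIV) UNIV (U, \<phi>)" for p
    proof -
      obtain U x where c: "(U, x) \<in> \<A>" "p \<in> U" by (rule obtain_chart_at)
      have s: "sm (U \<inter> V) (\<lambda>p. tc (U, x) p (inv_into UNIV (tc (V, y) p) w))" if "(V, y) \<in> \<A>" for V y w
        using tangent_transition[OF that c(1)] by (simp add: Int_commute)
      have b: "range (tc (U, x) p) = UNIV" if "p \<in> U" for p using tc_bij[OF c(1) that] by (simp add: bij_betw_def)
      show ?thesis
        using c chart(1) lin tc_bij tangent_transition s b
        by (intro exI[of _ U] exI[of _ "tc (U, x)"]) (auto simp: tangent_bundle_def adapted_triv_def)
    qed
    then show ?thesis
      unfolding vector_subbundle_def by (auto simp: tangent_bundle_def intro: exI[of _ UNIV])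
  qed
qed

lemma VF_tensorial:
  fixes \<Phi> :: "('m \<Rightarrow> 'e) \<Rightarrow> 'm \<Rightarrow> 'z::real_vector"
  assumes "\<And>X Y. X \<in> VF \<Longrightarrow> Y \<in> VF \<Longrightarrow> \<Phi> (\<lambda>q. X q + Y q) = (\<lambda>q. \<Phi> X q + \<Phi> Y q)"
    and "\<And>f X. f \<in> C \<Longrightarrow> X \<in> VF \<Longrightarrow> \<Phi> (\<lambda>q. f q *\<^sub>R X q) = (\<lambda>q. f q *\<^sub>R \<Phi> X q)"
    and "X \<in> VF" "Y \<in> VF" "X p = Y p"
  shows "\<Phi> X p = \<Phi> Y p"
proof -
  interpret T: subbundle tangent_bundle "\<lambda>_. UNIV" by (rule tangent_subbundle)
  have VF: "sub_sections tangent_bundle (\<lambda>_. UNIV) = VF"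
    by (simp add: sub_sections_def tangent_bundle_sections)
  have A: "atlas tangent_bundle = \<A>" by (simp add: tangent_bundle_def)
  show ?thesis using T.tensorial[of \<Phi> X Y p] assms unfolding VF A by blast
qed

end

section \<open>Bundle-valued differential forms\<close>

lemma alternating_slot_linear:
  assumes "\<omega> \<in> alternating_maps V q" "length us + length vs + 1 = q"
  shows "linear (\<lambda>u. \<omega> (us @ u # vs))"
proof -
  have l: "linear (\<lambda>u. \<omega> (ws[i := u]))" if "length ws = q" "i < q" for ws i
    using assms(1) that unfolding alternating_maps_def by blast
  have "linear (\<lambda>u. \<omega> ((us @ 0 # vs)[length us := u]))"
    using assms(2) by (intro l) auto
  then show ?thesis by (simp add: list_update_append)
qed

lemma alternating_add:
  "\<omega> \<in> alternating_maps V q \<Longrightarrow> length us + length vs + 1 = q \<Longrightarrow> \<omega> (us @ (u + v) # vs) = \<omega> (us @ u # vs) + \<omega> (us @ v # vs)"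
  using linear_add[OF alternating_slot_linear] by blast

lemma alternating_scale:
  "\<omega> \<in> alternating_maps V q \<Longrightarrow> length us + length vs + 1 = q \<Longrightarrow> \<omega> (us @ (r *\<^sub>R u) # vs) = r *\<^sub>R \<omega> (us @ u # vs)"
  using linear_cmul[OF alternating_slot_linear] by blast

text \<open>Needed for the cut off coordinate fields in \<open>smooth_along_frame\<close>.\<close>

lemma alternating_scale_all:
  assumes "\<omega> \<in> alternating_maps V q" "length us + length vs = q"
  shows "\<omega> (us @ map (\<lambda>v. r *\<^sub>R v) vs) = r ^ length vs *\<^sub>R \<omega> (us @ vs)"
  using assms(2)
proof (induction vs arbitrary: us)
  case (Cons v vs)
  have "\<omega> (us @ map (\<lambda>v. r *\<^sub>R v) (v # vs)) = r *\<^sub>R \<omega> ((us @ [v]) @ map (\<lambda>v. r *\<^sub>R v) vs)"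
    using alternating_scale[OF assms(1), of us "map (\<lambda>v. r *\<^sub>R v) vs" r v] Cons.prems by simp
  then show ?case using Cons.IH[of "us @ [v]"] Cons.prems by simp
qed simp

lemma alternating_in: "\<omega> \<in> alternating_maps V q \<Longrightarrow> length vs = q \<Longrightarrow> \<omega> vs \<in> V"
  and alternating_wrong_length: "\<omega> \<in> alternating_maps V q \<Longrightarrow> length vs \<noteq> q \<Longrightarrow> \<omega> vs = 0"
  and alternating_repeat: "\<omega> \<in> alternating_maps V q \<Longrightarrow> length vs = q \<Longrightarrow> i < j \<Longrightarrow> j < q \<Longrightarrow> vs ! i = vs ! j \<Longrightarrow> \<omega> vs = 0"
  unfolding alternating_maps_def by blast+

lemma alternating_swap:
  assumes "\<omega> \<in> alternating_maps V q" "length us + length ws + length zs + 2 = q"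
  shows "\<omega> (us @ u # ws @ v # zs) = - \<omega> (us @ v # ws @ u # zs)"
proof -
  have rep: "\<omega> (us @ w # ws @ w # zs) = 0" for w
  proof -
    have "(us @ w # ws @ w # zs) ! length us = (us @ w # ws @ w # zs) ! (length us + Suc (length ws))"
      by (simp only: nth_append_length nth_append_length_plus) simp
    then show ?thesis
      using assms by (intro alternating_repeat[OF assms(1), of _ "length us" "length us + Suc (length ws)"]) auto
  qed
  have "\<omega> (us @ (u + v) # ws @ (u + v) # zs) = \<omega> (us @ u # ws @ (u + v) # zs) + \<omega> (us @ v # ws @ (u + v) # zs)"
    using assms by (intro alternating_add[OF assms(1)]) auto
  moreover have "\<omega> ((us @ w # ws) @ (u + v) # zs) = \<omega> ((us @ w # ws) @ u # zs) + \<omega> ((us @ w # ws) @ v # zs)" for w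
    using assms by (intro alternating_add[OF assms(1)]) auto
  ultimately show ?thesis using rep[of "u + v"] rep[of u] rep[of v] by (simp add: eq_neg_iff_add_eq_0)
qed

lemma alternating_to_front:
  assumes "\<omega> \<in> alternating_maps V q" "length us + length vs + 1 = q"
  shows "\<omega> (us @ u # vs) = (-1) ^ length us *\<^sub>R \<omega> (u # us @ vs)"
  using assms(2)
proof (induction us arbitrary: vs rule: rev_induct)
  case (snoc w us)
  have "\<omega> ((us @ [w]) @ u # vs) = - \<omega> (us @ u # w # vs)"
    using alternating_swap[OF assms(1), of us "[]" vs w u] snoc.prems by simp
  also have "\<omega> (us @ u # w # vs) = (-1) ^ length us *\<^sub>R \<omega> (u # us @ w # vs)"
    using snoc.prems by (intro snoc.IH) simp
  finally show ?case by simp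
qed simp

context subbundle
begin

lemma form_alternating: "\<gamma> \<in> forms L K q \<Longrightarrow> \<gamma> p \<in> alternating_maps (K p) q"
  by (simp add: forms_def)

text \<open>The vector fields are replaced one after the other by their expansions in the coordinate fields of a chart.\<close>

lemma eval_form_section:
  assumes "\<gamma> \<in> forms L K q" "set Xs \<subseteq> VF" "length Xs = q"
  shows "eval_form \<gamma> Xs \<in> \<K>"
proof -
  note alt = form_alternating[OF assms(1)]
  obtain n :: nat and b :: "nat \<Rightarrow> 'e" where b: "\<And>w. w = (\<Sum>i<n. (w \<bullet> b i) *\<^sub>R b i)"
    by (rule subspace_onb[OF fin_e subspace_UNIV]) (metis UNIV_I)
  have mixed: "sm (U \<inter> V) (\<lambda>p. \<phi> p (\<gamma> p (map (\<lambda>X. X p) Xs @ map (tv (V, x) p) es)))"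
    if tr: "(U, \<phi>) \<in> trivs L" and c: "(V, x) \<in> atlas L" and "set Xs \<subseteq> VF" "length Xs + length es = q" for U \<phi> V x Xs es
    using that(3,4)
  proof (induction Xs arbitrary: es rule: rev_induct)
    case Nil
    then show ?case using assms(1) tr c unfolding forms_def by fastforce
  next
    case (snoc X Xs)
    have X: "X \<in> VF" "set Xs \<subseteq> VF" using snoc.prems by auto
    have o: "open (U \<inter> V)" using trivs_open[OF tr] chart(1)[OF c] by auto
    have "sm (U \<inter> V) (\<lambda>p. \<Sum>i<n. (tc (V, x) p (X p) \<bullet> b i) *\<^sub>R
        \<phi> p (\<gamma> p (map (\<lambda>X. X p) Xs @ map (tv (V, x) p) (b i # es))))"
      using snoc.prems X by (intro sm_sum sm_scaleR sm_inner_left o snoc.IH sm_subset[OF VF_D[OF X(1) c]]) auto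
    then show ?case
    proof (rule sm_cong[OF o])
      fix p assume p: "p \<in> U \<inter> V"
      have lin: "linear (\<lambda>u. \<gamma> p (map (\<lambda>X. X p) Xs @ u # map (tv (V, x) p) es))"
        using snoc.prems by (intro alternating_slot_linear[OF alt]) auto
      have ltv: "linear (tv (V, x) p)" using tv_linear[OF c] p by auto
      have "X p = tv (V, x) p (\<Sum>i<n. (tc (V, x) p (X p) \<bullet> b i) *\<^sub>R b i)"
        using b[of "tc (V, x) p (X p)"] tv_tc[OF c, of p "X p"] p by simp
      then have "X p = (\<Sum>i<n. (tc (V, x) p (X p) \<bullet> b i) *\<^sub>R tv (V, x) p (b i))"
        by (simp add: linear_sum[OF ltv] linear_cmul[OF ltv])
      then have "\<gamma> p (map (\<lambda>X. X p) (Xs @ [X]) @ map (tv (V, x) p) es) =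
          \<gamma> p (map (\<lambda>X. X p) Xs @ (\<Sum>i<n. (tc (V, x) p (X p) \<bullet> b i) *\<^sub>R tv (V, x) p (b i)) # map (tv (V, x) p) es)"
        by simp
      also have "\<dots> = (\<Sum>i<n. (tc (V, x) p (X p) \<bullet> b i) *\<^sub>R \<gamma> p (map (\<lambda>X. X p) Xs @ map (tv (V, x) p) (b i # es)))"
        using linear_sum[OF lin, of "\<lambda>i. (tc (V, x) p (X p) \<bullet> b i) *\<^sub>R tv (V, x) p (b i)" "{..<n}"]
        by (simp add: linear_cmul[OF lin])
      finally have e: "\<gamma> p (map (\<lambda>X. X p) (Xs @ [X]) @ map (tv (V, x) p) es) = \<dots>" .
      have "\<gamma> p (map (\<lambda>X. X p) Xs @ map (tv (V, x) p) (b i # es)) \<in> fibre L p" for i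
        using snoc.prems by (intro K_fibre alternating_in[OF alt]) auto
      then show "(\<Sum>i<n. (tc (V, x) p (X p) \<bullet> b i) *\<^sub>R
          \<phi> p (\<gamma> p (map (\<lambda>X. X p) Xs @ map (tv (V, x) p) (b i # es)))) =
          \<phi> p (\<gamma> p (map (\<lambda>X. X p) (Xs @ [X]) @ map (tv (V, x) p) es))"
        unfolding e using p by (intro triv_sum[OF trivs_triv[OF tr], symmetric]) auto
    qed
  qed
  have K: "eval_form \<gamma> Xs p \<in> K p" for p
    unfolding eval_form_def using assms by (intro alternating_in[OF alt]) auto
  moreover have "eval_form \<gamma> Xs \<in> \<Gamma>"
  proof (rule sectionI)
    show "eval_form \<gamma> Xs p \<in> fibre L p" for p by (rule K_fibre[OF K])
    fix U \<phi> assume tr: "(U, \<phi>) \<in> trivs L"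
    show "sm U (\<lambda>q. \<phi> q (eval_form \<gamma> Xs q))"
    proof (rule sm_local)
      fix p assume p: "p \<in> U"
      obtain V x where c: "(V, x) \<in> atlas L" "p \<in> V" by (rule obtain_chart_at)
      then show "\<exists>V. open V \<and> p \<in> V \<and> sm V (\<lambda>q. \<phi> q (eval_form \<gamma> Xs q))"
        using mixed[OF tr c(1) assms(2), of "[]"] assms(3) trivs_open[OF tr] chart(1)[OF c(1)] p
        by (intro exI[of _ "U \<inter> V"]) (auto simp: eval_form_def)
    qed
  qed
  ultimately show ?thesis by (auto simp: sub_sections_def)
qed

text \<open>Coordinate fields become global vector fields after multiplication by a bump function \<open>f\<close>; this introduces the factor \<open>f\<^sup>q\<close>,
which is invertible near the given point.\<close>

lemma smooth_along_frame:
  assumes alt: "\<And>p. \<gamma> p \<in> alternating_maps V q" and sec: "\<And>Xs. set Xs \<subseteq> VF \<Longrightarrow> length Xs = q \<Longrightarrow> eval_form \<gamma> Xs \<in> \<Gamma>"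
    and V: "\<And>p vs. \<gamma> p vs \<in> fibre L p"
    and tr: "(U, \<phi>) \<in> trivs L" and c: "c \<in> atlas L"
  shows "sm (U \<inter> fst c) (\<lambda>p. \<phi> p (\<gamma> p (map (tv c p) es)))"
proof -
  obtain V x where c': "c = (V, x)" by force
  note c = c[unfolded c']
  note t = trivs_triv[OF tr]
  have oUV: "open (U \<inter> V)" using trivs_open[OF tr] chart(1)[OF c] by auto
  show ?thesis
  proof (cases "length es = q")
    case False
    have "sm (U \<inter> V) (\<lambda>p. \<phi> p (\<gamma> p (map (tv c p) es)))"
      by (rule sm_cong[OF oUV sm_const[OF oUV, of 0]])
        (use False alternating_wrong_length[OF alt] triv_linear(3)[OF t] in auto)
    then show ?thesis by (simp add: c')
  next
    case True
    show ?thesis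
    proof (rule sm_local)
      fix p assume "p \<in> U \<inter> fst c"
      then have p: "p \<in> U" "p \<in> V" by (auto simp: c')
      obtain f S where f: "f \<in> C" "f p = 1" "closed S" "S \<subseteq> V" "\<And>q. q \<notin> S \<Longrightarrow> f q = 0"
        using bump[OF chart(1)[OF c] p(2)] by metis
      define Xs where "Xs = map (\<lambda>w q. f q *\<^sub>R tv (V, x) q w) es"
      have Xs: "set Xs \<subseteq> VF" "length Xs = q"
        using VF_bump_frame[OF c f(1,3,4,5)] True by (auto simp: Xs_def)
      have ev: "eval_form \<gamma> Xs q' = f q' ^ q *\<^sub>R \<gamma> q' (map (tv (V, x) q') es)" for q'
        using alternating_scale_all[OF alt[of q'], of "[]" "map (tv (V, x) q') es" "f q'"] True
        by (simp add: eval_form_def Xs_def comp_def)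
      let ?N = "U \<inter> V \<inter> {q. f q \<noteq> 0}"
      have N: "open ?N" "p \<in> ?N" using oUV open_nonzero[OF f(1)] p f(2) by auto
      have fp: "sm UNIV (\<lambda>q. f q ^ m)" for m
      proof (induction m)
        case (Suc m)
        then show ?case using sm_mult[of UNIV f] f(1) by simp
      qed (simp add: sm_const)
      have "sm ?N (\<lambda>q'. inverse (f q' ^ q) *\<^sub>R \<phi> q' (eval_form \<gamma> Xs q'))"
        by (intro sm_scaleR N sm_inverse sm_subset[OF fp] sm_subset[OF section_sm[OF sec[OF Xs] t]]) auto
      then have "sm ?N (\<lambda>q'. \<phi> q' (\<gamma> q' (map (tv c q') es)))"
        by (rule sm_cong[OF N(1)]) (use V in \<open>auto simp: ev c' triv_linear[OF t]\<close>)
      then show "\<exists>N. open N \<and> p \<in> N \<and> sm N (\<lambda>q'. \<phi> q' (\<gamma> q' (map (tv c q') es)))" using N by blast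
    qed
  qed
qed

lemma formI:
  assumes alt: "\<And>p. \<gamma> p \<in> alternating_maps (K p) q"
    and sec: "\<And>Xs. set Xs \<subseteq> VF \<Longrightarrow> length Xs = q \<Longrightarrow> eval_form \<gamma> Xs \<in> \<Gamma>"
  shows "\<gamma> \<in> forms L K q"
proof -
  have fib: "\<gamma> p vs \<in> fibre L p" for p vs
    using alternating_in[OF alt[of p], of vs] alternating_wrong_length[OF alt[of p], of vs] K_fibre subspace_0[OF K_subspace]
    by (cases "length vs = q") auto
  have alt': "\<gamma> p \<in> alternating_maps UNIV q" for p using alt[of p] by (auto simp: alternating_maps_def)
  show ?thesis unfolding forms_def
    using alt smooth_along_frame[OF alt' sec fib] by auto
qed

text \<open>By \<open>VF_tensorial\<close>, applied to one argument after the other, the value at \<open>p\<close> depends only on the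
values of the vector fields at \<open>p\<close>.\<close>

lemma form_of_multilinear:
  fixes \<Phi> :: "('m \<Rightarrow> 'e) list \<Rightarrow> 'm \<Rightarrow> 'v"
  assumes sec: "\<And>Xs. set Xs \<subseteq> VF \<Longrightarrow> length Xs = q \<Longrightarrow> \<Phi> Xs \<in> \<K>"
    and add: "\<And>Xs Ys X Y. set Xs \<subseteq> VF \<Longrightarrow> set Ys \<subseteq> VF \<Longrightarrow> X \<in> VF \<Longrightarrow> Y \<in> VF \<Longrightarrow> length Xs + length Ys + 1 = q \<Longrightarrow>
      \<Phi> (Xs @ (\<lambda>p. X p + Y p) # Ys) = (\<lambda>p. \<Phi> (Xs @ X # Ys) p + \<Phi> (Xs @ Y # Ys) p)"
    and scale: "\<And>Xs Ys X f. set Xs \<subseteq> VF \<Longrightarrow> set Ys \<subseteq> VF \<Longrightarrow> X \<in> VF \<Longrightarrow> f \<in> C \<Longrightarrow> length Xs + length Ys + 1 = q \<Longrightarrow>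
      \<Phi> (Xs @ (\<lambda>p. f p *\<^sub>R X p) # Ys) = (\<lambda>p. f p *\<^sub>R \<Phi> (Xs @ X # Ys) p)"
    and alt: "\<And>Xs i j. set Xs \<subseteq> VF \<Longrightarrow> length Xs = q \<Longrightarrow> i < j \<Longrightarrow> j < q \<Longrightarrow> Xs ! i = Xs ! j \<Longrightarrow> \<Phi> Xs = (\<lambda>p. 0)"
  obtains \<gamma> where "\<gamma> \<in> forms L K q" "\<And>Xs. set Xs \<subseteq> VF \<Longrightarrow> length Xs = q \<Longrightarrow> eval_form \<gamma> Xs = \<Phi> Xs"
    "\<And>p vs. \<gamma> p vs = (if length vs = q then \<Phi> (map (vf_ext (atlas L) p) vs) p else 0)"
proof -
  have point: "\<Phi> (Zs @ Xs) p = \<Phi> (Zs @ Ys) p"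
    if "map (\<lambda>X. X p) Xs = map (\<lambda>X. X p) Ys" "set Xs \<subseteq> VF" "set Ys \<subseteq> VF" "set Zs \<subseteq> VF" "length Zs + length Xs = q" for Xs Ys Zs p
    using that
  proof (induction Xs arbitrary: Ys Zs)
    case (Cons X Xs)
    then obtain Y Ys' where Ys: "Ys = Y # Ys'" "X p = Y p" "map (\<lambda>X. X p) Xs = map (\<lambda>X. X p) Ys'"
      by (auto simp: Cons_eq_map_conv)
    have mem: "X \<in> VF" "Y \<in> VF" "set Xs \<subseteq> VF" "set Ys' \<subseteq> VF" using Cons.prems Ys(1) by auto
    have "\<Phi> (Zs @ X # Xs) p = \<Phi> (Zs @ Y # Xs) p"
    proof (rule VF_tensorial[of "\<lambda>X. \<Phi> (Zs @ X # Xs)", OF _ _ mem(1,2) Ys(2)])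
      show "\<Phi> (Zs @ (\<lambda>q. X q + Y q) # Xs) = (\<lambda>q. \<Phi> (Zs @ X # Xs) q + \<Phi> (Zs @ Y # Xs) q)"
        if "X \<in> VF" "Y \<in> VF" for X Y using Cons.prems mem that by (intro add) auto
      show "\<Phi> (Zs @ (\<lambda>q. f q *\<^sub>R X q) # Xs) = (\<lambda>q. f q *\<^sub>R \<Phi> (Zs @ X # Xs) q)"
        if "f \<in> C" "X \<in> VF" for f X using Cons.prems mem that by (intro scale) auto
    qed
    also have "\<dots> = \<Phi> ((Zs @ [Y]) @ Xs) p" by simp
    also have "\<dots> = \<Phi> ((Zs @ [Y]) @ Ys') p" using Cons.prems mem Ys(3) by (intro Cons.IH) auto
    finally show ?case by (simp add: Ys(1))
  qed simp
  define \<gamma> where "\<gamma> p vs = (if length vs = q then \<Phi> (map (vf_ext (atlas L) p) vs) p else 0)" for p vs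
  have extVF: "set (map (vf_ext (atlas L) p) vs) \<subseteq> VF" for p vs using vf_ext(1) by auto
  have ev: "eval_form \<gamma> Xs = \<Phi> Xs" if "set Xs \<subseteq> VF" "length Xs = q" for Xs
  proof
    fix p
    have "\<Phi> ([] @ map (vf_ext (atlas L) p) (map (\<lambda>X. X p) Xs)) p = \<Phi> ([] @ Xs) p"
      by (rule point) (use that in \<open>auto simp: vf_ext\<close>)
    then show "eval_form \<gamma> Xs p = \<Phi> Xs p" using that by (simp add: eval_form_def \<gamma>_def)
  qed
  have slot: "\<gamma> p (us @ X p # vs) = \<Phi> (map (vf_ext (atlas L) p) us @ X # map (vf_ext (atlas L) p) vs) p"
    if "X \<in> VF" "length us + length vs + 1 = q" for X p us vs
  proof -
    let ?Xs = "map (vf_ext (atlas L) p) us @ X # map (vf_ext (atlas L) p) vs"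
    have "set ?Xs \<subseteq> VF" "length ?Xs = q" using that vf_ext(1) by auto
    then have "eval_form \<gamma> ?Xs p = \<Phi> ?Xs p" using ev by simp
    then show ?thesis by (simp add: eval_form_def comp_def vf_ext(2))
  qed
  have "\<gamma> p \<in> alternating_maps (K p) q" for p
    unfolding alternating_maps_def
  proof (intro CollectI conjI allI impI)
    show "\<gamma> p vs \<in> K p" if "length vs = q" for vs
      using that sec[OF extVF[of p vs]] section_K by (simp add: \<gamma>_def)
    show "\<gamma> p vs = 0" if "length vs \<noteq> q" for vs using that by (simp add: \<gamma>_def)
    show "linear (\<lambda>u. \<gamma> p (vs[i := u]))" if "length vs = q \<and> i < q" for vs i
    proof -
      let ?us = "take i vs" and ?ws = "drop (Suc i) vs"
      have upd: "vs[i := u] = ?us @ u # ?ws" for u using that by (simp add: upd_conv_take_nth_drop)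
      have len: "length ?us + length ?ws + 1 = q" using that by simp
      note X = vf_ext(1)[of p] and X' = vf_ext(2)[of p]
      have e: "set (map (vf_ext (atlas L) p) us) \<subseteq> VF" for us by (rule extVF)
      show ?thesis
      proof (rule linearI)
        fix u w
        have "\<gamma> p (?us @ (u + w) # ?ws) = \<Phi> (map (vf_ext (atlas L) p) ?us @ (\<lambda>q. vf_ext (atlas L) p u q + vf_ext (atlas L) p w q) # map (vf_ext (atlas L) p) ?ws) p"
          using slot[OF VF_add[OF X[of u] X[of w]] len, of p] by (simp add: X')
        also have "\<dots> = \<gamma> p (?us @ u # ?ws) + \<gamma> p (?us @ w # ?ws)"
        proof -
          have "\<Phi> (map (vf_ext (atlas L) p) ?us @ (\<lambda>q. vf_ext (atlas L) p u q + vf_ext (atlas L) p w q) # map (vf_ext (atlas L) p) ?ws) =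
              (\<lambda>q. \<Phi> (map (vf_ext (atlas L) p) ?us @ vf_ext (atlas L) p u # map (vf_ext (atlas L) p) ?ws) q
                + \<Phi> (map (vf_ext (atlas L) p) ?us @ vf_ext (atlas L) p w # map (vf_ext (atlas L) p) ?ws) q)"
            using len by (intro add e X) simp
          then show ?thesis using slot[OF X len, of p u] slot[OF X len, of p w] by (simp add: X')
        qed
        finally show "\<gamma> p (vs[i := u + w]) = \<gamma> p (vs[i := u]) + \<gamma> p (vs[i := w])" unfolding upd .
      next
        fix r u
        have "\<gamma> p (?us @ (r *\<^sub>R u) # ?ws) = \<Phi> (map (vf_ext (atlas L) p) ?us @ (\<lambda>q. r *\<^sub>R vf_ext (atlas L) p u q) # map (vf_ext (atlas L) p) ?ws) p"
          using slot[OF VF_scale[OF C_const[of r] X[of u]] len, of p] by (simp add: X')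
        also have "\<dots> = r *\<^sub>R \<gamma> p (?us @ u # ?ws)"
        proof -
          have "\<Phi> (map (vf_ext (atlas L) p) ?us @ (\<lambda>q. r *\<^sub>R vf_ext (atlas L) p u q) # map (vf_ext (atlas L) p) ?ws) =
              (\<lambda>q. r *\<^sub>R \<Phi> (map (vf_ext (atlas L) p) ?us @ vf_ext (atlas L) p u # map (vf_ext (atlas L) p) ?ws) q)"
            using len by (intro scale e X C_const) simp
          then show ?thesis using slot[OF X len, of p u] by (simp add: X')
        qed
        finally show "\<gamma> p (vs[i := r *\<^sub>R u]) = r *\<^sub>R \<gamma> p (vs[i := u])" unfolding upd .
      qed
    qed
    show "\<gamma> p vs = 0" if "length vs = q \<and> i < j \<and> j < q \<and> vs ! i = vs ! j" for vs i j
      using that alt[OF extVF[of p vs], of i j] by (simp add: \<gamma>_def)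
  qed
  then have "\<gamma> \<in> forms L K q"
  proof (rule formI)
    show "eval_form \<gamma> Xs \<in> \<Gamma>" if "set Xs \<subseteq> VF" "length Xs = q" for Xs
      using ev[OF that] sec[OF that] K_sec by simp
  qed
  then show ?thesis using that[of \<gamma>] ev \<gamma>_def by blast
qed

end

section \<open>Semisimple bundles of ideals\<close>

context subbundle
begin

lemma triv_subset:
  assumes "triv U \<phi>" "open N" "N \<subseteq> U"
  shows "triv N \<phi>"
proof -
  have "sm (N \<inter> V) (\<lambda>p. \<psi> p (iv \<phi> p w))"
    "sm (N \<inter> V) (\<lambda>p. \<phi> p (inv_into (fibre L p) (\<psi> p) w))" if "(V, \<psi>) \<in> trivs L" for V \<psi> w
    by (rule sm_subset[OF triv_props(4)[OF assms(1) that]] sm_subset[OF triv_props(5)[OF assms(1) that]];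
        use assms(3) in auto)+
  moreover have "linear_map_on (fibre L p) (\<phi> p)" "bij_betw (\<phi> p) (fibre L p) UNIV" if "p \<in> N" for p
    using triv_props(2,3)[OF assms(1)] assms(3) that by blast+
  ultimately show ?thesis
    unfolding triv_def adapted_triv_def using assms(2) by (auto simp: bij_betw_def)
qed

end

locale semisimple_ideal =
  fixes L :: "('m::{t2_space, second_countable_topology}, 'e::real_inner, 'v::real_vector, 'f::real_inner) algebroid_data"
    and K :: "'m \<Rightarrow> 'v set"
  assumes algebroid: "lie_algebroid L" and semisimple_ideal: "semisimple_bundle_of_ideals L K"
begin

sublocale subbundle L K
  using algebroid semisimple_ideal
  by unfold_locales (auto simp: lie_algebroid_def semisimple_bundle_of_ideals_def bundle_of_ideals_def)

lemma full_subbundle: "subbundle L (fibre L)"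
proof
  have "\<exists>U \<phi>. p \<in> U \<and> adapted_triv L (fibre L) UNIV (U, \<phi>)" for p
    using triv_cover[of p] trivs_triv unfolding triv_def by metis
  then show "vector_subbundle L (fibre L)"
    unfolding vector_subbundle_def using fibre_subspace by (auto intro: exI[of _ UNIV])
qed (use smooth_manifold_atlas vector_bundle in auto)

lemma section_through_fibre:
  assumes "a \<in> fibre L p"
  obtains \<alpha> where "\<alpha> \<in> \<Gamma>" "\<alpha> p = a"
proof -
  interpret F: subbundle L "fibre L" by (rule full_subbundle)
  show ?thesis using F.section_through[OF assms] that F.K_sec by blast
qed

lemma sec_ext:
  assumes "a \<in> fibre L p"
  shows "sec_ext L p a \<in> \<Gamma>" "sec_ext L p a p = a"
proof -
  have "\<exists>\<alpha>. \<alpha> \<in> \<Gamma> \<and> \<alpha> p = a" using section_through_fibre[OF assms] by metis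
  then have "sec_ext L p a \<in> \<Gamma> \<and> sec_ext L p a p = a" unfolding sec_ext_def by (rule someI_ex)
  then show "sec_ext L p a \<in> \<Gamma>" "sec_ext L p a p = a" by auto
qed

abbreviation "br \<equiv> bracket L"
abbreviation "\<rho> \<equiv> anchor_sec L"

lemma br_closed: "\<alpha> \<in> \<Gamma> \<Longrightarrow> \<beta> \<in> \<Gamma> \<Longrightarrow> br \<alpha> \<beta> \<in> \<Gamma>"
  using algebroid unfolding lie_algebroid_def by blast

lemma br_linear_left:
  "\<alpha> \<in> \<Gamma> \<Longrightarrow> \<beta> \<in> \<Gamma> \<Longrightarrow> \<eta> \<in> \<Gamma> \<Longrightarrow>
    br (\<lambda>p. r *\<^sub>R \<alpha> p + s *\<^sub>R \<beta> p) \<eta> = (\<lambda>p. r *\<^sub>R br \<alpha> \<eta> p + s *\<^sub>R br \<beta> \<eta> p)"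
  using algebroid unfolding lie_algebroid_def by blast

lemma br_anti: "\<alpha> \<in> \<Gamma> \<Longrightarrow> \<beta> \<in> \<Gamma> \<Longrightarrow> br \<alpha> \<beta> = (\<lambda>p. - br \<beta> \<alpha> p)"
  using algebroid unfolding lie_algebroid_def by blast

lemma br_jacobi0: "\<alpha> \<in> \<Gamma> \<Longrightarrow> \<beta> \<in> \<Gamma> \<Longrightarrow> \<eta> \<in> \<Gamma> \<Longrightarrow>
    (\<lambda>p. br \<alpha> (br \<beta> \<eta>) p + br \<beta> (br \<eta> \<alpha>) p + br \<eta> (br \<alpha> \<beta>) p) = (\<lambda>p. 0)"
  using algebroid unfolding lie_algebroid_def by blast

lemma br_leibniz: "\<alpha> \<in> \<Gamma> \<Longrightarrow> \<beta> \<in> \<Gamma> \<Longrightarrow> f \<in> C \<Longrightarrow>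
    br \<alpha> (\<lambda>p. f p *\<^sub>R \<beta> p) = (\<lambda>p. f p *\<^sub>R br \<alpha> \<beta> p + td f p (\<rho> \<alpha> p) *\<^sub>R \<beta> p)"
  using algebroid unfolding lie_algebroid_def anchor_sec_def by blast

lemma anchor_linear: "linear_map_on (fibre L p) (anchor L p)"
  using algebroid unfolding lie_algebroid_def by blast

lemma anchor_smooth: "(U, \<phi>) \<in> trivs L \<Longrightarrow> (V, x) \<in> atlas L \<Longrightarrow>
    sm (U \<inter> V) (\<lambda>p. tc (V, x) p (anchor L p (iv \<phi> p w)))"
proof -
  have "\<forall>(U, \<phi>)\<in>trivs L. \<forall>(V, x)\<in>atlas L. \<forall>w.
      sm (U \<inter> V) (\<lambda>p. tc (V, x) p (anchor L p (iv \<phi> p w)))"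
    using algebroid unfolding lie_algebroid_def by (elim conjE) assumption
  then show "(U, \<phi>) \<in> trivs L \<Longrightarrow> (V, x) \<in> atlas L \<Longrightarrow>
    sm (U \<inter> V) (\<lambda>p. tc (V, x) p (anchor L p (iv \<phi> p w)))" by fast
qed

lemma br_scale_left: "\<alpha> \<in> \<Gamma> \<Longrightarrow> \<eta> \<in> \<Gamma> \<Longrightarrow> br (\<lambda>p. r *\<^sub>R \<alpha> p) \<eta> = (\<lambda>p. r *\<^sub>R br \<alpha> \<eta> p)"
  using br_linear_left[of \<alpha> \<alpha> \<eta> r 0] by simp

lemma br_add_left: "\<alpha> \<in> \<Gamma> \<Longrightarrow> \<beta> \<in> \<Gamma> \<Longrightarrow> \<eta> \<in> \<Gamma> \<Longrightarrow> br (\<lambda>p. \<alpha> p + \<beta> p) \<eta> = (\<lambda>p. br \<alpha> \<eta> p + br \<beta> \<eta> p)"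
  using br_linear_left[of \<alpha> \<beta> \<eta> 1 1] by simp

lemma br_diff_left: "\<alpha> \<in> \<Gamma> \<Longrightarrow> \<beta> \<in> \<Gamma> \<Longrightarrow> \<eta> \<in> \<Gamma> \<Longrightarrow> br (\<lambda>p. \<alpha> p - \<beta> p) \<eta> = (\<lambda>p. br \<alpha> \<eta> p - br \<beta> \<eta> p)"
  using br_linear_left[of \<alpha> \<beta> \<eta> 1 "-1"] by simp

lemma br_minus_left: "\<alpha> \<in> \<Gamma> \<Longrightarrow> \<eta> \<in> \<Gamma> \<Longrightarrow> br (\<lambda>p. - \<alpha> p) \<eta> = (\<lambda>p. - br \<alpha> \<eta> p)"
  using br_scale_left[of \<alpha> \<eta> "-1"] by simp

lemma br_zero_left: "\<eta> \<in> \<Gamma> \<Longrightarrow> br (\<lambda>p. 0) \<eta> = (\<lambda>p. 0)"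
  using br_scale_left[of "\<lambda>p. 0" \<eta> 0] section_0 by simp

lemma br_add: "\<alpha> \<in> \<Gamma> \<Longrightarrow> \<beta> \<in> \<Gamma> \<Longrightarrow> \<eta> \<in> \<Gamma> \<Longrightarrow> br \<eta> (\<lambda>p. \<alpha> p + \<beta> p) = (\<lambda>p. br \<eta> \<alpha> p + br \<eta> \<beta> p)"
  using br_anti[of \<eta> "\<lambda>p. \<alpha> p + \<beta> p"] br_anti[of \<eta> \<alpha>] br_anti[of \<eta> \<beta>] by (simp add: section_add br_add_left)

lemma br_diff: "\<alpha> \<in> \<Gamma> \<Longrightarrow> \<beta> \<in> \<Gamma> \<Longrightarrow> \<eta> \<in> \<Gamma> \<Longrightarrow> br \<eta> (\<lambda>p. \<alpha> p - \<beta> p) = (\<lambda>p. br \<eta> \<alpha> p - br \<eta> \<beta> p)"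
  using br_anti[of \<eta> "\<lambda>p. \<alpha> p - \<beta> p"] br_anti[of \<eta> \<alpha>] br_anti[of \<eta> \<beta>] by (simp add: section_diff br_diff_left)

lemma br_scale: "\<alpha> \<in> \<Gamma> \<Longrightarrow> \<eta> \<in> \<Gamma> \<Longrightarrow> br \<eta> (\<lambda>p. r *\<^sub>R \<alpha> p) = (\<lambda>p. r *\<^sub>R br \<eta> \<alpha> p)"
  using br_leibniz[of \<eta> \<alpha> "\<lambda>p. r"] by (simp add: sm_const)

lemma br_minus: "\<alpha> \<in> \<Gamma> \<Longrightarrow> \<eta> \<in> \<Gamma> \<Longrightarrow> br \<eta> (\<lambda>p. - \<alpha> p) = (\<lambda>p. - br \<eta> \<alpha> p)"
  using br_scale[of \<alpha> \<eta> "-1"] by simp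

lemma br_zero: "\<eta> \<in> \<Gamma> \<Longrightarrow> br \<eta> (\<lambda>p. 0) = (\<lambda>p. 0)"
  using br_scale[of "\<lambda>p. 0" \<eta> 0] section_0 by simp

lemma br_jacobi:
  assumes "\<alpha> \<in> \<Gamma>" "\<beta> \<in> \<Gamma>" "\<eta> \<in> \<Gamma>"
  shows "br \<alpha> (br \<beta> \<eta>) p = br (br \<alpha> \<beta>) \<eta> p + br \<beta> (br \<alpha> \<eta>) p"
proof -
  have "br \<alpha> (br \<beta> \<eta>) p + br \<beta> (br \<eta> \<alpha>) p + br \<eta> (br \<alpha> \<beta>) p = 0"
    using fun_cong[OF br_jacobi0[OF assms], of p] .
  moreover have "br \<eta> (br \<alpha> \<beta>) p = - br (br \<alpha> \<beta>) \<eta> p"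
    using fun_cong[OF br_anti[OF assms(3) br_closed[OF assms(1,2)]], of p] .
  moreover have "br \<beta> (br \<eta> \<alpha>) p = - br \<beta> (br \<alpha> \<eta>) p"
    unfolding br_anti[OF assms(3,1)] br_minus[OF br_closed[OF assms(1,3)] assms(2)] by simp
  ultimately show ?thesis by (simp add: algebra_simps eq_neg_iff_add_eq_0)
qed

lemma anchor_VF:
  assumes "\<alpha> \<in> \<Gamma>"
  shows "\<rho> \<alpha> \<in> VF"
proof (rule VF_I_local)
  fix p
  obtain U \<phi> where U: "(U, \<phi>) \<in> trivs L" "p \<in> U" by (rule triv_cover)
  obtain V x where V: "(V, x) \<in> atlas L" "p \<in> V" by (rule obtain_chart_at)
  note t = trivs_triv[OF U(1)]
  obtain n :: nat and b :: "nat \<Rightarrow> 'f" where b: "\<And>w. w = (\<Sum>i<n. (w \<bullet> b i) *\<^sub>R b i)"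
    by (rule subspace_onb[OF fin_f subspace_UNIV]) (metis UNIV_I)
  have o: "open (U \<inter> V)" using trivs_open[OF U(1)] chart(1)[OF V(1)] by auto
  have "sm (U \<inter> V) (\<lambda>q. \<Sum>i<n. (\<phi> q (\<alpha> q) \<bullet> b i) *\<^sub>R tc (V, x) q (anchor L q (iv \<phi> q (b i))))"
    by (intro sm_sum sm_scaleR sm_inner_left o sm_subset[OF section_sm[OF assms t]] anchor_smooth[OF U(1) V(1)]) auto
  then have "sm (U \<inter> V) (\<lambda>q. tc (V, x) q (\<rho> \<alpha> q))"
  proof (rule sm_cong[OF o])
    fix q assume "q \<in> U \<inter> V"
    then have q: "q \<in> U" "q \<in> V" by auto
    have "\<alpha> q = iv \<phi> q (\<phi> q (\<alpha> q))"
      using triv_iv(3)[OF t q(1) section_fibre[OF assms]] by simp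
    also have "\<dots> = (\<Sum>i<n. (\<phi> q (\<alpha> q) \<bullet> b i) *\<^sub>R iv \<phi> q (b i))"
      by (rule iv_expand[OF t q(1) b])
    finally have "\<rho> \<alpha> q = anchor L q (\<Sum>i<n. (\<phi> q (\<alpha> q) \<bullet> b i) *\<^sub>R iv \<phi> q (b i))"
      by (simp add: anchor_sec_def)
    also have "\<dots> = (\<Sum>i<n. (\<phi> q (\<alpha> q) \<bullet> b i) *\<^sub>R anchor L q (iv \<phi> q (b i)))"
      by (intro linear_map_on_sum[OF anchor_linear fibre_subspace] triv_iv(1)[OF t q(1)])
    finally have e: "\<rho> \<alpha> q = (\<Sum>i<n. (\<phi> q (\<alpha> q) \<bullet> b i) *\<^sub>R anchor L q (iv \<phi> q (b i)))" .
    show "(\<Sum>i<n. (\<phi> q (\<alpha> q) \<bullet> b i) *\<^sub>R tc (V, x) q (anchor L q (iv \<phi> q (b i)))) = tc (V, x) q (\<rho> \<alpha> q)"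
      unfolding e linear_sum[OF tc_linear[OF V(1) q(2)]] linear_cmul[OF tc_linear[OF V(1) q(2)]] ..
  qed
  then show "\<exists>U x V. (U, x) \<in> atlas L \<and> open V \<and> p \<in> V \<and> V \<subseteq> U \<and> sm V (\<lambda>q. tc (U, x) q (\<rho> \<alpha> q))"
    using o U V by blast
qed

lemma anchor_add: "\<alpha> \<in> \<Gamma> \<Longrightarrow> \<beta> \<in> \<Gamma> \<Longrightarrow> \<rho> (\<lambda>p. \<alpha> p + \<beta> p) = (\<lambda>p. \<rho> \<alpha> p + \<rho> \<beta> p)"
  and anchor_scale: "\<alpha> \<in> \<Gamma> \<Longrightarrow> \<rho> (\<lambda>p. f p *\<^sub>R \<alpha> p) = (\<lambda>p. f p *\<^sub>R \<rho> \<alpha> p)"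
  using linear_map_onD[OF anchor_linear] section_fibre by (auto simp: anchor_sec_def)

lemma anchor_K: "\<xi> \<in> \<K> \<Longrightarrow> \<rho> \<xi> = (\<lambda>p. 0)"
  using semisimple_ideal section_K by (auto simp: anchor_sec_def semisimple_bundle_of_ideals_def bundle_of_ideals_def)

lemma anchor_diff: "\<alpha> \<in> \<Gamma> \<Longrightarrow> \<beta> \<in> \<Gamma> \<Longrightarrow> \<rho> (\<lambda>p. \<alpha> p - \<beta> p) = (\<lambda>p. \<rho> \<alpha> p - \<rho> \<beta> p)"
  using anchor_add[of \<alpha> "\<lambda>p. (-1) *\<^sub>R \<beta> p"] anchor_scale[of \<beta> "\<lambda>p. -1"] section_scale[OF C_const[of "-1"], of \<beta>] by simp

text \<open>This is a consequence of the Leibniz rule: in the Jacobi identity for \<open>\<alpha>\<close>, \<open>\<beta>\<close>, \<open>f\<eta>\<close> compare the coefficients of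
a section \<open>\<eta>\<close> that does not vanish at \<open>p\<close>. If the fibres are zero there is no such \<open>\<eta>\<close>, but then both sides are zero.\<close>

lemma anchor_morphism:
  assumes "\<alpha> \<in> \<Gamma>" "\<beta> \<in> \<Gamma>"
  shows "\<rho> (br \<alpha> \<beta>) = vb (\<rho> \<alpha>) (\<rho> \<beta>)"
proof (rule vf_eqI)
  fix f p assume f: "f \<in> C"
  note V = anchor_VF[OF assms(1)] anchor_VF[OF assms(2)]
  note f' = C_closed(4)[OF V(1) f] C_closed(4)[OF V(2) f]
  note br = br_closed[OF assms]
  show "td f p (\<rho> (br \<alpha> \<beta>) p) = td f p (vb (\<rho> \<alpha>) (\<rho> \<beta>) p)"
  proof (cases "\<exists>w::'f. w \<noteq> 0")
    case True
    then obtain w :: 'f where w: "w \<noteq> 0" by blast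
    obtain U \<phi> where U: "(U, \<phi>) \<in> trivs L" "p \<in> U" by (rule triv_cover)
    note t = trivs_triv[OF U(1)]
    obtain \<eta> where \<eta>: "\<eta> \<in> \<Gamma>" "\<eta> p = iv \<phi> p w"
      using section_through_fibre[OF triv_iv(1)[OF t U(2)]] by metis
    have nz: "\<eta> p \<noteq> 0" using triv_iv(2)[OF t U(2), of w] triv_linear(3)[OF t U(2)] w \<eta>(2) by auto
    have step: "br a (br c (\<lambda>q. f q *\<^sub>R \<eta> q)) p = f p *\<^sub>R br a (br c \<eta>) p + td f p (\<rho> a p) *\<^sub>R br c \<eta> p
        + td f p (\<rho> c p) *\<^sub>R br a \<eta> p + td (\<lambda>q. td f q (\<rho> c q)) p (\<rho> a p) *\<^sub>R \<eta> p"
      if "a \<in> \<Gamma>" "c \<in> \<Gamma>" for a c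
    proof -
      note fc = C_closed(4)[OF anchor_VF[OF that(2)] f]
      show ?thesis
        unfolding br_leibniz[OF that(2) \<eta>(1) f]
          br_add[OF section_scale[OF f br_closed[OF that(2) \<eta>(1)]] section_scale[OF fc \<eta>(1)] that(1)]
          br_leibniz[OF that(1) br_closed[OF that(2) \<eta>(1)] f] br_leibniz[OF that(1) \<eta>(1) fc]
        by (simp add: algebra_simps)
    qed
    have "br \<alpha> (br \<beta> (\<lambda>q. f q *\<^sub>R \<eta> q)) p = br (br \<alpha> \<beta>) (\<lambda>q. f q *\<^sub>R \<eta> q) p + br \<beta> (br \<alpha> (\<lambda>q. f q *\<^sub>R \<eta> q)) p"
      by (rule br_jacobi[OF assms section_scale[OF f \<eta>(1)]])
    moreover have "br (br \<alpha> \<beta>) (\<lambda>q. f q *\<^sub>R \<eta> q) p = f p *\<^sub>R br (br \<alpha> \<beta>) \<eta> p + td f p (\<rho> (br \<alpha> \<beta>) p) *\<^sub>R \<eta> p"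
      using fun_cong[OF br_leibniz[OF br \<eta>(1) f], of p] .
    moreover have "br \<alpha> (br \<beta> \<eta>) p = br (br \<alpha> \<beta>) \<eta> p + br \<beta> (br \<alpha> \<eta>) p" by (rule br_jacobi[OF assms \<eta>(1)])
    ultimately have "(td (\<lambda>q. td f q (\<rho> \<beta> q)) p (\<rho> \<alpha> p) - td (\<lambda>q. td f q (\<rho> \<alpha> q)) p (\<rho> \<beta> p)) *\<^sub>R \<eta> p
        = td f p (\<rho> (br \<alpha> \<beta>) p) *\<^sub>R \<eta> p"
      using step[OF assms] step[OF assms(2,1)] by (simp add: algebra_simps)
    then show ?thesis using nz td_vb_C[OF V f, of p] by simp
  next
    case False
    have "a = 0" if a: "a \<in> fibre L q" for a q
    proof -
      obtain U \<phi> where "(U, \<phi>) \<in> trivs L" "q \<in> U" by (rule triv_cover)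
      moreover have "\<phi> q a = \<phi> q 0" using False by metis
      ultimately show ?thesis using triv_inj[OF trivs_triv _ a subspace_0[OF fibre_subspace]] by blast
    qed
    then have z: "\<zeta> = (\<lambda>q. 0)" if "\<zeta> \<in> \<Gamma>" for \<zeta> using section_fibre[OF that] by auto
    have "\<rho> (\<lambda>q. 0) = (\<lambda>q. 0)" using anchor_K K_closed(4) by blast
    moreover have "vb (\<lambda>q. 0) (\<lambda>q. 0) p = 0"
    proof -
      have "vb (\<lambda>q. 0) (\<lambda>q. 0) p + vb (\<lambda>q. 0) (\<lambda>q. 0) p = 0"
        using fun_cong[OF vb_anti[OF VF_0 VF_0], of p] by (metis add.right_inverse)
      then show ?thesis by (metis scaleR_2 scaleR_eq_0_iff zero_neq_numeral)
    qed
    ultimately show ?thesis using z[OF assms(1)] z[OF assms(2)] z[OF br] by simp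
  qed
qed

subsection \<open>The adjoint action\<close>

lemma br_K: "\<alpha> \<in> \<Gamma> \<Longrightarrow> \<xi> \<in> \<K> \<Longrightarrow> br \<alpha> \<xi> \<in> \<K>"
  using semisimple_ideal by (auto simp: semisimple_bundle_of_ideals_def bundle_of_ideals_def)

lemma br_K': "\<xi> \<in> \<K> \<Longrightarrow> \<alpha> \<in> \<Gamma> \<Longrightarrow> br \<xi> \<alpha> \<in> \<K>"
  using br_anti[of \<xi> \<alpha>] br_K[of \<alpha> \<xi>] K_sec K_closed(5) by simp

lemma br_scale_K:
  assumes "f \<in> C" "\<xi> \<in> \<K>" "\<alpha> \<in> \<Gamma>"
  shows "br (\<lambda>p. f p *\<^sub>R \<alpha> p) \<xi> = (\<lambda>p. f p *\<^sub>R br \<alpha> \<xi> p)"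
proof -
  have td0: "td f p 0 = 0" for p using linear_0[OF td_C_linear[OF assms(1)]] .
  show ?thesis
    unfolding br_anti[OF section_scale[OF assms(1,3)] K_sec[OF assms(2)]] br_leibniz[OF K_sec[OF assms(2)] assms(3,1)]
      br_anti[OF assms(3) K_sec[OF assms(2)]] anchor_K[OF assms(2)] by (simp add: td0)
qed

lemma lie_bundle:
  obtains W bW where "semisimple_lie_algebra_on W bW" "\<And>p. \<exists>U \<phi>. p \<in> U \<and> adapted_triv L K W (U, \<phi>) \<and>
    (\<forall>q\<in>U. \<forall>\<xi>\<in>\<K>. \<forall>\<eta>\<in>\<K>. \<phi> q (br \<xi> \<eta> q) = bW (\<phi> q (\<xi> q)) (\<phi> q (\<eta> q)))"
  using semisimple_ideal unfolding semisimple_bundle_of_ideals_def lie_algebra_bundle_def by blast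

lemma br_K_pointwise:
  assumes "\<xi> \<in> \<K>" "\<xi>' \<in> \<K>" "\<eta> \<in> \<K>" "\<eta>' \<in> \<K>" "\<xi> p = \<xi>' p" "\<eta> p = \<eta>' p"
  shows "br \<xi> \<eta> p = br \<xi>' \<eta>' p"
proof -
  obtain W bW where lb: "\<And>p. \<exists>U \<phi>. p \<in> U \<and> adapted_triv L K W (U, \<phi>) \<and>
    (\<forall>q\<in>U. \<forall>\<xi>\<in>\<K>. \<forall>\<eta>\<in>\<K>. \<phi> q (br \<xi> \<eta> q) = bW (\<phi> q (\<xi> q)) (\<phi> q (\<eta> q)))"
    by (rule lie_bundle) blast
  obtain U \<phi> where U: "p \<in> U" "adapted_triv L K W (U, \<phi>)"
    "\<And>q \<xi> \<eta>. q \<in> U \<Longrightarrow> \<xi> \<in> \<K> \<Longrightarrow> \<eta> \<in> \<K> \<Longrightarrow> \<phi> q (br \<xi> \<eta> q) = bW (\<phi> q (\<xi> q)) (\<phi> q (\<eta> q))"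
    using lb[of p] by blast
  show ?thesis
    by (rule triv_inj[OF adapted_triv_triv[OF U(2)] U(1)])
      (use assms U br_closed K_sec section_fibre in simp_all)
qed

text \<open>The fibres of \<open>K\<close> have trivial centre.\<close>

lemma ad_injective:
  assumes "\<zeta> \<in> \<K>" "\<zeta>' \<in> \<K>" "\<And>\<xi>. \<xi> \<in> \<K> \<Longrightarrow> br \<zeta> \<xi> p = br \<zeta>' \<xi> p"
  shows "\<zeta> p = \<zeta>' p"
proof -
  obtain W bW where ss: "semisimple_lie_algebra_on W bW" and lb: "\<And>p. \<exists>U \<phi>. p \<in> U \<and> adapted_triv L K W (U, \<phi>) \<and>
    (\<forall>q\<in>U. \<forall>\<xi>\<in>\<K>. \<forall>\<eta>\<in>\<K>. \<phi> q (br \<xi> \<eta> q) = bW (\<phi> q (\<xi> q)) (\<phi> q (\<eta> q)))"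
    by (rule lie_bundle) blast
  obtain U \<phi> where U: "p \<in> U" "adapted_triv L K W (U, \<phi>)"
    "\<And>q \<xi> \<eta>. q \<in> U \<Longrightarrow> \<xi> \<in> \<K> \<Longrightarrow> \<eta> \<in> \<K> \<Longrightarrow> \<phi> q (br \<xi> \<eta> q) = bW (\<phi> q (\<xi> q)) (\<phi> q (\<eta> q))"
    using lb[of p] by blast
  note t = adapted_triv_triv[OF U(2)]
  define \<delta> where "\<delta> q = \<zeta> q - \<zeta>' q" for q
  have \<delta>: "\<delta> \<in> \<K>" using K_closed(2)[OF assms(1,2)] by (simp add: \<delta>_def[abs_def])
  have im: "\<phi> p ` K p = W" using U(1,2) by (auto simp: adapted_triv_def)
  have "\<phi> p (\<delta> p) = 0"
  proof (rule semisimple_centre_trivial[OF fin_f ss])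
    show "\<phi> p (\<delta> p) \<in> W" using im section_K[OF \<delta>] by blast
    fix y assume "y \<in> W"
    then obtain a where a: "a \<in> K p" "y = \<phi> p a" using im by blast
    obtain \<xi> where \<xi>: "\<xi> \<in> \<K>" "\<xi> p = a" using section_through[OF a(1)] by metis
    have "br \<delta> \<xi> = (\<lambda>q. br \<zeta> \<xi> q - br \<zeta>' \<xi> q)"
      unfolding \<delta>_def[abs_def] by (rule br_diff_left) (use assms \<xi> K_sec in auto)
    then have "br \<delta> \<xi> p = 0" using assms(3)[OF \<xi>(1)] by simp
    then show "bW (\<phi> p (\<delta> p)) y = 0"
      using U(3)[OF U(1) \<delta> \<xi>(1)] triv_linear(3)[OF t U(1)] \<xi>(2) a(2) by simp
  qed
  then have "\<delta> p = 0"
    using triv_inj[OF t U(1) section_fibre[OF K_sec[OF \<delta>]] subspace_0[OF fibre_subspace]] triv_linear(3)[OF t U(1)] by simp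
  then show ?thesis by (simp add: \<delta>_def)
qed

text \<open>On every fibre \<open>T\<close> induces a derivation, which is inner. The section \<open>\<zeta>\<close> obtained in this way is unique, and it is smooth
since \<open>semisimple_derivations_inner\<close> expresses it by the values of \<open>T\<close> on finitely many local sections.\<close>

lemma ad_surjective:
  fixes T :: "('m \<Rightarrow> 'v) \<Rightarrow> 'm \<Rightarrow> 'v"
  assumes T: "\<And>\<xi>. \<xi> \<in> \<K> \<Longrightarrow> T \<xi> \<in> \<K>"
    and add: "\<And>\<xi> \<eta>. \<xi> \<in> \<K> \<Longrightarrow> \<eta> \<in> \<K> \<Longrightarrow> T (\<lambda>q. \<xi> q + \<eta> q) = (\<lambda>q. T \<xi> q + T \<eta> q)"
    and scale: "\<And>f \<xi>. f \<in> C \<Longrightarrow> \<xi> \<in> \<K> \<Longrightarrow> T (\<lambda>q. f q *\<^sub>R \<xi> q) = (\<lambda>q. f q *\<^sub>R T \<xi> q)"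
    and der: "\<And>\<xi> \<eta>. \<xi> \<in> \<K> \<Longrightarrow> \<eta> \<in> \<K> \<Longrightarrow> T (br \<xi> \<eta>) = (\<lambda>q. br (T \<xi>) \<eta> q + br \<xi> (T \<eta>) q)"
  obtains \<zeta> where "\<zeta> \<in> \<K>" "\<And>\<xi>. \<xi> \<in> \<K> \<Longrightarrow> T \<xi> = br \<zeta> \<xi>"
proof -
  obtain W bW where ss: "semisimple_lie_algebra_on W bW" and lb: "\<And>p. \<exists>U \<phi>. p \<in> U \<and> adapted_triv L K W (U, \<phi>) \<and>
    (\<forall>q\<in>U. \<forall>\<xi>\<in>\<K>. \<forall>\<eta>\<in>\<K>. \<phi> q (br \<xi> \<eta> q) = bW (\<phi> q (\<xi> q)) (\<phi> q (\<eta> q)))"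
    by (rule lie_bundle) blast
  have lie: "lie_algebra_on W bW" using ss by (simp add: semisimple_lie_algebra_on_def)
  then have subW: "subspace W" and Wbr: "\<And>a c. a \<in> W \<Longrightarrow> c \<in> W \<Longrightarrow> bW a c \<in> W" by (auto simp: lie_algebra_on_def)
  obtain n :: nat and b z where bz: "\<And>i. i < n \<Longrightarrow> b i \<in> W" "\<And>i. i < n \<Longrightarrow> z i \<in> W"
    and inner: "\<And>T y. lie_derivation_on W bW T \<Longrightarrow> y \<in> W \<Longrightarrow>
       T y = bW (\<Sum>i<n. (\<Sum>j<n. T (bW (b i) (b j)) \<bullet> b j) *\<^sub>R z i) y"
    by (rule semisimple_derivations_inner[OF fin_f ss]) (rule that; assumption)
  \<comment> \<open>\<open>P q \<zeta>\<close>: the section \<open>\<zeta>\<close> induces \<open>T\<close> at the point \<open>q\<close>.\<close>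
  define P where "P q \<zeta> \<longleftrightarrow> \<zeta> \<in> \<K> \<and> (\<forall>\<xi>\<in>\<K>. T \<xi> q = br \<zeta> \<xi> q)" for q \<zeta>
  have loc: "\<exists>U \<phi> Z. p \<in> U \<and> triv U \<phi> \<and> sm U Z \<and> (\<forall>q\<in>U. \<exists>\<zeta>. P q \<zeta> \<and> \<phi> q (\<zeta> q) = Z q)" for p
  proof -
    obtain U \<phi> where U: "p \<in> U" "adapted_triv L K W (U, \<phi>)"
      "\<And>q \<xi> \<eta>. q \<in> U \<Longrightarrow> \<xi> \<in> \<K> \<Longrightarrow> \<eta> \<in> \<K> \<Longrightarrow> \<phi> q (br \<xi> \<eta> q) = bW (\<phi> q (\<xi> q)) (\<phi> q (\<eta> q))"
      using lb[of p] by blast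
    note t = adapted_triv_triv[OF U(2)]
    have o: "open U" by (rule triv_props(1)[OF t])
    have im: "\<phi> q ` K q = W" if "q \<in> U" for q using U(2) that by (auto simp: adapted_triv_def)
    have lift: "\<exists>\<xi>\<in>\<K>. \<phi> q (\<xi> q) = w" if "q \<in> U" "w \<in> W" for q w
      using im[OF that(1)] that(2) section_through by (metis imageE)
    define Tq where "Tq q w = \<phi> q (T (SOME \<xi>. \<xi> \<in> \<K> \<and> \<phi> q (\<xi> q) = w) q)" for q w
    have Tq: "Tq q (\<phi> q (\<xi> q)) = \<phi> q (T \<xi> q)" if q: "q \<in> U" and \<xi>: "\<xi> \<in> \<K>" for q \<xi>
    proof -
      define \<xi>' where "\<xi>' = (SOME \<xi>'. \<xi>' \<in> \<K> \<and> \<phi> q (\<xi>' q) = \<phi> q (\<xi> q))"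
      have \<xi>': "\<xi>' \<in> \<K> \<and> \<phi> q (\<xi>' q) = \<phi> q (\<xi> q)" unfolding \<xi>'_def by (rule someI[of _ \<xi>]) (simp add: \<xi>)
      then have "\<xi>' q = \<xi> q" using triv_inj[OF t q] section_fibre K_sec \<xi> by blast
      then have "T \<xi>' q = T \<xi> q" using tensorial[of T, OF add scale] \<xi> \<xi>' by blast
      then show ?thesis by (simp add: Tq_def \<xi>'_def)
    qed
    have derq: "lie_derivation_on W bW (Tq q)" if q: "q \<in> U" for q
      unfolding lie_derivation_on_def linear_map_on_def
    proof (intro conjI ballI allI)
      fix a c r assume a: "a \<in> W" and c: "c \<in> W"
      obtain \<xi> \<eta> where \<xi>: "\<xi> \<in> \<K>" "\<phi> q (\<xi> q) = a" "\<eta> \<in> \<K>" "\<phi> q (\<eta> q) = c"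
        using lift[OF q a] lift[OF q c] by blast
      note fib = section_fibre[OF K_sec]
      note lin = triv_linear[OF t q]
      have "a + c = \<phi> q (\<xi> q + \<eta> q)" using \<xi> fib by (simp add: lin)
      then show "Tq q (a + c) = Tq q a + Tq q c"
        using Tq[OF q K_closed(1)[OF \<xi>(1,3)]] Tq[OF q \<xi>(1)] Tq[OF q \<xi>(3)] add[OF \<xi>(1,3)] T \<xi> fib by (simp add: lin)
      have "bW a c = \<phi> q (br \<xi> \<eta> q)" using U(3)[OF q \<xi>(1,3)] \<xi> by simp
      then have "Tq q (bW a c) = \<phi> q (T (br \<xi> \<eta>) q)" using Tq[OF q br_K[OF K_sec[OF \<xi>(1)] \<xi>(3)]] by simp
      also have "\<dots> = \<phi> q (br (T \<xi>) \<eta> q) + \<phi> q (br \<xi> (T \<eta>) q)"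
        unfolding der[OF \<xi>(1,3)] using \<xi> T br_closed K_sec section_fibre by (intro lin) auto
      also have "\<dots> = bW (Tq q a) c + bW a (Tq q c)"
        using U(3)[OF q T[OF \<xi>(1)] \<xi>(3)] U(3)[OF q \<xi>(1) T[OF \<xi>(3)]] Tq[OF q \<xi>(1)] Tq[OF q \<xi>(3)] \<xi> by simp
      finally show "Tq q (bW a c) = bW (Tq q a) c + bW a (Tq q c)" .
    next
      fix a r assume a: "a \<in> W"
      obtain \<xi> where \<xi>: "\<xi> \<in> \<K>" "\<phi> q (\<xi> q) = a" using lift[OF q a] by blast
      have "r *\<^sub>R a = \<phi> q (r *\<^sub>R \<xi> q)" using \<xi> section_fibre K_sec by (simp add: triv_linear[OF t q])
      then show "Tq q (r *\<^sub>R a) = r *\<^sub>R Tq q a"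
        using Tq[OF q K_closed(3)[OF C_const \<xi>(1)], of r] Tq[OF q \<xi>(1)] scale[OF C_const \<xi>(1)] T \<xi> section_fibre K_sec
        by (simp add: triv_linear[OF t q])
      show "Tq q a \<in> W" using Tq[OF q \<xi>(1)] \<xi> im[OF q] section_K[OF T[OF \<xi>(1)]] by auto
    qed
    define Z where "Z q = (\<Sum>i<n. (\<Sum>j<n. Tq q (bW (b i) (b j)) \<bullet> b j) *\<^sub>R z i)" for q
    have ZW: "Z q \<in> W" for q unfolding Z_def using bz by (intro subspace_sum subW subspace_scale) auto
    have ex: "\<exists>\<zeta>. P q \<zeta> \<and> \<phi> q (\<zeta> q) = Z q" if q: "q \<in> U" for q
    proof -
      obtain \<zeta> where \<zeta>: "\<zeta> \<in> \<K>" "\<phi> q (\<zeta> q) = Z q" using lift[OF q ZW] by blast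
      have "T \<xi> q = br \<zeta> \<xi> q" if \<xi>: "\<xi> \<in> \<K>" for \<xi>
      proof (rule triv_inj[OF t q])
        have "\<phi> q (\<xi> q) \<in> W" using im[OF q] section_K[OF \<xi>] by blast
        then have "Tq q (\<phi> q (\<xi> q)) = bW (Z q) (\<phi> q (\<xi> q))" unfolding Z_def by (rule inner[OF derq[OF q]])
        then show "\<phi> q (T \<xi> q) = \<phi> q (br \<zeta> \<xi> q)" using Tq[OF q \<xi>] U(3)[OF q \<zeta>(1) \<xi>] \<zeta>(2) by simp
      qed (use T[OF \<xi>] br_K[OF K_sec[OF \<zeta>(1)] \<xi>] K_sec section_fibre in auto)
      then show ?thesis using \<zeta> by (auto simp: P_def)
    qed
    obtain f S where f: "f \<in> C" "f p = 1" "closed S" "S \<subseteq> U" "\<And>q. q \<notin> S \<Longrightarrow> f q = 0"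
      using bump[OF o U(1)] by metis
    \<comment> \<open>Cut off sections with values \<open>f [b i, b j]\<close>: where \<open>f\<close> is nonzero, the coefficients of \<open>Z\<close> can be read off from \<open>T (e i j)\<close>.\<close>
    define e where "e i j = (\<lambda>q. if q \<in> U then f q *\<^sub>R iv \<phi> q (bW (b i) (b j)) else 0)" for i j
    have e: "e i j \<in> \<K>" if "i < n" "j < n" for i j
      unfolding e_def by (rule bump_frame[OF U(2) f(1,3,4,5) Wbr[OF bz(1)[OF that(1)] bz(1)[OF that(2)]]])
    let ?N = "U \<inter> {q. f q \<noteq> 0}"
    have N: "open ?N" "p \<in> ?N" using o open_nonzero[OF f(1)] U(1) f(2) by auto
    have fN: "sm ?N f" using f(1) sm_subset[of UNIV f ?N] by simp
    have "sm ?N (\<lambda>q. \<Sum>i<n. (\<Sum>j<n. inverse (f q) * (\<phi> q (T (e i j) q) \<bullet> b j)) *\<^sub>R z i)"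
      by (intro sm_sum sm_scaleR sm_mult sm_inner_left sm_inverse sm_const N fN sm_subset[OF section_sm[OF K_sec[OF T[OF e]] t]]) auto
    then have "sm ?N Z"
    proof (rule sm_cong[OF N(1)])
      fix q assume "q \<in> ?N"
      then have q: "q \<in> U" "f q \<noteq> 0" by auto
      have "Tq q (bW (b i) (b j)) \<bullet> b j = inverse (f q) * (\<phi> q (T (e i j) q) \<bullet> b j)" if ij: "i < n" "j < n" for i j
      proof -
        have w: "bW (b i) (b j) \<in> W" using Wbr bz(1) ij by blast
        have "\<phi> q (e i j q) = f q *\<^sub>R bW (b i) (b j)"
          using q(1) by (simp add: e_def triv_linear[OF t] triv_iv[OF t])
        then have "Tq q (f q *\<^sub>R bW (b i) (b j)) = \<phi> q (T (e i j) q)" using Tq[OF q(1) e[OF ij]] by simp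
        moreover have "Tq q (f q *\<^sub>R bW (b i) (b j)) = f q *\<^sub>R Tq q (bW (b i) (b j))"
          using derq[OF q(1)] linear_map_onD(2)[of W "Tq q"] w by (auto simp: lie_derivation_on_def)
        ultimately have "\<phi> q (T (e i j) q) = f q *\<^sub>R Tq q (bW (b i) (b j))" by simp
        then show ?thesis using q(2) by simp
      qed
      then show "(\<Sum>i<n. (\<Sum>j<n. inverse (f q) * (\<phi> q (T (e i j) q) \<bullet> b j)) *\<^sub>R z i) = Z q"
        unfolding Z_def by (intro sum.cong arg_cong2[where f = "(*\<^sub>R)"]) auto
    qed
    moreover have "triv ?N \<phi>"
      by (rule triv_subset[OF t N(1)]) auto
    ultimately show ?thesis using N ex by (intro exI[of _ ?N] exI[of _ \<phi>] exI[of _ Z]) auto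
  qed
  have Puniq: "\<zeta> q = \<zeta>' q" if "P q \<zeta>" "P q \<zeta>'" for q \<zeta> \<zeta>'
  proof (rule ad_injective)
    show "\<zeta> \<in> \<K>" "\<zeta>' \<in> \<K>" using that by (simp_all add: P_def)
    fix \<xi> assume \<xi>: "\<xi> \<in> \<K>"
    have "T \<xi> q = br \<zeta> \<xi> q" "T \<xi> q = br \<zeta>' \<xi> q" using that \<xi> by (simp_all add: P_def)
    then show "br \<zeta> \<xi> q = br \<zeta>' \<xi> q" by simp
  qed
  define \<zeta> where "\<zeta> q = (SOME \<zeta>. P q \<zeta>) q" for q
  have \<zeta>: "\<zeta> q = \<zeta>' q" if "P q \<zeta>'" for q \<zeta>'
    unfolding \<zeta>_def using someI[of "P q", OF that] that by (rule Puniq)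
  have exP: "\<exists>\<zeta>. P q \<zeta>" for q using loc[of q] by blast
  have \<zeta>K: "\<zeta> q \<in> K q" for q
  proof -
    obtain \<zeta>' where "P q \<zeta>'" using exP by blast
    then show ?thesis using \<zeta>[of q \<zeta>'] section_K[of \<zeta>' q] by (simp add: P_def)
  qed
  have "\<zeta> \<in> \<Gamma>"
  proof (rule sectionI_local)
    show "\<zeta> q \<in> fibre L q" for q by (rule K_fibre[OF \<zeta>K])
    fix p
    obtain U \<phi> Z where U: "p \<in> U" "triv U \<phi>" "sm U Z" "\<And>q. q \<in> U \<Longrightarrow> \<exists>\<zeta>. P q \<zeta> \<and> \<phi> q (\<zeta> q) = Z q"
      using loc[of p] by blast
    have "sm U (\<lambda>q. \<phi> q (\<zeta> q))"
    proof (rule sm_cong[OF triv_props(1)[OF U(2)] U(3)])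
      fix q assume "q \<in> U"
      then obtain \<zeta>' where "P q \<zeta>'" "\<phi> q (\<zeta>' q) = Z q" using U(4) by blast
      then show "Z q = \<phi> q (\<zeta> q)" using \<zeta>[of q \<zeta>'] by simp
    qed
    then show "\<exists>U \<phi> N. triv U \<phi> \<and> open N \<and> p \<in> N \<and> N \<subseteq> U \<and> sm N (\<lambda>q. \<phi> q (\<zeta> q))"
      using U(1,2) triv_props(1)[OF U(2)] by blast
  qed
  then have \<zeta>\<Gamma>: "\<zeta> \<in> \<K>" using \<zeta>K by (auto simp: sub_sections_def)
  show ?thesis
  proof (rule that[OF \<zeta>\<Gamma>])
    fix \<xi> assume \<xi>: "\<xi> \<in> \<K>"
    show "T \<xi> = br \<zeta> \<xi>"
    proof
      fix q
      obtain \<zeta>' where \<zeta>': "P q \<zeta>'" using exP by blast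
      then have "T \<xi> q = br \<zeta>' \<xi> q" using \<xi> by (simp add: P_def)
      also have "\<dots> = br \<zeta> \<xi> q" using \<zeta>' \<zeta>[OF \<zeta>'] \<zeta>\<Gamma> \<xi> by (intro br_K_pointwise) (auto simp: P_def)
      finally show "T \<xi> q = br \<zeta> \<xi> q" .
    qed
  qed
qed

end

section \<open>Lie derivatives of forms\<close>

text \<open>The sum of all terms in which \<open>D\<close> is applied to one entry of the list; the recursive form suits inductions in which the list is
split at an entry.\<close>

fun slot_sum :: "('a \<Rightarrow> 'a) \<Rightarrow> ('a list \<Rightarrow> 'b::ab_group_add) \<Rightarrow> 'a list \<Rightarrow> 'b" where
  "slot_sum D \<Phi> [] = 0"
| "slot_sum D \<Phi> (X # Xs) = \<Phi> (D X # Xs) + slot_sum D (\<lambda>Zs. \<Phi> (X # Zs)) Xs"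

lemma slot_sum_eq_sum: "slot_sum D \<Phi> Xs = (\<Sum>j<length Xs. \<Phi> (Xs[j := D (Xs ! j)]))"
proof (induction Xs arbitrary: \<Phi>)
  case (Cons X Xs)
  show ?case by (simp add: Cons sum.lessThan_Suc_shift del: sum.lessThan_Suc)
qed simp

lemma slot_sum_append:
  "slot_sum D \<Phi> (Xs @ Ys) = slot_sum D (\<lambda>Zs. \<Phi> (Zs @ Ys)) Xs + slot_sum D (\<lambda>Zs. \<Phi> (Xs @ Zs)) Ys"
  by (induction Xs arbitrary: \<Phi>) (simp_all add: add.assoc)

lemma slot_sum_cong:
  assumes "\<And>X. X \<in> S \<Longrightarrow> D X \<in> S" "set Xs \<subseteq> S" "\<And>Zs. set Zs \<subseteq> S \<Longrightarrow> length Zs = length Xs \<Longrightarrow> \<Phi> Zs = \<Psi> Zs"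
  shows "slot_sum D \<Phi> Xs = slot_sum D \<Psi> Xs"
  using assms(2,3)
proof (induction Xs arbitrary: \<Phi> \<Psi>)
  case (Cons X Xs)
  have "slot_sum D (\<lambda>Zs. \<Phi> (X # Zs)) Xs = slot_sum D (\<lambda>Zs. \<Psi> (X # Zs)) Xs"
    using Cons.prems by (intro Cons.IH) auto
  moreover have "\<Phi> (D X # Xs) = \<Psi> (D X # Xs)" using Cons.prems assms(1) by auto
  ultimately show ?case by simp
qed simp

lemma slot_sum_cong_length:
  assumes "\<And>Zs. length Zs = length Xs \<Longrightarrow> \<Phi> Zs = \<Psi> Zs"
  shows "slot_sum D \<Phi> Xs = slot_sum D \<Psi> Xs"
  by (rule slot_sum_cong[of UNIV]) (use assms in auto)

lemma slot_sum_add: "slot_sum D (\<lambda>Zs. \<Phi> Zs + \<Psi> Zs) Xs = slot_sum D \<Phi> Xs + slot_sum D \<Psi> Xs"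
  and slot_sum_diff: "slot_sum D (\<lambda>Zs. \<Phi> Zs - \<Psi> Zs) Xs = slot_sum D \<Phi> Xs - slot_sum D \<Psi> Xs"
  and slot_sum_zero: "slot_sum D (\<lambda>Zs. 0) Xs = 0"
  by (simp_all add: slot_sum_eq_sum sum.distrib sum_subtractf)

lemma slot_sum_scale:
  fixes \<Phi> :: "'a list \<Rightarrow> 'b::real_vector"
  shows "slot_sum D (\<lambda>Zs. r *\<^sub>R \<Phi> Zs) Xs = r *\<^sub>R slot_sum D \<Phi> Xs"
  unfolding slot_sum_eq_sum by (rule scaleR_sum_right[symmetric])

text \<open>The terms in which \<open>D\<close> and \<open>D'\<close> act on different entries cancel.\<close>

lemma slot_sum_commutator:
  assumes "\<And>us X ws. X \<in> S \<Longrightarrow> set us \<subseteq> S \<Longrightarrow> set ws \<subseteq> S \<Longrightarrow> length us + length ws + 1 = length Xs \<Longrightarrow>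
      \<Phi> (us @ D' (D X) # ws) - \<Phi> (us @ D (D' X) # ws) = \<Phi> (us @ E X # ws)" "set Xs \<subseteq> S"
  shows "slot_sum D (slot_sum D' \<Phi>) Xs - slot_sum D' (slot_sum D \<Phi>) Xs = slot_sum E \<Phi> Xs"
  using assms
proof (induction Xs arbitrary: \<Phi>)
  case (Cons X Xs)
  have "slot_sum D (slot_sum D' (\<lambda>Zs. \<Phi> (X # Zs))) Xs - slot_sum D' (slot_sum D (\<lambda>Zs. \<Phi> (X # Zs))) Xs =
      slot_sum E (\<lambda>Zs. \<Phi> (X # Zs)) Xs"
  proof (rule Cons.IH)
    show "\<Phi> (X # us @ D' (D Y) # ws) - \<Phi> (X # us @ D (D' Y) # ws) = \<Phi> (X # us @ E Y # ws)"
      if "Y \<in> S" "set us \<subseteq> S" "set ws \<subseteq> S" "length us + length ws + 1 = length Xs" for us Y ws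
      using Cons.prems(1)[of Y "X # us" ws] Cons.prems(2) that by simp
  qed (use Cons.prems in auto)
  moreover have "\<Phi> (D' (D X) # Xs) - \<Phi> (D (D' X) # Xs) = \<Phi> (E X # Xs)"
    using Cons.prems(1)[of X "[]" Xs] Cons.prems(2) by simp
  ultimately show ?case by (simp add: slot_sum_add algebra_simps)
qed simp

lemma two_slots:
  assumes "i < j" "j < length Xs"
  obtains us ws zs where "Xs = us @ Xs ! i # ws @ Xs ! j # zs"
proof -
  have 1: "Xs = take i Xs @ Xs ! i # drop (Suc i) Xs" using assms by (intro id_take_nth_drop) simp
  have "j - Suc i < length (drop (Suc i) Xs)" using assms by simp
  then have "drop (Suc i) Xs = take (j - Suc i) (drop (Suc i) Xs) @ drop (Suc i) Xs ! (j - Suc i) # drop (Suc (j - Suc i)) (drop (Suc i) Xs)"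
    by (rule id_take_nth_drop)
  moreover have "drop (Suc i) Xs ! (j - Suc i) = Xs ! j" using assms by simp
  ultimately show ?thesis using that[of "take i Xs" "take (j - Suc i) (drop (Suc i) Xs)" "drop (Suc (j - Suc i)) (drop (Suc i) Xs)"] 1
    by metis
qed

context manifold
begin

lemma vb_scale_left:
  assumes "X \<in> VF" "Y \<in> VF" "f \<in> C"
  shows "vb (\<lambda>p. f p *\<^sub>R X p) Y = (\<lambda>p. f p *\<^sub>R vb X Y p - td f p (Y p) *\<^sub>R X p)"
  unfolding vb_anti[OF VF_scale[OF assms(3,1)] assms(2)] vb_scale_right[OF assms(2,1,3)] vb_anti[OF assms(1,2)]
  by (simp add: algebra_simps)

lemma vb_add_left:
  assumes "X \<in> VF" "Y \<in> VF" "Z \<in> VF"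
  shows "vb (\<lambda>p. X p + Y p) Z = (\<lambda>p. vb X Z p + vb Y Z p)"
  unfolding vb_anti[OF VF_add[OF assms(1,2)] assms(3)] vb_add_right[OF assms(3,1,2)] vb_anti[OF assms(1,3)] vb_anti[OF assms(2,3)]
  by simp

lemma vb_zero_left: "Y \<in> VF \<Longrightarrow> vb (\<lambda>p. 0) Y = (\<lambda>p. 0)"
  using vb_scale_left[OF VF_0 _ C_const[of 0], of Y] by simp

end

context semisimple_ideal
begin

lemma br_sum:
  assumes "\<alpha> \<in> \<Gamma>" "\<And>i. i \<in> I \<Longrightarrow> \<xi> i \<in> \<K>"
  shows "br \<alpha> (\<lambda>p. \<Sum>i\<in>I. \<xi> i p) = (\<lambda>p. \<Sum>i\<in>I. br \<alpha> (\<xi> i) p)"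
  using assms(2)
proof (induction I rule: infinite_finite_induct)
  case (insert i I)
  then show ?case using br_add[of "\<xi> i" "\<lambda>p. \<Sum>i\<in>I. \<xi> i p" \<alpha>] K_sum[of I \<xi>] assms(1) K_sec by simp
qed (simp_all add: br_zero assms(1))

abbreviation "ext p \<equiv> map (vf_ext (atlas L) p)"

lemma ext_VF: "set (ext p vs) \<subseteq> VF" using vf_ext(1) by auto

lemma ext_at: "map (\<lambda>X. X p) (ext p vs) = vs" by (simp add: comp_def vf_ext(2))

text \<open>The Lie derivative of a form, evaluated on vector fields instead of tangent vectors.\<close>

definition LD :: "('m \<Rightarrow> 'v) \<Rightarrow> (('m \<Rightarrow> 'e) list \<Rightarrow> 'm \<Rightarrow> 'v) \<Rightarrow> ('m \<Rightarrow> 'e) list \<Rightarrow> 'm \<Rightarrow> 'v" where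
  "LD \<alpha> \<Phi> Xs p = br \<alpha> (\<Phi> Xs) p - slot_sum (vb (\<rho> \<alpha>)) (\<lambda>Zs. \<Phi> Zs p) Xs"

lemma lie_deriv_LD: "lie_deriv L \<alpha> \<gamma> p vs = LD \<alpha> (eval_form \<gamma>) (ext p vs) p"
  by (simp add: lie_deriv_def LD_def slot_sum_eq_sum Let_def)

context
  fixes \<gamma> :: "('m, 'e, 'v) vform" and q :: nat
  assumes \<gamma>: "\<gamma> \<in> forms L K q"
begin

lemma eval_slot_add:
  "length Xs + length Ys + 1 = q \<Longrightarrow>
    eval_form \<gamma> (Xs @ (\<lambda>p. X p + Y p) # Ys) p = eval_form \<gamma> (Xs @ X # Ys) p + eval_form \<gamma> (Xs @ Y # Ys) p"
  using alternating_add[OF form_alternating[OF \<gamma>], of "map (\<lambda>X. X p) Xs" "map (\<lambda>X. X p) Ys" p]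
  by (simp add: eval_form_def)

lemma eval_slot_scale:
  "length Xs + length Ys + 1 = q \<Longrightarrow>
    eval_form \<gamma> (Xs @ (\<lambda>p. f p *\<^sub>R X p) # Ys) p = f p *\<^sub>R eval_form \<gamma> (Xs @ X # Ys) p"
  using alternating_scale[OF form_alternating[OF \<gamma>], of "map (\<lambda>X. X p) Xs" "map (\<lambda>X. X p) Ys" p]
  by (simp add: eval_form_def)

lemma eval_slot_diff:
  "length Xs + length Ys + 1 = q \<Longrightarrow>
    eval_form \<gamma> (Xs @ (\<lambda>p. X p - Y p) # Ys) p = eval_form \<gamma> (Xs @ X # Ys) p - eval_form \<gamma> (Xs @ Y # Ys) p"
  using eval_slot_add[of Xs Ys X "\<lambda>p. (-1) *\<^sub>R Y p" p] eval_slot_scale[of Xs Ys "\<lambda>p. -1" Y p] by simp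

lemma eval_swap:
  "length Xs + length Ys + length Zs + 2 = q \<Longrightarrow>
    eval_form \<gamma> (Xs @ X # Ys @ Y # Zs) p = - eval_form \<gamma> (Xs @ Y # Ys @ X # Zs) p"
  using alternating_swap[OF form_alternating[OF \<gamma>], of "map (\<lambda>X. X p) Xs" "map (\<lambda>X. X p) Ys" "map (\<lambda>X. X p) Zs" p "X p" "Y p"]
  by (simp add: eval_form_def)

lemma eval_repeat:
  assumes "length Xs + length Ys + length Zs + 2 = q"
  shows "eval_form \<gamma> (Xs @ X # Ys @ X # Zs) p = 0"
proof -
  have "eval_form \<gamma> (Xs @ X # Ys @ X # Zs) p + eval_form \<gamma> (Xs @ X # Ys @ X # Zs) p = 0"
    using eval_swap[OF assms, of X X p] by (metis add.left_inverse)
  then show ?thesis by (metis scaleR_2 scaleR_eq_0_iff zero_neq_numeral)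
qed

lemma eval_wrong_length: "length Xs \<noteq> q \<Longrightarrow> eval_form \<gamma> Xs = (\<lambda>p. 0)"
  using alternating_wrong_length[OF form_alternating[OF \<gamma>]] by (auto simp: eval_form_def)

lemma eval_K: "set Xs \<subseteq> VF \<Longrightarrow> eval_form \<gamma> Xs \<in> \<K>"
  using eval_form_section[OF \<gamma>] eval_wrong_length K_closed(4) by (cases "length Xs = q") auto

lemma update_VF: "X \<in> VF \<Longrightarrow> set Xs \<subseteq> VF \<Longrightarrow> set (Xs[j := X]) \<subseteq> VF"
  using set_update_subset_insert[of Xs j X] by auto

lemma slot_sum_K:
  assumes "X \<in> VF" "set Xs \<subseteq> VF"
  shows "(\<lambda>p. slot_sum (vb X) (\<lambda>Zs. eval_form \<gamma> Zs p) Xs) \<in> \<K>"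
  unfolding slot_sum_eq_sum
proof (rule K_sum)
  fix j assume "j \<in> {..<length Xs}"
  then have "Xs ! j \<in> VF" using assms(2) by auto
  then show "eval_form \<gamma> (Xs[j := vb X (Xs ! j)]) \<in> \<K>"
    by (intro eval_K update_VF VF_vb assms)
qed

lemma br_slot_sum:
  assumes "\<alpha> \<in> \<Gamma>" "X \<in> VF" "set Xs \<subseteq> VF"
  shows "br \<alpha> (\<lambda>p. slot_sum (vb X) (\<lambda>Zs. eval_form \<gamma> Zs p) Xs) p = slot_sum (vb X) (\<lambda>Zs. br \<alpha> (eval_form \<gamma> Zs) p) Xs"
proof -
  have "eval_form \<gamma> (Xs[j := vb X (Xs ! j)]) \<in> \<K>" if "j \<in> {..<length Xs}" for j
    using that assms by (intro eval_K update_VF VF_vb) auto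
  then show ?thesis unfolding slot_sum_eq_sum using br_sum[OF assms(1), of "{..<length Xs}" "\<lambda>j. eval_form \<gamma> (Xs[j := vb X (Xs ! j)])"]
    by simp
qed

lemma LD_K: "\<alpha> \<in> \<Gamma> \<Longrightarrow> set Xs \<subseteq> VF \<Longrightarrow> LD \<alpha> (eval_form \<gamma>) Xs \<in> \<K>"
  unfolding LD_def[abs_def] by (intro K_closed(2) br_K slot_sum_K anchor_VF eval_K)

lemma lie_deriv_wrong_length:
  assumes "\<alpha> \<in> \<Gamma>" "length vs \<noteq> q"
  shows "lie_deriv L \<alpha> \<gamma> p vs = 0"
proof -
  have "slot_sum (vb (\<rho> \<alpha>)) (\<lambda>Zs. eval_form \<gamma> Zs p) (ext p vs) = slot_sum (vb (\<rho> \<alpha>)) (\<lambda>Zs. 0) (ext p vs)"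
    using assms(2) eval_wrong_length by (intro slot_sum_cong_length) simp
  then show ?thesis
    using assms eval_wrong_length[of "ext p vs"] by (simp add: lie_deriv_LD LD_def slot_sum_zero br_zero)
qed

text \<open>The derivatives of \<open>f\<close> that arise from \<open>[\<alpha>, f \<zeta>]\<close> and from \<open>[\<rho>(\<alpha>), f X]\<close> cancel, so \<open>LD\<close> is
multilinear over \<open>C\<close>.\<close>

lemma lie_deriv_form:
  assumes \<alpha>: "\<alpha> \<in> \<Gamma>"
  shows "lie_deriv L \<alpha> \<gamma> \<in> forms L K q"
    and "set Xs \<subseteq> VF \<Longrightarrow> length Xs = q \<Longrightarrow> eval_form (lie_deriv L \<alpha> \<gamma>) Xs = LD \<alpha> (eval_form \<gamma>) Xs"
proof -
  let ?E = "eval_form \<gamma>" and ?D = "vb (\<rho> \<alpha>)"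
  note a = anchor_VF[OF \<alpha>]
  obtain \<gamma>' where \<gamma>': "\<gamma>' \<in> forms L K q" "\<And>Xs. set Xs \<subseteq> VF \<Longrightarrow> length Xs = q \<Longrightarrow> eval_form \<gamma>' Xs = LD \<alpha> ?E Xs"
    "\<And>p vs. \<gamma>' p vs = (if length vs = q then LD \<alpha> ?E (ext p vs) p else 0)"
  proof (rule form_of_multilinear[of q "LD \<alpha> ?E"])
    show "LD \<alpha> ?E Xs \<in> \<K>" if "set Xs \<subseteq> VF" "length Xs = q" for Xs by (rule LD_K[OF \<alpha> that(1)])
    fix Xs Ys :: "('m \<Rightarrow> 'e) list" and X Y
    assume V: "set Xs \<subseteq> VF" "set Ys \<subseteq> VF" "X \<in> VF" "Y \<in> VF" and l: "length Xs + length Ys + 1 = q"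
    have E: "?E (Xs @ X # Ys) \<in> \<Gamma>" "?E (Xs @ Y # Ys) \<in> \<Gamma>" using V by (auto intro!: K_sec eval_K)
    show "LD \<alpha> ?E (Xs @ (\<lambda>p. X p + Y p) # Ys) = (\<lambda>p. LD \<alpha> ?E (Xs @ X # Ys) p + LD \<alpha> ?E (Xs @ Y # Ys) p)"
    proof
      fix p
      have "?E (Xs @ (\<lambda>p. X p + Y p) # Ys) = (\<lambda>p. ?E (Xs @ X # Ys) p + ?E (Xs @ Y # Ys) p)"
        using eval_slot_add[OF l] by blast
      then have 1: "br \<alpha> (?E (Xs @ (\<lambda>p. X p + Y p) # Ys)) p = br \<alpha> (?E (Xs @ X # Ys)) p + br \<alpha> (?E (Xs @ Y # Ys)) p"
        using br_add[OF E \<alpha>] by simp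
      have 2: "slot_sum ?D (\<lambda>Zs. ?E (Zs @ (\<lambda>p. X p + Y p) # Ys) p) Xs =
          slot_sum ?D (\<lambda>Zs. ?E (Zs @ X # Ys) p) Xs + slot_sum ?D (\<lambda>Zs. ?E (Zs @ Y # Ys) p) Xs"
        unfolding slot_sum_add[symmetric] using l by (intro slot_sum_cong_length eval_slot_add) simp
      have 3: "slot_sum ?D (\<lambda>Zs. ?E (Xs @ (\<lambda>p. X p + Y p) # Zs) p) Ys =
          slot_sum ?D (\<lambda>Zs. ?E (Xs @ X # Zs) p) Ys + slot_sum ?D (\<lambda>Zs. ?E (Xs @ Y # Zs) p) Ys"
        unfolding slot_sum_add[symmetric] using l by (intro slot_sum_cong_length eval_slot_add) simp
      have 4: "?E (Xs @ ?D (\<lambda>p. X p + Y p) # Ys) p = ?E (Xs @ ?D X # Ys) p + ?E (Xs @ ?D Y # Ys) p"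
        unfolding vb_add_right[OF a V(3,4)] by (rule eval_slot_add[OF l])
      show "LD \<alpha> ?E (Xs @ (\<lambda>p. X p + Y p) # Ys) p = LD \<alpha> ?E (Xs @ X # Ys) p + LD \<alpha> ?E (Xs @ Y # Ys) p"
        unfolding LD_def slot_sum_append slot_sum.simps 1 2 3 4 by simp
    qed
  next
    fix Xs Ys :: "('m \<Rightarrow> 'e) list" and X and f :: "'m \<Rightarrow> real"
    assume V: "set Xs \<subseteq> VF" "set Ys \<subseteq> VF" "X \<in> VF" "f \<in> C" and l: "length Xs + length Ys + 1 = q"
    have E: "?E (Xs @ X # Ys) \<in> \<Gamma>" using V by (auto intro!: K_sec eval_K)
    show "LD \<alpha> ?E (Xs @ (\<lambda>p. f p *\<^sub>R X p) # Ys) = (\<lambda>p. f p *\<^sub>R LD \<alpha> ?E (Xs @ X # Ys) p)"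
    proof
      fix p
      have "?E (Xs @ (\<lambda>p. f p *\<^sub>R X p) # Ys) = (\<lambda>p. f p *\<^sub>R ?E (Xs @ X # Ys) p)"
        using eval_slot_scale[OF l] by blast
      then have 1: "br \<alpha> (?E (Xs @ (\<lambda>p. f p *\<^sub>R X p) # Ys)) p = f p *\<^sub>R br \<alpha> (?E (Xs @ X # Ys)) p + td f p (\<rho> \<alpha> p) *\<^sub>R ?E (Xs @ X # Ys) p"
        using br_leibniz[OF \<alpha> E V(4)] by simp
      have 2: "slot_sum ?D (\<lambda>Zs. ?E (Zs @ (\<lambda>p. f p *\<^sub>R X p) # Ys) p) Xs = f p *\<^sub>R slot_sum ?D (\<lambda>Zs. ?E (Zs @ X # Ys) p) Xs"
        unfolding slot_sum_scale[symmetric] using l by (intro slot_sum_cong_length eval_slot_scale) simp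
      have 3: "slot_sum ?D (\<lambda>Zs. ?E (Xs @ (\<lambda>p. f p *\<^sub>R X p) # Zs) p) Ys = f p *\<^sub>R slot_sum ?D (\<lambda>Zs. ?E (Xs @ X # Zs) p) Ys"
        unfolding slot_sum_scale[symmetric] using l by (intro slot_sum_cong_length eval_slot_scale) simp
      have 4: "?E (Xs @ ?D (\<lambda>p. f p *\<^sub>R X p) # Ys) p = f p *\<^sub>R ?E (Xs @ ?D X # Ys) p + td f p (\<rho> \<alpha> p) *\<^sub>R ?E (Xs @ X # Ys) p"
        unfolding vb_scale_right[OF a V(3,4)] using eval_slot_add[OF l] eval_slot_scale[OF l] by simp
      show "LD \<alpha> ?E (Xs @ (\<lambda>p. f p *\<^sub>R X p) # Ys) p = f p *\<^sub>R LD \<alpha> ?E (Xs @ X # Ys) p"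
        unfolding LD_def slot_sum_append slot_sum.simps 1 2 3 4 by (simp add: algebra_simps)
    qed
  next
    fix Xs :: "('m \<Rightarrow> 'e) list" and i j
    assume V: "set Xs \<subseteq> VF" "length Xs = q" "i < j" "j < q" "Xs ! i = Xs ! j"
    obtain us ws zs where Xs: "Xs = us @ Xs ! i # ws @ Xs ! j # zs" using two_slots[of i j Xs] V by metis
    define X where "X = Xs ! i"
    have Xs': "Xs = us @ X # ws @ X # zs" using Xs V(5) by (simp add: X_def)
    have l: "length us + length ws + length zs + 2 = q" using V(2) unfolding Xs' by simp
    show "LD \<alpha> ?E Xs = (\<lambda>p. 0)"
    proof
      fix p
      have "?E Xs = (\<lambda>p. 0)" unfolding Xs' using eval_repeat[OF l] by blast
      then have 1: "br \<alpha> (?E Xs) p = 0" using br_zero[OF \<alpha>] by simp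
      have 2: "slot_sum ?D (\<lambda>Zs. ?E (Zs @ X # ws @ X # zs) p) us = slot_sum ?D (\<lambda>Zs. 0) us"
        using l by (intro slot_sum_cong_length eval_repeat) simp
      have 3: "slot_sum ?D (\<lambda>Zs. ?E (us @ X # Zs @ X # zs) p) ws = slot_sum ?D (\<lambda>Zs. 0) ws"
        using l by (intro slot_sum_cong_length eval_repeat) simp
      have 4: "slot_sum ?D (\<lambda>Zs. ?E (us @ X # ws @ X # Zs) p) zs = slot_sum ?D (\<lambda>Zs. 0) zs"
        using l by (intro slot_sum_cong_length eval_repeat) simp
      have 5: "?E (us @ X # ws @ ?D X # zs) p = - ?E (us @ ?D X # ws @ X # zs) p"
        by (rule eval_swap[OF l])
      show "LD \<alpha> ?E Xs p = 0"
        unfolding LD_def 1 unfolding Xs' slot_sum_append slot_sum.simps 2 3 4 5 by (simp add: slot_sum_zero)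
    qed
  qed blast
  have e: "\<gamma>' = lie_deriv L \<alpha> \<gamma>"
  proof (intro ext)
    fix p vs
    show "\<gamma>' p vs = lie_deriv L \<alpha> \<gamma> p vs"
      using lie_deriv_wrong_length[OF \<alpha>, of vs p] by (simp add: \<gamma>'(3) lie_deriv_LD)
  qed
  show "lie_deriv L \<alpha> \<gamma> \<in> forms L K q" using \<gamma>'(1) e by simp
  show "set Xs \<subseteq> VF \<Longrightarrow> length Xs = q \<Longrightarrow> eval_form (lie_deriv L \<alpha> \<gamma>) Xs = LD \<alpha> (eval_form \<gamma>) Xs"
    using \<gamma>'(2) e by simp
qed

lemma eval_update_linear:
  assumes "length Xs = q" "j < q"
  shows "linear (\<lambda>u. \<gamma> p ((map (\<lambda>X. X p) Xs)[j := u]))"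
  using form_alternating[OF \<gamma>, of p] assms unfolding alternating_maps_def by fastforce

lemma eval_update: "eval_form \<gamma> (Xs[j := X]) p = \<gamma> p ((map (\<lambda>X. X p) Xs)[j := X p])"
  by (simp add: eval_form_def map_update)

lemma lie_deriv_linear:
  assumes "\<alpha> \<in> \<Gamma>" "\<beta> \<in> \<Gamma>"
  shows "lie_deriv L (\<lambda>p. r *\<^sub>R \<alpha> p + s *\<^sub>R \<beta> p) \<gamma> p vs = r *\<^sub>R lie_deriv L \<alpha> \<gamma> p vs + s *\<^sub>R lie_deriv L \<beta> \<gamma> p vs"
proof -
  have sec: "(\<lambda>p. r *\<^sub>R \<alpha> p) \<in> \<Gamma>" "(\<lambda>p. s *\<^sub>R \<beta> p) \<in> \<Gamma>" using assms by (auto intro!: section_scale C_const)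
  have sec': "(\<lambda>p. r *\<^sub>R \<alpha> p + s *\<^sub>R \<beta> p) \<in> \<Gamma>" using section_add[OF sec] .
  show ?thesis
  proof (cases "length vs = q")
    case True
    let ?Xs = "ext p vs"
    note V = anchor_VF[OF assms(1)] anchor_VF[OF assms(2)]
    have vb: "vb (\<rho> (\<lambda>p. r *\<^sub>R \<alpha> p + s *\<^sub>R \<beta> p)) X = (\<lambda>p. r *\<^sub>R vb (\<rho> \<alpha>) X p + s *\<^sub>R vb (\<rho> \<beta>) X p)" if "X \<in> VF" for X
      unfolding anchor_add[OF sec] anchor_scale[OF assms(1)] anchor_scale[OF assms(2)]
        vb_add_left[OF VF_scale[OF C_const V(1)] VF_scale[OF C_const V(2)] that]
        vb_scale_left[OF V(1) that C_const] vb_scale_left[OF V(2) that C_const] by simp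
    have "slot_sum (vb (\<rho> (\<lambda>p. r *\<^sub>R \<alpha> p + s *\<^sub>R \<beta> p))) (\<lambda>Zs. eval_form \<gamma> Zs p) ?Xs =
        r *\<^sub>R slot_sum (vb (\<rho> \<alpha>)) (\<lambda>Zs. eval_form \<gamma> Zs p) ?Xs + s *\<^sub>R slot_sum (vb (\<rho> \<beta>)) (\<lambda>Zs. eval_form \<gamma> Zs p) ?Xs"
      unfolding slot_sum_eq_sum scaleR_sum_right sum.distrib[symmetric]
    proof (intro sum.cong refl)
      fix j assume "j \<in> {..<length ?Xs}"
      then have j: "j < q" "?Xs ! j \<in> VF" using True vf_ext(1) by auto
      have l: "linear (\<lambda>u. \<gamma> p ((map (\<lambda>X. X p) ?Xs)[j := u]))" using True j by (intro eval_update_linear) auto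
      show "eval_form \<gamma> (?Xs[j := vb (\<rho> (\<lambda>p. r *\<^sub>R \<alpha> p + s *\<^sub>R \<beta> p)) (?Xs ! j)]) p =
          r *\<^sub>R eval_form \<gamma> (?Xs[j := vb (\<rho> \<alpha>) (?Xs ! j)]) p + s *\<^sub>R eval_form \<gamma> (?Xs[j := vb (\<rho> \<beta>) (?Xs ! j)]) p"
        unfolding vb[OF j(2)] eval_update linear_add[OF l] linear_cmul[OF l] ..
    qed
    moreover have "br (\<lambda>p. r *\<^sub>R \<alpha> p + s *\<^sub>R \<beta> p) (eval_form \<gamma> ?Xs) p = r *\<^sub>R br \<alpha> (eval_form \<gamma> ?Xs) p + s *\<^sub>R br \<beta> (eval_form \<gamma> ?Xs) p"
      using br_linear_left[OF assms K_sec[OF eval_K[OF ext_VF]], of r s] by simp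
    ultimately show ?thesis unfolding lie_deriv_LD LD_def by (simp add: algebra_simps)
  qed (simp add: lie_deriv_wrong_length sec' assms)
qed

text \<open>The extra term comes from \<open>[f \<rho>(\<alpha>), X] = f [\<rho>(\<alpha>), X] - X(f) \<rho>(\<alpha>)\<close>; moving \<open>\<rho>(\<alpha>)\<close> to the front produces
the signs of the wedge product.\<close>

lemma lie_deriv_leibniz:
  assumes "\<alpha> \<in> \<Gamma>" "f \<in> C"
  shows "lie_deriv L (\<lambda>p. f p *\<^sub>R \<alpha> p) \<gamma> p vs = f p *\<^sub>R lie_deriv L \<alpha> \<gamma> p vs + d_wedge (atlas L) f (contract (\<rho> \<alpha>) \<gamma>) p vs"
proof (cases "length vs = q")
  case True
  let ?Xs = "ext p vs"
  note V = anchor_VF[OF assms(1)]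
  have vb: "vb (\<rho> (\<lambda>p. f p *\<^sub>R \<alpha> p)) X = (\<lambda>p. f p *\<^sub>R vb (\<rho> \<alpha>) X p - td f p (X p) *\<^sub>R \<rho> \<alpha> p)" if "X \<in> VF" for X
    unfolding anchor_scale[OF assms(1)] by (rule vb_scale_left[OF V that assms(2)])
  have "slot_sum (vb (\<rho> (\<lambda>p. f p *\<^sub>R \<alpha> p))) (\<lambda>Zs. eval_form \<gamma> Zs p) ?Xs =
      f p *\<^sub>R slot_sum (vb (\<rho> \<alpha>)) (\<lambda>Zs. eval_form \<gamma> Zs p) ?Xs - d_wedge (atlas L) f (contract (\<rho> \<alpha>) \<gamma>) p vs"
    unfolding slot_sum_eq_sum scaleR_sum_right d_wedge_def length_map sum_subtractf[symmetric]
  proof (intro sum.cong refl)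
    fix j assume "j \<in> {..<length vs}"
    then have j: "j < q" "j < length vs" "?Xs ! j \<in> VF" using True vf_ext(1) by auto
    have l: "linear (\<lambda>u. \<gamma> p ((map (\<lambda>X. X p) ?Xs)[j := u]))" using True j by (intro eval_update_linear) auto
    have "\<gamma> p (vs[j := \<rho> \<alpha> p]) = \<gamma> p (take j vs @ \<rho> \<alpha> p # drop (Suc j) vs)"
      using j by (simp add: upd_conv_take_nth_drop)
    also have "\<dots> = (-1) ^ length (take j vs) *\<^sub>R \<gamma> p (\<rho> \<alpha> p # take j vs @ drop (Suc j) vs)"
      using j True by (intro alternating_to_front[OF form_alternating[OF \<gamma>]]) simp
    finally have front: "\<gamma> p (vs[j := \<rho> \<alpha> p]) = (-1) ^ j *\<^sub>R contract (\<rho> \<alpha>) \<gamma> p (delete_nth j vs)"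
      using j by (simp add: contract_def delete_nth_def)
    have Xj: "(?Xs ! j) p = vs ! j" using j by (simp add: vf_ext(2))
    show "eval_form \<gamma> (?Xs[j := vb (\<rho> (\<lambda>p. f p *\<^sub>R \<alpha> p)) (?Xs ! j)]) p =
        f p *\<^sub>R eval_form \<gamma> (?Xs[j := vb (\<rho> \<alpha>) (?Xs ! j)]) p
        - ((-1) ^ j * td f p (vs ! j)) *\<^sub>R contract (\<rho> \<alpha>) \<gamma> p (delete_nth j vs)"
      unfolding vb[OF j(3)] eval_update linear_diff[OF l] linear_cmul[OF l] unfolding ext_at front Xj by simp
  qed
  moreover have "br (\<lambda>p. f p *\<^sub>R \<alpha> p) (eval_form \<gamma> ?Xs) p = f p *\<^sub>R br \<alpha> (eval_form \<gamma> ?Xs) p"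
    using br_scale_K[OF assms(2) eval_K[OF ext_VF] assms(1)] by simp
  ultimately show ?thesis unfolding lie_deriv_LD LD_def by (simp add: algebra_simps)
next
  case False
  have "contract (\<rho> \<alpha>) \<gamma> p (delete_nth j vs) = 0" if "j < length vs" for j
    using False that alternating_wrong_length[OF form_alternating[OF \<gamma>]] by (auto simp: contract_def delete_nth_def)
  then have "d_wedge (atlas L) f (contract (\<rho> \<alpha>) \<gamma>) p vs = 0" by (simp add: d_wedge_def)
  then show ?thesis using False by (simp add: lie_deriv_wrong_length section_scale assms del: mem_Collect_eq)
qed

text \<open>The Jacobi identity for the values of the form, and \<open>slot_sum_commutator\<close> for its arguments.\<close>

lemma lie_deriv_bracket:
  assumes "\<alpha> \<in> \<Gamma>" "\<beta> \<in> \<Gamma>"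
  shows "lie_deriv L (br \<alpha> \<beta>) \<gamma> p vs =
    lie_deriv L \<alpha> (lie_deriv L \<beta> \<gamma>) p vs - lie_deriv L \<beta> (lie_deriv L \<alpha> \<gamma>) p vs"
proof (cases "length vs = q")
  case True
  let ?Xs = "ext p vs" and ?E = "eval_form \<gamma>"
  have X: "set ?Xs \<subseteq> VF" "length ?Xs = q" using ext_VF True by auto
  have iter: "lie_deriv L a (lie_deriv L c \<gamma>) p vs =
      br a (br c (?E ?Xs)) p - slot_sum (vb (\<rho> c)) (\<lambda>Zs. br a (?E Zs) p) ?Xs
      - slot_sum (vb (\<rho> a)) (\<lambda>Zs. br c (?E Zs) p) ?Xs
      + slot_sum (vb (\<rho> a)) (slot_sum (vb (\<rho> c)) (\<lambda>Zs. ?E Zs p)) ?Xs"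
    if a: "a \<in> \<Gamma>" and c: "c \<in> \<Gamma>" for a c
  proof -
    note V = anchor_VF[OF a] anchor_VF[OF c]
    have "slot_sum (vb (\<rho> a)) (\<lambda>Zs. eval_form (lie_deriv L c \<gamma>) Zs p) ?Xs = slot_sum (vb (\<rho> a)) (\<lambda>Zs. LD c ?E Zs p) ?Xs"
      by (rule slot_sum_cong[of VF]) (use V X lie_deriv_form(2)[OF c] VF_vb in auto)
    also have "\<dots> = slot_sum (vb (\<rho> a)) (\<lambda>Zs. br c (?E Zs) p) ?Xs - slot_sum (vb (\<rho> a)) (slot_sum (vb (\<rho> c)) (\<lambda>Zs. ?E Zs p)) ?Xs"
      unfolding LD_def slot_sum_diff ..
    finally have 1: "slot_sum (vb (\<rho> a)) (\<lambda>Zs. eval_form (lie_deriv L c \<gamma>) Zs p) ?Xs = \<dots>" .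
    have E: "br c (?E ?Xs) \<in> \<Gamma>" "(\<lambda>p. slot_sum (vb (\<rho> c)) (\<lambda>Zs. ?E Zs p) ?Xs) \<in> \<Gamma>"
      using br_closed[OF c] slot_sum_K[OF V(2) X(1)] eval_K[OF X(1)] K_sec by auto
    have "eval_form (lie_deriv L c \<gamma>) ?Xs = (\<lambda>p'. br c (?E ?Xs) p' - slot_sum (vb (\<rho> c)) (\<lambda>Zs. ?E Zs p') ?Xs)"
      using lie_deriv_form(2)[OF c X] unfolding LD_def[abs_def] .
    then have "br a (eval_form (lie_deriv L c \<gamma>) ?Xs) p = br a (br c (?E ?Xs)) p - slot_sum (vb (\<rho> c)) (\<lambda>Zs. br a (?E Zs) p) ?Xs"
      using fun_cong[OF br_diff[OF E a], of p] br_slot_sum[OF a V(2) X(1), of p] by simp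
    then show ?thesis unfolding lie_deriv_LD[of a "lie_deriv L c \<gamma>"] LD_def[of a] 1 by simp
  qed
  note V = anchor_VF[OF assms(1)] anchor_VF[OF assms(2)]
  have comm: "slot_sum (vb (\<rho> \<beta>)) (slot_sum (vb (\<rho> \<alpha>)) (\<lambda>Zs. ?E Zs p)) ?Xs
      - slot_sum (vb (\<rho> \<alpha>)) (slot_sum (vb (\<rho> \<beta>)) (\<lambda>Zs. ?E Zs p)) ?Xs = slot_sum (vb (vb (\<rho> \<alpha>) (\<rho> \<beta>))) (\<lambda>Zs. ?E Zs p) ?Xs"
  proof (rule slot_sum_commutator[of VF])
    fix us ws :: "('m \<Rightarrow> 'e) list" and X assume "X \<in> VF" and "length us + length ws + 1 = length ?Xs"
    then have l: "length us + length ws + 1 = q" and X': "X \<in> VF" using True by auto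
    have j: "vb (vb (\<rho> \<alpha>) (\<rho> \<beta>)) X = (\<lambda>p. vb (\<rho> \<alpha>) (vb (\<rho> \<beta>) X) p - vb (\<rho> \<beta>) (vb (\<rho> \<alpha>) X) p)"
      using vb_jacobi[OF V X'] by auto
    show "?E (us @ vb (\<rho> \<alpha>) (vb (\<rho> \<beta>) X) # ws) p - ?E (us @ vb (\<rho> \<beta>) (vb (\<rho> \<alpha>) X) # ws) p = ?E (us @ vb (vb (\<rho> \<alpha>) (\<rho> \<beta>)) X # ws) p"
      unfolding j by (rule eval_slot_diff[OF l, symmetric])
  qed (rule X(1))
  have "br (br \<alpha> \<beta>) (?E ?Xs) p = br \<alpha> (br \<beta> (?E ?Xs)) p - br \<beta> (br \<alpha> (?E ?Xs)) p"
    using br_jacobi[OF assms K_sec[OF eval_K[OF X(1)]], of p] by simp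
  then show ?thesis
    unfolding iter[OF assms] iter[OF assms(2,1)]
    unfolding lie_deriv_LD LD_def anchor_morphism[OF assms] comm[symmetric] by (simp add: algebra_simps)
next
  case False
  have "lie_deriv L a (lie_deriv L c \<gamma>) p vs = 0" if "a \<in> \<Gamma>" "c \<in> \<Gamma>" for a c
  proof -
    note alt = form_alternating[OF lie_deriv_form(1)[OF that(2)]]
    have z: "eval_form (lie_deriv L c \<gamma>) Zs = (\<lambda>p. 0)" if "length Zs \<noteq> q" for Zs
      using alternating_wrong_length[OF alt] that by (auto simp: eval_form_def)
    have "slot_sum (vb (\<rho> a)) (\<lambda>Zs. eval_form (lie_deriv L c \<gamma>) Zs p) (ext p vs) = slot_sum (vb (\<rho> a)) (\<lambda>Zs. 0) (ext p vs)"
      using False z by (intro slot_sum_cong_length) simp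
    then show ?thesis using False z[of "ext p vs"] that
      unfolding lie_deriv_LD[of a] LD_def[of a] by (simp add: slot_sum_zero br_zero)
  qed
  then show ?thesis using False by (simp add: lie_deriv_wrong_length br_closed assms)
qed

end

lemma contract_form:
  assumes "\<gamma> \<in> forms L K (Suc r)" "X \<in> VF"
  shows "contract X \<gamma> \<in> forms L K r"
proof (rule formI)
  note alt = form_alternating[OF assms(1)]
  show "contract X \<gamma> p \<in> alternating_maps (K p) r" for p
    unfolding alternating_maps_def contract_def
  proof (intro CollectI conjI allI impI)
    show "\<gamma> p (X p # vs) \<in> K p" if "length vs = r" for vs using that by (intro alternating_in[OF alt]) simp
    show "\<gamma> p (X p # vs) = 0" if "length vs \<noteq> r" for vs using that by (intro alternating_wrong_length[OF alt]) simp
    show "linear (\<lambda>u. \<gamma> p (X p # vs[i := u]))" if "length vs = r \<and> i < r" for vs i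
      using alternating_slot_linear[OF alt, of "X p # take i vs" "drop (Suc i) vs" p] that
      by (simp add: upd_conv_take_nth_drop)
    show "\<gamma> p (X p # vs) = 0" if "length vs = r \<and> i < j \<and> j < r \<and> vs ! i = vs ! j" for vs i j
      using that by (intro alternating_repeat[OF alt, of _ "Suc i" "Suc j"]) auto
  qed
  show "eval_form (contract X \<gamma>) Xs \<in> \<Gamma>" if "set Xs \<subseteq> VF" "length Xs = r" for Xs
    using eval_form_section[OF assms(1), of "X # Xs"] that assms(2) K_sec by (simp add: eval_form_def contract_def)
qed

lemma lie_deriv_contract:
  assumes "\<gamma> \<in> forms L K (Suc r)" "\<alpha> \<in> \<Gamma>" "X \<in> VF"
  shows "lie_deriv L \<alpha> (contract X \<gamma>) p vs - lie_deriv L \<alpha> \<gamma> p (X p # vs) = \<gamma> p (vb (\<rho> \<alpha>) X p # vs)"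
proof (cases "length vs = r")
  case True
  let ?Xs = "ext p vs"
  have ev: "eval_form (contract X \<gamma>) Zs = eval_form \<gamma> (X # Zs)" for Zs by (simp add: eval_form_def contract_def)
  have "lie_deriv L \<alpha> \<gamma> p (X p # vs) = eval_form (lie_deriv L \<alpha> \<gamma>) (X # ?Xs) p"
    by (simp add: eval_form_def comp_def vf_ext(2))
  also have "\<dots> = LD \<alpha> (eval_form \<gamma>) (X # ?Xs) p"
    using True assms(3) ext_VF by (subst lie_deriv_form(2)[OF assms(1,2)]) auto
  finally show ?thesis
    unfolding lie_deriv_LD[of _ "contract X \<gamma>"] LD_def ev by (simp add: eval_form_def comp_def vf_ext(2))
next
  case False
  then show ?thesis
    using lie_deriv_wrong_length[OF contract_form[OF assms(1,3)] assms(2) False]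
      lie_deriv_wrong_length[OF assms(1,2), of "X p # vs" p]
      alternating_wrong_length[OF form_alternating[OF assms(1)], of "vb (\<rho> \<alpha>) X p # vs" p] by simp
qed

subsection \<open>Bundle maps into forms\<close>

text \<open>A section is a combination, with smooth coefficients, of the sections that are constant in a trivialisation.\<close>

lemma form_bundle_map_app:
  assumes "c\<^sub>1 \<in> form_bundle_maps L K r" "\<alpha> \<in> \<Gamma>"
  shows "app_sec c\<^sub>1 \<alpha> \<in> forms L K r"
proof -
  have c: "\<And>p a. a \<in> fibre L p \<Longrightarrow> c\<^sub>1 p a \<in> alternating_maps (K p) r"
    "\<And>p vs. linear_map_on (fibre L p) (\<lambda>a. c\<^sub>1 p a vs)"
    using assms(1) by (auto simp: form_bundle_maps_def)
  have s: "sm (U \<inter> V) (\<lambda>p. \<phi> p (c\<^sub>1 p (iv \<phi> p w) (map (tv (V, x) p) es)))"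
    if "(U, \<phi>) \<in> trivs L" "(V, x) \<in> atlas L" for U \<phi> V x w es
    using assms(1) that unfolding form_bundle_maps_def by fastforce
  obtain n :: nat and b :: "nat \<Rightarrow> 'f" where b: "\<And>w. w = (\<Sum>i<n. (w \<bullet> b i) *\<^sub>R b i)"
    by (rule subspace_onb[OF fin_f subspace_UNIV]) (metis UNIV_I)
  have alt: "app_sec c\<^sub>1 \<alpha> p \<in> alternating_maps (K p) r" for p
    using c(1) section_fibre[OF assms(2)] by (simp add: app_sec_def)
  have "sm (U \<inter> V) (\<lambda>p. \<phi> p (app_sec c\<^sub>1 \<alpha> p (map (tv (V, x) p) es)))"
    if tr: "(U, \<phi>) \<in> trivs L" and V: "(V, x) \<in> atlas L" for U \<phi> V x es
  proof -
    note t = trivs_triv[OF tr]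
    have o: "open (U \<inter> V)" using trivs_open[OF tr] chart(1)[OF V] by auto
    have "sm (U \<inter> V) (\<lambda>p. \<Sum>i<n. (\<phi> p (\<alpha> p) \<bullet> b i) *\<^sub>R \<phi> p (c\<^sub>1 p (iv \<phi> p (b i)) (map (tv (V, x) p) es)))"
      by (intro sm_sum sm_scaleR sm_inner_left o s[OF tr V] sm_subset[OF section_sm[OF assms(2) t]]) auto
    then show ?thesis
    proof (rule sm_cong[OF o])
      fix p assume "p \<in> U \<inter> V"
      then have p: "p \<in> U" by auto
      let ?vs = "map (tv (V, x) p) es"
      have "\<alpha> p = iv \<phi> p (\<phi> p (\<alpha> p))" using triv_iv(3)[OF t p section_fibre[OF assms(2)]] by simp
      also have "\<dots> = (\<Sum>i<n. (\<phi> p (\<alpha> p) \<bullet> b i) *\<^sub>R iv \<phi> p (b i))" by (rule iv_expand[OF t p b])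
      finally have "app_sec c\<^sub>1 \<alpha> p ?vs = c\<^sub>1 p (\<Sum>i<n. (\<phi> p (\<alpha> p) \<bullet> b i) *\<^sub>R iv \<phi> p (b i)) ?vs"
        by (simp add: app_sec_def)
      also have "\<dots> = (\<Sum>i<n. (\<phi> p (\<alpha> p) \<bullet> b i) *\<^sub>R c\<^sub>1 p (iv \<phi> p (b i)) ?vs)"
        by (rule linear_map_on_sum[OF c(2) fibre_subspace triv_iv(1)[OF t p]])
      finally have e: "app_sec c\<^sub>1 \<alpha> p ?vs = \<dots>" .
      have "c\<^sub>1 p (iv \<phi> p (b i)) ?vs \<in> fibre L p" for i
        using alternating_in[OF c(1)[OF triv_iv(1)[OF t p]], of ?vs] alternating_wrong_length[OF c(1)[OF triv_iv(1)[OF t p]], of ?vs]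
          K_fibre subspace_0[OF fibre_subspace] by (cases "length ?vs = r") auto
      then show "(\<Sum>i<n. (\<phi> p (\<alpha> p) \<bullet> b i) *\<^sub>R \<phi> p (c\<^sub>1 p (iv \<phi> p (b i)) ?vs)) = \<phi> p (app_sec c\<^sub>1 \<alpha> p ?vs)"
        unfolding e by (intro triv_sum[OF t p, symmetric]) auto
    qed
  qed
  then show ?thesis using alt by (auto simp: forms_def)
qed

lemma form_bundle_mapI:
  assumes alt: "\<And>p a. a \<in> fibre L p \<Longrightarrow> c\<^sub>1 p a \<in> alternating_maps (K p) r"
    and zero: "\<And>p a. a \<notin> fibre L p \<Longrightarrow> c\<^sub>1 p a = (\<lambda>vs. 0)"
    and lin: "\<And>p vs. linear_map_on (fibre L p) (\<lambda>a. c\<^sub>1 p a vs)"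
    and app: "\<And>\<alpha>. \<alpha> \<in> \<Gamma> \<Longrightarrow> app_sec c\<^sub>1 \<alpha> \<in> forms L K r"
  shows "c\<^sub>1 \<in> form_bundle_maps L K r"
proof -
  interpret F: subbundle L "fibre L" by (rule full_subbundle)
  have "sm (U \<inter> V) (\<lambda>p. \<phi> p (c\<^sub>1 p (iv \<phi> p w) (map (tv (V, x) p) es)))"
    if tr: "(U, \<phi>) \<in> trivs L" and V: "(V, x) \<in> atlas L" for U \<phi> V x w es
  proof (rule sm_local)
    fix p assume p: "p \<in> U \<inter> V"
    note t = trivs_triv[OF tr]
    have o: "open (U \<inter> V)" using trivs_open[OF tr] chart(1)[OF V] by auto
    obtain f S where f: "f \<in> C" "f p = 1" "closed S" "S \<subseteq> U" "\<And>q. q \<notin> S \<Longrightarrow> f q = 0"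
      using bump[OF trivs_open[OF tr], of p] p by (metis IntD1)
    define \<alpha> where "\<alpha> q = (if q \<in> U then f q *\<^sub>R iv \<phi> q w else 0)" for q
    have "\<alpha> \<in> sub_sections L (fibre L)"
      using F.bump_frame[OF t[unfolded triv_def] f(1,3,4,5), of w] unfolding \<alpha>_def[abs_def] by simp
    then have \<alpha>: "\<alpha> \<in> \<Gamma>" by (rule F.K_sec)
    have s: "sm (U \<inter> V) (\<lambda>q. \<phi> q (app_sec c\<^sub>1 \<alpha> q (map (tv (V, x) q) es)))"
      using app[OF \<alpha>] tr V unfolding forms_def by fastforce
    let ?N = "U \<inter> V \<inter> {q. f q \<noteq> 0}"
    have N: "open ?N" "p \<in> ?N" using o open_nonzero[OF f(1)] p f(2) by auto
    have fN: "sm ?N f" using f(1) sm_subset[of UNIV f ?N] by simp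
    have "sm ?N (\<lambda>q. inverse (f q) *\<^sub>R \<phi> q (app_sec c\<^sub>1 \<alpha> q (map (tv (V, x) q) es)))"
      by (intro sm_scaleR N sm_inverse fN sm_subset[OF s]) auto
    then have "sm ?N (\<lambda>q. \<phi> q (c\<^sub>1 q (iv \<phi> q w) (map (tv (V, x) q) es)))"
    proof (rule sm_cong[OF N(1)])
      fix q assume "q \<in> ?N"
      then have q: "q \<in> U" "f q \<noteq> 0" by auto
      let ?vs = "map (tv (V, x) q) es"
      note iv = triv_iv(1)[OF t q(1), of w]
      have "c\<^sub>1 q (iv \<phi> q w) ?vs \<in> fibre L q"
        using alternating_in[OF alt[OF iv], of ?vs] alternating_wrong_length[OF alt[OF iv], of ?vs]
          K_fibre subspace_0[OF fibre_subspace] by (cases "length ?vs = r") auto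
      then have "\<phi> q (app_sec c\<^sub>1 \<alpha> q ?vs) = f q *\<^sub>R \<phi> q (c\<^sub>1 q (iv \<phi> q w) ?vs)"
        using linear_map_onD(2)[OF lin iv] q(1) by (simp add: app_sec_def \<alpha>_def triv_linear[OF t])
      then show "inverse (f q) *\<^sub>R \<phi> q (app_sec c\<^sub>1 \<alpha> q ?vs) = \<phi> q (c\<^sub>1 q (iv \<phi> q w) ?vs)"
        using q(2) by simp
    qed
    then show "\<exists>N. open N \<and> p \<in> N \<and> sm N (\<lambda>q. \<phi> q (c\<^sub>1 q (iv \<phi> q w) (map (tv (V, x) q) es)))"
      using N by blast
  qed
  then show ?thesis unfolding form_bundle_maps_def using alt zero lin by auto
qed

end

section \<open>Horizontal IM forms\<close>

context semisimple_ideal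
begin

lemma br_ad_injective:
  assumes "\<zeta> \<in> \<K>" "\<zeta>' \<in> \<K>" "\<And>\<xi>. \<xi> \<in> \<K> \<Longrightarrow> br \<xi> \<zeta> p = br \<xi> \<zeta>' p"
  shows "\<zeta> p = \<zeta>' p"
proof (rule ad_injective[OF assms(1,2)])
  fix \<xi> assume \<xi>: "\<xi> \<in> \<K>"
  show "br \<zeta> \<xi> p = br \<zeta>' \<xi> p"
    unfolding br_anti[OF K_sec[OF assms(1)] K_sec[OF \<xi>]] br_anti[OF K_sec[OF assms(2)] K_sec[OF \<xi>]] using assms(3)[OF \<xi>] by simp
qed

text \<open>\<open>\<rho>(\<xi>) = 0\<close>.\<close>

lemma LD_vertical:
  assumes "\<gamma> \<in> forms L K q" "\<xi> \<in> \<K>" "set Xs \<subseteq> VF"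
  shows "LD \<xi> (eval_form \<gamma>) Xs = br \<xi> (eval_form \<gamma> Xs)"
proof
  fix p
  have "eval_form \<gamma> (Xs[j := vb (\<rho> \<xi>) (Xs ! j)]) p = 0" if "j < length Xs" for j
  proof (cases "length Xs = q")
    case True
    have "Xs ! j \<in> VF" using nth_mem[OF that] assms(3) by blast
    then have "vb (\<rho> \<xi>) (Xs ! j) = (\<lambda>p. 0)" using vb_zero_left anchor_K[OF assms(2)] by simp
    then show ?thesis using eval_update[OF assms(1), of Xs j] linear_0[OF eval_update_linear[OF assms(1) True, of j p]] True that by simp
  next
    case False
    then show ?thesis using eval_wrong_length[OF assms(1), of "Xs[j := vb (\<rho> \<xi>) (Xs ! j)]"] by simp
  qed
  then show "LD \<xi> (eval_form \<gamma>) Xs p = br \<xi> (eval_form \<gamma> Xs) p" by (simp add: LD_def slot_sum_eq_sum)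
qed

lemma lie_deriv_vertical:
  "\<gamma> \<in> forms L K q \<Longrightarrow> \<xi> \<in> \<K> \<Longrightarrow> lie_deriv L \<xi> \<gamma> p vs = br \<xi> (eval_form \<gamma> (ext p vs)) p"
  by (simp only: lie_deriv_LD LD_vertical[OF _ _ ext_VF])

lemma eval_ext: "eval_form \<gamma> (ext p vs) p = \<gamma> p vs"
  by (simp add: eval_form_def comp_def vf_ext(2))

lemma lie_deriv_zero: "\<alpha> \<in> \<Gamma> \<Longrightarrow> lie_deriv L \<alpha> (\<lambda>p vs. 0) = (\<lambda>p vs. 0)"
  by (intro ext) (simp add: lie_deriv_LD LD_def eval_form_def slot_sum_zero br_zero)

lemma delta0_app: "\<alpha> \<in> \<Gamma> \<Longrightarrow> app_sec (snd (delta0 L \<gamma>)) \<alpha> = contract (\<rho> \<alpha>) \<gamma>"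
  by (auto simp: app_sec_def delta0_def contract_def anchor_sec_def section_fibre)

lemma form_cons_linear:
  assumes "\<gamma> \<in> forms L K q"
  shows "linear (\<lambda>u. \<gamma> p (u # vs))"
proof (cases "Suc (length vs) = q")
  case True
  then show ?thesis using alternating_slot_linear[OF form_alternating[OF assms], of "[]" vs p] by simp
next
  case False
  then have "\<gamma> p (u # vs) = 0" for u using alternating_wrong_length[OF form_alternating[OF assms]] by simp
  then show ?thesis by (simp add: module_hom_zero)
qed

lemma contract_degree_0: "\<gamma> \<in> forms L K 0 \<Longrightarrow> contract X \<gamma> = (\<lambda>p vs. 0)"
  using alternating_wrong_length[OF form_alternating] by (fastforce simp: contract_def)

lemma delta0_bundle_map:
  assumes \<gamma>: "\<gamma> \<in> forms L K q"
  shows "snd (delta0 L \<gamma>) \<in> (case q of 0 \<Rightarrow> {\<lambda>p a vs. 0} | Suc r \<Rightarrow> form_bundle_maps L K r)"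
proof (cases q)
  case 0
  have "snd (delta0 L \<gamma>) = (\<lambda>p a vs. 0)"
    using alternating_wrong_length[OF form_alternating[OF \<gamma>]] 0 by (intro ext) (auto simp: delta0_def)
  then show ?thesis using 0 by simp
next
  case (Suc r)
  have "snd (delta0 L \<gamma>) \<in> form_bundle_maps L K r"
  proof (rule form_bundle_mapI)
    show app: "app_sec (snd (delta0 L \<gamma>)) \<alpha> \<in> forms L K r" if "\<alpha> \<in> \<Gamma>" for \<alpha>
      unfolding delta0_app[OF that] using \<gamma> Suc anchor_VF[OF that] by (intro contract_form) auto
    show "snd (delta0 L \<gamma>) p a \<in> alternating_maps (K p) r" if a: "a \<in> fibre L p" for p a
    proof -
      obtain \<alpha> where "\<alpha> \<in> \<Gamma>" "\<alpha> p = a" using section_through_fibre[OF a] by metis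
      then show ?thesis using form_alternating[OF app, of \<alpha> p] by (simp add: app_sec_def)
    qed
    show "snd (delta0 L \<gamma>) p a = (\<lambda>vs. 0)" if "a \<notin> fibre L p" for p a using that by (simp add: delta0_def)
    show "linear_map_on (fibre L p) (\<lambda>a. snd (delta0 L \<gamma>) p a vs)" for p vs
    proof -
      note l = form_cons_linear[OF \<gamma>, of p vs] and a = linear_map_onD[OF anchor_linear[of p]]
      show ?thesis unfolding linear_map_on_def delta0_def
        by (simp add: subspace_add[OF fibre_subspace] subspace_scale[OF fibre_subspace] a linear_add[OF l] linear_cmul[OF l])
    qed
  qed
  then show ?thesis using Suc by simp
qed

lemma delta0_horizontal:
  assumes \<gamma>: "\<gamma> \<in> forms L K q"
  shows "delta0 L \<gamma> \<in> horizontal_im_forms L K q"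
proof -
  obtain c\<^sub>0 c\<^sub>1 where c: "delta0 L \<gamma> = (c\<^sub>0, c\<^sub>1)" by force
  have c0: "c\<^sub>0 \<alpha> = lie_deriv L \<alpha> \<gamma>" if "\<alpha> \<in> \<Gamma>" for \<alpha> using c that by (auto simp: delta0_def)
  have c1: "app_sec c\<^sub>1 \<alpha> = contract (\<rho> \<alpha>) \<gamma>" if "\<alpha> \<in> \<Gamma>" for \<alpha> using delta0_app[OF that, of \<gamma>] c by simp
  have "(c\<^sub>0, c\<^sub>1) \<in> im_forms L K q"
    unfolding im_forms_def
  proof (intro CollectI case_prodI conjI ballI allI impI)
    show "c\<^sub>0 \<alpha> \<in> forms L K q" if "\<alpha> \<in> \<Gamma>" for \<alpha> using lie_deriv_form(1)[OF \<gamma> that] c0[OF that] by simp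
    show "c\<^sub>0 \<alpha> = form_zero" if "\<alpha> \<notin> \<Gamma>" for \<alpha> using c that by (auto simp: delta0_def)
    show "c\<^sub>1 \<in> (case q of 0 \<Rightarrow> {\<lambda>p a vs. 0} | Suc r \<Rightarrow> form_bundle_maps L K r)"
      using delta0_bundle_map[OF \<gamma>] c by simp
    fix \<alpha> assume \<alpha>: "\<alpha> \<in> \<Gamma>"
    {
      fix f assume f: "f \<in> C"
      show "c\<^sub>0 (\<lambda>p. f p *\<^sub>R \<alpha> p) = form_add (form_scale f (c\<^sub>0 \<alpha>)) (d_wedge (atlas L) f (app_sec c\<^sub>1 \<alpha>))"
        unfolding c0[OF \<alpha>] c0[OF section_scale[OF f \<alpha>]] c1[OF \<alpha>]
        by (intro ext) (simp add: lie_deriv_leibniz[OF \<gamma> \<alpha> f] form_add_def form_scale_def)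
    }
    fix \<beta> assume \<beta>: "\<beta> \<in> \<Gamma>"
    show "c\<^sub>0 (\<lambda>p. r *\<^sub>R \<alpha> p + s *\<^sub>R \<beta> p) = form_add (form_scale (\<lambda>_. r) (c\<^sub>0 \<alpha>)) (form_scale (\<lambda>_. s) (c\<^sub>0 \<beta>))" for r s
    proof -
      have "(\<lambda>p. r *\<^sub>R \<alpha> p + s *\<^sub>R \<beta> p) \<in> \<Gamma>" by (intro section_add section_scale[OF C_const] \<alpha> \<beta>)
      then show ?thesis unfolding c0[OF \<alpha>] c0[OF \<beta>]
        by (intro ext) (simp add: c0 lie_deriv_linear[OF \<gamma> \<alpha> \<beta>] form_add_def form_scale_def)
    qed
    show "c\<^sub>0 (br \<alpha> \<beta>) = form_add (lie_deriv L \<alpha> (c\<^sub>0 \<beta>)) (form_minus (lie_deriv L \<beta> (c\<^sub>0 \<alpha>)))"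
      unfolding c0[OF \<alpha>] c0[OF \<beta>] c0[OF br_closed[OF \<alpha> \<beta>]]
      by (intro ext) (simp add: lie_deriv_bracket[OF \<gamma> \<alpha> \<beta>] form_add_def form_minus_def)
    show "app_sec c\<^sub>1 (br \<alpha> \<beta>) = form_add (lie_deriv L \<alpha> (app_sec c\<^sub>1 \<beta>)) (form_minus (contract (\<rho> \<beta>) (c\<^sub>0 \<alpha>)))"
    proof (cases q)
      case 0
      have "contract X \<gamma> = (\<lambda>p vs. 0)" "contract X (lie_deriv L \<alpha> \<gamma>) = (\<lambda>p vs. 0)" for X
        using contract_degree_0 \<gamma> lie_deriv_form(1)[OF \<gamma> \<alpha>] 0 by auto
      then show ?thesis unfolding c0[OF \<alpha>] c1[OF \<beta>] c1[OF br_closed[OF \<alpha> \<beta>]]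
        by (simp add: form_add_def form_minus_def lie_deriv_zero \<alpha>)
    next
      case (Suc r)
      show ?thesis unfolding c0[OF \<alpha>] c1[OF \<beta>] c1[OF br_closed[OF \<alpha> \<beta>]] anchor_morphism[OF \<alpha> \<beta>]
        using lie_deriv_contract[OF \<gamma>[unfolded Suc] \<alpha> anchor_VF[OF \<beta>]]
        by (intro ext) (simp add: form_add_def form_minus_def contract_def)
    qed
    show "contract (\<rho> \<alpha>) (app_sec c\<^sub>1 \<beta>) = form_minus (contract (\<rho> \<beta>) (app_sec c\<^sub>1 \<alpha>))"
    proof (intro ext)
      fix p vs
      have "\<gamma> p (\<rho> \<beta> p # \<rho> \<alpha> p # vs) = - \<gamma> p (\<rho> \<alpha> p # \<rho> \<beta> p # vs)"
      proof (cases "length vs + 2 = q")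
        case True
        then show ?thesis using alternating_swap[OF form_alternating[OF \<gamma>], of "[]" "[]" vs p "\<rho> \<beta> p" "\<rho> \<alpha> p"] by simp
      next
        case False
        then show ?thesis using alternating_wrong_length[OF form_alternating[OF \<gamma>, of p]] by simp
      qed
      then show "contract (\<rho> \<alpha>) (app_sec c\<^sub>1 \<beta>) p vs = form_minus (contract (\<rho> \<beta>) (app_sec c\<^sub>1 \<alpha>)) p vs"
        unfolding c1[OF \<alpha>] c1[OF \<beta>] by (simp add: contract_def form_minus_def)
    qed
  qed
  moreover have "c\<^sub>1 p a = (\<lambda>vs. 0)" if "a \<in> K p" for p a
  proof
    fix vs
    have "anchor L p a = 0" using that semisimple_ideal by (auto simp: semisimple_bundle_of_ideals_def bundle_of_ideals_def)
    then show "c\<^sub>1 p a vs = 0" using c linear_0[OF form_cons_linear[OF \<gamma>, of p vs]] by (auto simp: delta0_def)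
  qed
  ultimately show ?thesis unfolding c by (simp add: horizontal_im_forms_def)
qed

lemma delta0_add:
  assumes "\<gamma> \<in> forms L K q" "\<gamma>' \<in> forms L K q"
  shows "delta0 L (form_add \<gamma> \<gamma>') = im_add (delta0 L \<gamma>) (delta0 L \<gamma>')"
proof -
  have "lie_deriv L \<alpha> (form_add \<gamma> \<gamma>') p vs = lie_deriv L \<alpha> \<gamma> p vs + lie_deriv L \<alpha> \<gamma>' p vs" if \<alpha>: "\<alpha> \<in> \<Gamma>" for \<alpha> p vs
  proof -
    have e: "eval_form (form_add \<gamma> \<gamma>') Zs = (\<lambda>p. eval_form \<gamma> Zs p + eval_form \<gamma>' Zs p)" for Zs
      by (simp add: eval_form_def form_add_def)
    note G = K_sec[OF eval_K[OF assms(1) ext_VF]] K_sec[OF eval_K[OF assms(2) ext_VF]]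
    show ?thesis unfolding lie_deriv_LD LD_def e slot_sum_add br_add[OF G \<alpha>] by simp
  qed
  then show ?thesis
    by (auto simp: delta0_def im_add_def form_add_def form_zero_def fun_eq_iff)
qed

lemma delta0_scale:
  assumes "\<gamma> \<in> forms L K q"
  shows "delta0 L (form_scale (\<lambda>_. r) \<gamma>) = im_scale r (delta0 L \<gamma>)"
proof -
  have "lie_deriv L \<alpha> (form_scale (\<lambda>_. r) \<gamma>) p vs = r *\<^sub>R lie_deriv L \<alpha> \<gamma> p vs" if \<alpha>: "\<alpha> \<in> \<Gamma>" for \<alpha> p vs
  proof -
    have e: "eval_form (form_scale (\<lambda>_. r) \<gamma>) Zs = (\<lambda>p. r *\<^sub>R eval_form \<gamma> Zs p)" for Zs
      by (simp add: eval_form_def form_scale_def)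
    note G = K_sec[OF eval_K[OF assms ext_VF]]
    show ?thesis unfolding lie_deriv_LD LD_def e slot_sum_scale br_scale[OF G \<alpha>] by (simp add: scaleR_diff_right)
  qed
  then show ?thesis
    by (auto simp: delta0_def im_scale_def form_scale_def form_zero_def fun_eq_iff)
qed

text \<open>By \<open>lie_deriv_vertical\<close> the restriction of \<open>\<delta>\<^sup>0\<gamma>\<close> to \<open>\<Gamma>(K)\<close> is \<open>\<xi> \<mapsto> [\<xi>, \<gamma>]\<close>.\<close>

lemma delta0_inj: "inj_on (delta0 L) (forms L K q)"
proof (rule inj_onI, intro ext)
  fix \<gamma> \<gamma>' p vs
  assume \<gamma>: "\<gamma> \<in> forms L K q" and \<gamma>': "\<gamma>' \<in> forms L K q" and e: "delta0 L \<gamma> = delta0 L \<gamma>'"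
  have "eval_form \<gamma> (ext p vs) p = eval_form \<gamma>' (ext p vs) p"
  proof (rule br_ad_injective[OF eval_K[OF \<gamma> ext_VF] eval_K[OF \<gamma>' ext_VF]])
    fix \<xi> assume \<xi>: "\<xi> \<in> \<K>"
    have "fst (delta0 L \<gamma>) \<xi> p vs = fst (delta0 L \<gamma>') \<xi> p vs" using e by simp
    then have "lie_deriv L \<xi> \<gamma> p vs = lie_deriv L \<xi> \<gamma>' p vs" using K_sec[OF \<xi>] by (simp add: delta0_def)
    then show "br \<xi> (eval_form \<gamma> (ext p vs)) p = br \<xi> (eval_form \<gamma>' (ext p vs)) p"
      unfolding lie_deriv_vertical[OF \<gamma> \<xi>] lie_deriv_vertical[OF \<gamma>' \<xi>] .
  qed
  then show "\<gamma> p vs = \<gamma>' p vs" by (simp only: eval_ext)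
qed

lemma im_formD:
  assumes "(c\<^sub>0, c\<^sub>1) \<in> im_forms L K q"
  shows "\<alpha> \<in> \<Gamma> \<Longrightarrow> c\<^sub>0 \<alpha> \<in> forms L K q" "\<alpha> \<notin> \<Gamma> \<Longrightarrow> c\<^sub>0 \<alpha> = form_zero"
    "\<alpha> \<in> \<Gamma> \<Longrightarrow> \<beta> \<in> \<Gamma> \<Longrightarrow> c\<^sub>0 (\<lambda>p. r *\<^sub>R \<alpha> p + s *\<^sub>R \<beta> p) = form_add (form_scale (\<lambda>_. r) (c\<^sub>0 \<alpha>)) (form_scale (\<lambda>_. s) (c\<^sub>0 \<beta>))"
    "c\<^sub>1 \<in> (case q of 0 \<Rightarrow> {\<lambda>p a vs. 0} | Suc r \<Rightarrow> form_bundle_maps L K r)"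
    "\<alpha> \<in> \<Gamma> \<Longrightarrow> f \<in> C \<Longrightarrow> c\<^sub>0 (\<lambda>p. f p *\<^sub>R \<alpha> p) = form_add (form_scale f (c\<^sub>0 \<alpha>)) (d_wedge (atlas L) f (app_sec c\<^sub>1 \<alpha>))"
    "\<alpha> \<in> \<Gamma> \<Longrightarrow> \<beta> \<in> \<Gamma> \<Longrightarrow> c\<^sub>0 (br \<alpha> \<beta>) = form_add (lie_deriv L \<alpha> (c\<^sub>0 \<beta>)) (form_minus (lie_deriv L \<beta> (c\<^sub>0 \<alpha>)))"
    "\<alpha> \<in> \<Gamma> \<Longrightarrow> \<beta> \<in> \<Gamma> \<Longrightarrow> app_sec c\<^sub>1 (br \<alpha> \<beta>) = form_add (lie_deriv L \<alpha> (app_sec c\<^sub>1 \<beta>)) (form_minus (contract (\<rho> \<beta>) (c\<^sub>0 \<alpha>)))"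
  using assms unfolding im_forms_def mem_Collect_eq prod.case by (elim conjE, blast)+

text \<open>The \<open>\<zeta>\<close> that induces \<open>T Xs\<close> is unique, so it inherits multilinearity from \<open>T\<close>.\<close>

lemma form_of_derivations:
  fixes T :: "('m \<Rightarrow> 'e) list \<Rightarrow> ('m \<Rightarrow> 'v) \<Rightarrow> 'm \<Rightarrow> 'v"
  assumes inner: "\<And>Xs. set Xs \<subseteq> VF \<Longrightarrow> length Xs = q \<Longrightarrow> \<exists>\<zeta>\<in>\<K>. \<forall>\<xi>\<in>\<K>. T Xs \<xi> = br \<zeta> \<xi>"
    and add: "\<And>Xs Ys X Y \<xi> p. set Xs \<subseteq> VF \<Longrightarrow> set Ys \<subseteq> VF \<Longrightarrow> X \<in> VF \<Longrightarrow> Y \<in> VF \<Longrightarrow> length Xs + length Ys + 1 = q \<Longrightarrow> \<xi> \<in> \<K> \<Longrightarrow>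
      T (Xs @ (\<lambda>p. X p + Y p) # Ys) \<xi> p = T (Xs @ X # Ys) \<xi> p + T (Xs @ Y # Ys) \<xi> p"
    and scale: "\<And>Xs Ys X f \<xi> p. set Xs \<subseteq> VF \<Longrightarrow> set Ys \<subseteq> VF \<Longrightarrow> X \<in> VF \<Longrightarrow> f \<in> C \<Longrightarrow> length Xs + length Ys + 1 = q \<Longrightarrow> \<xi> \<in> \<K> \<Longrightarrow>
      T (Xs @ (\<lambda>p. f p *\<^sub>R X p) # Ys) \<xi> p = f p *\<^sub>R T (Xs @ X # Ys) \<xi> p"
    and alt: "\<And>Xs i j \<xi> p. set Xs \<subseteq> VF \<Longrightarrow> length Xs = q \<Longrightarrow> i < j \<Longrightarrow> j < q \<Longrightarrow> Xs ! i = Xs ! j \<Longrightarrow> \<xi> \<in> \<K> \<Longrightarrow> T Xs \<xi> p = 0"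
  obtains \<gamma> where "\<gamma> \<in> forms L K q"
    "\<And>Xs \<xi>. set Xs \<subseteq> VF \<Longrightarrow> length Xs = q \<Longrightarrow> \<xi> \<in> \<K> \<Longrightarrow> br (eval_form \<gamma> Xs) \<xi> = T Xs \<xi>"
proof -
  have "\<exists>\<Phi>. \<forall>Xs. set Xs \<subseteq> VF \<and> length Xs = q \<longrightarrow> \<Phi> Xs \<in> \<K> \<and> (\<forall>\<xi>\<in>\<K>. T Xs \<xi> = br (\<Phi> Xs) \<xi>)"
    using inner by (intro choice) blast
  then obtain \<Phi> where \<Phi>: "\<And>Xs. set Xs \<subseteq> VF \<Longrightarrow> length Xs = q \<Longrightarrow> \<Phi> Xs \<in> \<K>"
    "\<And>Xs \<xi>. set Xs \<subseteq> VF \<Longrightarrow> length Xs = q \<Longrightarrow> \<xi> \<in> \<K> \<Longrightarrow> br (\<Phi> Xs) \<xi> = T Xs \<xi>" by metis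
  have eqI: "\<zeta> = \<zeta>'" if "\<zeta> \<in> \<K>" "\<zeta>' \<in> \<K>" "\<And>\<xi> p. \<xi> \<in> \<K> \<Longrightarrow> br \<zeta> \<xi> p = br \<zeta>' \<xi> p" for \<zeta> \<zeta>'
    using ad_injective[OF that(1,2)] that(3) by (intro ext) blast
  have mem: "\<Phi> (Xs @ Z # Ys) \<in> \<K>" "\<And>\<xi>. \<xi> \<in> \<K> \<Longrightarrow> br (\<Phi> (Xs @ Z # Ys)) \<xi> = T (Xs @ Z # Ys) \<xi>"
    if "set Xs \<subseteq> VF" "set Ys \<subseteq> VF" "length Xs + length Ys + 1 = q" "Z \<in> VF" for Xs Ys Z
    using that \<Phi>[of "Xs @ Z # Ys"] by auto
  obtain \<gamma> where \<gamma>: "\<gamma> \<in> forms L K q" "\<And>Xs. set Xs \<subseteq> VF \<Longrightarrow> length Xs = q \<Longrightarrow> eval_form \<gamma> Xs = \<Phi> Xs"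
  proof (rule form_of_multilinear[of q \<Phi>])
    show "\<Phi> Xs \<in> \<K>" if "set Xs \<subseteq> VF" "length Xs = q" for Xs by (rule \<Phi>(1)[OF that])
  next
    fix Xs Ys :: "('m \<Rightarrow> 'e) list" and X Y
    assume V: "set Xs \<subseteq> VF" "set Ys \<subseteq> VF" "X \<in> VF" "Y \<in> VF" and l: "length Xs + length Ys + 1 = q"
    note P = mem[OF V(1,2) l]
    show "\<Phi> (Xs @ (\<lambda>p. X p + Y p) # Ys) = (\<lambda>p. \<Phi> (Xs @ X # Ys) p + \<Phi> (Xs @ Y # Ys) p)"
    proof (rule eqI[OF P(1)[OF VF_add[OF V(3,4)]] K_closed(1)[OF P(1)[OF V(3)] P(1)[OF V(4)]]])
      fix \<xi> p assume \<xi>: "\<xi> \<in> \<K>"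
      show "br (\<Phi> (Xs @ (\<lambda>p. X p + Y p) # Ys)) \<xi> p = br (\<lambda>p. \<Phi> (Xs @ X # Ys) p + \<Phi> (Xs @ Y # Ys) p) \<xi> p"
        unfolding br_add_left[OF K_sec[OF P(1)[OF V(3)]] K_sec[OF P(1)[OF V(4)]] K_sec[OF \<xi>]]
          P(2)[OF V(3) \<xi>] P(2)[OF V(4) \<xi>] P(2)[OF VF_add[OF V(3,4)] \<xi>] by (rule add[OF V l \<xi>])
    qed
  next
    fix Xs Ys :: "('m \<Rightarrow> 'e) list" and X and f :: "'m \<Rightarrow> real"
    assume V: "set Xs \<subseteq> VF" "set Ys \<subseteq> VF" "X \<in> VF" "f \<in> C" and l: "length Xs + length Ys + 1 = q"
    note P = mem[OF V(1,2) l]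
    show "\<Phi> (Xs @ (\<lambda>p. f p *\<^sub>R X p) # Ys) = (\<lambda>p. f p *\<^sub>R \<Phi> (Xs @ X # Ys) p)"
    proof (rule eqI[OF P(1)[OF VF_scale[OF V(4,3)]] K_closed(3)[OF V(4) P(1)[OF V(3)]]])
      fix \<xi> p assume \<xi>: "\<xi> \<in> \<K>"
      show "br (\<Phi> (Xs @ (\<lambda>p. f p *\<^sub>R X p) # Ys)) \<xi> p = br (\<lambda>p. f p *\<^sub>R \<Phi> (Xs @ X # Ys) p) \<xi> p"
        unfolding br_scale_K[OF V(4) \<xi> K_sec[OF P(1)[OF V(3)]]] P(2)[OF V(3) \<xi>] P(2)[OF VF_scale[OF V(4,3)] \<xi>]
        by (rule scale[OF V l \<xi>])
    qed
  next
    fix Xs :: "('m \<Rightarrow> 'e) list" and i j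
    assume V: "set Xs \<subseteq> VF" "length Xs = q" "i < j" "j < q" "Xs ! i = Xs ! j"
    show "\<Phi> Xs = (\<lambda>p. 0)"
    proof (rule eqI[OF \<Phi>(1)[OF V(1,2)] K_closed(4)])
      fix \<xi> p assume \<xi>: "\<xi> \<in> \<K>"
      show "br (\<Phi> Xs) \<xi> p = br (\<lambda>p. 0) \<xi> p"
        unfolding \<Phi>(2)[OF V(1,2) \<xi>] br_zero_left[OF K_sec[OF \<xi>]] by (rule alt[OF V \<xi>])
    qed
  qed blast
  show ?thesis by (rule that[OF \<gamma>(1)]) (use \<gamma>(2) \<Phi>(2) in simp)
qed

text \<open>The form \<open>\<gamma>\<close> is determined by \<open>c\<^sub>0(\<xi>) = [\<xi>, \<gamma>]\<close> for \<open>\<xi> \<in> \<Gamma>(K)\<close>. The other values of \<open>c\<close> are then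
found by bracketing with \<open>\<xi>\<close>.\<close>

lemma delta0_surj:
  assumes c: "c \<in> horizontal_im_forms L K q"
  obtains \<gamma> where "\<gamma> \<in> forms L K q" "delta0 L \<gamma> = c"
proof -
  obtain c\<^sub>0 c\<^sub>1 where cc: "c = (c\<^sub>0, c\<^sub>1)" by force
  have im: "(c\<^sub>0, c\<^sub>1) \<in> im_forms L K q" and hor: "\<And>p a. a \<in> K p \<Longrightarrow> c\<^sub>1 p a = (\<lambda>vs. 0)"
    using c by (auto simp: horizontal_im_forms_def cc)
  note D = im_formD[OF im]
  note ev = eval_form_section[OF D(1)[OF K_sec]]
  have app0: "app_sec c\<^sub>1 \<xi> = (\<lambda>p vs. 0)" if "\<xi> \<in> \<K>" for \<xi>
    using hor section_K[OF that] by (auto simp: app_sec_def)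
  \<comment> \<open>The minus sign is due to \<open>form_of_derivations\<close> having the form in the first argument of the bracket.\<close>
  have inner: "\<exists>\<zeta>\<in>\<K>. \<forall>\<xi>\<in>\<K>. (\<lambda>p. - eval_form (c\<^sub>0 \<xi>) Xs p) = br \<zeta> \<xi>" if X: "set Xs \<subseteq> VF" "length Xs = q" for Xs
  proof -
    obtain \<zeta> where \<zeta>: "\<zeta> \<in> \<K>" "\<And>\<xi>. \<xi> \<in> \<K> \<Longrightarrow> eval_form (c\<^sub>0 \<xi>) Xs = br \<zeta> \<xi>"
    proof (rule ad_surjective[of "\<lambda>\<xi>. eval_form (c\<^sub>0 \<xi>) Xs"])
      show "eval_form (c\<^sub>0 \<xi>) Xs \<in> \<K>" if "\<xi> \<in> \<K>" for \<xi> by (rule ev[OF that X])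
      fix \<xi> assume \<xi>: "\<xi> \<in> \<K>"
      show "eval_form (c\<^sub>0 (\<lambda>q. f q *\<^sub>R \<xi> q)) Xs = (\<lambda>q. f q *\<^sub>R eval_form (c\<^sub>0 \<xi>) Xs q)" if "f \<in> C" for f
        using D(5)[OF K_sec[OF \<xi>] that] by (simp add: app0[OF \<xi>] d_wedge_def form_add_def form_scale_def eval_form_def)
      fix \<eta> assume \<eta>: "\<eta> \<in> \<K>"
      show "eval_form (c\<^sub>0 (\<lambda>q. \<xi> q + \<eta> q)) Xs = (\<lambda>q. eval_form (c\<^sub>0 \<xi>) Xs q + eval_form (c\<^sub>0 \<eta>) Xs q)"
        using D(3)[OF K_sec[OF \<xi>] K_sec[OF \<eta>], of 1 1] by (simp add: form_add_def form_scale_def eval_form_def)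
      have l: "eval_form (lie_deriv L \<xi> (c\<^sub>0 \<eta>)) Xs = br \<xi> (eval_form (c\<^sub>0 \<eta>) Xs)" if "\<xi> \<in> \<K>" "\<eta> \<in> \<K>" for \<xi> \<eta>
        using lie_deriv_form(2)[OF D(1)[OF K_sec[OF that(2)]] K_sec[OF that(1)] X] LD_vertical[OF D(1)[OF K_sec[OF that(2)]] that(1) X(1)] by simp
      have "eval_form (c\<^sub>0 (br \<xi> \<eta>)) Xs = (\<lambda>q. eval_form (lie_deriv L \<xi> (c\<^sub>0 \<eta>)) Xs q - eval_form (lie_deriv L \<eta> (c\<^sub>0 \<xi>)) Xs q)"
        using D(6)[OF K_sec[OF \<xi>] K_sec[OF \<eta>]] by (simp add: form_add_def form_minus_def eval_form_def)
      then show "eval_form (c\<^sub>0 (br \<xi> \<eta>)) Xs = (\<lambda>q. br (eval_form (c\<^sub>0 \<xi>) Xs) \<eta> q + br \<xi> (eval_form (c\<^sub>0 \<eta>) Xs) q)"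
        unfolding l[OF \<xi> \<eta>] l[OF \<eta> \<xi>] br_anti[OF K_sec[OF ev[OF \<xi> X]] K_sec[OF \<eta>]] by (simp add: fun_eq_iff)
    qed blast
    have "(\<lambda>p. - eval_form (c\<^sub>0 \<xi>) Xs p) = br (\<lambda>p. - \<zeta> p) \<xi>" if "\<xi> \<in> \<K>" for \<xi>
      unfolding \<zeta>(2)[OF that] br_minus_left[OF K_sec[OF \<zeta>(1)] K_sec[OF that]] ..
    then show ?thesis using K_closed(5)[OF \<zeta>(1)] by blast
  qed
  obtain \<gamma> where \<gamma>: "\<gamma> \<in> forms L K q"
    "\<And>Xs \<xi>. set Xs \<subseteq> VF \<Longrightarrow> length Xs = q \<Longrightarrow> \<xi> \<in> \<K> \<Longrightarrow> br (eval_form \<gamma> Xs) \<xi> = (\<lambda>p. - eval_form (c\<^sub>0 \<xi>) Xs p)"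
  proof (rule form_of_derivations[of q "\<lambda>Xs \<xi> p. - eval_form (c\<^sub>0 \<xi>) Xs p"])
    show "\<exists>\<zeta>\<in>\<K>. \<forall>\<xi>\<in>\<K>. (\<lambda>p. - eval_form (c\<^sub>0 \<xi>) Xs p) = br \<zeta> \<xi>" if "set Xs \<subseteq> VF" "length Xs = q" for Xs
      by (rule inner[OF that])
  next
    fix Xs Ys :: "('m \<Rightarrow> 'e) list" and X Y \<xi> p
    assume l: "length Xs + length Ys + 1 = q" and \<xi>: "\<xi> \<in> \<K>"
    show "- eval_form (c\<^sub>0 \<xi>) (Xs @ (\<lambda>p. X p + Y p) # Ys) p
        = - eval_form (c\<^sub>0 \<xi>) (Xs @ X # Ys) p + - eval_form (c\<^sub>0 \<xi>) (Xs @ Y # Ys) p"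
      unfolding eval_slot_add[OF D(1)[OF K_sec[OF \<xi>]] l] by simp
  next
    fix Xs Ys :: "('m \<Rightarrow> 'e) list" and X \<xi> p and f :: "'m \<Rightarrow> real"
    assume l: "length Xs + length Ys + 1 = q" and \<xi>: "\<xi> \<in> \<K>"
    show "- eval_form (c\<^sub>0 \<xi>) (Xs @ (\<lambda>p. f p *\<^sub>R X p) # Ys) p = f p *\<^sub>R - eval_form (c\<^sub>0 \<xi>) (Xs @ X # Ys) p"
      unfolding eval_slot_scale[OF D(1)[OF K_sec[OF \<xi>]] l] by simp
  next
    fix Xs :: "('m \<Rightarrow> 'e) list" and i j \<xi> p
    assume "length Xs = q" "i < j" "j < q" "Xs ! i = Xs ! j" and \<xi>: "\<xi> \<in> \<K>"
    then have "eval_form (c\<^sub>0 \<xi>) Xs p = 0"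
      unfolding eval_form_def by (intro alternating_repeat[OF form_alternating[OF D(1)[OF K_sec[OF \<xi>]]], of _ i j]) auto
    then show "- eval_form (c\<^sub>0 \<xi>) Xs p = 0" by simp
  qed blast
  note E = eval_K[OF \<gamma>(1)]
  have ad: "eval_form (c\<^sub>0 \<xi>) Xs = br \<xi> (eval_form \<gamma> Xs)" if "set Xs \<subseteq> VF" "length Xs = q" "\<xi> \<in> \<K>" for Xs \<xi>
    unfolding br_anti[OF K_sec[OF that(3)] K_sec[OF E[OF that(1)]]] \<gamma>(2)[OF that] by simp
  \<comment> \<open>The IM equation for \<open>c\<^sub>0[\<alpha>, \<xi>]\<close>.\<close>
  have c0: "lie_deriv L \<alpha> \<gamma> = c\<^sub>0 \<alpha>" if \<alpha>: "\<alpha> \<in> \<Gamma>" for \<alpha>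
  proof (intro ext)
    fix p vs
    show "lie_deriv L \<alpha> \<gamma> p vs = c\<^sub>0 \<alpha> p vs"
    proof (cases "length vs = q")
      case True
      let ?Xs = "ext p vs" and ?D = "vb (\<rho> \<alpha>)"
      have X: "set ?Xs \<subseteq> VF" "length ?Xs = q" using ext_VF True by auto
      note a = anchor_VF[OF \<alpha>]
      note cE = eval_form_section[OF D(1)[OF \<alpha>] X]
      have "LD \<alpha> (eval_form \<gamma>) ?Xs p = eval_form (c\<^sub>0 \<alpha>) ?Xs p"
      proof (rule br_ad_injective[OF LD_K[OF \<gamma>(1) \<alpha> X(1)] cE])
        fix \<xi> assume \<xi>: "\<xi> \<in> \<K>"
        note \<xi>' = K_sec[OF \<xi>] and f\<xi> = D(1)[OF K_sec[OF \<xi>]]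
        have "eval_form (c\<^sub>0 (br \<alpha> \<xi>)) ?Xs p = lie_deriv L \<alpha> (c\<^sub>0 \<xi>) p vs - lie_deriv L \<xi> (c\<^sub>0 \<alpha>) p vs"
          using D(6)[OF \<alpha> \<xi>'] by (simp add: eval_ext form_add_def form_minus_def)
        also have "lie_deriv L \<xi> (c\<^sub>0 \<alpha>) p vs = br \<xi> (eval_form (c\<^sub>0 \<alpha>) ?Xs) p"
          by (rule lie_deriv_vertical[OF D(1)[OF \<alpha>] \<xi>])
        also have "lie_deriv L \<alpha> (c\<^sub>0 \<xi>) p vs = br \<alpha> (br \<xi> (eval_form \<gamma> ?Xs)) p - slot_sum ?D (\<lambda>Zs. br \<xi> (eval_form \<gamma> Zs) p) ?Xs"
        proof -
          have "slot_sum ?D (\<lambda>Zs. eval_form (c\<^sub>0 \<xi>) Zs p) ?Xs = slot_sum ?D (\<lambda>Zs. br \<xi> (eval_form \<gamma> Zs) p) ?Xs"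
            by (rule slot_sum_cong[of VF]) (use a X ad[OF _ _ \<xi>] VF_vb in auto)
          then show ?thesis unfolding lie_deriv_LD LD_def ad[OF X \<xi>] by simp
        qed
        also have "slot_sum ?D (\<lambda>Zs. br \<xi> (eval_form \<gamma> Zs) p) ?Xs = br \<xi> (\<lambda>p. slot_sum ?D (\<lambda>Zs. eval_form \<gamma> Zs p) ?Xs) p"
          by (rule br_slot_sum[OF \<gamma>(1) \<xi>' a X(1), symmetric])
        finally have 1: "br \<xi> (eval_form (c\<^sub>0 \<alpha>) ?Xs) p = br \<alpha> (br \<xi> (eval_form \<gamma> ?Xs)) p
            - br \<xi> (\<lambda>p. slot_sum ?D (\<lambda>Zs. eval_form \<gamma> Zs p) ?Xs) p - br (br \<alpha> \<xi>) (eval_form \<gamma> ?Xs) p"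
          unfolding ad[OF X br_K[OF \<alpha> \<xi>]] by (simp add: algebra_simps)
        have "br \<xi> (LD \<alpha> (eval_form \<gamma>) ?Xs) p = br \<xi> (br \<alpha> (eval_form \<gamma> ?Xs)) p
            - br \<xi> (\<lambda>p. slot_sum ?D (\<lambda>Zs. eval_form \<gamma> Zs p) ?Xs) p"
          unfolding LD_def[abs_def] br_diff[OF br_closed[OF \<alpha> K_sec[OF E[OF X(1)]]] K_sec[OF slot_sum_K[OF \<gamma>(1) a X(1)]] \<xi>'] ..
        then show "br \<xi> (LD \<alpha> (eval_form \<gamma>) ?Xs) p = br \<xi> (eval_form (c\<^sub>0 \<alpha>) ?Xs) p"
          unfolding 1 using br_jacobi[OF \<alpha> \<xi>' K_sec[OF E[OF X(1)]], of p] by simp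
      qed
      then show ?thesis by (simp add: lie_deriv_LD eval_ext)
    next
      case False
      then show ?thesis
        using lie_deriv_wrong_length[OF \<gamma>(1) \<alpha>, of vs p] alternating_wrong_length[OF form_alternating[OF D(1)[OF \<alpha>], of p], of vs] by simp
    qed
  qed
  \<comment> \<open>The IM equation for \<open>c\<^sub>1[\<xi>, \<beta>]\<close>, whose left-hand side vanishes as \<open>c\<close> is horizontal.\<close>
  have c1: "c\<^sub>1 p a vs = \<gamma> p (anchor L p a # vs)" if a: "a \<in> fibre L p" for p a vs
  proof (cases q)
    case 0
    then show ?thesis using D(4) alternating_wrong_length[OF form_alternating[OF \<gamma>(1), of p], of "anchor L p a # vs"] by simp
  next
    case (Suc r)
    then have fb: "c\<^sub>1 \<in> form_bundle_maps L K r" using D(4) by simp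
    obtain \<beta> where \<beta>: "\<beta> \<in> \<Gamma>" "\<beta> p = a" using section_through_fibre[OF a] by metis
    note f = form_bundle_map_app[OF fb \<beta>(1)]
    have "eval_form (app_sec c\<^sub>1 \<beta>) (ext p vs) p = eval_form \<gamma> (ext p (\<rho> \<beta> p # vs)) p"
    proof (rule br_ad_injective[OF eval_K[OF f ext_VF] E[OF ext_VF]])
      fix \<xi> assume \<xi>: "\<xi> \<in> \<K>"
      note \<xi>' = K_sec[OF \<xi>]
      have "0 = lie_deriv L \<xi> (app_sec c\<^sub>1 \<beta>) p vs - c\<^sub>0 \<xi> p (\<rho> \<beta> p # vs)"
        using D(7)[OF \<xi>' \<beta>(1)] app0[OF br_K'[OF \<xi> \<beta>(1)]]
        by (metis (no_types, lifting) add_uminus_conv_diff contract_def form_add_def form_minus_def)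
      then show "br \<xi> (eval_form (app_sec c\<^sub>1 \<beta>) (ext p vs)) p = br \<xi> (eval_form \<gamma> (ext p (\<rho> \<beta> p # vs))) p"
        using lie_deriv_vertical[OF f \<xi>, of p vs] lie_deriv_vertical[OF \<gamma>(1) \<xi>, of p "\<rho> \<beta> p # vs"] c0[OF \<xi>'] by simp
    qed
    then show ?thesis unfolding eval_ext using \<beta>(2) by (simp add: app_sec_def anchor_sec_def)
  qed
  have c1': "c\<^sub>1 p a vs = 0" if "a \<notin> fibre L p" for p a vs
  proof (cases q)
    case (Suc r)
    then have "c\<^sub>1 \<in> form_bundle_maps L K r" using D(4) by simp
    then show ?thesis using that by (simp add: form_bundle_maps_def)
  qed (use D(4) in simp)
  have "delta0 L \<gamma> = c"
    unfolding cc delta0_def using c0 D(2) c1 c1' by (auto simp: fun_eq_iff)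
  then show ?thesis using that \<gamma>(1) by blast
qed

theorem delta0_bij: "bij_betw (delta0 L) (forms L K q) (horizontal_im_forms L K q)"
  unfolding bij_betw_def using delta0_inj delta0_horizontal delta0_surj by blast

end

section \<open>Bracket-preserving connections\<close>

locale bracket_connection = semisimple_ideal L K
  for L :: "('m::{t2_space, second_countable_topology}, 'e::real_inner, 'v::real_vector, 'f::real_inner) algebroid_data"
    and K :: "'m \<Rightarrow> 'v set" +
  fixes D :: "('m, 'e, 'v) conn"
  assumes D_conn: "D \<in> linear_connections L K" and D_br: "bracket_preserving L K D"
begin

abbreviation N :: "('m \<Rightarrow> 'e) \<Rightarrow> ('m \<Rightarrow> 'v) \<Rightarrow> 'm \<Rightarrow> 'v" where "N \<equiv> covariant D"

lemma D_form: "\<xi> \<in> \<K> \<Longrightarrow> D \<xi> \<in> forms L K 1" and D_zero: "\<xi> \<notin> \<K> \<Longrightarrow> D \<xi> = form_zero"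
  and D_add: "\<xi> \<in> \<K> \<Longrightarrow> \<eta> \<in> \<K> \<Longrightarrow> D (\<lambda>p. \<xi> p + \<eta> p) = form_add (D \<xi>) (D \<eta>)"
  using D_conn by (auto simp: linear_connections_def)

lemma N_scale: "\<xi> \<in> \<K> \<Longrightarrow> f \<in> C \<Longrightarrow> X \<in> VF \<Longrightarrow>
    N X (\<lambda>p. f p *\<^sub>R \<xi> p) = (\<lambda>p. f p *\<^sub>R N X \<xi> p + td f p (X p) *\<^sub>R \<xi> p)"
  using D_conn unfolding linear_connections_def by blast

lemma N_br: "X \<in> VF \<Longrightarrow> \<xi> \<in> \<K> \<Longrightarrow> \<eta> \<in> \<K> \<Longrightarrow> N X (br \<xi> \<eta>) = (\<lambda>p. br (N X \<xi>) \<eta> p + br \<xi> (N X \<eta>) p)"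
  using D_br unfolding bracket_preserving_def by blast

lemma N_K: "X \<in> VF \<Longrightarrow> \<xi> \<in> \<K> \<Longrightarrow> N X \<xi> \<in> \<K>"
  unfolding covariant_def by (rule eval_K[OF D_form]) auto

lemma N_add: "\<xi> \<in> \<K> \<Longrightarrow> \<eta> \<in> \<K> \<Longrightarrow> N X (\<lambda>p. \<xi> p + \<eta> p) = (\<lambda>p. N X \<xi> p + N X \<eta> p)"
  by (simp add: covariant_def D_add eval_form_def form_add_def)

lemma N_minus: "X \<in> VF \<Longrightarrow> \<xi> \<in> \<K> \<Longrightarrow> N X (\<lambda>p. - \<xi> p) = (\<lambda>p. - N X \<xi> p)"
  using N_scale[OF _ C_const[of "-1"], of \<xi> X] by simp

lemma N_diff: "X \<in> VF \<Longrightarrow> \<xi> \<in> \<K> \<Longrightarrow> \<eta> \<in> \<K> \<Longrightarrow> N X (\<lambda>p. \<xi> p - \<eta> p) = (\<lambda>p. N X \<xi> p - N X \<eta> p)"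
  using N_add[of \<xi> "\<lambda>p. - \<eta> p" X] N_minus[of X \<eta>] K_closed(5)[of \<eta>] by simp

lemma N_zero: "X \<in> VF \<Longrightarrow> N X (\<lambda>p. 0) = (\<lambda>p. 0)"
  using N_scale[OF K_closed(4) C_const[of 0], of X] by simp

lemma N_add_left: "\<xi> \<in> \<K> \<Longrightarrow> N (\<lambda>p. X p + Y p) \<xi> p = N X \<xi> p + N Y \<xi> p"
  using eval_slot_add[OF D_form, of \<xi> "[]" "[]" X Y p] by (simp add: covariant_def)

lemma N_diff_left: "\<xi> \<in> \<K> \<Longrightarrow> N (\<lambda>p. X p - Y p) \<xi> p = N X \<xi> p - N Y \<xi> p"
  using eval_slot_diff[OF D_form, of \<xi> "[]" "[]" X Y p] by (simp add: covariant_def)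

lemma N_scale_left: "\<xi> \<in> \<K> \<Longrightarrow> N (\<lambda>p. f p *\<^sub>R X p) \<xi> p = f p *\<^sub>R N X \<xi> p"
  using eval_slot_scale[OF D_form, of \<xi> "[]" "[]" f X p] by (simp add: covariant_def)

lemma N_zero_left: "\<xi> \<in> \<K> \<Longrightarrow> N (\<lambda>p. 0) \<xi> p = 0"
  using N_scale_left[of \<xi> "\<lambda>p. 0" "\<lambda>p. 0" p] by simp

definition curv :: "('m \<Rightarrow> 'e) \<Rightarrow> ('m \<Rightarrow> 'e) \<Rightarrow> ('m \<Rightarrow> 'v) \<Rightarrow> 'm \<Rightarrow> 'v" where
  "curv X Y \<xi> p = N X (N Y \<xi>) p - N Y (N X \<xi>) p - N (vb X Y) \<xi> p"

text \<open>Up to sign the derivative of the connection along \<open>\<alpha>\<close>. For an IM connection it is \<open>[\<C>(\<alpha>)(X), \<xi>]\<close>,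
see \<open>defect_c0\<close>.\<close>

definition defect :: "('m \<Rightarrow> 'v) \<Rightarrow> ('m \<Rightarrow> 'e) \<Rightarrow> ('m \<Rightarrow> 'v) \<Rightarrow> 'm \<Rightarrow> 'v" where
  "defect \<alpha> X \<xi> p = N X (br \<alpha> \<xi>) p - br \<alpha> (N X \<xi>) p + N (vb (\<rho> \<alpha>) X) \<xi> p"

lemma curv_K: "X \<in> VF \<Longrightarrow> Y \<in> VF \<Longrightarrow> \<xi> \<in> \<K> \<Longrightarrow> curv X Y \<xi> \<in> \<K>"
  unfolding curv_def[abs_def] by (intro K_closed(2) N_K VF_vb)

lemma defect_K: "\<alpha> \<in> \<Gamma> \<Longrightarrow> X \<in> VF \<Longrightarrow> \<xi> \<in> \<K> \<Longrightarrow> defect \<alpha> X \<xi> \<in> \<K>"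
  unfolding defect_def[abs_def] by (intro K_closed(1,2) N_K VF_vb br_K anchor_VF)

text \<open>The curvature is a commutator of derivations of the bracket and \<open>C\<close>-linear as always.\<close>

lemma curv_inner:
  assumes X: "X \<in> VF" and Y: "Y \<in> VF"
  obtains \<zeta> where "\<zeta> \<in> \<K>" "\<And>\<xi>. \<xi> \<in> \<K> \<Longrightarrow> curv X Y \<xi> = br \<zeta> \<xi>"
proof (rule ad_surjective[of "curv X Y"])
  note V = VF_vb[OF X Y]
  show "curv X Y \<xi> \<in> \<K>" if "\<xi> \<in> \<K>" for \<xi> by (rule curv_K[OF X Y that])
  fix \<xi> assume \<xi>: "\<xi> \<in> \<K>"
  note NX = N_K[OF X \<xi>] and NY = N_K[OF Y \<xi>] and NV = N_K[OF V \<xi>]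
  show "curv X Y (\<lambda>q. f q *\<^sub>R \<xi> q) = (\<lambda>q. f q *\<^sub>R curv X Y \<xi> q)" if f: "f \<in> C" for f
  proof
    fix p
    note fX = C_closed(4)[OF X f] and fY = C_closed(4)[OF Y f]
    have 1: "N X (N Y (\<lambda>q. f q *\<^sub>R \<xi> q)) p = f p *\<^sub>R N X (N Y \<xi>) p + td f p (X p) *\<^sub>R N Y \<xi> p
        + td f p (Y p) *\<^sub>R N X \<xi> p + td (\<lambda>q. td f q (Y q)) p (X p) *\<^sub>R \<xi> p"
      unfolding N_scale[OF \<xi> f Y] N_add[OF K_closed(3)[OF f NY] K_closed(3)[OF fY \<xi>]]
        N_scale[OF NY f X] N_scale[OF \<xi> fY X] by (simp add: algebra_simps)
    have 2: "N Y (N X (\<lambda>q. f q *\<^sub>R \<xi> q)) p = f p *\<^sub>R N Y (N X \<xi>) p + td f p (Y p) *\<^sub>R N X \<xi> p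
        + td f p (X p) *\<^sub>R N Y \<xi> p + td (\<lambda>q. td f q (X q)) p (Y p) *\<^sub>R \<xi> p"
      unfolding N_scale[OF \<xi> f X] N_add[OF K_closed(3)[OF f NX] K_closed(3)[OF fX \<xi>]]
        N_scale[OF NX f Y] N_scale[OF \<xi> fX Y] by (simp add: algebra_simps)
    show "curv X Y (\<lambda>q. f q *\<^sub>R \<xi> q) p = f p *\<^sub>R curv X Y \<xi> p"
      unfolding curv_def 1 2 N_scale[OF \<xi> f V] td_vb_C[OF X Y f] by (simp add: algebra_simps)
  qed
  fix \<eta> assume \<eta>: "\<eta> \<in> \<K>"
  note MX = N_K[OF X \<eta>] and MY = N_K[OF Y \<eta>]
  show "curv X Y (\<lambda>q. \<xi> q + \<eta> q) = (\<lambda>q. curv X Y \<xi> q + curv X Y \<eta> q)"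
    unfolding curv_def[abs_def] N_add[OF \<xi> \<eta>] N_add[OF NX MX] N_add[OF NY MY] by (simp add: fun_eq_iff)
  show "curv X Y (br \<xi> \<eta>) = (\<lambda>q. br (curv X Y \<xi>) \<eta> q + br \<xi> (curv X Y \<eta>) q)"
  proof
    fix p
    note G = K_sec
    have B: "br a c \<in> \<K>" if "a \<in> \<K>" "c \<in> \<K>" for a c using that br_K G by blast
    have 1: "N X (N Y (br \<xi> \<eta>)) p = br (N X (N Y \<xi>)) \<eta> p + br (N Y \<xi>) (N X \<eta>) p + br (N X \<xi>) (N Y \<eta>) p + br \<xi> (N X (N Y \<eta>)) p"
      unfolding N_br[OF Y \<xi> \<eta>] N_add[OF B[OF NY \<eta>] B[OF \<xi> MY]] N_br[OF X NY \<eta>] N_br[OF X \<xi> MY] by simp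
    have 2: "N Y (N X (br \<xi> \<eta>)) p = br (N Y (N X \<xi>)) \<eta> p + br (N X \<xi>) (N Y \<eta>) p + br (N Y \<xi>) (N X \<eta>) p + br \<xi> (N Y (N X \<eta>)) p"
      unfolding N_br[OF X \<xi> \<eta>] N_add[OF B[OF NX \<eta>] B[OF \<xi> MX]] N_br[OF Y NX \<eta>] N_br[OF Y \<xi> MX] by simp
    have 3: "br (curv X Y \<xi>) \<eta> = (\<lambda>p. br (N X (N Y \<xi>)) \<eta> p - br (N Y (N X \<xi>)) \<eta> p - br (N (vb X Y) \<xi>) \<eta> p)"
      unfolding curv_def[abs_def]
        br_diff_left[OF G[OF K_closed(2)[OF N_K[OF X NY] N_K[OF Y NX]]] G[OF NV] G[OF \<eta>]]
        br_diff_left[OF G[OF N_K[OF X NY]] G[OF N_K[OF Y NX]] G[OF \<eta>]] ..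
    have 4: "br \<xi> (curv X Y \<eta>) = (\<lambda>p. br \<xi> (N X (N Y \<eta>)) p - br \<xi> (N Y (N X \<eta>)) p - br \<xi> (N (vb X Y) \<eta>) p)"
      unfolding curv_def[abs_def]
        br_diff[OF G[OF K_closed(2)[OF N_K[OF X MY] N_K[OF Y MX]]] G[OF N_K[OF V \<eta>]] G[OF \<xi>]]
        br_diff[OF G[OF N_K[OF X MY]] G[OF N_K[OF Y MX]] G[OF \<xi>]] ..
    show "curv X Y (br \<xi> \<eta>) p = br (curv X Y \<xi>) \<eta> p + br \<xi> (curv X Y \<eta>) p"
      unfolding 3 4 unfolding curv_def 1 2 N_br[OF V \<xi> \<eta>] by simp
  qed
qed (use that in blast)

lemma curv_add_left:
  assumes "X \<in> VF" "X' \<in> VF" "Y \<in> VF" "\<xi> \<in> \<K>"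
  shows "curv (\<lambda>p. X p + X' p) Y \<xi> p = curv X Y \<xi> p + curv X' Y \<xi> p"
proof -
  note NX = N_K[OF assms(1,4)] N_K[OF assms(2,4)] N_K[OF assms(3,4)]
  have e: "N (\<lambda>p. X p + X' p) \<xi> = (\<lambda>p. N X \<xi> p + N X' \<xi> p)" using N_add_left[OF assms(4)] by blast
  show ?thesis unfolding curv_def e N_add[OF NX(1,2)] N_add_left[OF NX(3)] vb_add_left[OF assms(1-3)] N_add_left[OF assms(4)] by simp
qed

lemma curv_scale_left:
  assumes "X \<in> VF" "Y \<in> VF" "\<xi> \<in> \<K>" "f \<in> C"
  shows "curv (\<lambda>p. f p *\<^sub>R X p) Y \<xi> p = f p *\<^sub>R curv X Y \<xi> p"
proof -
  note NX = N_K[OF assms(1,3)] N_K[OF assms(2,3)]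
  have e: "N (\<lambda>p. f p *\<^sub>R X p) \<xi> = (\<lambda>p. f p *\<^sub>R N X \<xi> p)" using N_scale_left[OF assms(3)] by blast
  show ?thesis unfolding curv_def e N_scale[OF NX(1) assms(4,2)] N_scale_left[OF NX(2)] vb_scale_left[OF assms(1,2,4)]
      N_diff_left[OF assms(3)] N_scale_left[OF assms(3)] by (simp add: algebra_simps)
qed

lemma curv_anti:
  assumes "X \<in> VF" "Y \<in> VF" "\<xi> \<in> \<K>"
  shows "curv X Y \<xi> p = - curv Y X \<xi> p"
proof -
  have "N (vb X Y) \<xi> p = - N (vb Y X) \<xi> p"
    using N_diff_left[OF assms(3), of "\<lambda>p. 0" "vb Y X" p] N_zero_left[OF assms(3), of p] vb_anti[OF assms(1,2)] by simp
  then show ?thesis by (simp add: curv_def)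
qed

lemma curv_add_right: "X \<in> VF \<Longrightarrow> Y \<in> VF \<Longrightarrow> Y' \<in> VF \<Longrightarrow> \<xi> \<in> \<K> \<Longrightarrow>
    curv X (\<lambda>p. Y p + Y' p) \<xi> p = curv X Y \<xi> p + curv X Y' \<xi> p"
  using curv_anti[of X "\<lambda>p. Y p + Y' p" \<xi> p] curv_anti[of X Y \<xi> p] curv_anti[of X Y' \<xi> p] curv_add_left[of Y Y' X \<xi> p] VF_add by simp

lemma curv_scale_right: "X \<in> VF \<Longrightarrow> Y \<in> VF \<Longrightarrow> \<xi> \<in> \<K> \<Longrightarrow> f \<in> C \<Longrightarrow>
    curv X (\<lambda>p. f p *\<^sub>R Y p) \<xi> p = f p *\<^sub>R curv X Y \<xi> p"
  using curv_anti[of X "\<lambda>p. f p *\<^sub>R Y p" \<xi> p] curv_anti[of X Y \<xi> p] curv_scale_left[of Y X \<xi> f p] VF_scale[of f Y] by simp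

lemma curvature_form:
  obtains F where "F \<in> forms L K 2" "\<And>X Y \<xi>. X \<in> VF \<Longrightarrow> Y \<in> VF \<Longrightarrow> \<xi> \<in> \<K> \<Longrightarrow> br \<xi> (eval_form F [X, Y]) = curv X Y \<xi>"
proof -
  have slot: "(\<exists>Y. Xs = [] \<and> Ys = [Y]) \<or> (\<exists>Y. Xs = [Y] \<and> Ys = [])" if "length Xs + length Ys + 1 = 2" for Xs Ys :: "('m \<Rightarrow> 'e) list"
    using that by (cases Xs; cases Ys) (auto simp: length_Suc_conv)
  have diag: "curv X X \<xi> p = 0" if "X \<in> VF" "\<xi> \<in> \<K>" for X \<xi> p
  proof -
    have "curv X X \<xi> p + curv X X \<xi> p = 0" using curv_anti[OF that(1,1,2), of p] by (metis add.left_inverse)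
    then show ?thesis by (metis scaleR_2 scaleR_eq_0_iff zero_neq_numeral)
  qed
  \<comment> \<open>The minus sign moves the form to the second argument of the bracket.\<close>
  obtain F where F: "F \<in> forms L K 2"
    "\<And>Xs \<xi>. set Xs \<subseteq> VF \<Longrightarrow> length Xs = 2 \<Longrightarrow> \<xi> \<in> \<K> \<Longrightarrow> br (eval_form F Xs) \<xi> = (\<lambda>p. - curv (Xs ! 0) (Xs ! 1) \<xi> p)"
  proof (rule form_of_derivations[of 2 "\<lambda>Xs \<xi> p. - curv (Xs ! 0) (Xs ! 1) \<xi> p"])
    fix Xs :: "('m \<Rightarrow> 'e) list" assume "set Xs \<subseteq> VF" "length Xs = 2"
    then have "Xs ! 0 \<in> VF" "Xs ! 1 \<in> VF" using nth_mem[of 0 Xs] nth_mem[of 1 Xs] by auto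
    then obtain \<zeta> where \<zeta>: "\<zeta> \<in> \<K>" "\<And>\<xi>. \<xi> \<in> \<K> \<Longrightarrow> curv (Xs ! 0) (Xs ! 1) \<xi> = br \<zeta> \<xi>" using curv_inner by metis
    have "(\<lambda>p. - curv (Xs ! 0) (Xs ! 1) \<xi> p) = br (\<lambda>p. - \<zeta> p) \<xi>" if "\<xi> \<in> \<K>" for \<xi>
      unfolding \<zeta>(2)[OF that] br_minus_left[OF K_sec[OF \<zeta>(1)] K_sec[OF that]] ..
    then show "\<exists>\<zeta>\<in>\<K>. \<forall>\<xi>\<in>\<K>. (\<lambda>p. - curv (Xs ! 0) (Xs ! 1) \<xi> p) = br \<zeta> \<xi>" using K_closed(5)[OF \<zeta>(1)] by blast
  next
    fix Xs Ys :: "('m \<Rightarrow> 'e) list" and X Y \<xi> p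
    assume V: "set Xs \<subseteq> VF" "set Ys \<subseteq> VF" "X \<in> VF" "Y \<in> VF" "\<xi> \<in> \<K>" and l: "length Xs + length Ys + 1 = 2"
    show "- curv ((Xs @ (\<lambda>p. X p + Y p) # Ys) ! 0) ((Xs @ (\<lambda>p. X p + Y p) # Ys) ! 1) \<xi> p =
        - curv ((Xs @ X # Ys) ! 0) ((Xs @ X # Ys) ! 1) \<xi> p + - curv ((Xs @ Y # Ys) ! 0) ((Xs @ Y # Ys) ! 1) \<xi> p"
      using slot[OF l] V by (auto simp: curv_add_left curv_add_right)
  next
    fix Xs Ys :: "('m \<Rightarrow> 'e) list" and X \<xi> p and f :: "'m \<Rightarrow> real"
    assume V: "set Xs \<subseteq> VF" "set Ys \<subseteq> VF" "X \<in> VF" "f \<in> C" "\<xi> \<in> \<K>" and l: "length Xs + length Ys + 1 = 2"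
    show "- curv ((Xs @ (\<lambda>p. f p *\<^sub>R X p) # Ys) ! 0) ((Xs @ (\<lambda>p. f p *\<^sub>R X p) # Ys) ! 1) \<xi> p =
        f p *\<^sub>R - curv ((Xs @ X # Ys) ! 0) ((Xs @ X # Ys) ! 1) \<xi> p"
      using slot[OF l] V by (auto simp: curv_scale_left curv_scale_right)
  next
    fix Xs :: "('m \<Rightarrow> 'e) list" and i j :: nat and \<xi> p
    assume V: "set Xs \<subseteq> VF" "length Xs = 2" "i < j" "j < 2" "Xs ! i = Xs ! j" "\<xi> \<in> \<K>"
    then have "i = 0" "j = 1" by auto
    moreover have "Xs ! 0 \<in> VF" using V(1,2) nth_mem[of 0 Xs] by auto
    ultimately show "- curv (Xs ! 0) (Xs ! 1) \<xi> p = 0" using V(5,6) diag by simp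
  qed blast
  show ?thesis
  proof (rule that[OF F(1)])
    fix X Y \<xi> assume V: "X \<in> VF" "Y \<in> VF" "\<xi> \<in> \<K>"
    have "set [X, Y] \<subseteq> VF" using V by simp
    note e = F(2)[OF this _ V(3)] eval_K[OF F(1) this]
    show "br \<xi> (eval_form F [X, Y]) = curv X Y \<xi>"
      unfolding br_anti[OF K_sec[OF V(3)] K_sec[OF e(2)]] using e(1) by simp
  qed
qed

subsection \<open>Exterior covariant derivatives\<close>

lemma ext_covariant_wrong_length:
  assumes "\<omega> \<in> forms L K q" "length vs \<noteq> Suc q"
  shows "ext_covariant L D \<omega> p vs = 0"
proof -
  let ?Xs = "ext p vs"
  have "N (?Xs ! i) (eval_form \<omega> (delete_nth i ?Xs)) p = 0" if "i < length ?Xs" for i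
  proof -
    have "?Xs ! i \<in> VF" using that vf_ext(1) by simp
    moreover have "eval_form \<omega> (delete_nth i ?Xs) = (\<lambda>p. 0)"
      using that assms(2) by (intro eval_wrong_length[OF assms(1)]) (auto simp: delete_nth_def)
    ultimately show ?thesis using N_zero by simp
  qed
  moreover have "eval_form \<omega> (vb (?Xs ! i) (?Xs ! j) # delete_nth i (delete_nth j ?Xs)) p = 0" if "i < j" "j < length ?Xs" for i j
  proof -
    have "eval_form \<omega> (vb (?Xs ! i) (?Xs ! j) # delete_nth i (delete_nth j ?Xs)) = (\<lambda>p. 0)"
      using that assms(2) by (intro eval_wrong_length[OF assms(1)]) (auto simp: delete_nth_def)
    then show ?thesis by simp
  qed
  ultimately show ?thesis unfolding ext_covariant_def Let_def by simp
qed

lemma ext_covariant_1: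
  "ext_covariant L D \<omega> p [u, w] = (let X = vf_ext (atlas L) p u; Y = vf_ext (atlas L) p w in
     N X (eval_form \<omega> [Y]) p - N Y (eval_form \<omega> [X]) p - eval_form \<omega> [vb X Y] p)"
  by (simp add: ext_covariant_def Let_def delete_nth_def numeral_2_eq_2)

lemma ext_covariant_2:
  "ext_covariant L D \<omega> p [u, v, w] = (let X = vf_ext (atlas L) p u; Y = vf_ext (atlas L) p v; Z = vf_ext (atlas L) p w in
     N X (eval_form \<omega> [Y, Z]) p - N Y (eval_form \<omega> [X, Z]) p + N Z (eval_form \<omega> [X, Y]) p
     - eval_form \<omega> [vb X Y, Z] p + eval_form \<omega> [vb X Z, Y] p - eval_form \<omega> [vb Y Z, X] p)"
  by (simp add: ext_covariant_def Let_def delete_nth_def numeral_3_eq_3 algebra_simps)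

text \<open>After bracketing with \<open>\<xi>\<close> only the terms \<open>\<nabla>\<^bsub>[[X, Y], Z]\<^esub>\<xi>\<close> and their permutations are left, and they
cancel by the Jacobi identity.\<close>

lemma bianchi:
  assumes F: "F \<in> forms L K 2" "\<And>X Y \<xi>. X \<in> VF \<Longrightarrow> Y \<in> VF \<Longrightarrow> \<xi> \<in> \<K> \<Longrightarrow> br \<xi> (eval_form F [X, Y]) = curv X Y \<xi>"
  shows "ext_covariant L D F = form_zero"
proof (intro ext)
  fix p vs
  show "ext_covariant L D F p vs = form_zero p vs"
  proof (cases "length vs = 3")
    case False
    then show ?thesis using ext_covariant_wrong_length[OF F(1)] by (simp add: form_zero_def)
  next
    case True
    then obtain u v w where vs: "vs = [u, v, w]" by (auto simp: numeral_3_eq_3 length_Suc_conv)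
    define X Y Z where "X = vf_ext (atlas L) p u" and "Y = vf_ext (atlas L) p v" and "Z = vf_ext (atlas L) p w"
    have V: "X \<in> VF" "Y \<in> VF" "Z \<in> VF" by (auto simp: X_def Y_def Z_def vf_ext(1))
    note VV = VF_vb[OF V(1,2)] VF_vb[OF V(1,3)] VF_vb[OF V(2,3)]
    let ?E = "\<lambda>A B. eval_form F [A, B]"
    have E: "?E A B \<in> \<K>" if "A \<in> VF" "B \<in> VF" for A B using that by (intro eval_K[OF F(1)]) auto
    have NE: "N A (?E B C') \<in> \<K>" if "A \<in> VF" "B \<in> VF" "C' \<in> VF" for A B C' using that by (intro N_K E)
    define G where "G q = N X (?E Y Z) q - N Y (?E X Z) q + N Z (?E X Y) q - ?E (vb X Y) Z q + ?E (vb X Z) Y q - ?E (vb Y Z) X q" for q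
    have G: "G \<in> \<K>" unfolding G_def[abs_def] by (intro K_closed(1,2) NE E V VV)
    have "G p = 0"
    proof (rule br_ad_injective[OF G K_closed(4)])
      fix \<xi> assume \<xi>: "\<xi> \<in> \<K>"
      note \<xi>' = K_sec[OF \<xi>]
      have brN: "br \<xi> (N A (?E B C')) p = N A (curv B C' \<xi>) p - curv B C' (N A \<xi>) p" if "A \<in> VF" "B \<in> VF" "C' \<in> VF" for A B C'
        using fun_cong[OF N_br[OF that(1) \<xi> E[OF that(2,3)]], of p] F(2)[OF that(2,3) \<xi>] F(2)[OF that(2,3) N_K[OF that(1) \<xi>]] by simp
      have Ncurv: "N A (curv B C' \<xi>) p = N A (N B (N C' \<xi>)) p - N A (N C' (N B \<xi>)) p - N A (N (vb B C') \<xi>) p" if W: "A \<in> VF" "B \<in> VF" "C' \<in> VF" for A B C'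
      proof -
        note m = N_K[OF W(2) N_K[OF W(3) \<xi>]] N_K[OF W(3) N_K[OF W(2) \<xi>]] N_K[OF VF_vb[OF W(2,3)] \<xi>]
        show ?thesis unfolding curv_def[abs_def] N_diff[OF W(1) K_closed(2)[OF m(1,2)] m(3)] N_diff[OF W(1) m(1,2)] ..
      qed
      have "br \<xi> G p = br \<xi> (N X (?E Y Z)) p - br \<xi> (N Y (?E X Z)) p + br \<xi> (N Z (?E X Y)) p
          - br \<xi> (?E (vb X Y) Z) p + br \<xi> (?E (vb X Z) Y) p - br \<xi> (?E (vb Y Z) X) p"
      proof -
        note g = NE[OF V(1,2,3)] NE[OF V(2,1,3)] NE[OF V(3,1,2)] E[OF VV(1) V(3)] E[OF VV(2) V(2)] E[OF VV(3) V(1)]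
        note g2 = K_closed(2)[OF g(1,2)] note g3 = K_closed(1)[OF g2 g(3)] note g4 = K_closed(2)[OF g3 g(4)]
        note g5 = K_closed(1)[OF g4 g(5)]
        show ?thesis unfolding G_def[abs_def]
            br_diff[OF K_sec[OF g5] K_sec[OF g(6)] \<xi>'] br_add[OF K_sec[OF g4] K_sec[OF g(5)] \<xi>']
            br_diff[OF K_sec[OF g3] K_sec[OF g(4)] \<xi>'] br_add[OF K_sec[OF g2] K_sec[OF g(3)] \<xi>']
            br_diff[OF K_sec[OF g(1)] K_sec[OF g(2)] \<xi>'] ..
      qed
      also have "\<dots> = N (vb (vb X Y) Z) \<xi> p - N (vb (vb X Z) Y) \<xi> p + N (vb (vb Y Z) X) \<xi> p"
        unfolding brN[OF V(1,2,3)] brN[OF V(2,1,3)] brN[OF V(3,1,2)] Ncurv[OF V(1,2,3)] Ncurv[OF V(2,1,3)] Ncurv[OF V(3,1,2)]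
          F(2)[OF VV(1) V(3) \<xi>] F(2)[OF VV(2) V(2) \<xi>] F(2)[OF VV(3) V(1) \<xi>]
        unfolding curv_def by simp
      also have "\<dots> = N (\<lambda>q. vb (vb X Y) Z q - vb (vb X Z) Y q + vb (vb Y Z) X q) \<xi> p"
        unfolding N_add_left[OF \<xi>] N_diff_left[OF \<xi>] ..
      also have "(\<lambda>q. vb (vb X Y) Z q - vb (vb X Z) Y q + vb (vb Y Z) X q) = (\<lambda>q. 0)"
      proof
        fix q
        have a: "vb X (vb Y Z) q = vb (vb X Y) Z q + vb Y (vb X Z) q" by (rule vb_jacobi[OF V])
        have b: "vb Y (vb X Z) q = - vb (vb X Z) Y q" using fun_cong[OF vb_anti[OF V(2) VV(2)]] .
        have c: "vb X (vb Y Z) q = - vb (vb Y Z) X q" using fun_cong[OF vb_anti[OF V(1) VV(3)]] .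
        show "vb (vb X Y) Z q - vb (vb X Z) Y q + vb (vb Y Z) X q = 0"
          using a unfolding b c by (simp add: neg_eq_iff_add_eq_0 add.commute)
      qed
      finally show "br \<xi> G p = br \<xi> (\<lambda>p. 0) p" using N_zero_left[OF \<xi>] br_zero[OF \<xi>'] by simp
    qed
    then show ?thesis unfolding vs ext_covariant_2 Let_def by (simp add: form_zero_def G_def X_def Y_def Z_def)
  qed
qed

end

section \<open>IM connections and their curvature\<close>

lemma eval_form_single: "eval_form \<gamma> [X] p = \<gamma> p [X p]"
  by (simp add: eval_form_def)

context semisimple_ideal
begin

text \<open>Equality of 1-forms is tested on vector fields, and after bracketing with sections of \<open>K\<close>.\<close>

lemma form1_ad_eqI:
  assumes "\<gamma> \<in> forms L K 1" "\<And>p vs. length vs \<noteq> 1 \<Longrightarrow> \<gamma>' p vs = 0" "\<And>X. X \<in> VF \<Longrightarrow> eval_form \<gamma>' [X] \<in> \<K>"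
    and "\<And>X \<xi> p. X \<in> VF \<Longrightarrow> \<xi> \<in> \<K> \<Longrightarrow> br (eval_form \<gamma> [X]) \<xi> p = br (eval_form \<gamma>' [X]) \<xi> p"
  shows "\<gamma> = \<gamma>'"
proof (intro ext)
  fix p vs
  show "\<gamma> p vs = \<gamma>' p vs"
  proof (cases "length vs = 1")
    case False
    then show ?thesis using assms(2) alternating_wrong_length[OF form_alternating[OF assms(1)], of vs p] by simp
  next
    case True
    then obtain u where vs: "vs = [u]" by (auto simp: length_Suc_conv)
    let ?X = "vf_ext (atlas L) p u"
    have X: "?X \<in> VF" by (rule vf_ext(1))
    have "eval_form \<gamma> [?X] p = eval_form \<gamma>' [?X] p"
    proof (rule ad_injective[OF eval_K[OF assms(1)] assms(3)[OF X]])
      show "set [?X] \<subseteq> VF" using X by simp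
      show "br (eval_form \<gamma> [?X]) \<xi> p = br (eval_form \<gamma>' [?X]) \<xi> p" if "\<xi> \<in> \<K>" for \<xi>
        using assms(4)[OF X that] .
    qed
    then show ?thesis by (simp add: vs eval_form_single vf_ext(2))
  qed
qed

lemma eval_lie_deriv_1:
  assumes "\<gamma> \<in> forms L K 1" "\<alpha> \<in> \<Gamma>" "X \<in> VF"
  shows "eval_form (lie_deriv L \<alpha> \<gamma>) [X] p = br \<alpha> (eval_form \<gamma> [X]) p - eval_form \<gamma> [vb (\<rho> \<alpha>) X] p"
  using lie_deriv_form(2)[OF assms(1,2), of "[X]"] assms(3) by (simp add: LD_def)

lemma lie_deriv_degree_0:
  "lie_deriv L \<alpha> \<gamma> p [] = br \<alpha> (\<lambda>p. \<gamma> p []) p"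
  by (simp add: lie_deriv_LD LD_def eval_form_def)

end

locale im_connection = semisimple_ideal L K
  for L :: "('m::{t2_space, second_countable_topology}, 'e::real_inner, 'v::real_vector, 'f::real_inner) algebroid_data"
    and K :: "'m \<Rightarrow> 'v set" +
  fixes c\<^sub>0 :: "('m \<Rightarrow> 'v) \<Rightarrow> ('m, 'e, 'v) vform" and c\<^sub>1 :: "'m \<Rightarrow> 'v \<Rightarrow> 'e list \<Rightarrow> 'v"
  assumes im_connection: "(c\<^sub>0, c\<^sub>1) \<in> im_connections L K"
begin

lemma im: "(c\<^sub>0, c\<^sub>1) \<in> im_forms L K 1" and vertical_id: "a \<in> K p \<Longrightarrow> c\<^sub>1 p a [] = a"
  using im_connection by (auto simp: im_connections_def vertical_part_def)

lemmas imD = im_formD[OF im]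

lemma c\<^sub>1: "c\<^sub>1 \<in> form_bundle_maps L K 0"
  using imD(4) by simp

abbreviation "ind \<equiv> induced_connection L K (c\<^sub>0, c\<^sub>1)"

lemma ind: "\<xi> \<in> \<K> \<Longrightarrow> ind \<xi> = c\<^sub>0 \<xi>" "\<xi> \<notin> \<K> \<Longrightarrow> ind \<xi> = form_zero"
  by (auto simp: induced_connection_def)

lemma cov_ind: "\<xi> \<in> \<K> \<Longrightarrow> covariant ind X \<xi> = eval_form (c\<^sub>0 \<xi>) [X]"
  by (simp add: covariant_def ind)

lemma app_vertical: "\<xi> \<in> \<K> \<Longrightarrow> app_sec c\<^sub>1 \<xi> p [] = \<xi> p"
  using vertical_id section_K by (simp add: app_sec_def)

lemma eval_c0: "\<alpha> \<in> \<Gamma> \<Longrightarrow> X \<in> VF \<Longrightarrow> eval_form (c\<^sub>0 \<alpha>) [X] \<in> \<K>"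
  using eval_K[OF imD(1)] by simp

lemma c0_bracket:
  assumes "\<alpha> \<in> \<Gamma>" "\<xi> \<in> \<K>" "X \<in> VF"
  shows "eval_form (c\<^sub>0 (br \<alpha> \<xi>)) [X] p =
    br \<alpha> (eval_form (c\<^sub>0 \<xi>) [X]) p - eval_form (c\<^sub>0 \<xi>) [vb (\<rho> \<alpha>) X] p - br \<xi> (eval_form (c\<^sub>0 \<alpha>) [X]) p"
proof -
  note \<xi> = K_sec[OF assms(2)]
  have "eval_form (c\<^sub>0 (br \<alpha> \<xi>)) [X] p = eval_form (lie_deriv L \<alpha> (c\<^sub>0 \<xi>)) [X] p - eval_form (lie_deriv L \<xi> (c\<^sub>0 \<alpha>)) [X] p"
    using imD(6)[OF assms(1) \<xi>] by (simp add: eval_form_def form_add_def form_minus_def)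
  moreover have "eval_form (lie_deriv L \<xi> (c\<^sub>0 \<alpha>)) [X] p = br \<xi> (eval_form (c\<^sub>0 \<alpha>) [X]) p"
    using lie_deriv_form(2)[OF imD(1)[OF assms(1)] \<xi>, of "[X]"] LD_vertical[OF imD(1)[OF assms(1)] assms(2), of "[X]"] assms(3) by simp
  ultimately show ?thesis using eval_lie_deriv_1[OF imD(1)[OF \<xi>] assms(1,3)] by simp
qed

lemma ind_linear_connection: "ind \<in> linear_connections L K"
  unfolding linear_connections_def
proof (intro CollectI conjI ballI allI impI)
  fix \<xi>
  show "ind \<xi> = form_zero" if "\<xi> \<notin> \<K>" using ind(2)[OF that] .
  assume \<xi>: "\<xi> \<in> \<K>"
  note \<xi>' = K_sec[OF \<xi>]
  show "ind \<xi> \<in> forms L K 1" using ind(1)[OF \<xi>] imD(1)[OF \<xi>'] by simp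
  show "ind (\<lambda>p. \<xi> p + \<eta> p) = form_add (ind \<xi>) (ind \<eta>)" if \<eta>: "\<eta> \<in> \<K>" for \<eta>
    using imD(3)[OF \<xi>' K_sec[OF \<eta>], of 1 1] K_closed(1)[OF \<xi> \<eta>] by (simp add: ind \<xi> \<eta> form_add_def form_scale_def)
  show "covariant ind X (\<lambda>p. f p *\<^sub>R \<xi> p) = (\<lambda>p. f p *\<^sub>R covariant ind X \<xi> p + td f p (X p) *\<^sub>R \<xi> p)"
    if f: "f \<in> C" and X: "X \<in> VF" for f X
    unfolding cov_ind[OF \<xi>] cov_ind[OF K_closed(3)[OF f \<xi>]] imD(5)[OF \<xi>' f]
    by (simp add: fun_eq_iff eval_form_single form_add_def form_scale_def d_wedge_def delete_nth_def app_vertical[OF \<xi>])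
qed

lemma ind_bracket_preserving: "bracket_preserving L K ind"
  unfolding bracket_preserving_def
proof (intro ballI ext)
  fix X \<xi> \<eta> p assume X: "X \<in> VF" and \<xi>: "\<xi> \<in> \<K>" and \<eta>: "\<eta> \<in> \<K>"
  have "eval_form (c\<^sub>0 (br \<xi> \<eta>)) [X] p = eval_form (lie_deriv L \<xi> (c\<^sub>0 \<eta>)) [X] p - eval_form (lie_deriv L \<eta> (c\<^sub>0 \<xi>)) [X] p"
    using imD(6)[OF K_sec[OF \<xi>] K_sec[OF \<eta>]] by (simp add: eval_form_def form_add_def form_minus_def)
  moreover have "eval_form (lie_deriv L a (c\<^sub>0 d)) [X] p = br a (eval_form (c\<^sub>0 d) [X]) p" if "a \<in> \<K>" "d \<in> \<K>" for a d
    using lie_deriv_form(2)[OF imD(1)[OF K_sec[OF that(2)]] K_sec[OF that(1)], of "[X]"]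
      LD_vertical[OF imD(1)[OF K_sec[OF that(2)]] that(1), of "[X]"] X by simp
  moreover have "br \<eta> (eval_form (c\<^sub>0 \<xi>) [X]) p = - br (eval_form (c\<^sub>0 \<xi>) [X]) \<eta> p"
    using fun_cong[OF br_anti[OF K_sec[OF \<eta>] K_sec[OF eval_c0[OF K_sec[OF \<xi>] X]]]] .
  ultimately show "covariant ind X (br \<xi> \<eta>) p = br (covariant ind X \<xi>) \<eta> p + br \<xi> (covariant ind X \<eta>) p"
    using \<xi> \<eta> br_K[OF K_sec[OF \<xi>] \<eta>] by (simp add: cov_ind)
qed

sublocale bracket_connection L K ind
  by unfold_locales (rule ind_linear_connection ind_bracket_preserving)+

lemma N_c0: "\<xi> \<in> \<K> \<Longrightarrow> eval_form (c\<^sub>0 \<xi>) [X] = N X \<xi>"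
  by (simp add: cov_ind)

text \<open>The IM equation for \<open>c\<^sub>0[\<alpha>, \<xi>]\<close>, where \<open>\<L>\<^sup>A\<^sub>\<xi> = [\<xi>, -]\<close>.\<close>

lemma defect_c0:
  assumes "\<alpha> \<in> \<Gamma>" "X \<in> VF" "\<xi> \<in> \<K>"
  shows "br (eval_form (c\<^sub>0 \<alpha>) [X]) \<xi> p = defect \<alpha> X \<xi> p"
proof -
  have "br (eval_form (c\<^sub>0 \<alpha>) [X]) \<xi> p = - br \<xi> (eval_form (c\<^sub>0 \<alpha>) [X]) p"
    using fun_cong[OF br_anti[OF K_sec[OF eval_c0[OF assms(1,2)]] K_sec[OF assms(3)]]] .
  then show ?thesis using c0_bracket[OF assms(1,3,2), of p] assms br_K[OF assms(1,3)]
    by (simp add: N_c0 defect_def algebra_simps)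
qed

definition ver :: "('m \<Rightarrow> 'v) \<Rightarrow> 'm \<Rightarrow> 'v" where
  "ver \<alpha> = (\<lambda>p. c\<^sub>1 p (\<alpha> p) [])"

lemma ver_K: "\<alpha> \<in> \<Gamma> \<Longrightarrow> ver \<alpha> \<in> \<K>"
  using eval_K[OF form_bundle_map_app[OF c\<^sub>1], of \<alpha> "[]"] by (simp add: eval_form_def app_sec_def ver_def)

lemma hor_eq: "horizontal_part (vertical_part (c\<^sub>0, c\<^sub>1)) \<alpha> = (\<lambda>p. \<alpha> p - ver \<alpha> p)"
  by (simp add: horizontal_part_def vertical_part_def ver_def)

text \<open>The IM equation for \<open>c\<^sub>1[\<xi>, \<alpha>]\<close>, where \<open>v\<close> is the identity on \<open>[\<xi>, \<alpha>]\<close>.\<close>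

lemma hor_bracket:
  assumes "\<alpha> \<in> \<Gamma>" "\<xi> \<in> \<K>"
  shows "br (horizontal_part (vertical_part (c\<^sub>0, c\<^sub>1)) \<alpha>) \<xi> = N (\<rho> \<alpha>) \<xi>"
proof
  fix p
  note \<xi> = K_sec[OF assms(2)] and v = K_sec[OF ver_K[OF assms(1)]]
  have "app_sec c\<^sub>1 (br \<xi> \<alpha>) p [] = lie_deriv L \<xi> (app_sec c\<^sub>1 \<alpha>) p [] - c\<^sub>0 \<xi> p [\<rho> \<alpha> p]"
    using imD(7)[OF \<xi> assms(1)] by (simp add: form_add_def form_minus_def contract_def)
  moreover have "app_sec c\<^sub>1 (br \<xi> \<alpha>) p [] = br \<xi> \<alpha> p" by (rule app_vertical[OF br_K'[OF assms(2,1)]])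
  moreover have "lie_deriv L \<xi> (app_sec c\<^sub>1 \<alpha>) p [] = br \<xi> (ver \<alpha>) p"
    by (simp add: lie_deriv_degree_0 app_sec_def ver_def)
  moreover have "N (\<rho> \<alpha>) \<xi> p = c\<^sub>0 \<xi> p [\<rho> \<alpha> p]" by (simp add: cov_ind[OF assms(2)] eval_form_single)
  ultimately have "N (\<rho> \<alpha>) \<xi> p = br \<xi> (ver \<alpha>) p - br \<xi> \<alpha> p" by simp
  also have "\<dots> = br \<alpha> \<xi> p - br (ver \<alpha>) \<xi> p"
    unfolding br_anti[OF \<xi> v] br_anti[OF \<xi> assms(1)] by simp
  finally show "br (horizontal_part (vertical_part (c\<^sub>0, c\<^sub>1)) \<alpha>) \<xi> p = N (\<rho> \<alpha>) \<xi> p"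
    unfolding hor_eq br_diff_left[OF assms(1) v \<xi>] by simp
qed

lemma splitting: "vertical_part (c\<^sub>0, c\<^sub>1) \<in> splittings L K"
  unfolding splittings_def vertical_part_def
proof (intro CollectI conjI allI ballI impI case_prodI2)
  have c: "\<And>p a. a \<in> fibre L p \<Longrightarrow> c\<^sub>1 p a \<in> alternating_maps (K p) 0" "\<And>p a. a \<notin> fibre L p \<Longrightarrow> c\<^sub>1 p a = (\<lambda>vs. 0)"
    "\<And>p vs. linear_map_on (fibre L p) (\<lambda>a. c\<^sub>1 p a vs)"
    using c\<^sub>1 by (auto simp: form_bundle_maps_def)
  show "linear_map_on (fibre L p) (\<lambda>a. snd (c\<^sub>0, c\<^sub>1) p a [])" for p using c(3) by simp
  show "(\<lambda>a. snd (c\<^sub>0, c\<^sub>1) p a []) ` fibre L p \<subseteq> K p" for p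
    using alternating_in[OF c(1)] by auto
  show "snd (c\<^sub>0, c\<^sub>1) p a [] = 0" if "a \<notin> fibre L p" for p a using c(2)[OF that] by simp
  show "snd (c\<^sub>0, c\<^sub>1) p a [] = a" if "a \<in> K p" for p a using vertical_id[OF that] by simp
  fix t U \<phi> w assume "t \<in> trivs L" "t = (U, \<phi>)"
  then have tr: "(U, \<phi>) \<in> trivs L" by simp
  show "sm U (\<lambda>p. \<phi> p (snd (c\<^sub>0, c\<^sub>1) p (iv \<phi> p w) []))"
  proof (rule sm_local)
    fix p assume p: "p \<in> U"
    obtain V x where V: "(V, x) \<in> atlas L" "p \<in> V" by (rule obtain_chart_at)
    have "sm (U \<inter> V) (\<lambda>p. \<phi> p (c\<^sub>1 p (iv \<phi> p w) (map (tv (V, x) p) [])))"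
    proof -
      have "\<forall>(U, \<phi>)\<in>trivs L. \<forall>c\<in>atlas L. \<forall>w es. sm (U \<inter> fst c)
          (\<lambda>p. \<phi> p (c\<^sub>1 p (iv \<phi> p w) (map (tv c p) es)))"
        using c\<^sub>1 unfolding form_bundle_maps_def by blast
      from bspec[OF bspec[OF this tr, unfolded prod.case] V(1), rule_format, of w "[]"] show ?thesis by simp
    qed
    then show "\<exists>V. open V \<and> p \<in> V \<and> sm V (\<lambda>p. \<phi> p (snd (c\<^sub>0, c\<^sub>1) p (iv \<phi> p w) []))"
      using p V trivs_open[OF tr] chart(1)[OF V(1)] by (intro exI[of _ "U \<inter> V"]) auto
  qed
qed

text \<open>On horizontal sections \<open>defect\<close> reduces to the curvature of the induced connection.\<close>

lemma curvature_1:
  assumes "\<alpha> \<in> \<Gamma>" "X \<in> VF" "\<xi> \<in> \<K>"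
  shows "br (eval_form (c\<^sub>0 (\<lambda>p. \<alpha> p - ver \<alpha> p)) [X]) \<xi> p = - curv (\<rho> \<alpha>) X \<xi> p"
proof -
  note v = ver_K[OF assms(1)]
  let ?h = "\<lambda>p. \<alpha> p - ver \<alpha> p"
  have h: "?h \<in> \<Gamma>" by (intro section_diff assms K_sec v)
  have r: "\<rho> ?h = \<rho> \<alpha>" unfolding anchor_diff[OF assms(1) K_sec[OF v]] anchor_K[OF v] by simp
  have b: "br ?h \<eta> = N (\<rho> \<alpha>) \<eta>" if "\<eta> \<in> \<K>" for \<eta> using hor_bracket[OF assms(1) that] unfolding hor_eq .
  show ?thesis unfolding defect_c0[OF h assms(2,3)] defect_def r b[OF assms(3)] b[OF N_K[OF assms(2,3)]] curv_def by simp
qed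

text \<open>The first component of the equation between the curvature and \<open>\<delta>\<^sup>0F\<close>. After bracketing with \<open>\<xi>\<close>, both sides expand into the same
products of the operators \<open>\<nabla>\<^sub>X\<close>, \<open>\<nabla>\<^sub>Y\<close> and \<open>[\<alpha>, -]\<close>.\<close>

lemma curvature_0:
  assumes F: "F \<in> forms L K 2" "\<And>X Y \<xi>. X \<in> VF \<Longrightarrow> Y \<in> VF \<Longrightarrow> \<xi> \<in> \<K> \<Longrightarrow> br \<xi> (eval_form F [X, Y]) = curv X Y \<xi>"
    and \<alpha>: "\<alpha> \<in> \<Gamma>" and X: "X \<in> VF" and Y: "Y \<in> VF"
  shows "N X (eval_form (c\<^sub>0 \<alpha>) [Y]) p - N Y (eval_form (c\<^sub>0 \<alpha>) [X]) p - eval_form (c\<^sub>0 \<alpha>) [vb X Y] p =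
    br \<alpha> (eval_form F [X, Y]) p - eval_form F [vb (\<rho> \<alpha>) X, Y] p - eval_form F [X, vb (\<rho> \<alpha>) Y] p"
proof -
  note a = anchor_VF[OF \<alpha>]
  note V = VF_vb[OF X Y] VF_vb[OF a X] VF_vb[OF a Y]
  let ?T = "\<lambda>X. eval_form (c\<^sub>0 \<alpha>) [X]" and ?E = "\<lambda>X Y. eval_form F [X, Y]"
  note T = eval_c0[OF \<alpha> X] eval_c0[OF \<alpha> Y] eval_c0[OF \<alpha> V(1)]
  have E: "?E A B \<in> \<K>" if "A \<in> VF" "B \<in> VF" for A B using that by (intro eval_K[OF F(1)]) auto
  define A where "A p = N X (?T Y) p - N Y (?T X) p - ?T (vb X Y) p" for p
  define B where "B p = br \<alpha> (?E X Y) p - ?E (vb (\<rho> \<alpha>) X) Y p - ?E X (vb (\<rho> \<alpha>) Y) p" for p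
  have A: "A \<in> \<K>" unfolding A_def[abs_def] by (intro K_closed(2) N_K T X Y)
  have B: "B \<in> \<K>" unfolding B_def[abs_def] by (intro K_closed(2) br_K E \<alpha> X Y V)
  have "A p = B p"
  proof (rule ad_injective[OF A B])
    fix \<xi> assume \<xi>: "\<xi> \<in> \<K>"
    note \<xi>' = K_sec[OF \<xi>]
    note a\<xi> = br_K[OF \<alpha> \<xi>]
    have Tb: "br (?T Z) \<eta> = defect \<alpha> Z \<eta>" if "Z \<in> VF" "\<eta> \<in> \<K>" for Z \<eta> using defect_c0[OF \<alpha> that] by blast
    have NT: "br (N W (?T Z)) \<xi> p = N W (N Z (br \<alpha> \<xi>)) p - N W (br \<alpha> (N Z \<xi>)) p + N W (N (vb (\<rho> \<alpha>) Z) \<xi>) p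
        - N Z (br \<alpha> (N W \<xi>)) p + br \<alpha> (N Z (N W \<xi>)) p - N (vb (\<rho> \<alpha>) Z) (N W \<xi>) p"
      if W: "W \<in> VF" and Z: "Z \<in> VF" for W Z
    proof -
      note TZ = eval_c0[OF \<alpha> Z] and aZ = VF_vb[OF a Z] and NW = N_K[OF W \<xi>]
      note m = N_K[OF Z a\<xi>] br_K[OF \<alpha> N_K[OF Z \<xi>]] N_K[OF aZ \<xi>]
      have "br (N W (?T Z)) \<xi> p = N W (br (?T Z) \<xi>) p - br (?T Z) (N W \<xi>) p"
        using fun_cong[OF N_br[OF W TZ \<xi>], of p] by simp
      also have "N W (br (?T Z) \<xi>) p = N W (N Z (br \<alpha> \<xi>)) p - N W (br \<alpha> (N Z \<xi>)) p + N W (N (vb (\<rho> \<alpha>) Z) \<xi>) p"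
        unfolding Tb[OF Z \<xi>] defect_def[abs_def] N_add[OF K_closed(2)[OF m(1,2)] m(3)] N_diff[OF W m(1,2)] ..
      also have "br (?T Z) (N W \<xi>) p = N Z (br \<alpha> (N W \<xi>)) p - br \<alpha> (N Z (N W \<xi>)) p + N (vb (\<rho> \<alpha>) Z) (N W \<xi>) p"
        unfolding Tb[OF Z NW] defect_def ..
      finally show ?thesis by simp
    qed
    have brA: "br A \<xi> p = br (N X (?T Y)) \<xi> p - br (N Y (?T X)) \<xi> p - defect \<alpha> (vb X Y) \<xi> p"
      unfolding A_def[abs_def]
        br_diff_left[OF K_sec[OF K_closed(2)[OF N_K[OF X T(2)] N_K[OF Y T(1)]]] K_sec[OF T(3)] \<xi>']
        br_diff_left[OF K_sec[OF N_K[OF X T(2)]] K_sec[OF N_K[OF Y T(1)]] \<xi>'] Tb[OF V(1) \<xi>] ..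
    have jac: "N (vb (\<rho> \<alpha>) (vb X Y)) \<xi> p = N (vb (vb (\<rho> \<alpha>) X) Y) \<xi> p + N (vb X (vb (\<rho> \<alpha>) Y)) \<xi> p"
    proof -
      have "vb (\<rho> \<alpha>) (vb X Y) = (\<lambda>q. vb (vb (\<rho> \<alpha>) X) Y q + vb X (vb (\<rho> \<alpha>) Y) q)"
        using vb_jacobi[OF a X Y] by blast
      then show ?thesis using N_add_left[OF \<xi>, of "vb (vb (\<rho> \<alpha>) X) Y" "vb X (vb (\<rho> \<alpha>) Y)" p] by metis
    qed
    have FE: "br (?E Z W) \<eta> p = - curv Z W \<eta> p" if "Z \<in> VF" "W \<in> VF" "\<eta> \<in> \<K>" for Z W \<eta> p
      using fun_cong[OF br_anti[OF K_sec[OF E[OF that(1,2)]] K_sec[OF that(3)]], of p] F(2)[OF that] by simp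
    have "br (br \<alpha> (?E X Y)) \<xi> p = br \<alpha> (br (?E X Y) \<xi>) p - br (?E X Y) (br \<alpha> \<xi>) p"
      using br_jacobi[OF \<alpha> K_sec[OF E[OF X Y]] \<xi>', of p] by simp
    also have "br (?E X Y) \<xi> = (\<lambda>p. - curv X Y \<xi> p)" using FE[OF X Y \<xi>] by blast
    also have "br \<alpha> (\<lambda>p. - curv X Y \<xi> p) p = - br \<alpha> (curv X Y \<xi>) p"
      unfolding br_minus[OF K_sec[OF curv_K[OF X Y \<xi>]] \<alpha>] ..
    also have "br \<alpha> (curv X Y \<xi>) p = br \<alpha> (N X (N Y \<xi>)) p - br \<alpha> (N Y (N X \<xi>)) p - br \<alpha> (N (vb X Y) \<xi>) p"
    proof -
      note m = N_K[OF X N_K[OF Y \<xi>]] N_K[OF Y N_K[OF X \<xi>]] N_K[OF V(1) \<xi>]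
      show ?thesis unfolding curv_def[abs_def] br_diff[OF K_sec[OF K_closed(2)[OF m(1,2)]] K_sec[OF m(3)] \<alpha>]
          br_diff[OF K_sec[OF m(1)] K_sec[OF m(2)] \<alpha>] ..
    qed
    finally have brE: "br (br \<alpha> (?E X Y)) \<xi> p = - (br \<alpha> (N X (N Y \<xi>)) p - br \<alpha> (N Y (N X \<xi>)) p - br \<alpha> (N (vb X Y) \<xi>) p)
        - br (?E X Y) (br \<alpha> \<xi>) p" .
    have brB: "br B \<xi> p = br (br \<alpha> (?E X Y)) \<xi> p - br (?E (vb (\<rho> \<alpha>) X) Y) \<xi> p - br (?E X (vb (\<rho> \<alpha>) Y)) \<xi> p"
      unfolding B_def[abs_def]
        br_diff_left[OF K_sec[OF K_closed(2)[OF br_K[OF \<alpha> E[OF X Y]] E[OF V(2) Y]]] K_sec[OF E[OF X V(3)]] \<xi>']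
        br_diff_left[OF K_sec[OF br_K[OF \<alpha> E[OF X Y]]] K_sec[OF E[OF V(2) Y]] \<xi>'] ..
    show "br A \<xi> p = br B \<xi> p"
      unfolding brA brB brE NT[OF X Y] NT[OF Y X] FE[OF X Y a\<xi>] FE[OF V(2) Y \<xi>] FE[OF X V(3) \<xi>]
      unfolding defect_def curv_def jac by (simp add: algebra_simps)
  qed
  then show ?thesis by (simp add: A_def B_def)
qed

lemma curvature_primitive:
  assumes F: "F \<in> forms L K 2" "\<And>X Y \<xi>. X \<in> VF \<Longrightarrow> Y \<in> VF \<Longrightarrow> \<xi> \<in> \<K> \<Longrightarrow> br \<xi> (eval_form F [X, Y]) = curv X Y \<xi>"
  shows "im_curvature L K (c\<^sub>0, c\<^sub>1) = delta0 L F"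
proof -
  have 0: "ext_covariant L ind (c\<^sub>0 \<alpha>) p vs = lie_deriv L \<alpha> F p vs" if \<alpha>: "\<alpha> \<in> \<Gamma>" for \<alpha> p vs
  proof (cases "length vs = 2")
    case False
    then show ?thesis using ext_covariant_wrong_length[OF imD(1)[OF \<alpha>], of vs p] lie_deriv_wrong_length[OF F(1) \<alpha> False] by simp
  next
    case True
    then obtain u w where vs: "vs = [u, w]" by (auto simp: numeral_2_eq_2 length_Suc_conv)
    note e = curvature_0[OF F \<alpha> vf_ext(1)[of p u] vf_ext(1)[of p w], of p]
    show ?thesis
      using e
      unfolding vs ext_covariant_1 Let_def lie_deriv_LD by (simp add: LD_def algebra_simps)
  qed
  have 1: "c\<^sub>0 (\<lambda>q. \<alpha> q - ver \<alpha> q) p vs = F p (\<rho> \<alpha> p # vs)" if \<alpha>: "\<alpha> \<in> \<Gamma>" for \<alpha> p vs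
  proof -
    note a = anchor_VF[OF \<alpha>]
    have h: "(\<lambda>q. \<alpha> q - ver \<alpha> q) \<in> \<Gamma>" by (intro section_diff \<alpha> K_sec ver_K)
    have "F \<in> forms L K (Suc 1)" using F(1) by (simp add: numeral_2_eq_2)
    then have cF: "contract (\<rho> \<alpha>) F \<in> forms L K 1" using a by (rule contract_form)
    have ev: "eval_form (contract (\<rho> \<alpha>) F) [X] = eval_form F [\<rho> \<alpha>, X]" for X by (simp add: eval_form_def contract_def)
    have "c\<^sub>0 (\<lambda>q. \<alpha> q - ver \<alpha> q) = contract (\<rho> \<alpha>) F"
    proof (rule form1_ad_eqI[OF imD(1)[OF h]])
      show "contract (\<rho> \<alpha>) F p vs = 0" if "length vs \<noteq> 1" for p vs
        using alternating_wrong_length[OF form_alternating[OF cF] that] .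
      show sec: "eval_form (contract (\<rho> \<alpha>) F) [X] \<in> \<K>" if "X \<in> VF" for X using eval_K[OF cF] that by simp
      show "br (eval_form (c\<^sub>0 (\<lambda>q. \<alpha> q - ver \<alpha> q)) [X]) \<xi> p = br (eval_form (contract (\<rho> \<alpha>) F) [X]) \<xi> p"
        if X: "X \<in> VF" and \<xi>: "\<xi> \<in> \<K>" for X \<xi> p
        using curvature_1[OF \<alpha> X \<xi>, of p] F(2)[OF a X \<xi>] fun_cong[OF br_anti[OF K_sec[OF sec[OF X]] K_sec[OF \<xi>]], of p]
        by (simp add: ev)
    qed
    then show ?thesis by (simp add: contract_def)
  qed
  show ?thesis
    unfolding im_curvature_def delta0_def fst_conv hor_eq
    using 0 1[OF sec_ext(1)] sec_ext(2) by (simp add: fun_eq_iff form_zero_def anchor_sec_def)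
qed

theorem uniquely_primitive:
  "\<exists>!F. F \<in> forms L K 2 \<and> im_curvature L K (c\<^sub>0, c\<^sub>1) = delta0 L F"
  "F \<in> forms L K 2 \<Longrightarrow> im_curvature L K (c\<^sub>0, c\<^sub>1) = delta0 L F \<Longrightarrow> ext_covariant L ind F = form_zero"
proof -
  obtain F0 where F0: "F0 \<in> forms L K 2" "\<And>X Y \<xi>. X \<in> VF \<Longrightarrow> Y \<in> VF \<Longrightarrow> \<xi> \<in> \<K> \<Longrightarrow> br \<xi> (eval_form F0 [X, Y]) = curv X Y \<xi>"
    by (rule curvature_form) (rule that; assumption)
  note prim = curvature_primitive[OF F0]
  have uniq: "F = F0" if "F \<in> forms L K 2" "im_curvature L K (c\<^sub>0, c\<^sub>1) = delta0 L F" for F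
    using inj_onD[OF delta0_inj _ that(1) F0(1)] that(2) prim by simp
  show "\<exists>!F. F \<in> forms L K 2 \<and> im_curvature L K (c\<^sub>0, c\<^sub>1) = delta0 L F"
    using F0(1) prim uniq by blast
  show "F \<in> forms L K 2 \<Longrightarrow> im_curvature L K (c\<^sub>0, c\<^sub>1) = delta0 L F \<Longrightarrow> ext_covariant L ind F = form_zero"
    using uniq bianchi[OF F0] by blast
qed

end

section \<open>Reconstructing an IM connection from a splitting and a connection\<close>

context bracket_connection
begin

lemma defect_add:
  assumes \<alpha>: "\<alpha> \<in> \<Gamma>" and X: "X \<in> VF" and \<xi>: "\<xi> \<in> \<K>" and \<eta>: "\<eta> \<in> \<K>"
  shows "defect \<alpha> X (\<lambda>q. \<xi> q + \<eta> q) p = defect \<alpha> X \<xi> p + defect \<alpha> X \<eta> p"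
  unfolding defect_def N_add[OF \<xi> \<eta>] br_add[OF K_sec[OF \<xi>] K_sec[OF \<eta>] \<alpha>] N_add[OF br_K[OF \<alpha> \<xi>] br_K[OF \<alpha> \<eta>]]
    br_add[OF K_sec[OF N_K[OF X \<xi>]] K_sec[OF N_K[OF X \<eta>]] \<alpha>] by simp

lemma defect_scale:
  assumes \<alpha>: "\<alpha> \<in> \<Gamma>" and X: "X \<in> VF" and \<xi>: "\<xi> \<in> \<K>" and f: "f \<in> C"
  shows "defect \<alpha> X (\<lambda>q. f q *\<^sub>R \<xi> q) p = f p *\<^sub>R defect \<alpha> X \<xi> p"
proof -
  note a = anchor_VF[OF \<alpha>]
  note NX = N_K[OF X \<xi>] and b = br_K[OF \<alpha> \<xi>] and fX = C_closed(4)[OF X f] and fa = C_closed(4)[OF a f]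
  have 1: "N X (br \<alpha> (\<lambda>q. f q *\<^sub>R \<xi> q)) p = f p *\<^sub>R N X (br \<alpha> \<xi>) p + td f p (X p) *\<^sub>R br \<alpha> \<xi> p
      + td f p (\<rho> \<alpha> p) *\<^sub>R N X \<xi> p + td (\<lambda>q. td f q (\<rho> \<alpha> q)) p (X p) *\<^sub>R \<xi> p"
    unfolding br_leibniz[OF \<alpha> K_sec[OF \<xi>] f] N_add[OF K_closed(3)[OF f b] K_closed(3)[OF fa \<xi>]]
      N_scale[OF b f X] N_scale[OF \<xi> fa X] by (simp add: algebra_simps)
  have 2: "br \<alpha> (N X (\<lambda>q. f q *\<^sub>R \<xi> q)) p = f p *\<^sub>R br \<alpha> (N X \<xi>) p + td f p (\<rho> \<alpha> p) *\<^sub>R N X \<xi> p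
      + td f p (X p) *\<^sub>R br \<alpha> \<xi> p + td (\<lambda>q. td f q (X q)) p (\<rho> \<alpha> p) *\<^sub>R \<xi> p"
    unfolding N_scale[OF \<xi> f X] br_add[OF K_sec[OF K_closed(3)[OF f NX]] K_sec[OF K_closed(3)[OF fX \<xi>]] \<alpha>]
      br_leibniz[OF \<alpha> K_sec[OF NX] f] br_leibniz[OF \<alpha> K_sec[OF \<xi>] fX] by (simp add: algebra_simps)
  show ?thesis
    unfolding defect_def 1 2 N_scale[OF \<xi> f VF_vb[OF a X]] td_vb_C[OF a X f] by (simp add: algebra_simps)
qed

text \<open>\<open>[\<alpha>, -]\<close> and covariant derivatives are derivations of the bracket.\<close>

lemma defect_derivation:
  assumes \<alpha>: "\<alpha> \<in> \<Gamma>" and X: "X \<in> VF" and \<xi>: "\<xi> \<in> \<K>" and \<eta>: "\<eta> \<in> \<K>"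
  shows "defect \<alpha> X (br \<xi> \<eta>) p = br (defect \<alpha> X \<xi>) \<eta> p + br \<xi> (defect \<alpha> X \<eta>) p"
proof -
  note a = VF_vb[OF anchor_VF[OF \<alpha>] X]
  note G = K_sec
  note NX = N_K[OF X \<xi>] and MX = N_K[OF X \<eta>] and b = br_K[OF \<alpha> \<xi>] and d = br_K[OF \<alpha> \<eta>]
  have B: "br u w \<in> \<K>" if "u \<in> \<K>" "w \<in> \<K>" for u w using that br_K G by blast
  have J: "br \<alpha> (br u w) = (\<lambda>p. br (br \<alpha> u) w p + br u (br \<alpha> w) p)" if "u \<in> \<K>" "w \<in> \<K>" for u w
    using br_jacobi[OF \<alpha> G[OF that(1)] G[OF that(2)]] by blast
  have 1: "N X (br \<alpha> (br \<xi> \<eta>)) p = br (N X (br \<alpha> \<xi>)) \<eta> p + br (br \<alpha> \<xi>) (N X \<eta>) p + br (N X \<xi>) (br \<alpha> \<eta>) p + br \<xi> (N X (br \<alpha> \<eta>)) p"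
    unfolding J[OF \<xi> \<eta>] N_add[OF B[OF b \<eta>] B[OF \<xi> d]] N_br[OF X b \<eta>] N_br[OF X \<xi> d] by simp
  have 2: "br \<alpha> (N X (br \<xi> \<eta>)) p = br (br \<alpha> (N X \<xi>)) \<eta> p + br (N X \<xi>) (br \<alpha> \<eta>) p + br (br \<alpha> \<xi>) (N X \<eta>) p + br \<xi> (br \<alpha> (N X \<eta>)) p"
    unfolding N_br[OF X \<xi> \<eta>] br_add[OF G[OF B[OF NX \<eta>]] G[OF B[OF \<xi> MX]] \<alpha>] J[OF NX \<eta>] J[OF \<xi> MX] by simp
  have 3: "br (defect \<alpha> X \<xi>) \<eta> = (\<lambda>p. br (N X (br \<alpha> \<xi>)) \<eta> p - br (br \<alpha> (N X \<xi>)) \<eta> p + br (N (vb (\<rho> \<alpha>) X) \<xi>) \<eta> p)"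
    unfolding defect_def[abs_def]
      br_add_left[OF G[OF K_closed(2)[OF N_K[OF X b] br_K[OF \<alpha> NX]]] G[OF N_K[OF a \<xi>]] G[OF \<eta>]]
      br_diff_left[OF G[OF N_K[OF X b]] G[OF br_K[OF \<alpha> NX]] G[OF \<eta>]] ..
  have 4: "br \<xi> (defect \<alpha> X \<eta>) = (\<lambda>p. br \<xi> (N X (br \<alpha> \<eta>)) p - br \<xi> (br \<alpha> (N X \<eta>)) p + br \<xi> (N (vb (\<rho> \<alpha>) X) \<eta>) p)"
    unfolding defect_def[abs_def]
      br_add[OF G[OF K_closed(2)[OF N_K[OF X d] br_K[OF \<alpha> MX]]] G[OF N_K[OF a \<eta>]] G[OF \<xi>]]
      br_diff[OF G[OF N_K[OF X d]] G[OF br_K[OF \<alpha> MX]] G[OF \<xi>]] ..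
  show ?thesis unfolding 3 4 unfolding defect_def 1 2 N_br[OF a \<xi> \<eta>] by simp
qed

lemma defect_add_field:
  assumes \<alpha>: "\<alpha> \<in> \<Gamma>" and X: "X \<in> VF" and Y: "Y \<in> VF" and \<xi>: "\<xi> \<in> \<K>"
  shows "defect \<alpha> (\<lambda>q. X q + Y q) \<xi> p = defect \<alpha> X \<xi> p + defect \<alpha> Y \<xi> p"
proof -
  have e: "N (\<lambda>q. X q + Y q) \<zeta> = (\<lambda>q. N X \<zeta> q + N Y \<zeta> q)" if "\<zeta> \<in> \<K>" for \<zeta>
    using N_add_left[OF that] by blast
  show ?thesis
    unfolding defect_def e[OF \<xi>] e[OF br_K[OF \<alpha> \<xi>]] vb_add_right[OF anchor_VF[OF \<alpha>] X Y] N_add_left[OF \<xi>]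
      br_add[OF K_sec[OF N_K[OF X \<xi>]] K_sec[OF N_K[OF Y \<xi>]] \<alpha>] by simp
qed

lemma defect_scale_field:
  assumes \<alpha>: "\<alpha> \<in> \<Gamma>" and X: "X \<in> VF" and f: "f \<in> C" and \<xi>: "\<xi> \<in> \<K>"
  shows "defect \<alpha> (\<lambda>q. f q *\<^sub>R X q) \<xi> p = f p *\<^sub>R defect \<alpha> X \<xi> p"
proof -
  have e: "N (\<lambda>q. f q *\<^sub>R X q) \<zeta> = (\<lambda>q. f q *\<^sub>R N X \<zeta> q)" if "\<zeta> \<in> \<K>" for \<zeta>
    using N_scale_left[OF that] by blast
  show ?thesis
    unfolding defect_def e[OF \<xi>] e[OF br_K[OF \<alpha> \<xi>]] vb_scale_right[OF anchor_VF[OF \<alpha>] X f] N_add_left[OF \<xi>] N_scale_left[OF \<xi>]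
      br_leibniz[OF \<alpha> K_sec[OF N_K[OF X \<xi>]] f] by (simp add: algebra_simps)
qed

lemma defect_inner:
  assumes \<alpha>: "\<alpha> \<in> \<Gamma>" and X: "X \<in> VF"
  obtains \<zeta> where "\<zeta> \<in> \<K>" "\<And>\<xi>. \<xi> \<in> \<K> \<Longrightarrow> defect \<alpha> X \<xi> = br \<zeta> \<xi>"
proof (rule ad_surjective[of "defect \<alpha> X"])
  show "defect \<alpha> X \<xi> \<in> \<K>" if "\<xi> \<in> \<K>" for \<xi> by (rule defect_K[OF \<alpha> X that])
  show "defect \<alpha> X (\<lambda>q. \<xi> q + \<eta> q) = (\<lambda>q. defect \<alpha> X \<xi> q + defect \<alpha> X \<eta> q)" if "\<xi> \<in> \<K>" "\<eta> \<in> \<K>" for \<xi> \<eta>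
    using defect_add[OF \<alpha> X that] by blast
  show "defect \<alpha> X (\<lambda>q. f q *\<^sub>R \<xi> q) = (\<lambda>q. f q *\<^sub>R defect \<alpha> X \<xi> q)" if "f \<in> C" "\<xi> \<in> \<K>" for f \<xi>
    using defect_scale[OF \<alpha> X that(2,1)] by blast
  show "defect \<alpha> X (br \<xi> \<eta>) = (\<lambda>q. br (defect \<alpha> X \<xi>) \<eta> q + br \<xi> (defect \<alpha> X \<eta>) q)" if "\<xi> \<in> \<K>" "\<eta> \<in> \<K>" for \<xi> \<eta>
    using defect_derivation[OF \<alpha> X that] by blast
qed (use that in blast)

lemma defect_form:
  assumes \<alpha>: "\<alpha> \<in> \<Gamma>"
  obtains \<gamma> where "\<gamma> \<in> forms L K 1" "\<And>X \<xi>. X \<in> VF \<Longrightarrow> \<xi> \<in> \<K> \<Longrightarrow> br (eval_form \<gamma> [X]) \<xi> = defect \<alpha> X \<xi>"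
proof (rule form_of_derivations[of 1 "\<lambda>Xs. defect \<alpha> (Xs ! 0)"])
  show "\<exists>\<zeta>\<in>\<K>. \<forall>\<xi>\<in>\<K>. defect \<alpha> (Xs ! 0) \<xi> = br \<zeta> \<xi>" if "set Xs \<subseteq> VF" "length Xs = 1" for Xs
    using defect_inner[OF \<alpha>, of "Xs ! 0"] that nth_mem[of 0 Xs] by (metis less_numeral_extra(1) subsetD)
next
  fix Xs Ys :: "('m \<Rightarrow> 'e) list" and X Y \<xi> p
  assume V: "X \<in> VF" "Y \<in> VF" "\<xi> \<in> \<K>" and l: "length Xs + length Ys + 1 = 1"
  show "defect \<alpha> ((Xs @ (\<lambda>p. X p + Y p) # Ys) ! 0) \<xi> p = defect \<alpha> ((Xs @ X # Ys) ! 0) \<xi> p + defect \<alpha> ((Xs @ Y # Ys) ! 0) \<xi> p"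
    using l defect_add_field[OF \<alpha> V] by simp
next
  fix Xs Ys :: "('m \<Rightarrow> 'e) list" and X \<xi> p and f :: "'m \<Rightarrow> real"
  assume V: "X \<in> VF" "f \<in> C" "\<xi> \<in> \<K>" and l: "length Xs + length Ys + 1 = 1"
  show "defect \<alpha> ((Xs @ (\<lambda>p. f p *\<^sub>R X p) # Ys) ! 0) \<xi> p = f p *\<^sub>R defect \<alpha> ((Xs @ X # Ys) ! 0) \<xi> p"
    using l defect_scale_field[OF \<alpha> V] by simp
next
  fix Xs :: "('m \<Rightarrow> 'e) list" and i j :: nat and \<xi> p assume "i < j" "j < 1"
  then show "defect \<alpha> (Xs ! 0) \<xi> p = 0" by simp
next
  fix \<gamma> assume \<gamma>: "\<gamma> \<in> forms L K 1"
    "\<And>Xs \<xi>. set Xs \<subseteq> VF \<Longrightarrow> length Xs = 1 \<Longrightarrow> \<xi> \<in> \<K> \<Longrightarrow> br (eval_form \<gamma> Xs) \<xi> = defect \<alpha> (Xs ! 0) \<xi>"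
  show ?thesis by (rule that[OF \<gamma>(1)]) (use \<gamma>(2)[of "[_]"] in simp)
qed

lemma defect_linear:
  assumes \<alpha>: "\<alpha> \<in> \<Gamma>" and \<beta>: "\<beta> \<in> \<Gamma>" and X: "X \<in> VF" and \<xi>: "\<xi> \<in> \<K>"
  shows "defect (\<lambda>q. r *\<^sub>R \<alpha> q + s *\<^sub>R \<beta> q) X \<xi> p = r *\<^sub>R defect \<alpha> X \<xi> p + s *\<^sub>R defect \<beta> X \<xi> p"
proof -
  note c = C_const[of r] C_const[of s]
  note sec = section_scale[OF c(1) \<alpha>] section_scale[OF c(2) \<beta>]
  note a = anchor_VF[OF \<alpha>] anchor_VF[OF \<beta>]
  note b = br_K[OF \<alpha> \<xi>] br_K[OF \<beta> \<xi>]
  have N: "N X (br (\<lambda>q. r *\<^sub>R \<alpha> q + s *\<^sub>R \<beta> q) \<xi>) p = r *\<^sub>R N X (br \<alpha> \<xi>) p + s *\<^sub>R N X (br \<beta> \<xi>) p"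
    unfolding br_linear_left[OF \<alpha> \<beta> K_sec[OF \<xi>]] N_add[OF K_closed(3)[OF c(1) b(1)] K_closed(3)[OF c(2) b(2)]]
      N_scale[OF b(1) c(1) X] N_scale[OF b(2) c(2) X] by simp
  have v: "vb (\<rho> (\<lambda>q. r *\<^sub>R \<alpha> q + s *\<^sub>R \<beta> q)) X = (\<lambda>q. r *\<^sub>R vb (\<rho> \<alpha>) X q + s *\<^sub>R vb (\<rho> \<beta>) X q)"
    unfolding anchor_add[OF sec] anchor_scale[OF \<alpha>] anchor_scale[OF \<beta>] vb_add_left[OF VF_scale[OF c(1) a(1)] VF_scale[OF c(2) a(2)] X]
      vb_scale_left[OF a(1) X c(1)] vb_scale_left[OF a(2) X c(2)] by simp
  show ?thesis
    unfolding defect_def N v N_add_left[OF \<xi>] N_scale_left[OF \<xi>] br_linear_left[OF \<alpha> \<beta> K_sec[OF N_K[OF X \<xi>]]]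
    by (simp add: algebra_simps)
qed

text \<open>The difference in the last term is \<open>[v(\<alpha>), \<xi>]\<close> for a splitting \<open>v\<close> that satisfies \<open>[h(\<alpha>), \<xi>] = \<nabla>\<^bsub>\<rho>(\<alpha>)\<^esub>\<xi>\<close>.\<close>

lemma defect_leibniz:
  assumes \<alpha>: "\<alpha> \<in> \<Gamma>" and f: "f \<in> C" and X: "X \<in> VF" and \<xi>: "\<xi> \<in> \<K>"
  shows "defect (\<lambda>q. f q *\<^sub>R \<alpha> q) X \<xi> p = f p *\<^sub>R defect \<alpha> X \<xi> p + td f p (X p) *\<^sub>R (br \<alpha> \<xi> p - N (\<rho> \<alpha>) \<xi> p)"
  unfolding defect_def br_scale_K[OF f \<xi> \<alpha>] br_scale_K[OF f N_K[OF X \<xi>] \<alpha>] N_scale[OF br_K[OF \<alpha> \<xi>] f X] anchor_scale[OF \<alpha>]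
    vb_scale_left[OF anchor_VF[OF \<alpha>] X f] N_diff_left[OF \<xi>] N_scale_left[OF \<xi>] by (simp add: algebra_simps)

end

text \<open>The data from which the IM connection \<open>(c\<^sub>0, c\<^sub>1)\<close> is reconstructed.\<close>

locale connection_pair = bracket_connection L K D
  for L :: "('m::{t2_space, second_countable_topology}, 'e::real_inner, 'v::real_vector, 'f::real_inner) algebroid_data"
    and K :: "'m \<Rightarrow> 'v set" and D :: "('m, 'e, 'v) conn" +
  fixes v :: "'m \<Rightarrow> 'v \<Rightarrow> 'v"
  assumes v_splitting: "v \<in> splittings L K"
    and v_horizontal: "\<And>\<alpha> \<xi>. \<alpha> \<in> \<Gamma> \<Longrightarrow> \<xi> \<in> \<K> \<Longrightarrow> br (horizontal_part v \<alpha>) \<xi> = N (\<rho> \<alpha>) \<xi>"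
begin

lemma v_linear: "linear_map_on (fibre L p) (v p)" and v_K: "a \<in> fibre L p \<Longrightarrow> v p a \<in> K p"
  and v_off: "a \<notin> fibre L p \<Longrightarrow> v p a = 0" and v_id: "a \<in> K p \<Longrightarrow> v p a = a"
  using v_splitting by (auto simp: splittings_def)

lemma v_smooth: "(U, \<phi>) \<in> trivs L \<Longrightarrow> sm U (\<lambda>p. \<phi> p (v p (iv \<phi> p w)))"
  using v_splitting unfolding splittings_def by blast

definition c\<^sub>1 :: "'m \<Rightarrow> 'v \<Rightarrow> 'e list \<Rightarrow> 'v" where
  "c\<^sub>1 p a vs = (if vs = [] then v p a else 0)"

lemma c1_bundle_map: "c\<^sub>1 \<in> form_bundle_maps L K 0"
  unfolding form_bundle_maps_def
proof (intro CollectI conjI allI ballI impI case_prodI2)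
  show "c\<^sub>1 p a \<in> alternating_maps (K p) 0" if "a \<in> fibre L p" for p a
    using v_K[OF that] by (simp add: alternating_maps_def c\<^sub>1_def)
  show "c\<^sub>1 p a = (\<lambda>vs. 0)" if "a \<notin> fibre L p" for p a
    using v_off[OF that] by (simp add: c\<^sub>1_def fun_eq_iff)
  show "linear_map_on (fibre L p) (\<lambda>a. c\<^sub>1 p a vs)" for p vs
    using v_linear[of p] by (cases "vs = []") (simp_all add: c\<^sub>1_def linear_map_on_def)
  fix t U \<phi> c w and es :: "'e list" assume "t \<in> trivs L" "t = (U, \<phi>)" and c: "c \<in> atlas L"
  then have tr: "(U, \<phi>) \<in> trivs L" by simp
  obtain V x where V: "c = (V, x)" by force
  have o: "open (U \<inter> fst c)" using trivs_open[OF tr] chart(1)[of V x] c V by auto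
  show "sm (U \<inter> fst c) (\<lambda>p. \<phi> p (c\<^sub>1 p (iv \<phi> p w) (map (tv c p) es)))"
  proof (cases "es = []")
    case True
    then show ?thesis using sm_subset[OF v_smooth[OF tr, of w], of "U \<inter> fst c"] by (simp add: c\<^sub>1_def)
  next
    case False
    show ?thesis
    proof (rule sm_cong[OF o sm_const[OF o, of 0]])
      fix p assume "p \<in> U \<inter> fst c"
      then show "0 = \<phi> p (c\<^sub>1 p (iv \<phi> p w) (map (tv c p) es))"
        using triv_linear(3)[OF trivs_triv[OF tr], of p] False by (simp add: c\<^sub>1_def)
    qed
  qed
qed

definition ver :: "('m \<Rightarrow> 'v) \<Rightarrow> 'm \<Rightarrow> 'v" where
  "ver \<alpha> = (\<lambda>p. v p (\<alpha> p))"

lemma ver_K: "\<alpha> \<in> \<Gamma> \<Longrightarrow> ver \<alpha> \<in> \<K>"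
  using eval_K[OF form_bundle_map_app[OF c1_bundle_map], of \<alpha> "[]"] by (simp add: eval_form_def app_sec_def ver_def c\<^sub>1_def)

lemma ver_bracket:
  assumes "\<alpha> \<in> \<Gamma>" "\<xi> \<in> \<K>"
  shows "br (ver \<alpha>) \<xi> p = br \<alpha> \<xi> p - N (\<rho> \<alpha>) \<xi> p"
proof -
  have "br (\<lambda>p. \<alpha> p - ver \<alpha> p) \<xi> p = N (\<rho> \<alpha>) \<xi> p"
    using fun_cong[OF v_horizontal[OF assms], of p] by (simp add: horizontal_part_def ver_def)
  then show ?thesis unfolding br_diff_left[OF assms(1) K_sec[OF ver_K[OF assms(1)]] K_sec[OF assms(2)]]
    by (simp add: algebra_simps)
qed

definition c\<^sub>0 :: "('m \<Rightarrow> 'v) \<Rightarrow> ('m, 'e, 'v) vform" where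
  "c\<^sub>0 \<alpha> = (if \<alpha> \<in> \<Gamma>
     then SOME \<gamma>. \<gamma> \<in> forms L K 1 \<and> (\<forall>X\<in>VF. \<forall>\<xi>\<in>\<K>. br (eval_form \<gamma> [X]) \<xi> = defect \<alpha> X \<xi>)
     else form_zero)"

lemma c0:
  assumes "\<alpha> \<in> \<Gamma>"
  shows "c\<^sub>0 \<alpha> \<in> forms L K 1" "X \<in> VF \<Longrightarrow> \<xi> \<in> \<K> \<Longrightarrow> br (eval_form (c\<^sub>0 \<alpha>) [X]) \<xi> = defect \<alpha> X \<xi>"
proof -
  have "\<exists>\<gamma>. \<gamma> \<in> forms L K 1 \<and> (\<forall>X\<in>VF. \<forall>\<xi>\<in>\<K>. br (eval_form \<gamma> [X]) \<xi> = defect \<alpha> X \<xi>)"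
    by (rule defect_form[OF assms]) blast
  from someI_ex[OF this] have "c\<^sub>0 \<alpha> \<in> forms L K 1 \<and> (\<forall>X\<in>VF. \<forall>\<xi>\<in>\<K>. br (eval_form (c\<^sub>0 \<alpha>) [X]) \<xi> = defect \<alpha> X \<xi>)"
    using assms by (simp add: c\<^sub>0_def)
  then show "c\<^sub>0 \<alpha> \<in> forms L K 1" "X \<in> VF \<Longrightarrow> \<xi> \<in> \<K> \<Longrightarrow> br (eval_form (c\<^sub>0 \<alpha>) [X]) \<xi> = defect \<alpha> X \<xi>" by auto
qed

lemma eval_c0: "\<alpha> \<in> \<Gamma> \<Longrightarrow> X \<in> VF \<Longrightarrow> eval_form (c\<^sub>0 \<alpha>) [X] \<in> \<K>"
  using eval_K[OF c0(1)] by simp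

lemma c0_wrong_length: "\<alpha> \<in> \<Gamma> \<Longrightarrow> length vs \<noteq> 1 \<Longrightarrow> c\<^sub>0 \<alpha> p vs = 0"
  using alternating_wrong_length[OF form_alternating[OF c0(1)]] by blast

lemma c0_linear:
  assumes \<alpha>: "\<alpha> \<in> \<Gamma>" and \<beta>: "\<beta> \<in> \<Gamma>"
  shows "c\<^sub>0 (\<lambda>p. r *\<^sub>R \<alpha> p + s *\<^sub>R \<beta> p) = form_add (form_scale (\<lambda>_. r) (c\<^sub>0 \<alpha>)) (form_scale (\<lambda>_. s) (c\<^sub>0 \<beta>))" (is "_ = ?R")
proof -
  have sec: "(\<lambda>p. r *\<^sub>R \<alpha> p + s *\<^sub>R \<beta> p) \<in> \<Gamma>" by (intro section_add section_scale C_const \<alpha> \<beta>)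
  have R: "eval_form ?R [X] = (\<lambda>p. r *\<^sub>R eval_form (c\<^sub>0 \<alpha>) [X] p + s *\<^sub>R eval_form (c\<^sub>0 \<beta>) [X] p)" for X
    by (simp add: eval_form_def form_add_def form_scale_def)
  show ?thesis
  proof (rule form1_ad_eqI[OF c0(1)[OF sec]])
    show "?R p vs = 0" if "length vs \<noteq> 1" for p vs
      using c0_wrong_length[OF \<alpha> that] c0_wrong_length[OF \<beta> that] by (simp add: form_add_def form_scale_def)
    fix X assume X: "X \<in> VF"
    show "eval_form ?R [X] \<in> \<K>" unfolding R by (intro K_closed(1,3) C_const eval_c0 \<alpha> \<beta> X)
    fix \<xi> p assume \<xi>: "\<xi> \<in> \<K>"
    show "br (eval_form (c\<^sub>0 (\<lambda>p. r *\<^sub>R \<alpha> p + s *\<^sub>R \<beta> p)) [X]) \<xi> p = br (eval_form ?R [X]) \<xi> p"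
      unfolding R br_linear_left[OF K_sec[OF eval_c0[OF \<alpha> X]] K_sec[OF eval_c0[OF \<beta> X]] K_sec[OF \<xi>]]
        c0(2)[OF sec X \<xi>] c0(2)[OF \<alpha> X \<xi>] c0(2)[OF \<beta> X \<xi>] by (rule defect_linear[OF \<alpha> \<beta> X \<xi>])
  qed
qed

lemma c0_leibniz:
  assumes \<alpha>: "\<alpha> \<in> \<Gamma>" and f: "f \<in> C"
  shows "c\<^sub>0 (\<lambda>p. f p *\<^sub>R \<alpha> p) = form_add (form_scale f (c\<^sub>0 \<alpha>)) (d_wedge (atlas L) f (app_sec c\<^sub>1 \<alpha>))" (is "_ = ?R")
proof -
  note sec = section_scale[OF f \<alpha>]
  have R: "eval_form ?R [X] = (\<lambda>p. f p *\<^sub>R eval_form (c\<^sub>0 \<alpha>) [X] p + td f p (X p) *\<^sub>R ver \<alpha> p)" for X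
    by (simp add: eval_form_def form_add_def form_scale_def d_wedge_def delete_nth_def app_sec_def c\<^sub>1_def ver_def)
  show ?thesis
  proof (rule form1_ad_eqI[OF c0(1)[OF sec]])
    show "?R p vs = 0" if l: "length vs \<noteq> 1" for p vs
    proof -
      have "d_wedge (atlas L) f (app_sec c\<^sub>1 \<alpha>) p vs = 0"
        unfolding d_wedge_def
      proof (rule sum.neutral, rule ballI)
        fix i assume "i \<in> {..<length vs}"
        then have "length (delete_nth i vs) \<noteq> 0" using l by (simp add: delete_nth_def)
        then show "((-1) ^ i * td f p (vs ! i)) *\<^sub>R app_sec c\<^sub>1 \<alpha> p (delete_nth i vs) = 0"
          by (simp add: app_sec_def c\<^sub>1_def)
      qed
      then show ?thesis using c0_wrong_length[OF \<alpha> l] by (simp add: form_add_def form_scale_def)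
    qed
    fix X assume X: "X \<in> VF"
    note T = eval_c0[OF \<alpha> X] and fX = C_closed(4)[OF X f] and w = ver_K[OF \<alpha>]
    show "eval_form ?R [X] \<in> \<K>" unfolding R by (intro K_closed(1,3) f fX T w)
    fix \<xi> p assume \<xi>: "\<xi> \<in> \<K>"
    show "br (eval_form (c\<^sub>0 (\<lambda>p. f p *\<^sub>R \<alpha> p)) [X]) \<xi> p = br (eval_form ?R [X]) \<xi> p"
      unfolding R br_add_left[OF K_sec[OF K_closed(3)[OF f T]] K_sec[OF K_closed(3)[OF fX w]] K_sec[OF \<xi>]]
        br_scale_K[OF f \<xi> K_sec[OF T]] br_scale_K[OF fX \<xi> K_sec[OF w]] c0(2)[OF sec X \<xi>] c0(2)[OF \<alpha> X \<xi>] ver_bracket[OF \<alpha> \<xi>]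
      by (rule defect_leibniz[OF \<alpha> f X \<xi>])
  qed
qed

lemma c0_bracket:
  assumes \<alpha>: "\<alpha> \<in> \<Gamma>" and \<beta>: "\<beta> \<in> \<Gamma>"
  shows "c\<^sub>0 (br \<alpha> \<beta>) = form_add (lie_deriv L \<alpha> (c\<^sub>0 \<beta>)) (form_minus (lie_deriv L \<beta> (c\<^sub>0 \<alpha>)))" (is "_ = ?R")
proof -
  note sec = br_closed[OF \<alpha> \<beta>]
  have R: "eval_form ?R [X] = (\<lambda>p. eval_form (lie_deriv L \<alpha> (c\<^sub>0 \<beta>)) [X] p - eval_form (lie_deriv L \<beta> (c\<^sub>0 \<alpha>)) [X] p)" for X
    by (simp add: eval_form_def form_add_def form_minus_def)
  have Lie: "lie_deriv L a (c\<^sub>0 d) \<in> forms L K 1" if "a \<in> \<Gamma>" "d \<in> \<Gamma>" for a d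
    using lie_deriv_form(1)[OF c0(1)[OF that(2)] that(1)] .
  have E: "eval_form (lie_deriv L a (c\<^sub>0 d)) [X] \<in> \<K>" if "a \<in> \<Gamma>" "d \<in> \<Gamma>" "X \<in> VF" for a d X
    using eval_K[OF Lie[OF that(1,2)]] that(3) by simp
  have half: "br (eval_form (lie_deriv L a (c\<^sub>0 d)) [X]) \<xi> p = br a (defect d X \<xi>) p - defect d X (br a \<xi>) p - defect d (vb (\<rho> a) X) \<xi> p"
    if a: "a \<in> \<Gamma>" and d: "d \<in> \<Gamma>" and X: "X \<in> VF" and \<xi>: "\<xi> \<in> \<K>" for a d X \<xi> p
  proof -
    note T = eval_c0[OF d X] and aX = VF_vb[OF anchor_VF[OF a] X]
    have "eval_form (lie_deriv L a (c\<^sub>0 d)) [X] = (\<lambda>p. br a (eval_form (c\<^sub>0 d) [X]) p - eval_form (c\<^sub>0 d) [vb (\<rho> a) X] p)"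
      using eval_lie_deriv_1[OF c0(1)[OF d] a X] by blast
    then have "br (eval_form (lie_deriv L a (c\<^sub>0 d)) [X]) \<xi> p
        = br (br a (eval_form (c\<^sub>0 d) [X])) \<xi> p - br (eval_form (c\<^sub>0 d) [vb (\<rho> a) X]) \<xi> p"
      using br_diff_left[OF K_sec[OF br_K[OF a T]] K_sec[OF eval_c0[OF d aX]] K_sec[OF \<xi>]] by simp
    also have "br (br a (eval_form (c\<^sub>0 d) [X])) \<xi> p = br a (br (eval_form (c\<^sub>0 d) [X]) \<xi>) p - br (eval_form (c\<^sub>0 d) [X]) (br a \<xi>) p"
      using br_jacobi[OF a K_sec[OF T] K_sec[OF \<xi>], of p] by simp
    finally show ?thesis unfolding c0(2)[OF d X \<xi>] c0(2)[OF d X br_K[OF a \<xi>]] c0(2)[OF d aX \<xi>] .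
  qed
  show ?thesis
  proof (rule form1_ad_eqI[OF c0(1)[OF sec]])
    show "?R p vs = 0" if "length vs \<noteq> 1" for p vs
      using alternating_wrong_length[OF form_alternating[OF Lie[OF \<alpha> \<beta>]] that]
        alternating_wrong_length[OF form_alternating[OF Lie[OF \<beta> \<alpha>]] that] by (simp add: form_add_def form_minus_def)
    fix X assume X: "X \<in> VF"
    show "eval_form ?R [X] \<in> \<K>" unfolding R by (intro K_closed(2) E \<alpha> \<beta> X)
    fix \<xi> p assume \<xi>: "\<xi> \<in> \<K>"
    note a = anchor_VF[OF \<alpha>] and b = anchor_VF[OF \<beta>]
    have br_defect: "br a (defect d X \<xi>) p = br a (N X (br d \<xi>)) p - br a (br d (N X \<xi>)) p + br a (N (vb (\<rho> d) X) \<xi>) p"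
      if a: "a \<in> \<Gamma>" and d: "d \<in> \<Gamma>" for a d
    proof -
      note m = N_K[OF X br_K[OF d \<xi>]] br_K[OF d N_K[OF X \<xi>]] N_K[OF VF_vb[OF anchor_VF[OF d] X] \<xi>]
      show ?thesis unfolding defect_def[abs_def] br_add[OF K_sec[OF K_closed(2)[OF m(1,2)]] K_sec[OF m(3)] a]
          br_diff[OF K_sec[OF m(1)] K_sec[OF m(2)] a] ..
    qed
    have J: "br (br \<alpha> \<beta>) \<eta> = (\<lambda>p. br \<alpha> (br \<beta> \<eta>) p - br \<beta> (br \<alpha> \<eta>) p)" if "\<eta> \<in> \<K>" for \<eta>
      using br_jacobi[OF \<alpha> \<beta> K_sec[OF that]] by (simp add: fun_eq_iff)
    have V: "vb (\<rho> (br \<alpha> \<beta>)) X = (\<lambda>q. vb (\<rho> \<alpha>) (vb (\<rho> \<beta>) X) q - vb (\<rho> \<beta>) (vb (\<rho> \<alpha>) X) q)"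
      unfolding anchor_morphism[OF \<alpha> \<beta>] using vb_jacobi[OF a b X] by (simp add: fun_eq_iff)
    have "defect (br \<alpha> \<beta>) X \<xi> p = N X (br \<alpha> (br \<beta> \<xi>)) p - N X (br \<beta> (br \<alpha> \<xi>)) p - br \<alpha> (br \<beta> (N X \<xi>)) p + br \<beta> (br \<alpha> (N X \<xi>)) p
        + N (vb (\<rho> \<alpha>) (vb (\<rho> \<beta>) X)) \<xi> p - N (vb (\<rho> \<beta>) (vb (\<rho> \<alpha>) X)) \<xi> p"
      unfolding defect_def V N_diff_left[OF \<xi>] J[OF \<xi>] J[OF N_K[OF X \<xi>]]
        N_diff[OF X br_K[OF \<alpha> br_K[OF \<beta> \<xi>]] br_K[OF \<beta> br_K[OF \<alpha> \<xi>]]] by simp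
    also have "\<dots> = br (eval_form ?R [X]) \<xi> p"
      unfolding R br_diff_left[OF K_sec[OF E[OF \<alpha> \<beta> X]] K_sec[OF E[OF \<beta> \<alpha> X]] K_sec[OF \<xi>]] half[OF \<alpha> \<beta> X \<xi>] half[OF \<beta> \<alpha> X \<xi>]
        br_defect[OF \<alpha> \<beta>] br_defect[OF \<beta> \<alpha>] defect_def by simp
    finally show "br (eval_form (c\<^sub>0 (br \<alpha> \<beta>)) [X]) \<xi> p = br (eval_form ?R [X]) \<xi> p" unfolding c0(2)[OF sec X \<xi>] .
  qed
qed

text \<open>With \<open>[v(\<beta>), \<xi>] = [\<beta>, \<xi>] - \<nabla>\<^bsub>\<rho>(\<beta>)\<^esub>\<xi>\<close> this becomes the Jacobi identity for \<open>\<alpha>\<close>, \<open>\<beta>\<close>, \<open>\<xi>\<close>.\<close>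

lemma c1_bracket:
  assumes \<alpha>: "\<alpha> \<in> \<Gamma>" and \<beta>: "\<beta> \<in> \<Gamma>"
  shows "app_sec c\<^sub>1 (br \<alpha> \<beta>) = form_add (lie_deriv L \<alpha> (app_sec c\<^sub>1 \<beta>)) (form_minus (contract (\<rho> \<beta>) (c\<^sub>0 \<alpha>)))"
proof (intro ext)
  fix p vs
  note sec = br_closed[OF \<alpha> \<beta>] and b = anchor_VF[OF \<beta>]
  note app = form_bundle_map_app[OF c1_bundle_map]
  show "app_sec c\<^sub>1 (br \<alpha> \<beta>) p vs = form_add (lie_deriv L \<alpha> (app_sec c\<^sub>1 \<beta>)) (form_minus (contract (\<rho> \<beta>) (c\<^sub>0 \<alpha>))) p vs"
  proof (cases "vs = []")
    case False
    then show ?thesis using lie_deriv_wrong_length[OF app[OF \<beta>] \<alpha>, of vs p] c0_wrong_length[OF \<alpha>, of "\<rho> \<beta> p # vs" p]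
      by (simp add: app_sec_def c\<^sub>1_def form_add_def form_minus_def contract_def)
  next
    case True
    note w = ver_K[OF \<beta>] and T = eval_c0[OF \<alpha> b]
    have "ver (br \<alpha> \<beta>) p = br \<alpha> (ver \<beta>) p - eval_form (c\<^sub>0 \<alpha>) [\<rho> \<beta>] p"
    proof (rule ad_injective[OF ver_K[OF sec] K_closed(2)[OF br_K[OF \<alpha> w] T]])
      fix \<xi> assume \<xi>: "\<xi> \<in> \<K>"
      have vb': "br (ver \<beta>) \<eta> = (\<lambda>p. br \<beta> \<eta> p - N (\<rho> \<beta>) \<eta> p)" if "\<eta> \<in> \<K>" for \<eta> using ver_bracket[OF \<beta> that] by blast
      have "br (\<lambda>p. br \<alpha> (ver \<beta>) p - eval_form (c\<^sub>0 \<alpha>) [\<rho> \<beta>] p) \<xi> p = br (br \<alpha> (ver \<beta>)) \<xi> p - defect \<alpha> (\<rho> \<beta>) \<xi> p"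
        unfolding br_diff_left[OF K_sec[OF br_K[OF \<alpha> w]] K_sec[OF T] K_sec[OF \<xi>]] c0(2)[OF \<alpha> b \<xi>] ..
      also have "br (br \<alpha> (ver \<beta>)) \<xi> p = br \<alpha> (br (ver \<beta>) \<xi>) p - br (ver \<beta>) (br \<alpha> \<xi>) p"
        using br_jacobi[OF \<alpha> K_sec[OF w] K_sec[OF \<xi>], of p] by simp
      also have "\<dots> = br \<alpha> (br \<beta> \<xi>) p - br \<alpha> (N (\<rho> \<beta>) \<xi>) p - (br \<beta> (br \<alpha> \<xi>) p - N (\<rho> \<beta>) (br \<alpha> \<xi>) p)"
        unfolding vb'[OF \<xi>] vb'[OF br_K[OF \<alpha> \<xi>]] br_diff[OF K_sec[OF br_K[OF \<beta> \<xi>]] K_sec[OF N_K[OF b \<xi>]] \<alpha>] ..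
      finally have "br (\<lambda>p. br \<alpha> (ver \<beta>) p - eval_form (c\<^sub>0 \<alpha>) [\<rho> \<beta>] p) \<xi> p
          = br \<alpha> (br \<beta> \<xi>) p - br \<beta> (br \<alpha> \<xi>) p - N (vb (\<rho> \<alpha>) (\<rho> \<beta>)) \<xi> p" by (simp add: defect_def)
      then show "br (ver (br \<alpha> \<beta>)) \<xi> p = br (\<lambda>p. br \<alpha> (ver \<beta>) p - eval_form (c\<^sub>0 \<alpha>) [\<rho> \<beta>] p) \<xi> p"
        unfolding ver_bracket[OF sec \<xi>] anchor_morphism[OF \<alpha> \<beta>] using br_jacobi[OF \<alpha> \<beta> K_sec[OF \<xi>], of p] by simp
    qed
    then show ?thesis
      unfolding True form_add_def form_minus_def lie_deriv_degree_0
      by (simp add: app_sec_def c\<^sub>1_def ver_def contract_def eval_form_single)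
  qed
qed

lemma im_connection: "(c\<^sub>0, c\<^sub>1) \<in> im_connections L K"
proof -
  have "(c\<^sub>0, c\<^sub>1) \<in> im_forms L K 1"
    unfolding im_forms_def mem_Collect_eq prod.case
  proof (intro conjI ballI allI impI)
    show "c\<^sub>1 \<in> (case 1 of 0 \<Rightarrow> {\<lambda>p a vs. 0} | Suc r \<Rightarrow> form_bundle_maps L K r)" using c1_bundle_map by simp
    fix \<alpha>
    show "c\<^sub>0 \<alpha> = form_zero" if "\<alpha> \<notin> \<Gamma>" using that by (simp add: c\<^sub>0_def)
    assume \<alpha>: "\<alpha> \<in> \<Gamma>"
    show "c\<^sub>0 \<alpha> \<in> forms L K 1" by (rule c0(1)[OF \<alpha>])
    show "c\<^sub>0 (\<lambda>p. f p *\<^sub>R \<alpha> p) = form_add (form_scale f (c\<^sub>0 \<alpha>)) (d_wedge (atlas L) f (app_sec c\<^sub>1 \<alpha>))" if "f \<in> C" for f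
      by (rule c0_leibniz[OF \<alpha> that])
    fix \<beta> assume \<beta>: "\<beta> \<in> \<Gamma>"
    show "c\<^sub>0 (\<lambda>p. r *\<^sub>R \<alpha> p + s *\<^sub>R \<beta> p) = form_add (form_scale (\<lambda>_. r) (c\<^sub>0 \<alpha>)) (form_scale (\<lambda>_. s) (c\<^sub>0 \<beta>))" for r s
      by (rule c0_linear[OF \<alpha> \<beta>])
    show "c\<^sub>0 (br \<alpha> \<beta>) = form_add (lie_deriv L \<alpha> (c\<^sub>0 \<beta>)) (form_minus (lie_deriv L \<beta> (c\<^sub>0 \<alpha>)))" by (rule c0_bracket[OF \<alpha> \<beta>])
    show "app_sec c\<^sub>1 (br \<alpha> \<beta>) = form_add (lie_deriv L \<alpha> (app_sec c\<^sub>1 \<beta>)) (form_minus (contract (\<rho> \<beta>) (c\<^sub>0 \<alpha>)))"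
      by (rule c1_bracket[OF \<alpha> \<beta>])
    show "contract (\<rho> \<alpha>) (app_sec c\<^sub>1 \<beta>) = form_minus (contract (\<rho> \<beta>) (app_sec c\<^sub>1 \<alpha>))"
      by (simp add: contract_def app_sec_def c\<^sub>1_def form_minus_def)
  qed
  then show ?thesis by (simp add: im_connections_def vertical_part_def c\<^sub>1_def v_id)
qed

lemma vertical_part_eq: "vertical_part (c\<^sub>0, c\<^sub>1) = v"
  by (simp add: vertical_part_def c\<^sub>1_def fun_eq_iff)

text \<open>For \<open>\<alpha> = \<xi>\<close> in \<open>\<Gamma>(K)\<close> the defect is \<open>[\<nabla>\<^sub>X\<xi>, -]\<close>, because the connection preserves brackets.\<close>

lemma induced_connection_eq: "induced_connection L K (c\<^sub>0, c\<^sub>1) = D"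
proof
  fix \<xi>
  show "induced_connection L K (c\<^sub>0, c\<^sub>1) \<xi> = D \<xi>"
  proof (cases "\<xi> \<in> \<K>")
    case False
    then show ?thesis by (simp add: induced_connection_def D_zero)
  next
    case True
    note \<xi> = True
    have "c\<^sub>0 \<xi> = D \<xi>"
    proof (rule form1_ad_eqI[OF c0(1)[OF K_sec[OF \<xi>]]])
      show "D \<xi> p vs = 0" if "length vs \<noteq> 1" for p vs
        using alternating_wrong_length[OF form_alternating[OF D_form[OF \<xi>]] that] .
      fix X assume X: "X \<in> VF"
      show "eval_form (D \<xi>) [X] \<in> \<K>" using N_K[OF X \<xi>] by (simp add: covariant_def)
      fix \<eta> p assume \<eta>: "\<eta> \<in> \<K>"
      have "defect \<xi> X \<eta> p = br (N X \<xi>) \<eta> p"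
        unfolding defect_def N_br[OF X \<xi> \<eta>] anchor_K[OF \<xi>] vb_zero_left[OF X] N_zero_left[OF \<eta>] by simp
      then show "br (eval_form (c\<^sub>0 \<xi>) [X]) \<eta> p = br (eval_form (D \<xi>) [X]) \<eta> p"
        unfolding c0(2)[OF K_sec[OF \<xi>] X \<eta>] by (simp add: covariant_def)
    qed
    then show ?thesis using \<xi> by (simp add: induced_connection_def)
  qed
qed

end

context semisimple_ideal
begin

text \<open>By \<open>defect_c0\<close> the brackets \<open>[c\<^sub>0(\<alpha>)(X), \<xi>]\<close> depend only on the induced connection.\<close>

lemma im_connection_determined:
  assumes c: "(c\<^sub>0, c\<^sub>1) \<in> im_connections L K" and d: "(d\<^sub>0, d\<^sub>1) \<in> im_connections L K"
    and v: "vertical_part (c\<^sub>0, c\<^sub>1) = vertical_part (d\<^sub>0, d\<^sub>1)"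
    and D: "induced_connection L K (c\<^sub>0, c\<^sub>1) = induced_connection L K (d\<^sub>0, d\<^sub>1)"
  shows "(c\<^sub>0, c\<^sub>1) = (d\<^sub>0, d\<^sub>1)"
proof -
  interpret c: im_connection L K c\<^sub>0 c\<^sub>1 by unfold_locales (rule c)
  interpret d: im_connection L K d\<^sub>0 d\<^sub>1 by unfold_locales (rule d)
  have "c\<^sub>1 p a vs = d\<^sub>1 p a vs" for p a vs
  proof (cases "vs = []")
    case True
    then show ?thesis using fun_cong[OF fun_cong[OF v, of p], of a] by (simp add: vertical_part_def)
  next
    case False
    have "e p a vs = 0" if e: "e \<in> form_bundle_maps L K 0" for e
    proof (cases "a \<in> fibre L p")
      case True
      then have "e p a \<in> alternating_maps (K p) 0" using e by (simp add: form_bundle_maps_def)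
      then show ?thesis using False by (intro alternating_wrong_length) auto
    next
      case False
      then show ?thesis using e by (simp add: form_bundle_maps_def)
    qed
    from this[OF c.c\<^sub>1] this[OF d.c\<^sub>1] show ?thesis by simp
  qed
  moreover have "c\<^sub>0 \<alpha> = d\<^sub>0 \<alpha>" for \<alpha>
  proof (cases "\<alpha> \<in> \<Gamma>")
    case False
    then show ?thesis by (simp add: c.imD(2) d.imD(2))
  next
    case \<alpha>: True
    show ?thesis
    proof (rule form1_ad_eqI[OF c.imD(1)[OF \<alpha>]])
      show "d\<^sub>0 \<alpha> p vs = 0" if "length vs \<noteq> 1" for p vs
        using alternating_wrong_length[OF form_alternating[OF d.imD(1)[OF \<alpha>]] that] .
      fix X assume X: "X \<in> VF"
      show "eval_form (d\<^sub>0 \<alpha>) [X] \<in> \<K>" by (rule d.eval_c0[OF \<alpha> X])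
      fix \<xi> p assume \<xi>: "\<xi> \<in> \<K>"
      show "br (eval_form (c\<^sub>0 \<alpha>) [X]) \<xi> p = br (eval_form (d\<^sub>0 \<alpha>) [X]) \<xi> p"
        unfolding c.defect_c0[OF \<alpha> X \<xi>] d.defect_c0[OF \<alpha> X \<xi>] c.defect_def d.defect_def D ..
    qed
  qed
  ultimately show ?thesis by (simp add: fun_eq_iff)
qed

theorem im_connections_bij:
  "bij_betw (\<lambda>c. (vertical_part c, induced_connection L K c)) (im_connections L K)
     {(v, D). v \<in> splittings L K \<and> D \<in> linear_connections L K \<and> bracket_preserving L K D \<and>
        (\<forall>\<alpha>\<in>\<Gamma>. \<forall>\<xi>\<in>\<K>. br (horizontal_part v \<alpha>) \<xi> = covariant D (\<rho> \<alpha>) \<xi>)}"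
  (is "bij_betw ?\<Phi> _ ?T")
  unfolding bij_betw_def
proof (intro conjI)
  show "inj_on ?\<Phi> (im_connections L K)"
  proof (rule inj_onI)
    fix c d assume "c \<in> im_connections L K" "d \<in> im_connections L K" "?\<Phi> c = ?\<Phi> d"
    then show "c = d" using im_connection_determined[of "fst c" "snd c" "fst d" "snd d"] by simp
  qed
  show "?\<Phi> ` im_connections L K = ?T"
  proof (rule equalityI; rule subsetI)
    fix y assume "y \<in> ?\<Phi> ` im_connections L K"
    then obtain c\<^sub>0 c\<^sub>1 where c: "(c\<^sub>0, c\<^sub>1) \<in> im_connections L K" and y: "y = ?\<Phi> (c\<^sub>0, c\<^sub>1)" by auto
    interpret im_connection L K c\<^sub>0 c\<^sub>1 by unfold_locales (rule c)
    show "y \<in> ?T" unfolding y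
      using splitting ind_linear_connection ind_bracket_preserving hor_bracket by simp
  next
    fix y assume "y \<in> ?T"
    then obtain v D where y: "y = (v, D)" and *: "v \<in> splittings L K" "D \<in> linear_connections L K" "bracket_preserving L K D"
      "\<And>\<alpha> \<xi>. \<alpha> \<in> \<Gamma> \<Longrightarrow> \<xi> \<in> \<K> \<Longrightarrow> br (horizontal_part v \<alpha>) \<xi> = covariant D (\<rho> \<alpha>) \<xi>" by auto
    interpret connection_pair L K D v by unfold_locales (rule *; assumption)+
    have "y = ?\<Phi> (c\<^sub>0, c\<^sub>1)" by (simp add: y vertical_part_eq induced_connection_eq)
    then show "y \<in> ?\<Phi> ` im_connections L K" using im_connection by (rule image_eqI)
  qed
qed

end

section \<open>IM forms and IM connections for semisimple bundles of ideals\<close>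

theorem proposition5p43:
  fixes L :: "('m::{t2_space, second_countable_topology}, 'e::real_inner, 'v::real_vector, 'f::real_inner)
                algebroid_data"
    and K :: "'m \<Rightarrow> 'v set"
  assumes "lie_algebroid L"
    and "semisimple_bundle_of_ideals L K"
  shows
    \<comment> \<open>(i)\<close>
    "(\<forall>q.
        (\<forall>\<gamma>\<in>forms L K q. \<forall>\<gamma>'\<in>forms L K q.
           delta0 L (form_add \<gamma> \<gamma>') = im_add (delta0 L \<gamma>) (delta0 L \<gamma>')) \<and>
        (\<forall>\<gamma>\<in>forms L K q. \<forall>r. delta0 L (form_scale (\<lambda>_. r) \<gamma>) = im_scale r (delta0 L \<gamma>)) \<and>
        bij_betw (delta0 L) (forms L K q) (horizontal_im_forms L K q))
     \<and>
     \<comment> \<open>(ii)\<close>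
     (\<forall>c\<in>im_connections L K.
        (\<exists>!F. F \<in> forms L K 2 \<and> im_curvature L K c = delta0 L F) \<and>
        (\<forall>F\<in>forms L K 2. im_curvature L K c = delta0 L F \<longrightarrow>
           ext_covariant L (induced_connection L K c) F = form_zero))
     \<and>
     \<comment> \<open>(iii)\<close>
     bij_betw (\<lambda>c. (vertical_part c, induced_connection L K c))
       (im_connections L K)
       {(v, D). v \<in> splittings L K \<and> D \<in> linear_connections L K \<and> bracket_preserving L K D \<and>
          (\<forall>\<alpha>\<in>sections L. \<forall>\<xi>\<in>sub_sections L K.
             bracket L (horizontal_part v \<alpha>) \<xi> = covariant D (anchor_sec L \<alpha>) \<xi>)}"
proof -
  interpret semisimple_ideal L K by unfold_locales (rule assms)+
  have curvature: "(\<exists>!F. F \<in> forms L K 2 \<and> im_curvature L K c = delta0 L F) \<and>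
      (\<forall>F\<in>forms L K 2. im_curvature L K c = delta0 L F \<longrightarrow> ext_covariant L (induced_connection L K c) F = form_zero)"
    if c: "c \<in> im_connections L K" for c
  proof -
    obtain c\<^sub>0 c\<^sub>1 where c': "c = (c\<^sub>0, c\<^sub>1)" by force
    interpret im_connection L K c\<^sub>0 c\<^sub>1 by unfold_locales (use c c' in simp)
    show ?thesis using uniquely_primitive unfolding c' by blast
  qed
  show ?thesis
    by (intro conjI allI ballI delta0_add delta0_scale delta0_bij curvature im_connections_bij)
qed

end
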